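(* Let $T$ be a Gaussian $SPHAR(p)$ process on $\mathbb{S}^2\times\mathbb{Z}$ with kernels $k=(k_1,\dots,k_p)'$, eigenvalues $\phi_{\ell;j}$ and Gaussian spherical white noise $Z$ with angular power spectrum $\{C_{\ell;Z}\}$, and let $\widehat{k}_N$ be the least squares estimator of $k$ with truncation level $L_N$ (all as defined in the context). Assume: (1) (Stationarity) there exists $\delta>0$ such that for all $\ell\ge 0$ the polynomial $\phi_\ell(z)=1-\phi_{\ell;1}z-\cdots-\phi_{\ell;p}z^p$ satisfies $\phi_\ell(z)\neq 0$ for all $z\in\mathbb{C}$ with $|z|\le 1+\delta$; (2) (Identifiability) $C_{\ell;Z}>0$ for all $\ell=0,1,2,\dots$; (3) (Smoothness) for all $j=1,\dots,p$ there exist constants $\gamma_j>0$ and $\beta_j>1$ such that $|\phi_{\ell;j}|\le \gamma_j\,\ell^{-\beta_j}$ for all $\ell>0$. Let $\beta_*=\min_{j\in\{1,\dots,p\}}\beta_j$. Then, for $L_N\sim N^d$ with $0<d<1$, $$\mathbb{E}\left[\int_{-1}^1\left\Vert \widehat{k}_N(z)-k(z)\right\Vert^2dz\right]=\mathcal{O}\left(N^{d-1}+N^{2d(1-\beta_* )}\right)\quad\text{as } N\to\infty.$$ Moreover, if (1), (2) hold and (3) holds in the strong sense, i.e. with $\beta_j>2$ for all $j=1,\dots,p$, then, for $L_N\sim N^d$ with $0<d<\frac13$, $$\mathbb{E}\left[\sup_{z\in[-1,1]}\left\Vert \widehat{k}_N(z)-k(z)\right\Vert\right]=\mathcal{O}\left(N^{(3d-1)/2}+N^{d(2-\beta_*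 )}\right)\quad\text{as } N\to\infty.$$
   Context: Notation. $\mathbb{S}^2$ is the unit sphere in $\mathbb{R}^3$; $\{Y_{\ell,m}:\ell\ge 0,\,-\ell\le m\le\ell\}$ is the standard real orthonormal basis of spherical harmonics of $L^2(\mathbb{S}^2)$; $P_\ell$ is the $\ell$-th Legendre polynomial ($P_\ell(1)=1$); $\Vert\cdot\Vert$ is the Euclidean norm on $\mathbb{R}^p$. For positive sequences, $a_N\sim b_N$ means that there are constants $c_1,c_2>0$ with $c_1b_N\le a_N\le c_2b_N$ for all $N$. White noise. A Gaussian spherical white noise $\{Z(x,t):(x,t)\in\mathbb{S}^2\times\mathbb{Z}\}$ is a sequence (in $t$) of i.i.d. Gaussian zero-mean isotropic random fields $Z_t(\cdot)=Z(\cdot,t)$ on $\mathbb{S}^2$ with covariance $\Gamma_Z(x,y)=\sum_{\ell\ge 0}\frac{2\ell+1}{4\pi}C_{\ell;Z}P_\ell(\langle x,y\rangle)$, where $\sum_{\ell}\frac{2\ell+1}{4\pi}C_{\ell;Z}<\infty$; $\{C_{\ell;Z}\}$ is its angular power spectrum. $SPHAR(p)$ process ($p\ge 1$ fixed). For $j=1,\dots,p$ let $k_j\in L^2[-1,1]$ and let $\Phi_j:L^2(\mathbb{S}^2)\to L^2(\mathbb{S}^2)$, $(\Phi_jf)(x)=\int_{\mathbb{S}^2}k_j(\langle x,y\rangle)f(y)\,dy$. Then $\Phi_jY_{\ell,m}=\phi_{\ell;j}Y_{\ell,m}$ for real numbers $\phi_{\ell;j}$, and $k_j(z)=\sum_{\ell\ge0}\phi_{\ell;j}\frac{2\ell+1}{4\pi}P_\ell(z)$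 in $L^2[-1,1]$; when $\sum_\ell(2\ell+1)|\phi_{\ell;j}|<\infty$ the expansion holds pointwise for every $z\in[-1,1]$ (and $k_j$ is identified with this sum). It is assumed that $\phi_{\ell;p}\ne0$ for at least one $\ell$. $\{T(x,t)\}$, with $T_t(\cdot)=T(\cdot,t)$, is the zero-mean, finite-variance, Gaussian, isotropic and (temporally) stationary random field satisfying $$T_t(x)-(\Phi_1T_{t-1})(x)-\cdots-(\Phi_pT_{t-p})(x)-Z_t(x)=0$$ for all $(x,t)\in\mathbb{S}^2\times\mathbb{Z}$, equality holding in $L^2(\Omega)$ and in $L^2(\Omega\times\mathbb{S}^2)$; under the stationarity assumption (1) the stationary isotropic solution exists and is unique. Equivalently, $a_{\ell,m}(t)=\int_{\mathbb{S}^2}T(x,t)Y_{\ell,m}(x)dx$ and $a_{\ell,m;Z}(t)=\int_{\mathbb{S}^2}Z(x,t)Y_{\ell,m}(x)dx$ satisfy $a_{\ell,m}(t)=\sum_{j=1}^p\phi_{\ell;j}a_{\ell,m}(t-j)+a_{\ell,m;Z}(t)$, where the processes are independent over $(\ell,m)$ and $\{a_{\ell,m;Z}(t)\}_t$ is i.i.d. $\mathcal{N}(0,C_{\ell;Z})$. Estimator. One observes $a_{\ell,m}(t)$ for $t=1,\dots,n$; set $N=n-p$, $N>p$. Given integers $L_N\to\infty$, let $\mathcal{P}_N=\mathrm{span}\{\frac{2\ell+1}{4\pi}P_\ell(\cdot):\ell\le L_N\}$ and $$\widehat{k}_N=(\widehat{k}_{1;N},\dots,\widehat{k}_{p;N})'=\underset{k\in\mathcal{P}_N^p}{\arg\min}\sum_{t=1}^N\Big\Vert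 T_{t+p}-\sum_{j=1}^p\Phi_jT_{t+p-j}\Big\Vert^2_{L^2(\mathbb{S}^2)},$$ where in the minimization $\Phi_j$ denotes the operator with kernel $k_j$, $k=(k_1,\dots,k_p)'$. *)

theory Defs
  imports
    "HOL-Probability.Probability"
    "HOL-Computational_Algebra.Polynomial"
    "HOL-Library.Landau_Symbols"
begin

abbreviation S2 :: "(real^3) set" where
  "S2 \<equiv> sphere 0 1"

(* Surface measure of the unit sphere: the measure of A is 3 times the volume of the solid cone
   {r x. 0 < r < 1, x \<in> A}, as in the polar coordinates formula; the total mass is 4 pi. *)
definition S2_measure :: "(real^3) measure" where
  "S2_measure =
     scale_measure 3 (distr (restrict_space lborel (ball 0 1 - {0})) (restrict_space borel S2) sgn)"

(* Rodrigues' formula *)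
definition legendre :: "nat \<Rightarrow> real poly" where
  "legendre l = smult (1 / (2 ^ l * fact l)) ((pderiv ^^ l) ([:-1, 0, 1:] ^ l))"

(* Real spherical harmonics for -l \<le> m \<le> l, in Cartesian form: at colatitude \<theta> and longitude \<psi>,
   (sin \<theta>)^|m| cos (|m| \<psi>) and (sin \<theta>)^|m| sin (|m| \<psi>) are the real and the imaginary part
   of (x1 + i x2)^|m|, and the remaining factor of the associated Legendre function is the
   |m|-th derivative of P_l at x3 = cos \<theta>. *)
definition sph_harm :: "nat \<Rightarrow> int \<Rightarrow> real^3 \<Rightarrow> real" where
  "sph_harm l m x =
     sqrt ((2 * real l + 1) / (4 * pi) * fact (l - nat \<bar>m\<bar>) / fact (l + nat \<bar>m\<bar>))
     * poly ((pderiv ^^ nat \<bar>m\<bar>) (legendre l)) (x $ 3)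
     * (if m = 0 then 1
        else if m > 0 then sqrt 2 * Re (Complex (x $ 1) (x $ 2) ^ nat \<bar>m\<bar>)
        else sqrt 2 * Im (Complex (x $ 1) (x $ 2) ^ nat \<bar>m\<bar>))"

definition kernel_op :: "(real \<Rightarrow> real) \<Rightarrow> (real^3 \<Rightarrow> real) \<Rightarrow> real^3 \<Rightarrow> real" where
  "kernel_op k f x = (\<integral>y. k (x \<bullet> y) * f y \<partial>S2_measure)"

definition legendre_term :: "nat \<Rightarrow> real \<Rightarrow> real" where
  "legendre_term l z = (2 * real l + 1) / (4 * pi) * poly (legendre l) z"

(* k is a (Borel) kernel in L2[-1,1] whose operator has the eigenvalues \<phi> l. The last conjunct
   fixes the pointwise representative of k when its Legendre series converges absolutely. *)
definition kernel_with_eigenvalues :: "(real \<Rightarrow> real) \<Rightarrow> (nat \<Rightarrow> real) \<Rightarrow> bool" where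
  "kernel_with_eigenvalues k \<phi> \<longleftrightarrow>
     set_borel_measurable lborel {-1..1} k \<and>
     set_integrable lborel {-1..1} (\<lambda>z. (k z)\<^sup>2) \<and>
     (\<forall>l m. \<bar>m\<bar> \<le> int l \<longrightarrow>
        (AE x in S2_measure. kernel_op k (sph_harm l m) x = \<phi> l * sph_harm l m x)) \<and>
     (summable (\<lambda>l. (2 * real l + 1) * \<bar>\<phi> l\<bar>) \<longrightarrow>
        (\<forall>z\<in>{-1..1}. k z = (\<Sum>l. \<phi> l * legendre_term l z)))"

(* Gaussian law; the degenerate (constant) case is included *)
definition gaussian_rv :: "'w measure \<Rightarrow> ('w \<Rightarrow> real) \<Rightarrow> bool" where
  "gaussian_rv M X \<longleftrightarrow>
     X \<in> borel_measurable M \<and>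
     (\<exists>\<mu> \<sigma>. (\<sigma> = 0 \<and> (AE \<omega> in M. X \<omega> = \<mu>)) \<or>
            (\<sigma> > 0 \<and> distributed M lborel X (\<lambda>x. ennreal (normal_density \<mu> \<sigma> x))))"

definition gaussian_family :: "'w measure \<Rightarrow> 'i set \<Rightarrow> ('i \<Rightarrow> 'w \<Rightarrow> real) \<Rightarrow> bool" where
  "gaussian_family M I X \<longleftrightarrow>
     (\<forall>J c. finite J \<and> J \<subseteq> I \<longrightarrow> gaussian_rv M (\<lambda>\<omega>. \<Sum>i\<in>J. c i * X i \<omega>))"

(* Law on the product sigma-algebra, i.e. the collection of finite-dimensional distributions *)
definition family_law :: "'w measure \<Rightarrow> 'i set \<Rightarrow> ('i \<Rightarrow> 'w \<Rightarrow> real) \<Rightarrow> ('i \<Rightarrow> real) measure" where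
  "family_law M I X = distr M (Pi\<^sub>M I (\<lambda>_. borel)) (\<lambda>\<omega>. \<lambda>i\<in>I. X i \<omega>)"

(* Fields are written X t x \<omega>, with X t the field at time t. Joint measurability in (x, \<omega>) makes
   the integrals of the paths over the sphere meaningful. *)
definition measurable_field :: "'w measure \<Rightarrow> (int \<Rightarrow> real^3 \<Rightarrow> 'w \<Rightarrow> real) \<Rightarrow> bool" where
  "measurable_field M X \<longleftrightarrow>
     (\<forall>t. (\<lambda>(x, \<omega>). X t x \<omega>) \<in> borel_measurable (S2_measure \<Otimes>\<^sub>M M))"

definition gaussian_spherical_white_noise ::
    "'w measure \<Rightarrow> (int \<Rightarrow> real^3 \<Rightarrow> 'w \<Rightarrow> real) \<Rightarrow> (nat \<Rightarrow> real) \<Rightarrow> bool" where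
  "gaussian_spherical_white_noise M Z C \<longleftrightarrow>
     measurable_field M Z \<and>
     prob_space.indep_vars M (\<lambda>t. Pi\<^sub>M S2 (\<lambda>_. borel)) (\<lambda>t \<omega>. \<lambda>x\<in>S2. Z t x \<omega>) (UNIV :: int set) \<and>
     (\<forall>s t. family_law M S2 (Z s) = family_law M S2 (Z t)) \<and>
     (\<forall>t. gaussian_family M S2 (Z t)) \<and>
     (\<forall>t. \<forall>x\<in>S2. (\<integral>\<omega>. Z t x \<omega> \<partial>M) = 0) \<and>
     (\<forall>t g. rotation_matrix g \<longrightarrow>
        family_law M S2 (\<lambda>x. Z t (g *v x)) = family_law M S2 (Z t)) \<and>
     (\<forall>l. C l \<ge> 0) \<and>
     summable (\<lambda>l. (2 * real l + 1) / (4 * pi) * C l) \<and>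
     (\<forall>t. \<forall>x\<in>S2. \<forall>y\<in>S2.
        (\<integral>\<omega>. Z t x \<omega> * Z t y \<omega> \<partial>M) = (\<Sum>l. C l * legendre_term l (x \<bullet> y)))"

definition sphar_residual ::
    "nat \<Rightarrow> (nat \<Rightarrow> real \<Rightarrow> real) \<Rightarrow> (int \<Rightarrow> real^3 \<Rightarrow> 'w \<Rightarrow> real) \<Rightarrow> int \<Rightarrow> real^3 \<Rightarrow> 'w \<Rightarrow> real" where
  "sphar_residual p k T t x \<omega> =
     T t x \<omega> - (\<Sum>j=1..p. kernel_op (k j) (\<lambda>y. T (t - int j) y \<omega>) x)"

(* The last two conjuncts are the autoregressive equation, in L2(\<Omega>) for each (t, x)
   and in L2(\<Omega> \<times> S2) for each t. *)
definition gaussian_sphar ::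
    "'w measure \<Rightarrow> nat \<Rightarrow> (nat \<Rightarrow> real \<Rightarrow> real) \<Rightarrow> (int \<Rightarrow> real^3 \<Rightarrow> 'w \<Rightarrow> real)
      \<Rightarrow> (int \<Rightarrow> real^3 \<Rightarrow> 'w \<Rightarrow> real) \<Rightarrow> bool" where
  "gaussian_sphar M p k Z T \<longleftrightarrow>
     measurable_field M T \<and>
     gaussian_family M (UNIV \<times> S2) (\<lambda>(t, x). T t x) \<and>
     (\<forall>t. \<forall>x\<in>S2. integrable M (\<lambda>\<omega>. (T t x \<omega>)\<^sup>2) \<and> (\<integral>\<omega>. T t x \<omega> \<partial>M) = 0) \<and>
     (\<forall>g \<tau>. rotation_matrix g \<longrightarrow>
        family_law M (UNIV \<times> S2) (\<lambda>(t, x). T (t + \<tau>) (g *v x))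
          = family_law M (UNIV \<times> S2) (\<lambda>(t, x). T t x)) \<and>
     (\<forall>t. \<forall>x\<in>S2. AE \<omega> in M. sphar_residual p k T t x \<omega> - Z t x \<omega> = 0) \<and>
     (\<forall>t. AE (x, \<omega>) in S2_measure \<Otimes>\<^sub>M M. sphar_residual p k T t x \<omega> - Z t x \<omega> = 0)"

definition legendre_space :: "nat \<Rightarrow> (real \<Rightarrow> real) set" where
  "legendre_space L = {\<lambda>z. \<Sum>l\<le>L. c l * legendre_term l z | c. True}"

definition sphar_sse ::
    "nat \<Rightarrow> (int \<Rightarrow> real^3 \<Rightarrow> 'w \<Rightarrow> real) \<Rightarrow> nat \<Rightarrow> 'w \<Rightarrow> (nat \<Rightarrow> real \<Rightarrow> real) \<Rightarrow> real" where
  "sphar_sse p T N \<omega> h =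
     (\<Sum>t=1..N. \<integral>x. (sphar_residual p h T (int (t + p)) x \<omega>)\<^sup>2 \<partial>S2_measure)"

(* kh N \<omega> is the estimator computed from n = N + p observations. It only has to be a minimiser
   almost surely, since the argmin is unique only almost surely. *)
definition sphar_lse ::
    "'w measure \<Rightarrow> nat \<Rightarrow> (int \<Rightarrow> real^3 \<Rightarrow> 'w \<Rightarrow> real) \<Rightarrow> (nat \<Rightarrow> nat)
      \<Rightarrow> (nat \<Rightarrow> 'w \<Rightarrow> nat \<Rightarrow> real \<Rightarrow> real) \<Rightarrow> bool" where
  "sphar_lse M p T L kh \<longleftrightarrow>
     (\<forall>N>p. AE \<omega> in M.
        is_arg_min (sphar_sse p T N \<omega>) (\<lambda>h. h \<in> {1..p} \<rightarrow> legendre_space (L N)) (kh N \<omega>))"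

definition kernel_dist :: "nat \<Rightarrow> (nat \<Rightarrow> real \<Rightarrow> real) \<Rightarrow> (nat \<Rightarrow> real \<Rightarrow> real) \<Rightarrow> real \<Rightarrow> real" where
  "kernel_dist p h k z = L2_set (\<lambda>j. h j z - k j z) {1..p}"

(* The risks are extended nonnegative reals, so that an infinite expectation is not
   silently replaced by 0. *)
definition L2_risk ::
    "'w measure \<Rightarrow> nat \<Rightarrow> ('w \<Rightarrow> nat \<Rightarrow> real \<Rightarrow> real) \<Rightarrow> (nat \<Rightarrow> real \<Rightarrow> real) \<Rightarrow> ennreal" where
  "L2_risk M p h k =
     (\<integral>\<^sup>+\<omega>. (\<integral>\<^sup>+z\<in>{-1..1}. ennreal ((kernel_dist p (h \<omega>) k z)\<^sup>2) \<partial>lborel) \<partial>M)"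

definition sup_risk ::
    "'w measure \<Rightarrow> nat \<Rightarrow> ('w \<Rightarrow> nat \<Rightarrow> real \<Rightarrow> real) \<Rightarrow> (nat \<Rightarrow> real \<Rightarrow> real) \<Rightarrow> ennreal" where
  "sup_risk M p h k = (\<integral>\<^sup>+\<omega>. (SUP z\<in>{-1..1}. ennreal (kernel_dist p (h \<omega>) k z)) \<partial>M)"

definition ennreal_bigo :: "(nat \<Rightarrow> ennreal) \<Rightarrow> (nat \<Rightarrow> real) \<Rightarrow> bool" where
  "ennreal_bigo r f \<longleftrightarrow>
     (\<forall>\<^sub>F N in sequentially. r N < \<infinity>) \<and> (\<lambda>N. enn2real (r N)) \<in> O(f)"

definition same_order_from :: "nat \<Rightarrow> (nat \<Rightarrow> real) \<Rightarrow> (nat \<Rightarrow> real) \<Rightarrow> bool" where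
  "same_order_from N0 a b \<longleftrightarrow> (\<exists>c1>0. \<exists>c2>0. \<forall>N\<ge>N0. c1 * b N \<le> a N \<and> a N \<le> c2 * b N)"

end

theory Submission
  imports Defs "HOL-Computational_Algebra.Fundamental_Theorem_Algebra"
begin

text \<open>Estimation splits over the levels \<open>l\<close> of the spherical harmonics. The Funk--Hecke formula says that a kernel
operator multiplies every harmonic of degree \<open>l\<close> by one number, so the \<open>2 l + 1\<close> coefficients of the field
at level \<open>l\<close> are autoregressions of order \<open>p\<close> with the same parameters \<open>\<phi> l 1, \<dots>, \<phi> l p\<close>, driven
by uncorrelated innovations (\<open>coeff_autoregression\<close>, \<open>noise_coeff_covariance\<close>), and they are jointly Gaussian
(\<open>coeff_in_closure\<close>). By orthonormality the sum of squares of a truncated kernel is a constant plus one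
regression criterion in \<open>p\<close> unknowns per level (\<open>residual_energy\<close>), hence a minimiser minimises each of them.

At one level the error \<open>\<Delta>\<close> of least squares satisfies \<open>Q \<Delta> \<le> 2 \<Delta> \<bullet> S\<close>, where \<open>Q\<close> is the quadratic form of the
design and the score \<open>S\<close> is a martingale sum, of squared size \<open>(2 l + 1) N\<close> (\<open>score_second_moment\<close>). Where
\<open>Q \<ge> c (2 l + 1) N\<close> on the unit sphere this gives an expected squared error of order \<open>1 / ((2 l + 1) N)\<close>. Since a risk
is to be bounded, the event that \<open>Q\<close> is nearly singular has to be paid for. In each block of \<open>p\<close> consecutive
times a fixed linear combination of the regressors has a component along an innovation that is uncorrelated with the
preceding blocks (\<open>block_correlation\<close>), so that the blocks escape from a small ball with nearly independent
probabilities (\<open>small_ball\<close>), and a grid makes the estimate uniform over the sphere (\<open>near_singular_prob\<close>). The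
probability that \<open>Q\<close> falls below \<open>4\<^sup>-\<^sup>k\<close> times its typical size decreases like \<open>64\<^sup>-\<^sup>k\<close>, faster
than the error can grow, and summation over \<open>k\<close> yields a bound of order \<open>1 / ((2 l + 1) N)\<close> for the risk
(\<open>least_squares_risk\<close>). Its constant involves the parameters only through \<open>p\<close> and \<open>\<delta>\<close>, because
the roots stay outside the disc of radius \<open>1 + \<delta>\<close> (\<open>variance_le\<close>); it is therefore the same for all levels
(\<open>coefficient_risk\<close>).

The rates follow by adding up levels. In \<open>L\<^sup>2\<close> the Legendre term of degree \<open>l\<close> has squared norm
\<open>(2 l + 1) / (8 \<pi>\<^sup>2)\<close>; each estimated level costs a constant over \<open>N\<close>, together \<open>L / N\<close>, and the levels beyond \<open>L\<close>
leave \<open>\<Sum>l>L. l powr (1 - 2 \<beta>)\<close>, of order \<open>L powr (2 - 2 \<beta>)\<close>. In the supremum norm the term is at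
most \<open>(2 l + 1) / (4 \<pi>)\<close>, the estimated levels cost \<open>\<Sum>l\<le>L. sqrt ((2 l + 1) / N)\<close>, of order
\<open>L powr (3 / 2) / sqrt N\<close>, and the others \<open>\<Sum>l>L. l powr (1 - \<beta>)\<close>, of order \<open>L powr (2 - \<beta>)\<close>.\<close>

section \<open>Inverting autoregressive recursions\<close>

text \<open>The polynomial \<open>P\<close> in the backward shift, applied to the two-sided sequence \<open>f\<close>.\<close>

definition shift_apply :: "complex poly \<Rightarrow> (int \<Rightarrow> complex) \<Rightarrow> int \<Rightarrow> complex" where
  "shift_apply P f t = (\<Sum>k\<le>degree P. coeff P k * f (t - int k))"

lemma shift_apply_bound:
  assumes "degree P \<le> n"
  shows "shift_apply P f t = (\<Sum>k\<le>n. coeff P k * f (t - int k))"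
  unfolding shift_apply_def
  by (rule sum.mono_neutral_left) (use assms in \<open>auto simp: coeff_eq_0\<close>)

text \<open>Factors of the polynomial can be inverted one at a time: this turns a recursion of order \<open>p\<close> into \<open>p\<close> recursions
of order one.\<close>

lemma shift_apply_linear_factor:
  "shift_apply ([:1, -r:] * Q) f t = shift_apply Q (\<lambda>s. f s - r * f (s - 1)) t"
proof -
  let ?d = "degree Q"
  have deg: "degree ([:1, -r:] * Q) \<le> Suc ?d"
    by (rule order.trans[OF degree_mult_le]) auto
  have co: "coeff ([:1, -r:] * Q) k = coeff Q k - (if k = 0 then 0 else r * coeff Q (k - 1))" for k
    by (cases k) auto
  have "shift_apply ([:1, -r:] * Q) f t
      = (\<Sum>k\<le>Suc ?d. coeff Q k * f (t - int k))
        - (\<Sum>k\<le>Suc ?d. (if k = 0 then 0 else r * coeff Q (k - 1)) * f (t - int k))"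
    unfolding shift_apply_bound[OF deg] co by (simp add: sum_subtractf left_diff_distrib)
  also have "(\<Sum>k\<le>Suc ?d. coeff Q k * f (t - int k)) = (\<Sum>k\<le>?d. coeff Q k * f (t - int k))"
    by (simp add: coeff_eq_0)
  also have "(\<Sum>k\<le>Suc ?d. (if k = 0 then 0 else r * coeff Q (k - 1)) * f (t - int k))
      = (\<Sum>k\<le>?d. r * coeff Q k * f (t - int k - 1))"
    by (subst sum.atMost_Suc_shift) (simp add: algebra_simps)
  finally show ?thesis
    unfolding shift_apply_def by (simp add: sum_subtractf[symmetric] algebra_simps)
qed

text \<open>Normalised at the origin, a polynomial is the product of the factors \<open>1 - z / z\<^sub>i\<close> over its roots \<open>z\<^sub>i\<close>; roots
outside a disc of radius \<open>R\<close> have inverses of modulus at most \<open>1 / R\<close>.\<close>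

lemma poly_factor_inverse_roots:
  fixes P :: "complex poly"
  assumes "poly P 0 = 1" and "R > 0" and "\<And>z. norm z \<le> R \<Longrightarrow> poly P z \<noteq> 0"
  shows "\<exists>rs. length rs = degree P \<and> P = (\<Prod>r\<leftarrow>rs. [:1, -r:]) \<and> (\<forall>r\<in>set rs. norm r \<le> 1 / R)"
  using assms(1,3)
proof (induction "degree P" arbitrary: P)
  case 0
  then obtain c where "P = [:c:]" by (metis degree_eq_zeroE)
  with 0 have "P = 1" by simp
  then show ?case by (intro exI[of _ "[]"]) auto
next
  case (Suc n)
  then have "\<not> constant (poly P)" by (metis constant_degree nat.distinct(1))
  then obtain z where z: "poly P z = 0" using fundamental_theorem_of_algebra by blast
  have z0: "norm z > R" using Suc.prems(2) z by force
  then have nz: "z \<noteq> 0" using assms(2) by auto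
  obtain Q0 where Q0: "P = [:-z, 1:] * Q0" using z by (metis dvdE poly_eq_0_iff_dvd)
  define Q where "Q = smult (-z) Q0"
  have PQ: "P = [:1, -(1/z):] * Q"
    unfolding Q0 Q_def using nz by (simp add: smult_add_right)
  have "P \<noteq> 0" using Suc.prems(1) by auto
  then have "Q \<noteq> 0" using PQ by auto
  then have dQ: "n = degree Q" using Suc.hyps(2) nz unfolding PQ by (subst (asm) degree_mult_eq) auto
  have "poly Q 0 = 1" using Suc.prems(1) unfolding PQ by simp
  moreover have "poly Q w \<noteq> 0" if "norm w \<le> R" for w
    using Suc.prems(2)[OF that] unfolding PQ by auto
  ultimately obtain rs where rs: "length rs = degree Q" "Q = (\<Prod>r\<leftarrow>rs. [:1, -r:])"
      "\<forall>r\<in>set rs. norm r \<le> 1 / R"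
    using Suc.hyps(1)[OF dQ] by blast
  have "norm (1/z) \<le> 1 / R" using z0 assms(2) by (simp add: norm_divide frac_le)
  then show ?case
    using rs dQ Suc.hyps(2) PQ by (intro exI[of _ "(1/z) # rs"]) auto
qed

text \<open>Iterating the inequality \<open>n\<close> steps into the past multiplies the a priori bound \<open>B\<close> by \<open>\<rho>\<^sup>n\<close>, so only the fixed point
\<open>b / (1 - \<rho>)\<close> of the recursion survives.\<close>

lemma affine_contraction_bound:
  fixes h :: "int \<Rightarrow> real"
  assumes "0 \<le> \<rho>" "\<rho> < 1" and bd: "\<And>t. t \<le> t0 \<Longrightarrow> h t \<le> B"
    and step: "\<And>t. t \<le> t0 \<Longrightarrow> h t \<le> \<rho> * h (t - 1) + b"
    and "t \<le> t0"
  shows "h t \<le> b / (1 - \<rho>)"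
proof -
  have *: "h t \<le> \<rho> ^ n * (B - b / (1 - \<rho>)) + b / (1 - \<rho>)" if "t \<le> t0" for n t
    using that
  proof (induction n arbitrary: t)
    case 0 then show ?case using bd by simp
  next
    case (Suc n)
    have "h t \<le> \<rho> * (\<rho> ^ n * (B - b / (1 - \<rho>)) + b / (1 - \<rho>)) + b"
      using step[OF Suc.prems] mult_left_mono[OF Suc.IH[of "t - 1"] assms(1)] Suc.prems by linarith
    also have "\<dots> = \<rho> ^ Suc n * (B - b / (1 - \<rho>)) + (\<rho> * (b / (1 - \<rho>)) + b)"
      by (simp add: algebra_simps)
    also have "\<rho> * (b / (1 - \<rho>)) + b = b / (1 - \<rho>)"
      using assms(2) by (simp add: field_simps)
    finally show ?case .
  qed
  have "(\<lambda>n. \<rho> ^ n * (B - b / (1 - \<rho>)) + b / (1 - \<rho>)) \<longlonglongrightarrow> 0 * (B - b / (1 - \<rho>)) + b / (1 - \<rho>)"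
    by (intro tendsto_intros LIMSEQ_power_zero) (use assms in auto)
  then show ?thesis using LIMSEQ_le_const[of _ "0 * (B - b / (1 - \<rho>)) + b / (1 - \<rho>)" "h t"] *[OF assms(5)] by auto
qed

text \<open>A bounded solution of a stable recursion inherits, up to a factor, every bound of its right hand side that is valid up
to time \<open>t0\<close>. A seminorm \<open>\<nu>\<close> takes the place of a solution formula, and is chosen twice: with the norm of \<open>L\<^sup>2\<close> it bounds the
variance of the process, and with \<open>\<nu> u = \<bar>E (u e)\<bar>\<close> for an innovation \<open>e\<close> and with \<open>b = 0\<close> it shows that the past is
uncorrelated with \<open>e\<close>. Stating it up to \<open>t0\<close> is what makes the second use possible.\<close>

lemma causal_seminorm_bound:
  fixes \<nu> :: "('w \<Rightarrow> complex) \<Rightarrow> real" and f :: "int \<Rightarrow> 'w \<Rightarrow> complex"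
  assumes closed: "\<And>u v c. u \<in> S \<Longrightarrow> v \<in> S \<Longrightarrow> (\<lambda>\<omega>. u \<omega> - c * v \<omega>) \<in> S"
    and nonneg: "\<And>u. u \<in> S \<Longrightarrow> 0 \<le> \<nu> u"
    and tri1: "\<And>u v c. u \<in> S \<Longrightarrow> v \<in> S \<Longrightarrow> \<nu> (\<lambda>\<omega>. u \<omega> - c * v \<omega>) \<le> \<nu> u + norm c * \<nu> v"
    and tri2: "\<And>u v c. u \<in> S \<Longrightarrow> v \<in> S \<Longrightarrow> \<nu> u \<le> \<nu> (\<lambda>\<omega>. u \<omega> - c * v \<omega>) + norm c * \<nu> v"
    and \<rho>: "0 \<le> \<rho>" "\<rho> < 1" "\<forall>r\<in>set rs. norm r \<le> \<rho>"
    and f: "\<And>t. f t \<in> S" "\<And>t. \<nu> (f t) \<le> B"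
    and b: "\<And>t. t \<le> t0 \<Longrightarrow> \<nu> (\<lambda>\<omega>. shift_apply (\<Prod>r\<leftarrow>rs. [:1, -r:]) (\<lambda>s. f s \<omega>) t) \<le> b"
    and t: "t \<le> t0"
  shows "\<nu> (f t) \<le> b / (1 - \<rho>) ^ length rs"
  using \<rho>(3) f b t
proof (induction rs arbitrary: f B t)
  case Nil
  then show ?case by (simp add: shift_apply_def)
next
  case (Cons r rs)
  define g where "g = (\<lambda>s \<omega>. f s \<omega> - r * f (s - 1) \<omega>)"
  have r: "norm r \<le> \<rho>" using Cons.prems by auto
  have gS: "g s \<in> S" for s unfolding g_def using closed Cons.prems by blast
  have g: "\<nu> (g s) \<le> b / (1 - \<rho>) ^ length rs" if "s \<le> t0" for s
  proof (rule Cons.IH[where B = "B + norm r * B"])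
    show "\<forall>r\<in>set rs. norm r \<le> \<rho>" using Cons.prems by auto
    show "\<nu> (g t) \<le> B + norm r * B" for t
    proof -
      have "\<nu> (g t) \<le> \<nu> (f t) + norm r * \<nu> (f (t - 1))"
        unfolding g_def by (rule tri1) (use Cons.prems in auto)
      also have "\<dots> \<le> B + norm r * B"
        by (intro add_mono mult_left_mono) (use Cons.prems in auto)
      finally show ?thesis .
    qed
    show "\<nu> (\<lambda>\<omega>. shift_apply (\<Prod>r\<leftarrow>rs. [:1, - r:]) (\<lambda>s. g s \<omega>) t) \<le> b" if "t \<le> t0" for t
      using Cons.prems(4)[OF that] unfolding g_def
      by (simp add: shift_apply_linear_factor del: mult_pCons_left)
  qed (use that gS in auto)
  have "\<nu> (f t) \<le> (b / (1 - \<rho>) ^ length rs) / (1 - \<rho>)"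
  proof (rule affine_contraction_bound[OF \<rho>(1,2), of t0 "\<lambda>t. \<nu> (f t)" B])
    show "\<nu> (f t) \<le> \<rho> * \<nu> (f (t - 1)) + b / (1 - \<rho>) ^ length rs" if "t \<le> t0" for t
    proof -
      have "\<nu> (f t) \<le> \<nu> (g t) + norm r * \<nu> (f (t - 1))"
        unfolding g_def by (rule tri2) (use Cons.prems in auto)
      moreover have "norm r * \<nu> (f (t - 1)) \<le> \<rho> * \<nu> (f (t - 1))"
        by (intro mult_right_mono r nonneg Cons.prems)
      ultimately show ?thesis using g[OF that] by linarith
    qed
  qed (use Cons.prems in auto)
  then show ?case by (simp add: mult.commute)
qed

section \<open>Square integrable functions and Gaussian spaces\<close>

definition square_integrable :: "'a measure \<Rightarrow> ('a \<Rightarrow> real) \<Rightarrow> bool" where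
  "square_integrable M X \<longleftrightarrow> X \<in> borel_measurable M \<and> integrable M (\<lambda>x. (X x)\<^sup>2)"

lemma square_integrable_measurable: "square_integrable M X \<Longrightarrow> X \<in> borel_measurable M"
  by (simp add: square_integrable_def)

lemma abs_mult_le_squares: "\<bar>a * b\<bar> \<le> a\<^sup>2 + b\<^sup>2" for a b :: real
proof -
  have "0 \<le> \<bar>a\<bar> * \<bar>b\<bar>" by simp
  moreover have "2 * (\<bar>a\<bar> * \<bar>b\<bar>) \<le> a\<^sup>2 + b\<^sup>2"
    using sum_squares_bound[of "\<bar>a\<bar>" "\<bar>b\<bar>"] by (simp add: mult.assoc)
  ultimately show ?thesis unfolding abs_mult by linarith
qed

lemma square_integrable_mult:
  assumes "square_integrable M X" "square_integrable M Y"
  shows "integrable M (\<lambda>x. X x * Y x)"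
proof (rule Bochner_Integration.integrable_bound)
  show "integrable M (\<lambda>x. (X x)\<^sup>2 + (Y x)\<^sup>2)" using assms unfolding square_integrable_def by auto
  show "(\<lambda>x. X x * Y x) \<in> borel_measurable M"
    using assms unfolding square_integrable_def by (intro borel_measurable_times) auto
  show "AE x in M. norm (X x * Y x) \<le> norm ((X x)\<^sup>2 + (Y x)\<^sup>2)" using abs_mult_le_squares by auto
qed

lemma square_integrable_cmult:
  "square_integrable M X \<Longrightarrow> square_integrable M (\<lambda>x. c * X x)"
  unfolding square_integrable_def by (auto simp: power_mult_distrib)

lemma square_integrable_add:
  assumes "square_integrable M X" "square_integrable M Y"
  shows "square_integrable M (\<lambda>x. X x + Y x)"
  using assms square_integrable_mult[OF assms] unfolding square_integrable_def
  by (auto simp: power2_sum mult.assoc)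

lemma square_integrable_diff:
  assumes "square_integrable M X" "square_integrable M Y"
  shows "square_integrable M (\<lambda>x. X x - Y x)"
  using assms square_integrable_mult[OF assms] unfolding square_integrable_def
  by (auto simp: power2_diff mult.assoc)

lemma square_integrable_sum:
  assumes "finite A" "\<And>i. i \<in> A \<Longrightarrow> square_integrable M (X i)"
  shows "square_integrable M (\<lambda>x. \<Sum>i\<in>A. X i x)"
  using assms
proof (induction A rule: finite_induct)
  case empty then show ?case by (simp add: square_integrable_def)
next
  case (insert a A)
  then show ?case by (simp add: square_integrable_add)
qed

lemma square_integrable_bound:
  assumes "square_integrable M Y" "X \<in> borel_measurable M" "AE x in M. \<bar>X x\<bar> \<le> \<bar>Y x\<bar>"
  shows "square_integrable M X"
  unfolding square_integrable_def
proof
  show "integrable M (\<lambda>x. (X x)\<^sup>2)"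
    by (rule Bochner_Integration.integrable_bound[of M "\<lambda>x. (Y x)\<^sup>2"])
       (use assms in \<open>auto simp: square_integrable_def abs_le_square_iff\<close>)
qed (use assms in auto)

text \<open>Evaluate at the minimiser \<open>s = b / c\<close>; if \<open>c = 0\<close>, a nonzero \<open>b\<close> would make the affine function negative
somewhere.\<close>

lemma quadratic_discriminant:
  fixes a b c :: real
  assumes q: "\<And>s. 0 \<le> a - 2 * s * b + s\<^sup>2 * c" and c: "0 \<le> c" shows "b\<^sup>2 \<le> a * c"
proof (cases "c = 0")
  case True
  have "b = 0"
  proof (rule ccontr)
    assume "b \<noteq> 0"
    with q[of "(a + 1) / (2 * b)"] True show False by simp
  qed
  then show ?thesis using True by simp
next
  case False
  then have "0 \<le> a - b\<^sup>2 / c" using q[of "b / c"] by (simp add: power2_eq_square field_simps)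
  then show ?thesis using False c by (simp add: field_simps)
qed

lemma L2_distance_expand:
  assumes X: "square_integrable M X" and Y: "square_integrable M Y"
  shows "(\<integral>x. (X x - s * Y x)\<^sup>2 \<partial>M) = (\<integral>x. (X x)\<^sup>2 \<partial>M) - 2 * s * (\<integral>x. X x * Y x \<partial>M) + s\<^sup>2 * (\<integral>x. (Y x)\<^sup>2 \<partial>M)"
proof -
  have "(\<lambda>x. (X x - s * Y x)\<^sup>2) = (\<lambda>x. (X x)\<^sup>2 - 2 * s * (X x * Y x) + s\<^sup>2 * (Y x)\<^sup>2)"
    by (auto simp: power2_eq_square algebra_simps)
  then show ?thesis
    using X Y square_integrable_mult[OF X Y] unfolding square_integrable_def by simp
qed

lemma cauchy_schwarz_L2:
  assumes X: "square_integrable M X" and Y: "square_integrable M Y"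
  shows "(\<integral>x. X x * Y x \<partial>M)\<^sup>2 \<le> (\<integral>x. (X x)\<^sup>2 \<partial>M) * (\<integral>x. (Y x)\<^sup>2 \<partial>M)"
proof (rule quadratic_discriminant)
  show "0 \<le> (\<integral>x. (X x)\<^sup>2 \<partial>M) - 2 * s * (\<integral>x. X x * Y x \<partial>M) + s\<^sup>2 * (\<integral>x. (Y x)\<^sup>2 \<partial>M)" for s
    unfolding L2_distance_expand[OF X Y, symmetric] by simp
qed simp

lemma cauchy_schwarz_L2_abs:
  assumes X: "square_integrable M X" and Y: "square_integrable M Y"
  shows "\<bar>\<integral>x. X x * Y x \<partial>M\<bar> \<le> sqrt (\<integral>x. (X x)\<^sup>2 \<partial>M) * sqrt (\<integral>x. (Y x)\<^sup>2 \<partial>M)"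
  unfolding real_sqrt_mult[symmetric]
  by (rule real_le_rsqrt) (simp add: cauchy_schwarz_L2[OF assms])

lemma minkowski_L2:
  assumes X: "square_integrable M X" and Y: "square_integrable M Y"
  shows "sqrt (\<integral>x. (X x + Y x)\<^sup>2 \<partial>M) \<le> sqrt (\<integral>x. (X x)\<^sup>2 \<partial>M) + sqrt (\<integral>x. (Y x)\<^sup>2 \<partial>M)"
proof (rule real_le_lsqrt)
  show "(\<integral>x. (X x + Y x)\<^sup>2 \<partial>M) \<le> (sqrt (\<integral>x. (X x)\<^sup>2 \<partial>M) + sqrt (\<integral>x. (Y x)\<^sup>2 \<partial>M))\<^sup>2"
    using cauchy_schwarz_L2_abs[OF X Y] L2_distance_expand[OF X Y, of "-1"] by (simp add: power2_sum)
qed auto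

text \<open>Gaussian laws are described by the characteristic function: then degenerate laws need no case distinction, and the
notion passes to limits in mean square.\<close>

definition centered_gaussian :: "'a measure \<Rightarrow> ('a \<Rightarrow> real) \<Rightarrow> bool" where
  "centered_gaussian M X \<longleftrightarrow> square_integrable M X \<and>
     (\<forall>\<theta>. (\<integral>\<omega>. iexp (\<theta> * X \<omega>) \<partial>M) = complex_of_real (exp (- (\<theta>\<^sup>2 * (\<integral>\<omega>. (X \<omega>)\<^sup>2 \<partial>M)) / 2)))"

lemma centered_gaussian_fourth_moment:
  assumes "prob_space M" and g: "centered_gaussian M X"
  shows "integrable M (\<lambda>\<omega>. X \<omega> ^ 4)" "(\<integral>\<omega>. X \<omega> ^ 4 \<partial>M) = 3 * (\<integral>\<omega>. (X \<omega>)\<^sup>2 \<partial>M)\<^sup>2"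
proof -
  interpret prob_space M by fact
  have X[measurable]: "X \<in> borel_measurable M" and X2: "integrable M (\<lambda>\<omega>. (X \<omega>)\<^sup>2)"
    using g by (auto simp: centered_gaussian_def square_integrable_def)
  define v where "v = (\<integral>\<omega>. (X \<omega>)\<^sup>2 \<partial>M)"
  have "integrable M (\<lambda>\<omega>. X \<omega> ^ 4) \<and> (\<integral>\<omega>. X \<omega> ^ 4 \<partial>M) = 3 * v\<^sup>2"
  proof (cases "v = 0")
    case True
    then have "AE \<omega> in M. (X \<omega>)\<^sup>2 = 0"
      using integral_nonneg_eq_0_iff_AE[OF X2] unfolding v_def by simp
    then have ae: "AE \<omega> in M. X \<omega> ^ 4 = 0" by auto
    then have "integrable M (\<lambda>\<omega>. X \<omega> ^ 4) \<longleftrightarrow> integrable M (\<lambda>\<omega>. 0::real)"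
      by (intro integrable_cong_AE) auto
    moreover have "(\<integral>\<omega>. X \<omega> ^ 4 \<partial>M) = 0" using integral_eq_zero_AE[OF ae] .
    ultimately show ?thesis using True by simp
  next
    case False
    then have v: "v > 0" unfolding v_def by (simp add: order_less_le)
    define D where "D = distr M borel (\<lambda>\<omega>. X \<omega> / sqrt v)"
    interpret D: real_distribution D unfolding D_def by (rule real_distribution_distr) simp
    have "char D = char std_normal_distribution"
    proof
      fix t
      have "char D t = (\<integral>\<omega>. iexp ((t / sqrt v) * X \<omega>) \<partial>M)"
        unfolding char_def D_def by (subst integral_distr) (auto simp: mult.commute)
      also have "\<dots> = complex_of_real (exp (- ((t / sqrt v)\<^sup>2 * v) / 2))"
        using g unfolding centered_gaussian_def v_def by blast
      also have "(t / sqrt v)\<^sup>2 * v = t\<^sup>2" using v by (simp add: power_divide)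
      finally show "char D t = char std_normal_distribution t"
        by (simp add: char_std_normal_distribution)
    qed
    then have D: "D = std_normal_distribution"
      using Levy_uniqueness D.real_distribution_axioms real_dist_normal_dist by blast
    have "integrable D (\<lambda>x. x ^ (2 * 2))" "(\<integral>x. x ^ (2 * 2) \<partial>D) = fact (2 * 2) / (2 ^ 2 * fact 2)"
      unfolding D by (rule std_normal_distribution_even_moments)+
    then have "integrable D (\<lambda>x. x ^ 4)" "(\<integral>x. x ^ 4 \<partial>D) = 3"
      by (simp_all add: fact_numeral)
    then have "integrable M (\<lambda>\<omega>. (X \<omega> / sqrt v) ^ 4)" "(\<integral>\<omega>. (X \<omega> / sqrt v) ^ 4 \<partial>M) = 3"
      unfolding D_def by (simp_all add: integrable_distr_eq integral_distr)
    moreover have "(X \<omega> / sqrt v) ^ 4 = X \<omega> ^ 4 / v\<^sup>2" for \<omega>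
      using v by (simp add: power_divide power4_eq_xxxx power2_eq_square)
    ultimately have i: "integrable M (\<lambda>\<omega>. X \<omega> ^ 4 / v\<^sup>2)" and e: "(\<integral>\<omega>. X \<omega> ^ 4 / v\<^sup>2 \<partial>M) = 3"
      by simp_all
    have "integrable M (\<lambda>\<omega>. v\<^sup>2 * (X \<omega> ^ 4 / v\<^sup>2))"
      by (rule integrable_mult_right) (rule i)
    then show ?thesis using v e by (simp add: field_simps)
  qed
  then show "integrable M (\<lambda>\<omega>. X \<omega> ^ 4)" "(\<integral>\<omega>. X \<omega> ^ 4 \<partial>M) = 3 * (\<integral>\<omega>. (X \<omega>)\<^sup>2 \<partial>M)\<^sup>2"
    unfolding v_def by auto
qed

text \<open>A linear space of centred Gaussian variables. Any family inside it is jointly Gaussian, so uncorrelated families are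
independent.\<close>

definition gaussian_space :: "'a measure \<Rightarrow> ('a \<Rightarrow> real) set \<Rightarrow> bool" where
  "gaussian_space M H \<longleftrightarrow> (\<forall>X\<in>H. centered_gaussian M X) \<and>
     (\<forall>X\<in>H. \<forall>Y\<in>H. \<forall>c. (\<lambda>\<omega>. X \<omega> + c * Y \<omega>) \<in> H)"

lemma gaussian_space_sq: "gaussian_space M H \<Longrightarrow> X \<in> H \<Longrightarrow> square_integrable M X"
  by (auto simp: gaussian_space_def centered_gaussian_def)

lemma gaussian_space_lin:
  "gaussian_space M H \<Longrightarrow> X \<in> H \<Longrightarrow> Y \<in> H \<Longrightarrow> (\<lambda>\<omega>. X \<omega> + c * Y \<omega>) \<in> H"
  by (simp add: gaussian_space_def)

lemma gaussian_space_zero: "gaussian_space M H \<Longrightarrow> X \<in> H \<Longrightarrow> (\<lambda>\<omega>. 0) \<in> H"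
proof -
  assume "gaussian_space M H" "X \<in> H"
  then have "(\<lambda>\<omega>. X \<omega> + (-1) * X \<omega>) \<in> H" unfolding gaussian_space_def by blast
  then show ?thesis by simp
qed

lemma gaussian_space_cmult: "gaussian_space M H \<Longrightarrow> X \<in> H \<Longrightarrow> (\<lambda>\<omega>. c * X \<omega>) \<in> H"
proof -
  assume *: "gaussian_space M H" "X \<in> H"
  show ?thesis using gaussian_space_lin[OF *(1) gaussian_space_zero[OF *] *(2), of c] by simp
qed

lemma gaussian_space_add: "gaussian_space M H \<Longrightarrow> X \<in> H \<Longrightarrow> Y \<in> H \<Longrightarrow> (\<lambda>\<omega>. X \<omega> + Y \<omega>) \<in> H"
  using gaussian_space_lin[of M H X Y 1] by simp

lemma gaussian_space_diff: "gaussian_space M H \<Longrightarrow> X \<in> H \<Longrightarrow> Y \<in> H \<Longrightarrow> (\<lambda>\<omega>. X \<omega> - Y \<omega>) \<in> H"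
proof -
  assume *: "gaussian_space M H" "X \<in> H" "Y \<in> H"
  show ?thesis using gaussian_space_lin[OF *, of "-1"] by simp
qed

lemma gaussian_space_sum:
  assumes "gaussian_space M H" "finite A" "\<And>i. i \<in> A \<Longrightarrow> X i \<in> H" "H \<noteq> {}"
  shows "(\<lambda>\<omega>. \<Sum>i\<in>A. X i \<omega>) \<in> H"
  using assms(2,3)
proof (induction A rule: finite_induct)
  case empty then show ?case using gaussian_space_zero[OF assms(1)] assms(4) by auto
next
  case (insert a A)
  then show ?case by (simp add: gaussian_space_add[OF assms(1)])
qed

text \<open>Polarisation: a product of four variables is a combination of fourth powers of the eight sums
\<open>x \<plusminus> y \<plusminus> z \<plusminus> w\<close>, each of which is Gaussian, with fourth moment three times the square of the second.\<close>

lemma isserlis: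
  assumes P: "prob_space M" and G: "gaussian_space M H" and H: "x \<in> H" "y \<in> H" "z \<in> H" "w \<in> H"
  shows "integrable M (\<lambda>\<omega>. x \<omega> * y \<omega> * z \<omega> * w \<omega>)"
    and "(\<integral>\<omega>. x \<omega> * y \<omega> * z \<omega> * w \<omega> \<partial>M)
      = (\<integral>\<omega>. x \<omega> * y \<omega> \<partial>M) * (\<integral>\<omega>. z \<omega> * w \<omega> \<partial>M)
      + (\<integral>\<omega>. x \<omega> * z \<omega> \<partial>M) * (\<integral>\<omega>. y \<omega> * w \<omega> \<partial>M)
      + (\<integral>\<omega>. x \<omega> * w \<omega> \<partial>M) * (\<integral>\<omega>. y \<omega> * z \<omega> \<partial>M)"
proof -
  define T where "T a b c = (\<lambda>\<omega>. x \<omega> + a * y \<omega> + b * z \<omega> + c * w \<omega>)" for a b c :: real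
  have TH: "T a b c \<in> H" for a b c
    unfolding T_def by (intro gaussian_space_lin[OF G] H)
  have cg: "centered_gaussian M (T a b c)" for a b c
    using G TH unfolding gaussian_space_def by blast
  have int: "integrable M (\<lambda>\<omega>. T a b c \<omega> ^ 4)" for a b c
    by (rule centered_gaussian_fourth_moment[OF P cg])
  have [simp]: "integrable M (\<lambda>\<omega>. u \<omega> * v \<omega>)" if "u \<in> H" "v \<in> H" for u v
    using square_integrable_mult gaussian_space_sq[OF G] that by blast
  define I where "I u v = (\<integral>\<omega>. u \<omega> * v \<omega> \<partial>M)" for u v :: "'a \<Rightarrow> real"
  have sq: "(\<integral>\<omega>. (T a b c \<omega>)\<^sup>2 \<partial>M) = I x x + a\<^sup>2 * I y y + b\<^sup>2 * I z z + c\<^sup>2 * I w w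
       + 2 * a * I x y + 2 * b * I x z + 2 * c * I x w + 2 * (a * b) * I y z + 2 * (a * c) * I y w + 2 * (b * c) * I z w" for a b c
  proof -
    have "(\<lambda>\<omega>. (T a b c \<omega>)\<^sup>2) = (\<lambda>\<omega>. x \<omega> * x \<omega> + a\<^sup>2 * (y \<omega> * y \<omega>) + b\<^sup>2 * (z \<omega> * z \<omega>) + c\<^sup>2 * (w \<omega> * w \<omega>)
       + 2 * a * (x \<omega> * y \<omega>) + 2 * b * (x \<omega> * z \<omega>) + 2 * c * (x \<omega> * w \<omega>)
       + 2 * (a * b) * (y \<omega> * z \<omega>) + 2 * (a * c) * (y \<omega> * w \<omega>) + 2 * (b * c) * (z \<omega> * w \<omega>))"
      unfolding T_def by (auto simp: power2_eq_square algebra_simps)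
    then show ?thesis unfolding I_def using H by simp
  qed
  have m4: "(\<integral>\<omega>. T a b c \<omega> ^ 4 \<partial>M) = 3 * (\<integral>\<omega>. (T a b c \<omega>)\<^sup>2 \<partial>M)\<^sup>2" for a b c
    by (rule centered_gaussian_fourth_moment[OF P cg])
  have pol: "A * B * C * D = (1/192) * ((A + 1 * B + 1 * C + 1 * D) ^ 4 - (A + 1 * B + 1 * C + (-1) * D) ^ 4
      - (A + 1 * B + (-1) * C + 1 * D) ^ 4 + (A + 1 * B + (-1) * C + (-1) * D) ^ 4
      - (A + (-1) * B + 1 * C + 1 * D) ^ 4 + (A + (-1) * B + 1 * C + (-1) * D) ^ 4
      + (A + (-1) * B + (-1) * C + 1 * D) ^ 4 - (A + (-1) * B + (-1) * C + (-1) * D) ^ 4)" for A B C D :: real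
    by (simp add: power4_eq_xxxx algebra_simps)
  have eq: "(\<lambda>\<omega>. x \<omega> * y \<omega> * z \<omega> * w \<omega>) = (\<lambda>\<omega>. (1/192) * (T 1 1 1 \<omega> ^ 4 - T 1 1 (-1) \<omega> ^ 4
      - T 1 (-1) 1 \<omega> ^ 4 + T 1 (-1) (-1) \<omega> ^ 4
      - T (-1) 1 1 \<omega> ^ 4 + T (-1) 1 (-1) \<omega> ^ 4
      + T (-1) (-1) 1 \<omega> ^ 4 - T (-1) (-1) (-1) \<omega> ^ 4))"
    unfolding T_def by (rule ext) (rule pol)
  show "integrable M (\<lambda>\<omega>. x \<omega> * y \<omega> * z \<omega> * w \<omega>)"
    unfolding eq using int by (intro integrable_mult_right Bochner_Integration.integrable_add Bochner_Integration.integrable_diff) auto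
  have "(\<integral>\<omega>. x \<omega> * y \<omega> * z \<omega> * w \<omega> \<partial>M) = I x y * I z w + I x z * I y w + I x w * I y z"
    unfolding eq using int by (simp add: m4 sq) (simp add: power2_eq_square algebra_simps)
  then show "(\<integral>\<omega>. x \<omega> * y \<omega> * z \<omega> * w \<omega> \<partial>M)
      = (\<integral>\<omega>. x \<omega> * y \<omega> \<partial>M) * (\<integral>\<omega>. z \<omega> * w \<omega> \<partial>M)
      + (\<integral>\<omega>. x \<omega> * z \<omega> \<partial>M) * (\<integral>\<omega>. y \<omega> * w \<omega> \<partial>M)
      + (\<integral>\<omega>. x \<omega> * w \<omega> \<partial>M) * (\<integral>\<omega>. y \<omega> * z \<omega> \<partial>M)" unfolding I_def .
qed

section \<open>A small ball estimate for successively renewed Gaussian variables\<close>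

text \<open>The characteristic function of \<open>r\<close> under the density \<open>exp (- s\<^sup>2 \<Sum> (q k)\<^sup>2 / 2)\<close>. At \<open>r = 0\<close> it is the Laplace
transform of the quadratic form \<open>\<Sum> (q k)\<^sup>2\<close>; the additional variable \<open>r\<close> is what makes an induction over \<open>n\<close>
possible.\<close>

definition damped_char :: "'a measure \<Rightarrow> real \<Rightarrow> (nat \<Rightarrow> 'a \<Rightarrow> real) \<Rightarrow> nat \<Rightarrow> ('a \<Rightarrow> real) \<Rightarrow> complex" where
  "damped_char M s q n r =
     (\<integral>\<omega>. complex_of_real (\<Prod>k<n. exp (- ((s * q k \<omega>)\<^sup>2 / 2))) * iexp (r \<omega>) \<partial>M)"

lemma norm_prod_exp_neg_le_1: "norm (complex_of_real (\<Prod>k<(n::nat). exp (- ((s * q k)\<^sup>2 / 2)))) \<le> 1"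
  unfolding norm_of_real by (subst abs_of_nonneg) (auto intro!: prod_le_1 prod_nonneg)

text \<open>A Gaussian factor is itself a characteristic function, \<open>exp (- x\<^sup>2 / 2) = E exp (i \<theta> x)\<close> for a standard normal \<open>\<theta>\<close>;
Fubini's theorem moves the average over \<open>\<theta>\<close> outside.\<close>

lemma damped_char_Suc:
  assumes "prob_space M" and [measurable]: "\<And>k. k \<le> n \<Longrightarrow> q k \<in> borel_measurable M" "r \<in> borel_measurable M"
  shows "damped_char M s q (Suc n) r
    = (\<integral>\<theta>. damped_char M s q n (\<lambda>\<omega>. r \<omega> + s * \<theta> * q n \<omega>) \<partial>std_normal_distribution)"
proof -
  interpret prob_space M by fact
  interpret N: real_distribution std_normal_distribution by (rule real_dist_normal_dist)
  interpret pair_prob_space M std_normal_distribution ..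
  have [measurable]: "q n \<in> borel_measurable M" by (rule assms) simp
  have [measurable]: "(\<lambda>\<omega>. complex_of_real (\<Prod>k<n. exp (- ((s * q k \<omega>)\<^sup>2 / 2)))) \<in> borel_measurable M"
    by (intro measurable_compose[OF _ borel_measurable_of_real] borel_measurable_prod
          measurable_compose[OF _ borel_measurable_exp] borel_measurable_uminus borel_measurable_divide
          borel_measurable_power borel_measurable_times borel_measurable_const assms) auto
  let ?p = "\<lambda>\<omega>. complex_of_real (\<Prod>k<n. exp (- ((s * q k \<omega>)\<^sup>2 / 2)))"
  have int: "integrable (M \<Otimes>\<^sub>M std_normal_distribution)
      (\<lambda>(\<omega>, \<theta>). ?p \<omega> * iexp (r \<omega> + s * \<theta> * q n \<omega>))"
  proof (rule P.integrable_const_bound[of _ 1])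
    show "AE x in M \<Otimes>\<^sub>M std_normal_distribution.
        norm (case x of (\<omega>, \<theta>) \<Rightarrow> ?p \<omega> * iexp (r \<omega> + s * \<theta> * q n \<omega>)) \<le> 1"
      using norm_prod_exp_neg_le_1 by (auto simp: norm_mult split_beta simp del: of_real_prod)
  qed measurable
  have ch: "(\<integral>\<theta>. iexp (s * \<theta> * q n \<omega>) \<partial>std_normal_distribution) = complex_of_real (exp (- ((s * q n \<omega>)\<^sup>2 / 2)))" for \<omega>
    using fun_cong[OF char_std_normal_distribution, of "s * q n \<omega>"]
    by (simp add: char_def mult_ac)
  have "damped_char M s q (Suc n) r
     = (\<integral>\<omega>. (\<integral>\<theta>. ?p \<omega> * iexp (r \<omega> + s * \<theta> * q n \<omega>) \<partial>std_normal_distribution) \<partial>M)"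
    unfolding damped_char_def
  proof (rule Bochner_Integration.integral_cong[OF refl])
    fix \<omega>
    have "(\<integral>\<theta>. ?p \<omega> * iexp (r \<omega> + s * \<theta> * q n \<omega>) \<partial>std_normal_distribution)
        = (\<integral>\<theta>. (?p \<omega> * iexp (r \<omega>)) * iexp (s * \<theta> * q n \<omega>) \<partial>std_normal_distribution)"
      by (simp add: exp_add distrib_left mult_ac)
    also have "\<dots> = (?p \<omega> * iexp (r \<omega>)) * complex_of_real (exp (- ((s * q n \<omega>)\<^sup>2 / 2)))"
      unfolding ch[symmetric] by (rule integral_mult_right_zero)
    finally show "complex_of_real (\<Prod>k<Suc n. exp (- ((s * q k \<omega>)\<^sup>2 / 2))) * iexp (r \<omega>)
        = (\<integral>\<theta>. ?p \<omega> * iexp (r \<omega> + s * \<theta> * q n \<omega>) \<partial>std_normal_distribution)"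
      by (simp add: mult_ac)
  qed
  also have "\<dots> = (\<integral>\<theta>. (\<integral>\<omega>. ?p \<omega> * iexp (r \<omega> + s * \<theta> * q n \<omega>) \<partial>M) \<partial>std_normal_distribution)"
    using Fubini_integral[OF int] by simp
  finally show ?thesis unfolding damped_char_def .
qed

text \<open>A component along a direction \<open>e\<close> that is uncorrelated with everything else splits off as the factor of an
independent normal variable.\<close>

lemma damped_char_shift:
  assumes P: "prob_space M" and G: "gaussian_space M H"
    and q: "\<And>k. k < n \<Longrightarrow> q k \<in> H" and e: "e \<in> H" and e1: "(\<integral>\<omega>. (e \<omega>)\<^sup>2 \<partial>M) = 1"
    and orth: "\<And>k. k < n \<Longrightarrow> (\<integral>\<omega>. q k \<omega> * e \<omega> \<partial>M) = 0"
    and r: "r \<in> H" "(\<integral>\<omega>. r \<omega> * e \<omega> \<partial>M) = 0"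
  shows "damped_char M s q n (\<lambda>\<omega>. r \<omega> + x * e \<omega>) = complex_of_real (exp (- (x\<^sup>2 / 2))) * damped_char M s q n r"
  using q orth r
proof (induction n arbitrary: r)
  case 0
  have sq: "square_integrable M r" "square_integrable M e" using gaussian_space_sq[OF G] 0 e by auto
  have "(\<integral>\<omega>. (r \<omega> + x * e \<omega>)\<^sup>2 \<partial>M) = (\<integral>\<omega>. (r \<omega>)\<^sup>2 + 2 * x * (r \<omega> * e \<omega>) + x\<^sup>2 * (e \<omega>)\<^sup>2 \<partial>M)"
    by (simp add: power2_eq_square algebra_simps)
  also have "\<dots> = (\<integral>\<omega>. (r \<omega>)\<^sup>2 \<partial>M) + x\<^sup>2"
    using sq square_integrable_mult[OF sq] 0 e1 unfolding square_integrable_def by simp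
  finally have v: "(\<integral>\<omega>. (r \<omega> + x * e \<omega>)\<^sup>2 \<partial>M) = (\<integral>\<omega>. (r \<omega>)\<^sup>2 \<partial>M) + x\<^sup>2" .
  have g: "(\<integral>\<omega>. iexp (Y \<omega>) \<partial>M) = complex_of_real (exp (- (\<integral>\<omega>. (Y \<omega>)\<^sup>2 \<partial>M) / 2))" if "Y \<in> H" for Y
  proof -
    have "(\<integral>\<omega>. iexp (1 * Y \<omega>) \<partial>M) = complex_of_real (exp (- (1\<^sup>2 * (\<integral>\<omega>. (Y \<omega>)\<^sup>2 \<partial>M)) / 2))"
      using G that unfolding gaussian_space_def centered_gaussian_def by blast
    then show ?thesis by simp
  qed
  have "- ((\<integral>\<omega>. (r \<omega>)\<^sup>2 \<partial>M) + x\<^sup>2) / 2 = - (x\<^sup>2 / 2) + (- (\<integral>\<omega>. (r \<omega>)\<^sup>2 \<partial>M) / 2)" by simp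
  then show ?case
    unfolding damped_char_def using g[OF gaussian_space_lin[OF G 0(3) e, of x]] g[OF 0(3)]
    by (simp add: v exp_add[symmetric] of_real_mult[symmetric] diff_divide_distrib add.commute
        del: exp_of_real of_real_mult)
next
  case (Suc n)
  have [measurable]: "Y \<in> borel_measurable M" if "Y \<in> H" for Y
    using gaussian_space_sq[OF G that] square_integrable_measurable by auto
  have sq: "square_integrable M Y" if "Y \<in> H" for Y
    using gaussian_space_sq[OF G that] .
  have step: "damped_char M s q n (\<lambda>\<omega>. r \<omega> + x * e \<omega> + s * \<theta> * q n \<omega>)
      = complex_of_real (exp (- (x\<^sup>2 / 2))) * damped_char M s q n (\<lambda>\<omega>. r \<omega> + s * \<theta> * q n \<omega>)" for \<theta>
  proof -
    have "damped_char M s q n (\<lambda>\<omega>. (r \<omega> + s * \<theta> * q n \<omega>) + x * e \<omega>)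
      = complex_of_real (exp (- (x\<^sup>2 / 2))) * damped_char M s q n (\<lambda>\<omega>. r \<omega> + s * \<theta> * q n \<omega>)"
    proof (rule Suc.IH)
      show "(\<lambda>\<omega>. r \<omega> + s * \<theta> * q n \<omega>) \<in> H" by (rule gaussian_space_lin[OF G]) (use Suc in auto)
      have "(\<integral>\<omega>. (r \<omega> + s * \<theta> * q n \<omega>) * e \<omega> \<partial>M) = (\<integral>\<omega>. r \<omega> * e \<omega> + s * \<theta> * (q n \<omega> * e \<omega>) \<partial>M)"
        by (simp add: algebra_simps)
      also have "\<dots> = 0"
        using square_integrable_mult[OF sq[of r] sq[OF e]] square_integrable_mult[OF sq[of "q n"] sq[OF e]] Suc.prems
        by simp
      finally show "(\<integral>\<omega>. (r \<omega> + s * \<theta> * q n \<omega>) * e \<omega> \<partial>M) = 0" .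
    qed (use Suc.prems in auto)
    then show ?thesis by (simp add: add_ac)
  qed
  have "damped_char M s q (Suc n) (\<lambda>\<omega>. r \<omega> + x * e \<omega>)
      = (\<integral>\<theta>. damped_char M s q n (\<lambda>\<omega>. r \<omega> + x * e \<omega> + s * \<theta> * q n \<omega>) \<partial>std_normal_distribution)"
    by (rule damped_char_Suc[OF P]) (use Suc.prems e gaussian_space_lin[OF G] in auto)
  also have "\<dots> = complex_of_real (exp (- (x\<^sup>2 / 2))) *
      (\<integral>\<theta>. damped_char M s q n (\<lambda>\<omega>. r \<omega> + s * \<theta> * q n \<omega>) \<partial>std_normal_distribution)"
    unfolding step by (rule integral_mult_right_zero)
  also have "(\<integral>\<theta>. damped_char M s q n (\<lambda>\<omega>. r \<omega> + s * \<theta> * q n \<omega>) \<partial>std_normal_distribution)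
      = damped_char M s q (Suc n) r"
    by (rule damped_char_Suc[OF P, symmetric]) (use Suc.prems in auto)
  finally show ?case .
qed

lemma gaussian_integral_shifted_exp_le:
  assumes "a \<noteq> 0"
  shows "(\<integral>\<theta>. exp (- ((x + a * \<theta>)\<^sup>2 / 2)) \<partial>std_normal_distribution) \<le> 1 / \<bar>a\<bar>"
proof -
  have nd: "exp (- ((x + a * \<theta>)\<^sup>2 / 2)) = sqrt (2 * pi) * (1 / \<bar>a\<bar>) * normal_density (- x / a) (1 / \<bar>a\<bar>) \<theta>" for \<theta>
  proof -
    have "(\<theta> - - x / a)\<^sup>2 / (2 * (1 / \<bar>a\<bar>)\<^sup>2) = (x + a * \<theta>)\<^sup>2 / 2"
      using assms by (simp add: power2_eq_square field_simps)
    moreover have "sqrt (2 * pi * (1 / \<bar>a\<bar>)\<^sup>2) = sqrt (2 * pi) * (1 / \<bar>a\<bar>)"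
      by (simp add: real_sqrt_mult real_sqrt_divide)
    ultimately show ?thesis unfolding normal_density_def using assms by simp
  qed
  have "(\<integral>\<theta>. exp (- ((x + a * \<theta>)\<^sup>2 / 2)) \<partial>std_normal_distribution)
      = (\<integral>\<theta>. std_normal_density \<theta> * exp (- ((x + a * \<theta>)\<^sup>2 / 2)) \<partial>lborel)"
    by (subst integral_density) auto
  also have "\<dots> \<le> (\<integral>\<theta>. (1 / \<bar>a\<bar>) * normal_density (- x / a) (1 / \<bar>a\<bar>) \<theta> \<partial>lborel)"
  proof (rule integral_mono')
    show "integrable lborel (\<lambda>\<theta>. (1 / \<bar>a\<bar>) * normal_density (- x / a) (1 / \<bar>a\<bar>) \<theta>)"
      using assms by (intro integrable_mult_right integrable_normal_density) auto
    fix \<theta> :: real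
    have "std_normal_density \<theta> \<le> 1 / sqrt (2 * pi)" unfolding std_normal_density_def by (simp add: divide_le_cancel)
    then have "std_normal_density \<theta> * exp (- ((x + a * \<theta>)\<^sup>2 / 2)) \<le> 1 / sqrt (2 * pi) * exp (- ((x + a * \<theta>)\<^sup>2 / 2))"
      by (intro mult_right_mono) auto
    then show "std_normal_density \<theta> * exp (- ((x + a * \<theta>)\<^sup>2 / 2)) \<le> (1 / \<bar>a\<bar>) * normal_density (- x / a) (1 / \<bar>a\<bar>) \<theta>"
      by (subst (asm) (2) nd) simp
  qed simp
  also have "\<dots> = 1 / \<bar>a\<bar>" using assms by simp
  finally show ?thesis .
qed

text \<open>Each variable \<open>q n\<close> has a component along a direction \<open>e n\<close> that is new compared with \<open>q 0, \<dots>, q (n - 1)\<close>. Averaging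
over \<open>\<theta>\<close> in \<open>damped_char_Suc\<close>, the shift along \<open>e n\<close> produces a Gaussian in \<open>\<theta>\<close> of width at most
\<open>1 / (c s)\<close>, and one factor \<open>1 / (c s)\<close> is gained for every variable. The bound has to be uniform in \<open>r\<close>, since the
remaining part of \<open>q n\<close> is absorbed in \<open>r\<close>.\<close>

lemma damped_char_bound:
  assumes P: "prob_space M" and G: "gaussian_space M H" and "s > 0" "c > 0"
    and q: "\<And>k. k < n \<Longrightarrow> q k \<in> H" and e: "\<And>k. k < n \<Longrightarrow> e k \<in> H"
    and e1: "\<And>k. k < n \<Longrightarrow> (\<integral>\<omega>. (e k \<omega>)\<^sup>2 \<partial>M) = 1"
    and orth: "\<And>k k'. k < n \<Longrightarrow> k' < k \<Longrightarrow> (\<integral>\<omega>. q k' \<omega> * e k \<omega> \<partial>M) = 0"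
    and cor: "\<And>k. k < n \<Longrightarrow> c \<le> \<bar>\<integral>\<omega>. q k \<omega> * e k \<omega> \<partial>M\<bar>"
    and r: "r \<in> H"
  shows "norm (damped_char M s q n r) \<le> (1 / (c * s)) ^ n"
  using q e e1 orth cor r
proof (induction n arbitrary: r)
  case 0
  interpret prob_space M by fact
  have "norm (\<integral>\<omega>. iexp (r \<omega>) \<partial>M) \<le> (\<integral>\<omega>. norm (iexp (r \<omega>)) \<partial>M)" by (rule integral_norm_bound)
  also have "\<dots> = 1" using prob_space by simp
  finally show ?case by (simp add: damped_char_def)
next
  case (Suc n)
  interpret prob_space M by fact
  interpret N: real_distribution std_normal_distribution by (rule real_dist_normal_dist)
  have [measurable]: "Y \<in> borel_measurable M" if "Y \<in> H" for Y
    using gaussian_space_sq[OF G that] square_integrable_measurable by auto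
  have sq: "square_integrable M Y" if "Y \<in> H" for Y
    using gaussian_space_sq[OF G that] .
  have H: "q n \<in> H" "e n \<in> H" "r \<in> H" using Suc.prems by auto
  have en: "(\<integral>\<omega>. e n \<omega> * e n \<omega> \<partial>M) = 1" using Suc.prems(3)[of n] by (simp add: power2_eq_square)
  define u where "u = (\<integral>\<omega>. q n \<omega> * e n \<omega> \<partial>M)"
  define x where "x = (\<integral>\<omega>. r \<omega> * e n \<omega> \<partial>M)"
  have u: "c \<le> \<bar>u\<bar>" using Suc.prems(5)[of n] unfolding u_def by simp
  then have u0: "u \<noteq> 0" using assms(4) by auto
  let ?K = "(1 / (c * s)) ^ n"
  have step: "norm (damped_char M s q n (\<lambda>\<omega>. r \<omega> + s * \<theta> * q n \<omega>)) \<le> exp (- ((x + (s * u) * \<theta>)\<^sup>2 / 2)) * ?K" for \<theta>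
  proof -
    \<comment> \<open>The part of \<open>r + s \<theta> q n\<close> that is uncorrelated with \<open>e n\<close>.\<close>
    define r' where "r' = (\<lambda>\<omega>. (r \<omega> + s * \<theta> * q n \<omega>) - (x + s * u * \<theta>) * e n \<omega>)"
    have r'H: "r' \<in> H"
      unfolding r'_def by (intro gaussian_space_diff[OF G] gaussian_space_lin[OF G] gaussian_space_cmult[OF G] H)
    have "(\<integral>\<omega>. r' \<omega> * e n \<omega> \<partial>M)
        = (\<integral>\<omega>. r \<omega> * e n \<omega> + s * \<theta> * (q n \<omega> * e n \<omega>) - (x + s * u * \<theta>) * (e n \<omega> * e n \<omega>) \<partial>M)"
      unfolding r'_def by (simp add: algebra_simps)
    also have "\<dots> = x + s * \<theta> * u - (x + s * u * \<theta>) * 1"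
      unfolding x_def u_def en[symmetric]
      using square_integrable_mult[OF sq[OF H(3)] sq[OF H(2)]] square_integrable_mult[OF sq[OF H(1)] sq[OF H(2)]]
        square_integrable_mult[OF sq[OF H(2)] sq[OF H(2)]] by simp
    finally have r'0: "(\<integral>\<omega>. r' \<omega> * e n \<omega> \<partial>M) = 0" by simp
    have "damped_char M s q n (\<lambda>\<omega>. r \<omega> + s * \<theta> * q n \<omega>) = damped_char M s q n (\<lambda>\<omega>. r' \<omega> + (x + s * u * \<theta>) * e n \<omega>)"
      unfolding r'_def by simp
    also have "\<dots> = complex_of_real (exp (- ((x + s * u * \<theta>)\<^sup>2 / 2))) * damped_char M s q n r'"
      by (rule damped_char_shift[OF P G _ H(2) _ _ r'H r'0]) (use Suc.prems in auto)
    finally have "norm (damped_char M s q n (\<lambda>\<omega>. r \<omega> + s * \<theta> * q n \<omega>))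
        = exp (- ((x + s * u * \<theta>)\<^sup>2 / 2)) * norm (damped_char M s q n r')"
      by (simp add: norm_mult del: of_real_exp)
    also have "\<dots> \<le> exp (- ((x + s * u * \<theta>)\<^sup>2 / 2)) * ?K"
      by (intro mult_left_mono Suc.IH[OF _ _ _ _ _ r'H]) (use Suc.prems in auto)
    finally show ?thesis .
  qed
  have "norm (damped_char M s q (Suc n) r)
     = norm (\<integral>\<theta>. damped_char M s q n (\<lambda>\<omega>. r \<omega> + s * \<theta> * q n \<omega>) \<partial>std_normal_distribution)"
    by (subst damped_char_Suc[OF P]) (use Suc.prems in auto)
  also have "\<dots> \<le> (\<integral>\<theta>. norm (damped_char M s q n (\<lambda>\<omega>. r \<omega> + s * \<theta> * q n \<omega>)) \<partial>std_normal_distribution)"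
    by (rule integral_norm_bound)
  also have "\<dots> \<le> (\<integral>\<theta>. exp (- ((x + (s * u) * \<theta>)\<^sup>2 / 2)) * ?K \<partial>std_normal_distribution)"
  proof (rule integral_mono')
    show "integrable std_normal_distribution (\<lambda>\<theta>. exp (- ((x + s * u * \<theta>)\<^sup>2 / 2)) * ?K)"
      by (intro integrable_mult_left N.integrable_const_bound[of _ 1]) auto
  qed (use step assms(3,4) in auto)
  also have "\<dots> = (\<integral>\<theta>. exp (- ((x + (s * u) * \<theta>)\<^sup>2 / 2)) \<partial>std_normal_distribution) * ?K"
    by (rule integral_mult_left_zero)
  also have "\<dots> \<le> 1 / \<bar>s * u\<bar> * ?K"
    by (intro mult_right_mono gaussian_integral_shifted_exp_le) (use u0 assms(3,4) in auto)
  also have "\<dots> \<le> 1 / (c * s) * ?K"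
    using u assms(3,4) by (intro mult_right_mono frac_le) (auto simp: abs_mult mult.commute)
  finally show ?case by simp
qed

text \<open>Markov's inequality for the exponential of \<open>- \<Sum> (q k)\<^sup>2 / (2 \<eta>)\<close>, whose expectation is a damped characteristic
function at the origin. The powers of \<open>\<eta>\<close> are as good as for independent variables.\<close>

lemma small_ball:
  assumes P: "prob_space M" and G: "gaussian_space M H" and "c > 0" "\<eta> > 0"
    and q: "\<And>k. k < n \<Longrightarrow> q k \<in> H" and e: "\<And>k. k < n \<Longrightarrow> e k \<in> H"
    and e1: "\<And>k. k < n \<Longrightarrow> (\<integral>\<omega>. (e k \<omega>)\<^sup>2 \<partial>M) = 1"
    and orth: "\<And>k k'. k < n \<Longrightarrow> k' < k \<Longrightarrow> (\<integral>\<omega>. q k' \<omega> * e k \<omega> \<partial>M) = 0"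
    and cor: "\<And>k. k < n \<Longrightarrow> c \<le> \<bar>\<integral>\<omega>. q k \<omega> * e k \<omega> \<partial>M\<bar>"
  shows "measure M {\<omega> \<in> space M. (\<Sum>k<n. (q k \<omega>)\<^sup>2) \<le> real n * \<eta>} \<le> (sqrt (exp 1 * \<eta>) / c) ^ n"
proof (cases "n = 0")
  case True
  interpret prob_space M by fact
  show ?thesis using True prob_space by simp
next
  case False
  interpret prob_space M by fact
  \<comment> \<open>With this choice the exponential is at least \<open>exp (- n / 2)\<close> on the event.\<close>
  define s where "s = 1 / sqrt \<eta>"
  have s: "s > 0" unfolding s_def using assms by simp
  have sm: "Y \<in> borel_measurable M" if "Y \<in> H" for Y
    using gaussian_space_sq[OF G that] square_integrable_measurable by auto
  have [measurable]: "(\<lambda>\<omega>. (\<Sum>k<n. (q k \<omega>)\<^sup>2)) \<in> borel_measurable M"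
    by (intro borel_measurable_sum borel_measurable_power sm q) auto
  define F where "F = (\<lambda>\<omega>. (\<Prod>k<n. exp (- ((s * q k \<omega>)\<^sup>2 / 2))))"
  have F: "F \<omega> = exp (- (\<Sum>k<n. (q k \<omega>)\<^sup>2) / (2 * \<eta>))" for \<omega>
    unfolding F_def exp_sum[OF finite_lessThan, symmetric] s_def using assms(4)
    by (simp add: power_mult_distrib sum_divide_distrib sum_negf power_divide mult_ac)
  have [measurable]: "F \<in> borel_measurable M" unfolding F by measurable
  have F1: "0 \<le> F \<omega>" "F \<omega> \<le> 1" for \<omega> unfolding F using assms(4) by (auto intro!: divide_nonneg_nonneg sum_nonneg)
  have intF: "integrable M F" by (rule integrable_const_bound[of _ 1]) (use F1 in auto)
  let ?A = "{\<omega> \<in> space M. (\<Sum>k<n. (q k \<omega>)\<^sup>2) \<le> real n * \<eta>}"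
  have A[measurable]: "?A \<in> sets M" by measurable
  have "measure M ?A = (\<integral>\<omega>. indicator ?A \<omega> \<partial>M)" by simp
  also have "\<dots> \<le> (\<integral>\<omega>. exp (real n / 2) * F \<omega> \<partial>M)"
  proof (rule integral_mono)
    show "integrable M (indicator ?A :: 'a \<Rightarrow> real)"
      by (rule integrable_real_indicator) (auto simp: emeasure_eq_measure)
    fix \<omega> assume "\<omega> \<in> space M"
    show "indicator ?A \<omega> \<le> exp (real n / 2) * F \<omega>"
    proof (cases "\<omega> \<in> ?A")
      case True
      then have "(\<Sum>k<n. (q k \<omega>)\<^sup>2) / (2 * \<eta>) \<le> real n / 2" using assms(4) by (simp add: field_simps)
      then have "1 \<le> exp (real n / 2 + - (\<Sum>k<n. (q k \<omega>)\<^sup>2) / (2 * \<eta>))" by simp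
      then show ?thesis using True unfolding F exp_add[symmetric] by simp
    qed (use F1 in auto)
  qed (use intF in auto)
  also have "\<dots> = exp (real n / 2) * (\<integral>\<omega>. F \<omega> \<partial>M)" by simp
  also have "(\<integral>\<omega>. F \<omega> \<partial>M) = norm (damped_char M s q n (\<lambda>\<omega>. 0))"
  proof -
    have "damped_char M s q n (\<lambda>\<omega>. 0) = (\<integral>\<omega>. complex_of_real (F \<omega>) \<partial>M)"
      unfolding damped_char_def F_def by simp
    also have "\<dots> = complex_of_real (\<integral>\<omega>. F \<omega> \<partial>M)" by (rule integral_complex_of_real)
    finally show ?thesis using F1 by (simp add: integral_nonneg)
  qed
  also have "\<dots> \<le> (1 / (c * s)) ^ n"
  proof (rule damped_char_bound[OF P G s \<open>c > 0\<close> q e e1 orth cor])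
    show "(\<lambda>\<omega>. 0) \<in> H" using gaussian_space_zero[OF G q[of 0]] False by auto
  qed auto
  also have "exp (real n / 2) * (1 / (c * s)) ^ n = (sqrt (exp 1 * \<eta>) / c) ^ n"
  proof -
    have "exp (real n / 2) = exp (1/2) ^ n" by (simp add: exp_of_nat_mult[symmetric])
    moreover have "exp (1/2) = sqrt (exp 1)"
      by (rule real_sqrt_unique[symmetric]) (auto simp: exp_double[symmetric] power2_eq_square exp_add[symmetric])
    ultimately show ?thesis unfolding s_def by (simp add: power_mult_distrib[symmetric] real_sqrt_mult mult_ac)
  qed
  finally show ?thesis by simp
qed

section \<open>Families of Gaussian autoregressions with common parameters\<close>

definition ar_residual :: "nat \<Rightarrow> (nat \<Rightarrow> real) \<Rightarrow> (int \<Rightarrow> 'w \<Rightarrow> real) \<Rightarrow> int \<Rightarrow> 'w \<Rightarrow> real" where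
  "ar_residual p \<phi> f t \<omega> = f t \<omega> - (\<Sum>j=1..p. \<phi> j * f (t - int j) \<omega>)"

text \<open>Each of the at most \<open>p\<close> first order recursions with ratio \<open>1 / (1 + \<delta>)\<close> multiplies the standard deviation by at most
\<open>1 / (1 - 1 / (1 + \<delta>))\<close>, starting from innovations of unit variance.\<close>

definition ar_variance_bound :: "nat \<Rightarrow> real \<Rightarrow> real" where
  "ar_variance_bound p \<delta> = (1 / (1 - 1 / (1 + \<delta>)) ^ p)\<^sup>2"

text \<open>Here \<open>m\<close> autoregressions share the parameters \<open>\<phi>\<close> and are driven by uncorrelated innovations of unit variance, all
inside one Gaussian space. Boundedness of the second moments selects the stationary solution.\<close>

locale gaussian_ar = prob_space M for M :: "'w measure" +
  fixes H :: "('w \<Rightarrow> real) set" and a :: "nat \<Rightarrow> int \<Rightarrow> 'w \<Rightarrow> real"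
    and p m :: nat and \<phi> :: "nat \<Rightarrow> real" and \<delta> :: real
  assumes gaussian: "gaussian_space M H"
    and a_in: "i < m \<Longrightarrow> a i t \<in> H"
    and innovations: "i < m \<Longrightarrow> i' < m \<Longrightarrow>
      (\<integral>\<omega>. ar_residual p \<phi> (a i) t \<omega> * ar_residual p \<phi> (a i') s \<omega> \<partial>M) = (if i = i' \<and> t = s then 1 else 0)"
    and bounded: "i < m \<Longrightarrow> \<exists>B. \<forall>t. (\<integral>\<omega>. (a i t \<omega>)\<^sup>2 \<partial>M) \<le> B"
    and \<delta>: "\<delta> > 0"
    and stable: "norm (z::complex) \<le> 1 + \<delta> \<Longrightarrow> 1 - (\<Sum>j=1..p. of_real (\<phi> j) * z ^ j) \<noteq> 0"
begin

abbreviation "\<epsilon> i \<equiv> ar_residual p \<phi> (a i)"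
abbreviation "\<kappa> \<equiv> ar_variance_bound p \<delta>"

lemma sq: "X \<in> H \<Longrightarrow> square_integrable M X"
  by (rule gaussian_space_sq[OF gaussian])

lemma mH: "X \<in> H \<Longrightarrow> X \<in> borel_measurable M"
  using sq square_integrable_measurable by blast

lemma iH: "X \<in> H \<Longrightarrow> Y \<in> H \<Longrightarrow> integrable M (\<lambda>\<omega>. X \<omega> * Y \<omega>)"
  by (intro square_integrable_mult sq)

lemma \<epsilon>_in: assumes "i < m" shows "\<epsilon> i t \<in> H"
proof -
  have "(\<lambda>\<omega>. \<Sum>j=1..p. \<phi> j * a i (t - int j) \<omega>) \<in> H"
    by (rule gaussian_space_sum[OF gaussian]) (use a_in[OF assms] gaussian_space_cmult[OF gaussian] in auto)
  from gaussian_space_diff[OF gaussian a_in[OF assms] this]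
  show ?thesis unfolding ar_residual_def[abs_def] .
qed

lemma char_poly:
  "\<exists>rs :: complex list. length rs \<le> p \<and> (\<forall>r\<in>set rs. norm r \<le> 1 / (1 + \<delta>)) \<and>
    (\<forall>f t. shift_apply (\<Prod>r\<leftarrow>rs. [:1, -r:]) f t = f t - (\<Sum>j=1..p. of_real (\<phi> j) * f (t - int j)))"
proof -
  define P :: "complex poly" where "P = 1 - (\<Sum>j=1..p. monom (of_real (\<phi> j)) j)"
  have pP: "poly P z = 1 - (\<Sum>j=1..p. of_real (\<phi> j) * z ^ j)" for z
    unfolding P_def by (simp add: poly_sum poly_monom)
  have "poly P 0 = 1" unfolding pP by (simp add: power_0_left)
  moreover have "poly P z \<noteq> 0" if "norm z \<le> 1 + \<delta>" for z
    unfolding pP by (rule stable[OF that])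
  ultimately obtain rs where rs: "length rs = degree P" "P = (\<Prod>r\<leftarrow>rs. [:1, -r:])"
      "\<forall>r\<in>set rs. norm r \<le> 1 / (1 + \<delta>)"
    using poly_factor_inverse_roots[of P "1 + \<delta>"] \<delta> by force
  have cP: "coeff P k = (if k = 0 then 1 else if k \<le> p then - of_real (\<phi> k) else 0)" for k
    unfolding P_def coeff_diff coeff_sum coeff_monom by (auto simp: sum.delta Suc_le_eq)
  have dP: "degree P \<le> p" by (rule degree_le) (auto simp: cP)
  have "shift_apply P f t = f t - (\<Sum>j=1..p. of_real (\<phi> j) * f (t - int j))" for f t
  proof -
    have "shift_apply P f t = (\<Sum>k\<le>p. coeff P k * f (t - int k))" by (rule shift_apply_bound[OF dP])
    also have "\<dots> = f t + (\<Sum>k=1..p. coeff P k * f (t - int k))"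
      by (simp add: atMost_atLeast0 sum.atLeast_Suc_atMost[of 0] cP)
    also have "(\<Sum>k=1..p. coeff P k * f (t - int k)) = - (\<Sum>j=1..p. of_real (\<phi> j) * f (t - int j))"
      by (simp add: cP sum_negf[symmetric])
    finally show ?thesis by simp
  qed
  then have "\<forall>f t. shift_apply (\<Prod>r\<leftarrow>rs. [:1, -r:]) f t = f t - (\<Sum>j=1..p. of_real (\<phi> j) * f (t - int j))"
    unfolding rs(2)[symmetric] by blast
  then show ?thesis using rs(3) rs(1) dP by (intro exI[of _ rs]) simp
qed

lemma shift_of_real:
  "of_real (a i t \<omega>) - (\<Sum>j=1..p. of_real (\<phi> j) * of_real (a i (t - int j) \<omega>)) = complex_of_real (\<epsilon> i t \<omega>)"
  by (simp add: ar_residual_def)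

lemma variance_le:
  assumes i: "i < m" shows "(\<integral>\<omega>. (a i t \<omega>)\<^sup>2 \<partial>M) \<le> \<kappa>"
proof -
  obtain rs :: "complex list" where rs: "length rs \<le> p" "\<forall>r\<in>set rs. norm r \<le> 1 / (1 + \<delta>)"
    "\<And>f t. shift_apply (\<Prod>r\<leftarrow>rs. [:1, -r:]) f t = f t - (\<Sum>j=1..p. of_real (\<phi> j) * f (t - int j))"
    using char_poly by blast
  obtain B where B: "\<And>t. (\<integral>\<omega>. (a i t \<omega>)\<^sup>2 \<partial>M) \<le> B" using bounded[OF i] by blast
  define S where "S = {u :: 'w \<Rightarrow> complex. u \<in> borel_measurable M \<and> square_integrable M (\<lambda>\<omega>. norm (u \<omega>))}"
  define \<nu> where "\<nu> u = sqrt (\<integral>\<omega>. (norm (u \<omega>))\<^sup>2 \<partial>M)" for u :: "'w \<Rightarrow> complex"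
  have dom: "\<nu> w \<le> \<nu> u + norm c * \<nu> v \<and> square_integrable M (\<lambda>\<omega>. norm (w \<omega>))"
    if u: "u \<in> S" and v: "v \<in> S" and w: "w \<in> borel_measurable M" "\<And>\<omega>. norm (w \<omega>) \<le> norm (u \<omega>) + norm c * norm (v \<omega>)"
    for u v w :: "'w \<Rightarrow> complex" and c :: complex
  proof -
    have u': "square_integrable M (\<lambda>\<omega>. norm (u \<omega>))" and v': "square_integrable M (\<lambda>\<omega>. norm c * norm (v \<omega>))"
      using u v square_integrable_cmult unfolding S_def by auto
    have s: "square_integrable M (\<lambda>\<omega>. norm (u \<omega>) + norm c * norm (v \<omega>))"
      by (rule square_integrable_add[OF u' v'])
    have w': "square_integrable M (\<lambda>\<omega>. norm (w \<omega>))"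
      by (rule square_integrable_bound[OF s]) (use w in \<open>auto simp: abs_of_nonneg\<close>)
    have "\<nu> w \<le> sqrt (\<integral>\<omega>. (norm (u \<omega>) + norm c * norm (v \<omega>))\<^sup>2 \<partial>M)"
      unfolding \<nu>_def using s w' w
      by (intro real_sqrt_le_mono integral_mono power_mono) (auto simp: square_integrable_def)
    also have "\<dots> \<le> sqrt (\<integral>\<omega>. (norm (u \<omega>))\<^sup>2 \<partial>M) + sqrt (\<integral>\<omega>. (norm c * norm (v \<omega>))\<^sup>2 \<partial>M)"
      by (rule minkowski_L2[OF u' v'])
    also have "\<dots> = \<nu> u + norm c * \<nu> v"
      unfolding \<nu>_def by (simp add: power_mult_distrib real_sqrt_mult)
    finally show ?thesis using w' by simp
  qed
  have closed: "(\<lambda>\<omega>. u \<omega> - c * v \<omega>) \<in> S" and tri1: "\<nu> (\<lambda>\<omega>. u \<omega> - c * v \<omega>) \<le> \<nu> u + norm c * \<nu> v"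
    if "u \<in> S" "v \<in> S" for u v c
  proof -
    have n: "norm (u \<omega> - c * v \<omega>) \<le> norm (u \<omega>) + norm c * norm (v \<omega>)" for \<omega>
      using norm_triangle_ineq4[of "u \<omega>" "c * v \<omega>"] by (simp add: norm_mult)
    have m: "(\<lambda>\<omega>. u \<omega> - c * v \<omega>) \<in> borel_measurable M" using that by (auto simp: S_def)
    show "(\<lambda>\<omega>. u \<omega> - c * v \<omega>) \<in> S" "\<nu> (\<lambda>\<omega>. u \<omega> - c * v \<omega>) \<le> \<nu> u + norm c * \<nu> v"
      using dom[OF that m n] m by (simp_all add: S_def)
  qed
  have tri2: "\<nu> u \<le> \<nu> (\<lambda>\<omega>. u \<omega> - c * v \<omega>) + norm c * \<nu> v" if "u \<in> S" "v \<in> S" for u v c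
  proof -
    have "norm (u \<omega>) \<le> norm (u \<omega> - c * v \<omega>) + norm c * norm (v \<omega>)" for \<omega>
      using norm_triangle_ineq[of "u \<omega> - c * v \<omega>" "c * v \<omega>"] by (simp add: norm_mult)
    then show ?thesis using dom[OF closed[OF that] that(2), of u c] that by (simp add: S_def)
  qed
  have aS: "(\<lambda>\<omega>. complex_of_real (a i t \<omega>)) \<in> S" for t
    using sq[OF a_in[OF i, of t]] by (auto simp: S_def square_integrable_def)
  have \<rho>: "0 \<le> 1 / (1 + \<delta>)" "1 / (1 + \<delta>) < 1" using \<delta> by auto
  have nn: "0 \<le> \<nu> u" for u unfolding \<nu>_def by simp
  have bd: "\<nu> (\<lambda>\<omega>. complex_of_real (a i t \<omega>)) \<le> sqrt B" for t
    unfolding \<nu>_def using B by simp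
  have res: "\<nu> (\<lambda>\<omega>. shift_apply (\<Prod>r\<leftarrow>rs. [:1, -r:]) (\<lambda>s. complex_of_real (a i s \<omega>)) s') \<le> 1" for s'
    unfolding rs(3) shift_of_real \<nu>_def using innovations[OF i i, of s' s'] by (simp add: power2_eq_square)
  have "\<nu> (\<lambda>\<omega>. complex_of_real (a i t \<omega>)) \<le> 1 / (1 - 1 / (1 + \<delta>)) ^ length rs"
    by (rule causal_seminorm_bound[where S = S and \<nu> = \<nu> and f = "\<lambda>t \<omega>. complex_of_real (a i t \<omega>)",
          OF closed nn tri1 tri2 \<rho> rs(2) aS bd res order.refl])
  also have "\<dots> \<le> 1 / (1 - 1 / (1 + \<delta>)) ^ p"
    using \<delta> rs(1) by (intro divide_left_mono power_decreasing) auto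
  finally have "sqrt (\<integral>\<omega>. (a i t \<omega>)\<^sup>2 \<partial>M) \<le> 1 / (1 - 1 / (1 + \<delta>)) ^ p"
    unfolding \<nu>_def by simp
  then show ?thesis
    unfolding ar_variance_bound_def by (rule sqrt_le_D)
qed

text \<open>The innovation at time \<open>t\<close> is uncorrelated with earlier innovations, and the process is a stable function of
innovations: \<open>causal_seminorm_bound\<close> with right hand side \<open>0\<close>. Different coordinates are uncorrelated at all times.\<close>

lemma orth_past:
  assumes i: "i < m" "i' < m" and "i \<noteq> i' \<or> s < t"
  shows "(\<integral>\<omega>. a i' s \<omega> * \<epsilon> i t \<omega> \<partial>M) = 0"
proof -
  obtain rs :: "complex list" where rs: "length rs \<le> p" "\<forall>r\<in>set rs. norm r \<le> 1 / (1 + \<delta>)"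
    "\<And>f t. shift_apply (\<Prod>r\<leftarrow>rs. [:1, -r:]) f t = f t - (\<Sum>j=1..p. of_real (\<phi> j) * f (t - int j))"
    using char_poly by blast
  define S where "S = {u :: 'w \<Rightarrow> complex. integrable M (\<lambda>\<omega>. \<epsilon> i t \<omega> *\<^sub>R u \<omega>)}"
  define \<nu> where "\<nu> u = norm (\<integral>\<omega>. \<epsilon> i t \<omega> *\<^sub>R u \<omega> \<partial>M)" for u :: "'w \<Rightarrow> complex"
  have eq: "(\<lambda>\<omega>. \<epsilon> i t \<omega> *\<^sub>R (u \<omega> - c * v \<omega>)) = (\<lambda>\<omega>. \<epsilon> i t \<omega> *\<^sub>R u \<omega> - c * (\<epsilon> i t \<omega> *\<^sub>R v \<omega>))" for u v :: "'w \<Rightarrow> complex" and c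
    by (rule ext) (simp add: scaleR_conv_of_real algebra_simps)
  have lin: "(\<integral>\<omega>. \<epsilon> i t \<omega> *\<^sub>R (u \<omega> - c * v \<omega>) \<partial>M)
      = (\<integral>\<omega>. \<epsilon> i t \<omega> *\<^sub>R u \<omega> \<partial>M) - c * (\<integral>\<omega>. \<epsilon> i t \<omega> *\<^sub>R v \<omega> \<partial>M)" if "u \<in> S" "v \<in> S" for u v c
    unfolding eq using that[unfolded S_def mem_Collect_eq]
    by (simp only: Bochner_Integration.integral_diff integrable_mult_right integral_mult_right_zero)
  have closed: "(\<lambda>\<omega>. u \<omega> - c * v \<omega>) \<in> S" if "u \<in> S" "v \<in> S" for u v c
    using that unfolding S_def mem_Collect_eq eq by (intro Bochner_Integration.integrable_diff integrable_mult_right)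
  obtain B where B: "\<And>t. (\<integral>\<omega>. (a i' t \<omega>)\<^sup>2 \<partial>M) \<le> B" using bounded[OF i(2)] by blast
  have ofr: "(\<integral>\<omega>. \<epsilon> i t \<omega> *\<^sub>R complex_of_real (X \<omega>) \<partial>M) = complex_of_real (\<integral>\<omega>. X \<omega> * \<epsilon> i t \<omega> \<partial>M)" for X
    unfolding integral_complex_of_real[symmetric] by (intro Bochner_Integration.integral_cong) (auto simp: scaleR_conv_of_real mult.commute)
  have aS: "(\<lambda>\<omega>. complex_of_real (a i' s \<omega>)) \<in> S" for s
    using iH[OF \<epsilon>_in[OF i(1)] a_in[OF i(2)]] by (simp add: S_def scaleR_conv_of_real of_real_mult[symmetric] del: of_real_mult)
  have tri1: "\<nu> (\<lambda>\<omega>. u \<omega> - c * v \<omega>) \<le> \<nu> u + norm c * \<nu> v" if "u \<in> S" "v \<in> S" for u v c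
    unfolding \<nu>_def lin[OF that] norm_mult[symmetric] by (rule norm_triangle_ineq4)
  have tri2: "\<nu> u \<le> \<nu> (\<lambda>\<omega>. u \<omega> - c * v \<omega>) + norm c * \<nu> v" if "u \<in> S" "v \<in> S" for u v c
    unfolding \<nu>_def lin[OF that] norm_mult[symmetric] by (metis diff_add_cancel norm_triangle_ineq)
  have \<rho>: "0 \<le> 1 / (1 + \<delta>)" "1 / (1 + \<delta>) < 1" using \<delta> by auto
  have nn: "0 \<le> \<nu> u" for u unfolding \<nu>_def by simp
  have bd: "\<nu> (\<lambda>\<omega>. complex_of_real (a i' s \<omega>)) \<le> sqrt B" for s
  proof -
    have "\<bar>\<integral>\<omega>. a i' s \<omega> * \<epsilon> i t \<omega> \<partial>M\<bar> \<le> sqrt (\<integral>\<omega>. (a i' s \<omega>)\<^sup>2 \<partial>M) * sqrt (\<integral>\<omega>. (\<epsilon> i t \<omega>)\<^sup>2 \<partial>M)"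
      by (intro cauchy_schwarz_L2_abs sq a_in \<epsilon>_in i)
    also have "\<dots> = sqrt (\<integral>\<omega>. (a i' s \<omega>)\<^sup>2 \<partial>M)"
      using innovations[OF i(1) i(1), of t t] by (simp add: power2_eq_square)
    also have "\<dots> \<le> sqrt B" using B by simp
    finally show ?thesis unfolding \<nu>_def ofr by simp
  qed
  have res: "\<nu> (\<lambda>\<omega>. shift_apply (\<Prod>r\<leftarrow>rs. [:1, -r:]) (\<lambda>s. complex_of_real (a i' s \<omega>)) s') \<le> 0" if "s' \<le> s" for s'
  proof -
    have "(\<integral>\<omega>. \<epsilon> i' s' \<omega> * \<epsilon> i t \<omega> \<partial>M) = 0"
      using innovations[OF i(2) i(1), of s' t] assms(3) that by auto
    then show ?thesis unfolding rs(3) shift_of_real \<nu>_def ofr by simp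
  qed
  have "\<nu> (\<lambda>\<omega>. complex_of_real (a i' s \<omega>)) \<le> 0 / (1 - 1 / (1 + \<delta>)) ^ length rs"
    by (rule causal_seminorm_bound[where S = S and \<nu> = \<nu> and f = "\<lambda>t \<omega>. complex_of_real (a i' t \<omega>)",
          OF closed nn tri1 tri2 \<rho> rs(2) aS bd res order.refl])
  then show ?thesis unfolding \<nu>_def ofr by simp
qed

lemma corr_same:
  assumes i: "i < m" shows "(\<integral>\<omega>. a i t \<omega> * \<epsilon> i t \<omega> \<partial>M) = 1"
proof -
  have "(\<integral>\<omega>. \<epsilon> i t \<omega> * \<epsilon> i t \<omega> \<partial>M)
      = (\<integral>\<omega>. a i t \<omega> * \<epsilon> i t \<omega> - (\<Sum>j=1..p. \<phi> j * (a i (t - int j) \<omega> * \<epsilon> i t \<omega>)) \<partial>M)"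
    by (subst (1) ar_residual_def) (simp add: left_diff_distrib sum_distrib_right mult.assoc)
  also have "\<dots> = (\<integral>\<omega>. a i t \<omega> * \<epsilon> i t \<omega> \<partial>M) - (\<Sum>j=1..p. \<phi> j * (\<integral>\<omega>. a i (t - int j) \<omega> * \<epsilon> i t \<omega> \<partial>M))"
    using iH[OF a_in[OF i] \<epsilon>_in[OF i]] by (subst Bochner_Integration.integral_diff) auto
  also have "(\<Sum>j=1..p. \<phi> j * (\<integral>\<omega>. a i (t - int j) \<omega> * \<epsilon> i t \<omega> \<partial>M)) = 0"
    by (rule sum.neutral) (use orth_past[OF i i] in auto)
  finally show ?thesis using innovations[OF i i, of t t] by simp
qed

lemma corr_le:
  assumes "i < m" shows "\<bar>\<integral>\<omega>. a i s \<omega> * \<epsilon> i t \<omega> \<partial>M\<bar> \<le> sqrt \<kappa>"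
proof -
  have "\<bar>\<integral>\<omega>. a i s \<omega> * \<epsilon> i t \<omega> \<partial>M\<bar> \<le> sqrt (\<integral>\<omega>. (a i s \<omega>)\<^sup>2 \<partial>M) * sqrt (\<integral>\<omega>. (\<epsilon> i t \<omega>)\<^sup>2 \<partial>M)"
    by (intro cauchy_schwarz_L2_abs sq a_in \<epsilon>_in assms)
  also have "\<dots> = sqrt (\<integral>\<omega>. (a i s \<omega>)\<^sup>2 \<partial>M)"
    using innovations[OF assms assms, of t t] by (simp add: power2_eq_square)
  also have "\<dots> \<le> sqrt \<kappa>" using variance_le[OF assms] by simp
  finally show ?thesis .
qed

definition block_bound :: real where "block_bound = 1 / (2 * (1 + sqrt \<kappa>) ^ p)"

lemma \<kappa>_nonneg: "0 \<le> \<kappa>" unfolding ar_variance_bound_def by simp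

lemma block_bound_pos: "block_bound > 0"
  unfolding block_bound_def using \<kappa>_nonneg by (auto intro!: divide_pos_pos mult_pos_pos zero_less_power add_pos_nonneg)

text \<open>The correlations of the regressors \<open>a (s + p - j)\<close> with the innovations at the times \<open>s + p - k\<close> form a triangular
matrix with unit diagonal and entries bounded by \<open>sqrt \<kappa>\<close>. Its inverse is bounded, so a vector with a coordinate of
size \<open>1 / 2\<close> cannot be mapped to a vector all of whose coordinates are below \<open>block_bound\<close>: by forward substitution the
coordinates of \<open>v\<close> would grow at most geometrically with ratio \<open>1 + sqrt \<kappa>\<close>.\<close>

lemma block_correlation:
  assumes i: "i < m" and j0: "j0 \<in> {1..p}" "1/2 \<le> \<bar>v j0\<bar>"
  shows "\<exists>k\<in>{1..p}. block_bound \<le> \<bar>\<integral>\<omega>. (\<Sum>j=1..p. v j * a i (s + int p - int j) \<omega>) * \<epsilon> i (s + int p - int k) \<omega> \<partial>M\<bar>"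
proof (rule ccontr)
  define A where "A j k = (\<integral>\<omega>. a i (s + int p - int j) \<omega> * \<epsilon> i (s + int p - int k) \<omega> \<partial>M)" for j k :: nat
  define u where "u k = (\<integral>\<omega>. (\<Sum>j=1..p. v j * a i (s + int p - int j) \<omega>) * \<epsilon> i (s + int p - int k) \<omega> \<partial>M)" for k :: nat
  assume "\<not> ?thesis"
  then have small: "\<bar>u k\<bar> < block_bound" if "k \<in> {1..p}" for k using that unfolding u_def by force
  have K: "0 \<le> sqrt \<kappa>" using \<kappa>_nonneg by simp
  have uk: "u k = (\<Sum>j=1..p. v j * A j k)" for k
  proof -
    have "u k = (\<integral>\<omega>. (\<Sum>j=1..p. v j * (a i (s + int p - int j) \<omega> * \<epsilon> i (s + int p - int k) \<omega>)) \<partial>M)"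
      unfolding u_def by (simp add: sum_distrib_right mult.assoc)
    then show ?thesis unfolding A_def using iH[OF a_in[OF i] \<epsilon>_in[OF i]] by simp
  qed
  have vk: "\<bar>v k\<bar> \<le> \<bar>u k\<bar> + sqrt \<kappa> * (\<Sum>j=1..<k. \<bar>v j\<bar>)" if k: "k \<in> {1..p}" for k
  proof -
    have "u k = (\<Sum>j\<in>{1..k}. v j * A j k)"
      unfolding uk using k orth_past[OF i i] by (intro sum.mono_neutral_right) (auto simp: A_def)
    also have "{1..k} = insert k {1..<k}" using k by auto
    also have "(\<Sum>j\<in>insert k {1..<k}. v j * A j k) = v k + (\<Sum>j=1..<k. v j * A j k)"
      using corr_same[OF i] by (simp add: A_def)
    finally have "v k = u k - (\<Sum>j=1..<k. v j * A j k)" by simp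
    then have "\<bar>v k\<bar> \<le> \<bar>u k\<bar> + \<bar>\<Sum>j=1..<k. v j * A j k\<bar>" by linarith
    also have "\<bar>\<Sum>j=1..<k. v j * A j k\<bar> \<le> (\<Sum>j=1..<k. \<bar>v j\<bar> * sqrt \<kappa>)"
      unfolding A_def by (intro order.trans[OF sum_abs] sum_mono)
        (auto simp: abs_mult intro!: mult_left_mono corr_le[OF i])
    also have "\<dots> = sqrt \<kappa> * (\<Sum>j=1..<k. \<bar>v j\<bar>)" by (simp add: sum_distrib_left mult.commute)
    finally show ?thesis by simp
  qed
  have geo: "block_bound + sqrt \<kappa> * (\<Sum>j=1..<Suc k. \<bar>v j\<bar>) \<le> block_bound * (1 + sqrt \<kappa>) ^ k" if "k \<le> p" for k
    using that
  proof (induction k)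
    case 0 then show ?case by simp
  next
    case (Suc k)
    have IH: "block_bound + sqrt \<kappa> * (\<Sum>j=1..<Suc k. \<bar>v j\<bar>) \<le> block_bound * (1 + sqrt \<kappa>) ^ k" using Suc by simp
    have "\<bar>v (Suc k)\<bar> \<le> block_bound * (1 + sqrt \<kappa>) ^ k"
      using vk[of "Suc k"] small[of "Suc k"] IH Suc.prems by simp
    then have "sqrt \<kappa> * \<bar>v (Suc k)\<bar> \<le> sqrt \<kappa> * (block_bound * (1 + sqrt \<kappa>) ^ k)" by (rule mult_left_mono[OF _ K])
    then show ?case using IH by (simp add: algebra_simps)
  qed
  obtain k where k: "j0 = Suc k" using j0(1) by (cases j0) auto
  have "\<bar>v j0\<bar> < block_bound + sqrt \<kappa> * (\<Sum>j=1..<j0. \<bar>v j\<bar>)"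
    using vk[OF j0(1)] small[OF j0(1)] by linarith
  also have "\<dots> \<le> block_bound * (1 + sqrt \<kappa>) ^ k" unfolding k using geo[of k] j0(1) k by simp
  also have "\<dots> \<le> block_bound * (1 + sqrt \<kappa>) ^ p"
    using block_bound_pos K j0(1) k by (intro mult_left_mono power_increasing) auto
  also have "\<dots> = 1/2" unfolding block_bound_def using K by (simp add: add_nonneg_eq_0_iff)
  finally show False using j0(2) by simp
qed

end

section \<open>Score and design of the regression\<close>

context gaussian_ar
begin

abbreviation lagged :: "nat \<Rightarrow> nat \<Rightarrow> nat \<Rightarrow> 'w \<Rightarrow> real" where
  "lagged i t j \<equiv> a i (int t + int p - int j)"

abbreviation noise :: "nat \<Rightarrow> nat \<Rightarrow> 'w \<Rightarrow> real" where
  "noise i t \<equiv> \<epsilon> i (int t + int p)"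

definition score :: "nat \<Rightarrow> nat \<Rightarrow> 'w \<Rightarrow> real" where
  "score N j \<omega> = (\<Sum>(i,t)\<in>{..<m}\<times>{1..N}. lagged i t j \<omega> * noise i t \<omega>)"

definition design_form :: "nat \<Rightarrow> (nat \<Rightarrow> real) \<Rightarrow> 'w \<Rightarrow> real" where
  "design_form N v \<omega> = (\<Sum>(i,t)\<in>{..<m}\<times>{1..N}. (\<Sum>j=1..p. v j * lagged i t j \<omega>)\<^sup>2)"

definition noise_energy :: "nat \<Rightarrow> 'w \<Rightarrow> real" where
  "noise_energy N \<omega> = (\<Sum>(i,t)\<in>{..<m}\<times>{1..N}. (noise i t \<omega>)\<^sup>2)"

definition design_trace :: "nat \<Rightarrow> 'w \<Rightarrow> real" where
  "design_trace N \<omega> = (\<Sum>(i,t)\<in>{..<m}\<times>{1..N}. \<Sum>j=1..p. (lagged i t j \<omega>)\<^sup>2)"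

lemma noise_in: "i < m \<Longrightarrow> noise i t \<in> H" by (rule \<epsilon>_in)
lemma lagged_in: "i < m \<Longrightarrow> lagged i t j \<in> H" by (rule a_in)

lemma score_measurable [measurable]: "score N j \<in> borel_measurable M"
  unfolding score_def[abs_def] split_beta
  by (intro borel_measurable_sum borel_measurable_times mH noise_in lagged_in) auto

lemma design_form_measurable [measurable]: "design_form N v \<in> borel_measurable M"
  unfolding design_form_def[abs_def] split_beta
  by (intro borel_measurable_sum borel_measurable_times borel_measurable_power borel_measurable_const mH noise_in lagged_in) auto

lemma noise_energy_measurable [measurable]: "noise_energy N \<in> borel_measurable M"
  unfolding noise_energy_def[abs_def] split_beta
  by (intro borel_measurable_sum borel_measurable_power mH noise_in) auto

lemma design_trace_measurable [measurable]: "design_trace N \<in> borel_measurable M"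
  unfolding design_trace_def[abs_def] split_beta
  by (intro borel_measurable_sum borel_measurable_power mH lagged_in) auto

lemma noise_energy_nonneg: "0 \<le> noise_energy N \<omega>"
  unfolding noise_energy_def by (auto intro!: sum_nonneg)

lemma design_trace_nonneg: "0 \<le> design_trace N \<omega>"
  unfolding design_trace_def by (auto intro!: sum_nonneg)

lemma innovation_product_zero:
  assumes "x \<in> H" "y \<in> H" "z \<in> H" "e \<in> H"
    and "(\<integral>\<omega>. x \<omega> * e \<omega> \<partial>M) = 0" "(\<integral>\<omega>. y \<omega> * e \<omega> \<partial>M) = 0" "(\<integral>\<omega>. z \<omega> * e \<omega> \<partial>M) = 0"
  shows "(\<integral>\<omega>. x \<omega> * y \<omega> * z \<omega> * e \<omega> \<partial>M) = 0"
  using isserlis(2)[OF prob_space_axioms gaussian assms(1-4)] assms(5-7) by simp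

text \<open>The summands are martingale differences. By Isserlis' theorem a product of two of them has mean zero, because the
later innovation is uncorrelated with the three other factors, and on the diagonal the variance of the regressor
remains.\<close>

lemma score_second_moment:
  assumes j: "j \<in> {1..p}"
  shows "integrable M (\<lambda>\<omega>. (score N j \<omega>)\<^sup>2)" "(\<integral>\<omega>. (score N j \<omega>)\<^sup>2 \<partial>M) \<le> real (m * N) * \<kappa>"
proof -
  define I where "I = {..<m} \<times> {1..N}"
  define g where "g x \<omega> = lagged (fst x) (snd x) j \<omega> * noise (fst x) (snd x) \<omega>" for x \<omega>
  have score: "score N j \<omega> = (\<Sum>x\<in>I. g x \<omega>)" for \<omega>
    unfolding score_def I_def g_def split_beta ..
  have fin: "finite I" unfolding I_def by auto
  have g2: "g x \<omega> * g y \<omega> = lagged (fst x) (snd x) j \<omega> * noise (fst x) (snd x) \<omega> * lagged (fst y) (snd y) j \<omega> * noise (fst y) (snd y) \<omega>" for x y \<omega>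
    unfolding g_def by simp
  have int: "integrable M (\<lambda>\<omega>. g x \<omega> * g y \<omega>)" if "x \<in> I" "y \<in> I" for x y
    unfolding g2 by (rule isserlis(1)[OF prob_space_axioms gaussian]) (use that in \<open>auto simp: I_def intro: noise_in lagged_in\<close>)
  have less: "(\<integral>\<omega>. g x \<omega> * g y \<omega> \<partial>M) = 0"
    if "x \<in> I" "y \<in> I" "snd x < snd y \<or> (snd x = snd y \<and> fst x \<noteq> fst y)" for x y
    unfolding g2
  proof (rule innovation_product_zero)
    show "lagged (fst x) (snd x) j \<in> H" "noise (fst x) (snd x) \<in> H" "lagged (fst y) (snd y) j \<in> H" "noise (fst y) (snd y) \<in> H"
      using that by (auto simp: I_def intro: noise_in lagged_in)
    show "(\<integral>\<omega>. lagged (fst x) (snd x) j \<omega> * noise (fst y) (snd y) \<omega> \<partial>M) = 0"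
      by (rule orth_past) (use that j in \<open>auto simp: I_def\<close>)
    show "(\<integral>\<omega>. lagged (fst y) (snd y) j \<omega> * noise (fst y) (snd y) \<omega> \<partial>M) = 0"
      by (rule orth_past) (use that j in \<open>auto simp: I_def\<close>)
    show "(\<integral>\<omega>. noise (fst x) (snd x) \<omega> * noise (fst y) (snd y) \<omega> \<partial>M) = 0"
      by (subst innovations) (use that in \<open>auto simp: I_def\<close>)
  qed
  have orth: "(\<integral>\<omega>. g x \<omega> * g y \<omega> \<partial>M) = 0" if "x \<in> I" "y \<in> I" "x \<noteq> y" for x y
  proof (cases "snd x < snd y \<or> (snd x = snd y \<and> fst x \<noteq> fst y)")
    case True then show ?thesis using less that by blast
  next
    case False
    then have "(\<integral>\<omega>. g y \<omega> * g x \<omega> \<partial>M) = 0"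
      using that by (intro less) (auto simp: prod_eq_iff)
    then show ?thesis by (simp add: mult.commute)
  qed
  have diag: "(\<integral>\<omega>. g x \<omega> * g x \<omega> \<partial>M) \<le> \<kappa>" if "x \<in> I" for x
  proof -
    have H: "lagged (fst x) (snd x) j \<in> H" "noise (fst x) (snd x) \<in> H" and i: "fst x < m"
      using that by (auto simp: I_def intro: noise_in lagged_in)
    have z1: "(\<integral>\<omega>. lagged (fst x) (snd x) j \<omega> * noise (fst x) (snd x) \<omega> \<partial>M) = 0"
      by (rule orth_past) (use that j in \<open>auto simp: I_def\<close>)
    have z2: "(\<integral>\<omega>. noise (fst x) (snd x) \<omega> * lagged (fst x) (snd x) j \<omega> \<partial>M) = 0"
      using z1 by (simp add: mult.commute)
    have "(\<integral>\<omega>. g x \<omega> * g x \<omega> \<partial>M) = (\<integral>\<omega>. (lagged (fst x) (snd x) j \<omega>)\<^sup>2 \<partial>M)"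
      unfolding g2 isserlis(2)[OF prob_space_axioms gaussian H H] z1 z2
      using innovations[OF i i, of "int (snd x) + int p" "int (snd x) + int p"] by (simp add: power2_eq_square)
    also have "\<dots> \<le> \<kappa>" by (rule variance_le[OF i])
    finally show ?thesis .
  qed
  have sq: "(score N j \<omega>)\<^sup>2 = (\<Sum>x\<in>I. \<Sum>y\<in>I. g x \<omega> * g y \<omega>)" for \<omega>
    unfolding score power2_eq_square sum_product ..
  have i2: "integrable M (\<lambda>\<omega>. (score N j \<omega>)\<^sup>2)" unfolding sq by (intro Bochner_Integration.integrable_sum int)
  have "(\<integral>\<omega>. (score N j \<omega>)\<^sup>2 \<partial>M) = (\<Sum>x\<in>I. \<Sum>y\<in>I. (\<integral>\<omega>. g x \<omega> * g y \<omega> \<partial>M))"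
    unfolding sq using int by (simp add: Bochner_Integration.integral_sum)
  also have "\<dots> = (\<Sum>x\<in>I. \<Sum>y\<in>I. if y = x then (\<integral>\<omega>. g x \<omega> * g x \<omega> \<partial>M) else 0)"
    using orth by (intro sum.cong refl) auto
  also have "\<dots> = (\<Sum>x\<in>I. (\<integral>\<omega>. g x \<omega> * g x \<omega> \<partial>M))"
    using fin by simp
  also have "\<dots> \<le> (\<Sum>x\<in>I. \<kappa>)" by (intro sum_mono diag)
  also have "\<dots> = real (m * N) * \<kappa>" unfolding I_def by simp
  finally show "(\<integral>\<omega>. (score N j \<omega>)\<^sup>2 \<partial>M) \<le> real (m * N) * \<kappa>" .
  show "integrable M (\<lambda>\<omega>. (score N j \<omega>)\<^sup>2)" by (rule i2)
qed

lemma noise_energy_second_moment: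
  "square_integrable M (noise_energy N)" "(\<integral>\<omega>. (noise_energy N \<omega>)\<^sup>2 \<partial>M) \<le> 3 * (real (m * N))\<^sup>2"
proof -
  define I where "I = {..<m} \<times> {1..N}"
  define g where "g x = noise (fst x) (snd x)" for x
  have E: "noise_energy N \<omega> = (\<Sum>x\<in>I. (g x \<omega>)\<^sup>2)" for \<omega>
    unfolding noise_energy_def I_def g_def split_beta ..
  have gH: "g x \<in> H" if "x \<in> I" for x using that unfolding g_def I_def by (auto intro: noise_in)
  then have cg: "centered_gaussian M (g x)" if "x \<in> I" for x
    using that gaussian unfolding gaussian_space_def by auto
  have var: "(\<integral>\<omega>. (g x \<omega>)\<^sup>2 \<partial>M) = 1" if "x \<in> I" for x
    unfolding power2_eq_square g_def using that by (subst innovations) (auto simp: I_def)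
  note m4 = centered_gaussian_fourth_moment[OF prob_space_axioms cg]
  have le: "(noise_energy N \<omega>)\<^sup>2 \<le> real (m * N) * (\<Sum>x\<in>I. (g x \<omega>) ^ 4)" for \<omega>
  proof -
    have "(\<Sum>x\<in>I. 1 * (g x \<omega>)\<^sup>2)\<^sup>2 \<le> (\<Sum>x\<in>I. 1\<^sup>2) * (\<Sum>x\<in>I. ((g x \<omega>)\<^sup>2)\<^sup>2)"
      by (rule Cauchy_Schwarz_ineq_sum)
    then show ?thesis unfolding E by (simp add: I_def)
  qed
  have int: "integrable M (\<lambda>\<omega>. real (m * N) * (\<Sum>x\<in>I. (g x \<omega>) ^ 4))"
    using m4(1) by auto
  show si: "square_integrable M (noise_energy N)"
    unfolding square_integrable_def
    by (intro conjI Bochner_Integration.integrable_bound[OF int]) (auto intro!: order.trans[OF le])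
  have "(\<integral>\<omega>. (noise_energy N \<omega>)\<^sup>2 \<partial>M) \<le> (\<integral>\<omega>. real (m * N) * (\<Sum>x\<in>I. (g x \<omega>) ^ 4) \<partial>M)"
    by (rule integral_mono) (use si int le in \<open>auto simp: square_integrable_def\<close>)
  also have "\<dots> = real (m * N) * (\<Sum>x\<in>I. 3)"
    using m4 var by (simp add: Bochner_Integration.integral_sum)
  also have "\<dots> = 3 * (real (m * N))\<^sup>2" by (simp add: I_def power2_eq_square)
  finally show "(\<integral>\<omega>. (noise_energy N \<omega>)\<^sup>2 \<partial>M) \<le> 3 * (real (m * N))\<^sup>2" .
qed

lemma design_trace_mean:
  "integrable M (design_trace N)" "(\<integral>\<omega>. design_trace N \<omega> \<partial>M) \<le> real (m * N) * (real p * \<kappa>)"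
proof -
  have int: "integrable M (\<lambda>\<omega>. (lagged i t j \<omega>)\<^sup>2)" if "i < m" for i t j
    using sq[OF lagged_in[OF that]] by (simp add: square_integrable_def)
  show "integrable M (design_trace N)" unfolding design_trace_def[abs_def]
    by (intro Bochner_Integration.integrable_sum) (auto simp: split_beta intro!: Bochner_Integration.integrable_sum int)
  have "(\<integral>\<omega>. design_trace N \<omega> \<partial>M) = (\<Sum>x\<in>{..<m}\<times>{1..N}. \<Sum>j=1..p. (\<integral>\<omega>. (lagged (fst x) (snd x) j \<omega>)\<^sup>2 \<partial>M))"
    unfolding design_trace_def split_beta
    by (subst Bochner_Integration.integral_sum) (auto intro!: Bochner_Integration.integrable_sum int sum.cong Bochner_Integration.integral_sum)
  also have "\<dots> \<le> (\<Sum>x\<in>{..<m}\<times>{1..N}. \<Sum>j=1..p. \<kappa>)"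
    by (intro sum_mono variance_le) auto
  also have "\<dots> = real (m * N) * (real p * \<kappa>)" by simp
  finally show "(\<integral>\<omega>. design_trace N \<omega> \<partial>M) \<le> real (m * N) * (real p * \<kappa>)" .
qed

text \<open>Only the first time of each block of length \<open>p\<close> is kept. Enumerated with the \<open>m\<close> coordinates of a block in succession,
these linear combinations satisfy the hypotheses of \<open>small_ball\<close>: the witness in a block is an innovation within that
block, uncorrelated with all earlier blocks and with the other coordinates.\<close>

lemma design_form_small_ball:
  assumes "m \<ge> 1" "p \<ge> 1" and v: "j0 \<in> {1..p}" "1/2 \<le> \<bar>v j0\<bar>" and B: "B * p \<le> N" and "\<eta> > 0"
  shows "measure M {\<omega> \<in> space M. design_form N v \<omega> \<le> real (m * B) * \<eta>}
      \<le> (sqrt (exp 1 * \<eta>) / block_bound) ^ (m * B)"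
proof -
  \<comment> \<open>The index \<open>k\<close> stands for coordinate \<open>k mod m\<close> at the first time of block \<open>k div m\<close>.\<close>
  define s where "s k = 1 + int ((k div m) * p)" for k :: nat
  define q where "q k \<omega> = (\<Sum>j=1..p. v j * a (k mod m) (s k + int p - int j) \<omega>)" for k \<omega>
  have i: "k mod m < m" for k using assms(1) by simp
  have "\<exists>l\<in>{1..p}. block_bound \<le> \<bar>\<integral>\<omega>. q k \<omega> * \<epsilon> (k mod m) (s k + int p - int l) \<omega> \<partial>M\<bar>" for k
    using block_correlation[of "k mod m" j0 v "s k", OF i[of k] v] unfolding q_def .
  then obtain l where l: "\<And>k. l k \<in> {1..p}"
      "\<And>k. block_bound \<le> \<bar>\<integral>\<omega>. q k \<omega> * \<epsilon> (k mod m) (s k + int p - int (l k)) \<omega> \<partial>M\<bar>"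
    by metis
  define e where "e k = \<epsilon> (k mod m) (s k + int p - int (l k))" for k
  have qH: "q k \<in> H" for k
  proof -
    have "(\<lambda>\<omega>. \<Sum>j=1..p. v j * a (k mod m) (s k + int p - int j) \<omega>) \<in> H"
      using gaussian_space_cmult[OF gaussian] a_in[OF i] a_in[OF i[of 0]]
      by (intro gaussian_space_sum[OF gaussian]) auto
    then show ?thesis unfolding q_def[abs_def] .
  qed
  have eH: "e k \<in> H" for k unfolding e_def by (rule \<epsilon>_in[OF i])
  have sb: "measure M {\<omega> \<in> space M. (\<Sum>k<m * B. (q k \<omega>)\<^sup>2) \<le> real (m * B) * \<eta>}
      \<le> (sqrt (exp 1 * \<eta>) / block_bound) ^ (m * B)"
  proof (rule small_ball[OF prob_space_axioms gaussian block_bound_pos \<open>\<eta> > 0\<close> qH eH])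
    show "(\<integral>\<omega>. (e k \<omega>)\<^sup>2 \<partial>M) = 1" for k
      unfolding e_def power2_eq_square by (subst innovations[OF i i]) simp
    show "block_bound \<le> \<bar>\<integral>\<omega>. q k \<omega> * e k \<omega> \<partial>M\<bar>" for k unfolding e_def by (rule l)
    fix k k' assume "k < m * B" "k' < k"
    have z: "(\<integral>\<omega>. a (k' mod m) (s k' + int p - int j) \<omega> * e k \<omega> \<partial>M) = 0" if j: "j \<in> {1..p}" for j
      unfolding e_def
    proof (rule orth_past[OF i i])
      show "k mod m \<noteq> k' mod m \<or> s k' + int p - int j < s k + int p - int (l k)"
      proof (cases "k' div m = k div m")
        case True
        then have "k mod m \<noteq> k' mod m" using \<open>k' < k\<close> by (metis div_mult_mod_eq less_not_refl)
        then show ?thesis by simp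
      next
        case False
        then have "Suc (k' div m) \<le> k div m" using \<open>k' < k\<close> div_le_mono[of k' k m] by simp
        then have "Suc (k' div m) * p \<le> (k div m) * p" by (rule mult_le_mono1)
        then have "(k' div m) * p + p \<le> (k div m) * p" by simp
        then have "int ((k' div m) * p) + int p \<le> int ((k div m) * p)"
          unfolding of_nat_add[symmetric] of_nat_le_iff .
        then show ?thesis using j l(1)[of k] unfolding s_def by auto
      qed
    qed
    have "(\<integral>\<omega>. q k' \<omega> * e k \<omega> \<partial>M) = (\<integral>\<omega>. (\<Sum>j=1..p. v j * (a (k' mod m) (s k' + int p - int j) \<omega> * e k \<omega>)) \<partial>M)"
      unfolding q_def by (simp add: sum_distrib_right mult.assoc)
    also have "\<dots> = (\<Sum>j=1..p. v j * (\<integral>\<omega>. a (k' mod m) (s k' + int p - int j) \<omega> * e k \<omega> \<partial>M))"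
      using iH[OF a_in[OF i] eH] by simp
    also have "\<dots> = 0" using z by simp
    finally show "(\<integral>\<omega>. q k' \<omega> * e k \<omega> \<partial>M) = 0" .
  qed
  have le: "(\<Sum>k<m * B. (q k \<omega>)\<^sup>2) \<le> design_form N v \<omega>" for \<omega>
  proof -
    define h where "h k = (k mod m, 1 + (k div m) * p)" for k
    have inj: "inj_on h {..<m * B}"
    proof (rule inj_onI)
      fix x y assume "h x = h y"
      then have "x mod m = y mod m" "x div m = y div m" using assms(2) by (auto simp: h_def)
      then show "x = y" by (metis div_mult_mod_eq)
    qed
    have sub: "h ` {..<m * B} \<subseteq> {..<m} \<times> {1..N}"
    proof
      fix x assume "x \<in> h ` {..<m * B}"
      then obtain k where k: "k < m * B" "x = h k" by auto
      have "k div m < B" using k(1) assms(1) by (simp add: div_less_iff_less_mult mult.commute)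
      then have "Suc (k div m) * p \<le> B * p" by (intro mult_le_mono1) simp
      then show "x \<in> {..<m} \<times> {1..N}" using k(2) B assms(2) i by (auto simp: h_def)
    qed
    have "(\<Sum>k<m * B. (q k \<omega>)\<^sup>2) = (\<Sum>x\<in>h ` {..<m * B}. (\<Sum>j=1..p. v j * lagged (fst x) (snd x) j \<omega>)\<^sup>2)"
      by (subst sum.reindex[OF inj]) (simp add: q_def h_def s_def)
    also have "\<dots> \<le> (\<Sum>x\<in>{..<m} \<times> {1..N}. (\<Sum>j=1..p. v j * lagged (fst x) (snd x) j \<omega>)\<^sup>2)"
      by (rule sum_mono2) (use sub in auto)
    finally show ?thesis unfolding design_form_def split_beta .
  qed
  have "measure M {\<omega> \<in> space M. design_form N v \<omega> \<le> real (m * B) * \<eta>}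
      \<le> measure M {\<omega> \<in> space M. (\<Sum>k<m * B. (q k \<omega>)\<^sup>2) \<le> real (m * B) * \<eta>}"
  proof (rule finite_measure_mono)
    have "(\<lambda>\<omega>. \<Sum>k<m * B. (q k \<omega>)\<^sup>2) \<in> borel_measurable M"
      by (intro borel_measurable_sum borel_measurable_power mH qH)
    then show "{\<omega> \<in> space M. (\<Sum>k<m * B. (q k \<omega>)\<^sup>2) \<le> real (m * B) * \<eta>} \<in> sets M" by measurable
  qed (use le order.trans in blast)
  then show ?thesis using sb by linarith
qed

end

lemma exponential_beats_power: "\<exists>C>0. \<forall>n::nat. 3 ^ p * real n ^ (p + 2) \<le> C * 2 ^ n"
proof -
  have "filterlim (\<lambda>n. real n * ln 2) at_top sequentially"
    unfolding mult.commute[of _ "ln 2 :: real"]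
    by (rule filterlim_tendsto_pos_mult_at_top[OF tendsto_const _ filterlim_real_sequentially]) simp
  then have "(\<lambda>n. (real n * ln 2) ^ (p + 2) / exp (real n * ln 2)) \<longlonglongrightarrow> 0"
    by (rule filterlim_compose[OF tendsto_power_div_exp_0])
  then have "(\<lambda>n. (1 / ln 2 ^ (p + 2)) * ((real n * ln 2) ^ (p + 2) / exp (real n * ln 2))) \<longlonglongrightarrow> (1 / ln 2 ^ (p + 2)) * 0"
    by (intro tendsto_mult_left)
  moreover have "(1 / ln 2 ^ (p + 2)) * ((real n * ln 2) ^ (p + 2) / exp (real n * ln 2)) = real n ^ (p + 2) / 2 ^ n" for n
    unfolding power_mult_distrib by (simp add: exp_of_nat_mult)
  ultimately have "(\<lambda>n. real n ^ (p + 2) / 2 ^ n) \<longlonglongrightarrow> 0" by simp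
  then have "Bseq (\<lambda>n. real n ^ (p + 2) / 2 ^ n)" by (rule convergent_imp_Bseq[OF convergentI])
  then obtain K where K: "K > 0" "\<And>n. norm (real n ^ (p + 2) / 2 ^ n) \<le> K" unfolding Bseq_def by blast
  have "3 ^ p * real n ^ (p + 2) \<le> (3 ^ p * K) * 2 ^ n" for n
    using K(2)[of n] by (simp add: field_simps)
  then show ?thesis using K(1) by (intro exI[of _ "3 ^ p * K"]) auto
qed

lemma block_count:
  fixes m N :: nat
  assumes "p \<ge> 1" and B: "B = N div p" and n: "n = m * B" and "B \<ge> 1"
  shows "real (m * N) \<le> 2 * real p * real n"
proof -
  have "N = B * p + N mod p" unfolding B by simp
  moreover have "N mod p < p" using assms(1) by simp
  moreover have "1 * p \<le> B * p" using assms(4) by (intro mult_le_mono1) simp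
  moreover have "2 * p * B = B * p + B * p" by simp
  ultimately have "N \<le> 2 * p * B" by linarith
  then have "m * N \<le> m * (2 * p * B)" by simp
  also have "\<dots> = 2 * p * n" unfolding n by simp
  finally have "real (m * N) \<le> real (2 * p * n)" by (rule of_nat_mono)
  then show ?thesis by simp
qed

section \<open>Near singularity of the design\<close>

text \<open>Points of the lattice \<open>\<int>\<^sup>p / R\<close> on the boundary of the unit cube.\<close>

definition sup_sphere_grid :: "nat \<Rightarrow> nat \<Rightarrow> (nat \<Rightarrow> real) set" where
  "sup_sphere_grid p R = (\<lambda>z j. real_of_int (z j) / real R) `
     {z \<in> {1..p} \<rightarrow>\<^sub>E {- int R..int R}. \<exists>j\<in>{1..p}. \<bar>z j\<bar> = int R}"

lemma finite_sup_sphere_grid: "finite (sup_sphere_grid p R)"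
  unfolding sup_sphere_grid_def
  by (intro finite_imageI finite_subset[OF Collect_restrict] finite_PiE) auto

lemma card_sup_sphere_grid: "card (sup_sphere_grid p R) \<le> (2 * R + 1) ^ p"
proof -
  have fin: "finite ({1..p} \<rightarrow>\<^sub>E {- int R..int R})" by (intro finite_PiE) auto
  have "card (sup_sphere_grid p R) \<le> card {z \<in> {1..p} \<rightarrow>\<^sub>E {- int R..int R}. \<exists>j\<in>{1..p}. \<bar>z j\<bar> = int R}"
    unfolding sup_sphere_grid_def by (intro card_image_le finite_subset[OF Collect_restrict] fin)
  also have "\<dots> \<le> card ({1..p} \<rightarrow>\<^sub>E {- int R..int R})"
    by (intro card_mono fin) auto
  also have "\<dots> = (2 * R + 1) ^ p" by (subst card_PiE) (auto simp: nat_add_distrib nat_mult_distrib)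
  finally show ?thesis .
qed

lemma nearest_in_sup_sphere_grid:
  assumes "R \<ge> 1" "\<And>j. j \<in> {1..p} \<Longrightarrow> \<bar>v j\<bar> \<le> 1" "j0 \<in> {1..p}" "\<bar>v j0\<bar> = 1"
  shows "\<exists>w\<in>sup_sphere_grid p R. \<forall>j\<in>{1..p}. \<bar>w j - v j\<bar> \<le> 1 / real R"
proof -
  define z where "z = (\<lambda>j\<in>{1..p}. \<lfloor>v j * real R\<rfloor>)"
  have R: "real R > 0" using assms(1) by simp
  have zin: "z \<in> {1..p} \<rightarrow>\<^sub>E {- int R..int R}"
  proof (rule PiE_I)
    fix j assume j: "j \<in> {1..p}"
    have "- 1 \<le> v j" "v j \<le> 1" using assms(2)[OF j] by auto
    then have "- real R \<le> v j * real R" "v j * real R \<le> real R"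
      using R mult_right_mono[of "-1" "v j" "real R"] mult_right_mono[of "v j" 1 "real R"] by auto
    then show "z j \<in> {- int R..int R}" using j unfolding z_def by (auto simp: le_floor_iff floor_le_iff)
  qed (auto simp: z_def)
  have "v j0 = 1 \<or> v j0 = -1" using assms(4) by linarith
  then have "\<bar>z j0\<bar> = int R" using assms(3) unfolding z_def by (auto simp: floor_minus)
  then have "(\<lambda>j. real_of_int (z j) / real R) \<in> sup_sphere_grid p R"
    unfolding sup_sphere_grid_def using zin assms(3) by blast
  moreover have "\<bar>real_of_int (z j) / real R - v j\<bar> \<le> 1 / real R" if "j \<in> {1..p}" for j
  proof -
    have "\<bar>real_of_int (z j) - v j * real R\<bar> \<le> 1" using that unfolding z_def by simp linarith
    then have "\<bar>real_of_int (z j) - v j * real R\<bar> / real R \<le> 1 / real R" using R by (intro divide_right_mono) auto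
    moreover have "\<bar>real_of_int (z j) - v j * real R\<bar> / real R = \<bar>(real_of_int (z j) - v j * real R) / real R\<bar>"
      using R by (simp add: abs_divide)
    moreover have "(real_of_int (z j) - v j * real R) / real R = real_of_int (z j) / real R - v j"
      using R by (simp add: field_simps)
    ultimately show ?thesis by simp
  qed
  ultimately show ?thesis by (intro bexI[of _ "\<lambda>j. real_of_int (z j) / real R"]) auto
qed

lemma grid_has_unit_coordinate:
  assumes "w \<in> sup_sphere_grid p R" "R \<ge> 1"
  shows "\<exists>j\<in>{1..p}. 1/2 \<le> \<bar>w j\<bar>"
proof -
  obtain z j where zj: "w = (\<lambda>j. real_of_int (z j) / real R)" "j \<in> {1..p}" "\<bar>z j\<bar> = int R"
    using assms(1) unfolding sup_sphere_grid_def by auto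
  have "\<bar>w j\<bar> = real_of_int \<bar>z j\<bar> / real R" unfolding zj(1) by (simp add: abs_divide)
  also have "\<dots> = 1" unfolding zj(3) using assms(2) by simp
  finally show ?thesis using zj(2) by (intro bexI[of _ j]) auto
qed

context gaussian_ar
begin

lemma design_form_le_trace:
  assumes "\<And>j. j \<in> {1..p} \<Longrightarrow> \<bar>u j\<bar> \<le> r"
  shows "design_form N u \<omega> \<le> real p * r\<^sup>2 * design_trace N \<omega>"
proof -
  have "(\<Sum>j=1..p. (u j)\<^sup>2) \<le> (\<Sum>j=1..p. r\<^sup>2)"
    by (intro sum_mono) (metis assms abs_ge_zero power2_abs power_mono)
  then have u2: "(\<Sum>j=1..p. (u j)\<^sup>2) \<le> real p * r\<^sup>2" by simp
  show ?thesis
    unfolding design_form_def design_trace_def split_beta sum_distrib_left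
  proof (rule sum_mono)
    fix x
    have "(\<Sum>j=1..p. u j * lagged (fst x) (snd x) j \<omega>)\<^sup>2
        \<le> (\<Sum>j=1..p. (u j)\<^sup>2) * (\<Sum>j=1..p. (lagged (fst x) (snd x) j \<omega>)\<^sup>2)"
      by (rule Cauchy_Schwarz_ineq_sum)
    also have "\<dots> \<le> (real p * r\<^sup>2) * (\<Sum>j=1..p. (lagged (fst x) (snd x) j \<omega>)\<^sup>2)"
      by (intro mult_right_mono u2 sum_nonneg) auto
    finally show "(\<Sum>j=1..p. u j * lagged (fst x) (snd x) j \<omega>)\<^sup>2
        \<le> (\<Sum>j=1..p. real p * r\<^sup>2 * (lagged (fst x) (snd x) j \<omega>)\<^sup>2)"
      by (simp only: sum_distrib_left)
  qed
qed

lemma design_form_perturb: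
  "design_form N w \<omega> \<le> 2 * design_form N v \<omega> + 2 * design_form N (\<lambda>j. w j - v j) \<omega>"
proof -
  have sq: "(x + y)\<^sup>2 \<le> 2 * x\<^sup>2 + 2 * y\<^sup>2" for x y :: real
    using sum_squares_bound[of x y] by (simp add: power2_sum)
  show ?thesis
    unfolding design_form_def split_beta sum_distrib_left sum.distrib[symmetric]
  proof (rule sum_mono)
    fix x
    let ?l = "\<lambda>j. lagged (fst x) (snd x) j \<omega>"
    have eq: "(\<Sum>j=1..p. w j * ?l j) = (\<Sum>j=1..p. v j * ?l j) + (\<Sum>j=1..p. (w j - v j) * ?l j)"
      by (simp add: sum.distrib[symmetric] algebra_simps)
    show "(\<Sum>j=1..p. w j * ?l j)\<^sup>2 \<le> 2 * (\<Sum>j=1..p. v j * ?l j)\<^sup>2 + 2 * (\<Sum>j=1..p. (w j - v j) * ?l j)\<^sup>2"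
      unfolding eq by (rule sq)
  qed
qed

lemma design_form_scale: "design_form N (\<lambda>j. c * v j) \<omega> = c\<^sup>2 * design_form N v \<omega>"
  unfolding design_form_def split_beta sum_distrib_left
  by (simp add: mult.assoc sum_distrib_left[symmetric] power_mult_distrib)

text \<open>Either the regressors are unusually large, or the quadratic form is small at a point of the grid. Outside of this
event the form is bounded below on the whole sphere, because it varies by at most the trace divided by \<open>R\<^sup>2\<close>
between a point and the nearest point of the grid (\<open>near_singularI\<close>).\<close>

definition near_singular :: "nat \<Rightarrow> nat \<Rightarrow> real \<Rightarrow> 'w set" where
  "near_singular N R \<theta> = {\<omega>\<in>space M. \<theta> * (real R)\<^sup>2 / (4 * real p) \<le> design_trace N \<omega>}
     \<union> (\<Union>w\<in>sup_sphere_grid p R. {\<omega>\<in>space M. design_form N w \<omega> \<le> \<theta>})"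

lemma near_singular_sets [measurable]: "near_singular N R \<theta> \<in> sets M"
  unfolding near_singular_def
  by (intro sets.Un sets.finite_UN finite_sup_sphere_grid) measurable

lemma near_singularI:
  assumes "p \<ge> 1" "R \<ge> 1" "\<omega> \<in> space M" "\<And>j. j \<in> {1..p} \<Longrightarrow> \<bar>v j\<bar> \<le> 1" "j0 \<in> {1..p}" "\<bar>v j0\<bar> = 1"
    and "design_form N v \<omega> \<le> \<theta> / 4"
  shows "\<omega> \<in> near_singular N R \<theta>"
proof (cases "\<theta> * (real R)\<^sup>2 / (4 * real p) \<le> design_trace N \<omega>")
  case True
  then show ?thesis using assms(3) unfolding near_singular_def by auto
next
  case False
  obtain w where w: "w \<in> sup_sphere_grid p R" "\<And>j. j \<in> {1..p} \<Longrightarrow> \<bar>w j - v j\<bar> \<le> 1 / real R"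
    using nearest_in_sup_sphere_grid[of R p v, OF assms(2,4,5,6)] by blast
  have "design_form N (\<lambda>j. w j - v j) \<omega> \<le> real p * (1 / real R)\<^sup>2 * design_trace N \<omega>"
    by (rule design_form_le_trace) (rule w(2))
  also have "\<dots> \<le> real p * (1 / real R)\<^sup>2 * (\<theta> * (real R)\<^sup>2 / (4 * real p))"
    using False by (intro mult_left_mono) auto
  also have "\<dots> = \<theta> / 4" using assms(1,2) by (simp add: power_divide)
  finally have "design_form N w \<omega> \<le> \<theta>"
    using design_form_perturb[of N w \<omega> v] assms(7) by linarith
  then show ?thesis using w(1) assms(3) unfolding near_singular_def by auto
qed

text \<open>With this threshold the base of the power in \<open>design_form_small_ball\<close> is \<open>1 / 2\<close>, and \<open>1 / (2 * 2\<^sup>k)\<close> at the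
threshold divided by \<open>4\<^sup>k\<close>.\<close>

definition \<eta>0 :: real where "\<eta>0 = block_bound\<^sup>2 / (4 * exp 1)"

lemma \<eta>0_pos: "\<eta>0 > 0" unfolding \<eta>0_def using block_bound_pos by simp

text \<open>Markov's inequality for the trace and a union bound over the grid. With mesh \<open>R = n * 16\<^sup>k\<close> the first part is of order
\<open>4\<^sup>k / 16\<^sup>2\<^sup>k = 64\<^sup>-\<^sup>k\<close>. In the second, the number of points \<open>(3 R)\<^sup>p\<close> is polynomial in \<open>n\<close> and \<open>16\<^sup>k\<close> and is
beaten by \<open>(2 * 2\<^sup>k)\<^sup>-\<^sup>n\<close> as soon as \<open>n \<ge> 4 p + 6\<close>.\<close>

lemma near_singular_prob:
  assumes "m \<ge> 1" "p \<ge> 1" and B: "B = N div p" and n: "n = m * B" and B6: "4 * p + 6 \<le> B"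
    and C: "\<And>n::nat. 3 ^ p * real n ^ (p + 2) \<le> C * 2 ^ n"
  shows "measure M (near_singular N (n * 16 ^ k) (real n * (\<eta>0 / 4 ^ k)))
      \<le> (8 * real p ^ 3 * \<kappa> / \<eta>0 + C) / (real n)\<^sup>2 * (1 / 64) ^ k"
proof -
  define R where "R = n * 16 ^ k"
  define \<theta> where "\<theta> = real n * (\<eta>0 / 4 ^ k)"
  have n1: "n \<ge> 1" and nB: "B \<le> n" using n assms(1) B6 by (auto simp: Suc_le_eq)
  have npos: "real n > 0" using n1 by simp
  have R1: "R \<ge> 1" unfolding R_def using n1 by simp
  have th: "\<theta> > 0" unfolding \<theta>_def using npos \<eta>0_pos by simp
  have BN: "B * p \<le> N" unfolding B by simp
  have mN: "real (m * N) \<le> 2 * real p * real n" by (rule block_count[OF assms(2) B n]) (use B6 in simp)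
  have p1: "measure M {\<omega>\<in>space M. \<theta> * (real R)\<^sup>2 / (4 * real p) \<le> design_trace N \<omega>}
      \<le> 8 * real p ^ 3 * \<kappa> / \<eta>0 / (real n)\<^sup>2 * (1 / 64) ^ k"
  proof -
    have "measure M {\<omega>\<in>space M. \<theta> * (real R)\<^sup>2 / (4 * real p) \<le> design_trace N \<omega>}
        \<le> (\<integral>\<omega>. design_trace N \<omega> \<partial>M) / (\<theta> * (real R)\<^sup>2 / (4 * real p))"
      by (rule integral_Markov_inequality_measure[where A = "space M"])
         (use design_trace_mean design_trace_nonneg th R1 assms(2) in auto)
    also have "\<dots> \<le> (2 * real p * real n * (real p * \<kappa>)) / (\<theta> * (real R)\<^sup>2 / (4 * real p))"
      using th \<kappa>_nonneg mN
      by (intro divide_right_mono order.trans[OF design_trace_mean(2)] mult_right_mono) auto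
    also have "\<dots> = 8 * real p ^ 3 * \<kappa> / \<eta>0 / (real n)\<^sup>2 * (4 ^ k / (16 ^ k)\<^sup>2)"
      unfolding \<theta>_def R_def using npos \<eta>0_pos assms(2) by (simp add: field_simps power2_eq_square power3_eq_cube)
    also have "(4::real) ^ k / (16 ^ k)\<^sup>2 = (1 / 64) ^ k"
      by (simp add: power2_eq_square power_mult_distrib[symmetric] power_divide[symmetric])
    finally show ?thesis .
  qed
  have p2: "measure M {\<omega>\<in>space M. design_form N w \<omega> \<le> \<theta>} \<le> (1 / (2 * 2 ^ k)) ^ n" if w: "w \<in> sup_sphere_grid p R" for w
  proof -
    obtain j0 where j0: "j0 \<in> {1..p}" "1/2 \<le> \<bar>w j0\<bar>" using grid_has_unit_coordinate[OF w R1] by blast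
    have "measure M {\<omega> \<in> space M. design_form N w \<omega> \<le> real (m * B) * (\<eta>0 / 4 ^ k)}
        \<le> (sqrt (exp 1 * (\<eta>0 / 4 ^ k)) / block_bound) ^ (m * B)"
      by (rule design_form_small_ball[of j0 w B N "\<eta>0 / 4 ^ k", OF assms(1,2) j0 BN]) (use \<eta>0_pos in simp)
    also have "sqrt (exp 1 * (\<eta>0 / 4 ^ k)) = block_bound / (2 * 2 ^ k)"
    proof (rule real_sqrt_unique)
      have "(2 ^ k)\<^sup>2 = (4::real) ^ k" by (simp add: power2_eq_square power_mult_distrib[symmetric])
      then show "(block_bound / (2 * 2 ^ k))\<^sup>2 = exp 1 * (\<eta>0 / 4 ^ k)"
        unfolding \<eta>0_def by (simp add: power_divide power_mult_distrib)
    qed (use block_bound_pos in simp)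
    finally show ?thesis unfolding \<theta>_def n using block_bound_pos by simp
  qed
  have "measure M (\<Union>w\<in>sup_sphere_grid p R. {\<omega>\<in>space M. design_form N w \<omega> \<le> \<theta>})
      \<le> (\<Sum>w\<in>sup_sphere_grid p R. measure M {\<omega>\<in>space M. design_form N w \<omega> \<le> \<theta>})"
    by (rule finite_measure_subadditive_finite) (auto simp: finite_sup_sphere_grid)
  also have "\<dots> \<le> (\<Sum>w\<in>sup_sphere_grid p R. (1 / (2 * 2 ^ k)) ^ n)"
    by (rule sum_mono) (rule p2)
  also have "\<dots> = real (card (sup_sphere_grid p R)) * (1 / (2 * 2 ^ k)) ^ n" by simp
  also have "\<dots> \<le> (3 * real R) ^ p * (1 / (2 * 2 ^ k)) ^ n"
  proof (rule mult_right_mono)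
    have "card (sup_sphere_grid p R) \<le> (3 * R) ^ p"
      using R1 by (intro order.trans[OF card_sup_sphere_grid] power_mono) auto
    then have "real (card (sup_sphere_grid p R)) \<le> real ((3 * R) ^ p)" by (rule of_nat_mono)
    then show "real (card (sup_sphere_grid p R)) \<le> (3 * real R) ^ p" by simp
  qed simp
  also have "\<dots> = (3 ^ p * real n ^ p / 2 ^ n) * (16 ^ p / 2 ^ n) ^ k"
    unfolding R_def by (simp add: power_mult_distrib power_divide power_mult[symmetric] mult.commute[of k])
  also have "\<dots> \<le> (C / (real n)\<^sup>2) * (1 / 64) ^ k"
  proof (intro mult_mono power_mono)
    have "3 ^ p * real n ^ p * (real n)\<^sup>2 \<le> C * 2 ^ n"
      using C[of n] by (simp add: power2_eq_square mult_ac)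
    then show "3 ^ p * real n ^ p / 2 ^ n \<le> C / (real n)\<^sup>2" using npos by (simp add: field_simps)
    have "(2::real) ^ (4 * p + 6) \<le> 2 ^ n" using B6 nB by (intro power_increasing) auto
    moreover have "(2::real) ^ (4 * p + 6) = 16 ^ p * 64" by (simp add: power_add power_mult)
    ultimately have "(16::real) ^ p * 64 \<le> 2 ^ n" by metis
    then show "16 ^ p / 2 ^ n \<le> (1 / 64 :: real)" by (simp add: divide_simps)
    have "0 \<le> C" using C[of 0] by simp
    then show "0 \<le> C / (real n)\<^sup>2" by simp
  qed auto
  finally have p2': "measure M (\<Union>w\<in>sup_sphere_grid p R. {\<omega>\<in>space M. design_form N w \<omega> \<le> \<theta>})
      \<le> (C / (real n)\<^sup>2) * (1 / 64) ^ k" .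
  have "measure M (near_singular N R \<theta>) \<le> measure M {\<omega>\<in>space M. \<theta> * (real R)\<^sup>2 / (4 * real p) \<le> design_trace N \<omega>}
     + measure M (\<Union>w\<in>sup_sphere_grid p R. {\<omega>\<in>space M. design_form N w \<omega> \<le> \<theta>})"
    unfolding near_singular_def
    by (intro measure_Un_le sets.finite_UN finite_sup_sphere_grid) measurable
  also have "\<dots> \<le> 8 * real p ^ 3 * \<kappa> / \<eta>0 / (real n)\<^sup>2 * (1 / 64) ^ k + (C / (real n)\<^sup>2) * (1 / 64) ^ k"
    by (intro add_mono p1 p2')
  also have "\<dots> = (8 * real p ^ 3 * \<kappa> / \<eta>0 + C) / (real n)\<^sup>2 * (1 / 64) ^ k"
    by (simp add: add_divide_distrib algebra_simps)
  finally show ?thesis unfolding R_def \<theta>_def .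
qed

end

section \<open>Risk of least squares at one level\<close>

context gaussian_ar
begin

text \<open>A bound that holds without any lower bound of the design: by Cauchy--Schwarz the score in direction \<open>\<Delta>\<close> is at
most \<open>sqrt (Q \<Delta>)\<close> times the norm of the noise.\<close>

lemma quadratic_bound_imp_energy_bound:
  assumes "design_form N \<Delta> \<omega> \<le> 2 * (\<Sum>j=1..p. \<Delta> j * score N j \<omega>)"
  shows "design_form N \<Delta> \<omega> \<le> 4 * noise_energy N \<omega>"
proof -
  define D where "D = design_form N \<Delta> \<omega>"
  define W where "W = noise_energy N \<omega>"
  define S where "S = (\<Sum>j=1..p. \<Delta> j * score N j \<omega>)"
  have D0: "0 \<le> D" unfolding D_def design_form_def by (auto intro!: sum_nonneg)
  have "S = (\<Sum>x\<in>{..<m}\<times>{1..N}. (\<Sum>j=1..p. \<Delta> j * lagged (fst x) (snd x) j \<omega>) * noise (fst x) (snd x) \<omega>)"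
    unfolding S_def score_def split_beta
    unfolding sum_distrib_left sum_distrib_right mult.assoc by (rule sum.swap)
  then have "S\<^sup>2 \<le> D * W"
    unfolding D_def W_def design_form_def noise_energy_def split_beta
    by (simp only:) (rule Cauchy_Schwarz_ineq_sum)
  moreover have "D\<^sup>2 \<le> (2 * S)\<^sup>2" using assms D0 unfolding D_def[symmetric] S_def[symmetric] by (intro power_mono) auto
  ultimately have "D\<^sup>2 \<le> 4 * (D * W)" unfolding power_mult_distrib by simp
  then have "D * D \<le> (4 * W) * D" by (simp add: power2_eq_square mult_ac)
  then show ?thesis
    unfolding D_def[symmetric] W_def[symmetric]
    using D0 noise_energy_nonneg[of N \<omega>] W_def by (cases "D = 0") auto
qed

text \<open>The first term is the size of the error where the design is not near singular. The \<open>k\<close>-th term of the series is a bound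
for the error where the form is below \<open>4\<^sup>-\<^sup>k\<close>, but not below a quarter of that, times its typical size. The
error itself need not be measurable, which is why a measurable bound is introduced.\<close>

definition ls_dominator :: "nat \<Rightarrow> nat \<Rightarrow> 'w \<Rightarrow> ennreal" where
  "ls_dominator N n \<omega> =
     ennreal (64 * (real p)\<^sup>2 / (real n * \<eta>0)\<^sup>2 * (\<Sum>j=1..p. (score N j \<omega>)\<^sup>2))
     + (\<Sum>k. ennreal (64 * real p / (real n * \<eta>0) * 4 ^ k * noise_energy N \<omega>)
            * indicator (near_singular N (n * 16 ^ k) (real n * (\<eta>0 / 4 ^ k))) \<omega>)"

lemma ls_dominator_measurable [measurable]: "ls_dominator N n \<in> borel_measurable M"
  unfolding ls_dominator_def[abs_def] by measurable

text \<open>Scale \<open>\<Delta>\<close> to the boundary of the unit cube, \<open>\<Delta> = d v\<close>, and let \<open>Q\<close> be the value of the form at \<open>v\<close>. If \<open>Q\<close> is of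
order \<open>n\<close>, then \<open>d\<^sup>2 Q \<le> 2 d \<bar>S\<bar>\<close> bounds \<open>d\<close> by the score; otherwise choose \<open>k\<close> by the size of \<open>Q\<close> and use
\<open>d\<^sup>2 Q \<le> 4 \<Sum> \<epsilon>\<^sup>2\<close>.\<close>

lemma ls_dominator_bounds:
  assumes "p \<ge> 1" "n \<ge> 1" "\<omega> \<in> space M"
    and escape: "\<omega> \<notin> (\<Inter>k. near_singular N (n * 16 ^ k) (real n * (\<eta>0 / 4 ^ k)))"
    and ls: "design_form N \<Delta> \<omega> \<le> 2 * (\<Sum>j=1..p. \<Delta> j * score N j \<omega>)"
  shows "ennreal (\<Sum>j=1..p. (\<Delta> j)\<^sup>2) \<le> ls_dominator N n \<omega>"
proof -
  define d where "d = Max ((\<lambda>j. \<bar>\<Delta> j\<bar>) ` {1..p})"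
  have fin: "finite ((\<lambda>j. \<bar>\<Delta> j\<bar>) ` {1..p})" and ne: "(\<lambda>j. \<bar>\<Delta> j\<bar>) ` {1..p} \<noteq> {}" using assms(1) by auto
  have dle: "\<bar>\<Delta> j\<bar> \<le> d" if "j \<in> {1..p}" for j unfolding d_def using that fin by (intro Max_ge) auto
  obtain j0 where j0: "j0 \<in> {1..p}" "\<bar>\<Delta> j0\<bar> = d" using Max_in[OF fin ne] unfolding d_def by auto
  have d0: "0 \<le> d" using j0 by auto
  have n0: "real n * \<eta>0 > 0" using assms(2) \<eta>0_pos by simp
  have "(\<Sum>j=1..p. (\<Delta> j)\<^sup>2) \<le> (\<Sum>j=1..p. d\<^sup>2)"
    by (intro sum_mono) (metis dle abs_ge_zero power2_abs power_mono)
  then have sum_le: "(\<Sum>j=1..p. (\<Delta> j)\<^sup>2) \<le> real p * d\<^sup>2" by simp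
  show ?thesis
  proof (cases "d = 0")
    case True
    then have "(\<Sum>j=1..p. (\<Delta> j)\<^sup>2) \<le> 0" using sum_le by simp
    then show ?thesis by (simp add: ennreal_neg)
  next
    case False
    then have d: "d > 0" using d0 by simp
    define v where "v j = \<Delta> j / d" for j
    have v1: "\<bar>v j\<bar> \<le> 1" if "j \<in> {1..p}" for j using dle[OF that] d unfolding v_def by simp
    have v2: "\<bar>v j0\<bar> = 1" using j0 d unfolding v_def by simp
    define Q where "Q = design_form N v \<omega>"
    have "design_form N (\<lambda>j. d * v j) \<omega> = d\<^sup>2 * Q" unfolding Q_def by (rule design_form_scale)
    moreover have "(\<lambda>j. d * v j) = \<Delta>" using d unfolding v_def by auto
    ultimately have QD: "design_form N \<Delta> \<omega> = d\<^sup>2 * Q" by simp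
    have Q0: "0 \<le> Q" unfolding Q_def design_form_def by (auto intro!: sum_nonneg)
    show ?thesis
    proof (cases "Q \<ge> real n * \<eta>0 / 4")
      case True
      have "(\<Sum>j=1..p. \<Delta> j * score N j \<omega>) \<le> (\<Sum>j=1..p. d * \<bar>score N j \<omega>\<bar>)"
      proof (rule sum_mono)
        fix j assume "j \<in> {1..p}"
        have "\<Delta> j * score N j \<omega> \<le> \<bar>\<Delta> j\<bar> * \<bar>score N j \<omega>\<bar>" by (metis abs_ge_self abs_mult)
        also have "\<dots> \<le> d * \<bar>score N j \<omega>\<bar>" by (intro mult_right_mono dle \<open>j \<in> {1..p}\<close>) auto
        finally show "\<Delta> j * score N j \<omega> \<le> d * \<bar>score N j \<omega>\<bar>" .
      qed
      then have "d\<^sup>2 * Q \<le> 2 * (d * (\<Sum>j=1..p. \<bar>score N j \<omega>\<bar>))"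
        using ls unfolding QD sum_distrib_left[of d, symmetric] by linarith
      then have "d * (d * Q) \<le> d * (2 * (\<Sum>j=1..p. \<bar>score N j \<omega>\<bar>))"
        by (simp add: power2_eq_square mult_ac)
      then have "d * Q \<le> 2 * (\<Sum>j=1..p. \<bar>score N j \<omega>\<bar>)" using d by simp
      moreover have "d * (real n * \<eta>0 / 4) \<le> d * Q" using True d by (intro mult_left_mono) auto
      ultimately have "d * (real n * \<eta>0) \<le> 8 * (\<Sum>j=1..p. \<bar>score N j \<omega>\<bar>)" by simp
      then have "(d * (real n * \<eta>0))\<^sup>2 \<le> (8 * (\<Sum>j=1..p. \<bar>score N j \<omega>\<bar>))\<^sup>2"
        using d n0 by (intro power_mono) auto
      also have "\<dots> = 64 * (\<Sum>j=1..p. 1 * \<bar>score N j \<omega>\<bar>)\<^sup>2" by (simp add: power_mult_distrib)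
      also have "\<dots> \<le> 64 * ((\<Sum>j=1..p. 1\<^sup>2) * (\<Sum>j=1..p. \<bar>score N j \<omega>\<bar>\<^sup>2))"
        by (intro mult_left_mono Cauchy_Schwarz_ineq_sum) simp
      finally have "d\<^sup>2 * (real n * \<eta>0)\<^sup>2 \<le> 64 * (real p * (\<Sum>j=1..p. (score N j \<omega>)\<^sup>2))"
        by (simp add: power_mult_distrib)
      then have "d\<^sup>2 \<le> 64 * (real p * (\<Sum>j=1..p. (score N j \<omega>)\<^sup>2)) / (real n * \<eta>0)\<^sup>2"
        using n0 by (subst pos_le_divide_eq) (simp_all only: zero_less_power)
      then have "real p * d\<^sup>2 \<le> real p * (64 * (real p * (\<Sum>j=1..p. (score N j \<omega>)\<^sup>2)) / (real n * \<eta>0)\<^sup>2)"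
        by (rule mult_left_mono) simp
      then have "(\<Sum>j=1..p. (\<Delta> j)\<^sup>2) \<le> 64 * (real p)\<^sup>2 / (real n * \<eta>0)\<^sup>2 * (\<Sum>j=1..p. (score N j \<omega>)\<^sup>2)"
        using sum_le by (simp add: power2_eq_square mult_ac)
      then have "ennreal (\<Sum>j=1..p. (\<Delta> j)\<^sup>2) \<le> ennreal (64 * (real p)\<^sup>2 / (real n * \<eta>0)\<^sup>2 * (\<Sum>j=1..p. (score N j \<omega>)\<^sup>2))"
        by (rule ennreal_leI)
      then show ?thesis unfolding ls_dominator_def by (rule order.trans) simp
    next
      case False
      have inside: "\<omega> \<in> near_singular N (n * 16 ^ k) (real n * (\<eta>0 / 4 ^ k))"
        if "Q \<le> real n * (\<eta>0 / 4 ^ k) / 4" for k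
        by (rule near_singularI[where v = v and ?j0.0 = j0])
           (use assms(1-3) v1 v2 j0 that in \<open>auto simp: Q_def\<close>)
      have "\<exists>k. \<omega> \<notin> near_singular N (n * 16 ^ k) (real n * (\<eta>0 / 4 ^ k))" using escape by auto
      then have ex: "\<exists>k. \<not> Q \<le> real n * (\<eta>0 / 4 ^ k) / 4" using inside by blast
      \<comment> \<open>The first threshold below \<open>Q\<close>; the previous one puts the sample in the event of index \<open>k = l - 1\<close>.\<close>
      define l where "l = (LEAST k. \<not> Q \<le> real n * (\<eta>0 / 4 ^ k) / 4)"
      have l: "\<not> Q \<le> real n * (\<eta>0 / 4 ^ l) / 4" unfolding l_def using LeastI_ex[OF ex] .
      have "l \<noteq> 0" using l False by (cases "l = 0") auto
      then obtain k where k: "l = Suc k" using not0_implies_Suc by blast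
      have "Q \<le> real n * (\<eta>0 / 4 ^ k) / 4"
        using not_less_Least[of k "\<lambda>k. \<not> Q \<le> real n * (\<eta>0 / 4 ^ k) / 4"] k unfolding l_def by auto
      then have ink: "\<omega> \<in> near_singular N (n * 16 ^ k) (real n * (\<eta>0 / 4 ^ k))" by (rule inside)
      have "d\<^sup>2 * (real n * \<eta>0 / (16 * 4 ^ k)) \<le> d\<^sup>2 * Q"
        using l unfolding k by (intro mult_left_mono) (auto simp: field_simps)
      also have "\<dots> \<le> 4 * noise_energy N \<omega>"
        using quadratic_bound_imp_energy_bound[OF ls] unfolding QD .
      finally have "d\<^sup>2 \<le> 64 / (real n * \<eta>0) * 4 ^ k * noise_energy N \<omega>"
        using n0 by (simp add: field_simps)
      then have "real p * d\<^sup>2 \<le> real p * (64 / (real n * \<eta>0) * 4 ^ k * noise_energy N \<omega>)"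
        by (rule mult_left_mono) simp
      then have "(\<Sum>j=1..p. (\<Delta> j)\<^sup>2) \<le> 64 * real p / (real n * \<eta>0) * 4 ^ k * noise_energy N \<omega>"
        using sum_le by (simp add: mult_ac)
      then have "ennreal (\<Sum>j=1..p. (\<Delta> j)\<^sup>2) \<le> ennreal (64 * real p / (real n * \<eta>0) * 4 ^ k * noise_energy N \<omega>)
          * indicator (near_singular N (n * 16 ^ k) (real n * (\<eta>0 / 4 ^ k))) \<omega>"
        using ink by (simp add: ennreal_leI)
      also have "\<dots> \<le> (\<Sum>k. ennreal (64 * real p / (real n * \<eta>0) * 4 ^ k * noise_energy N \<omega>)
            * indicator (near_singular N (n * 16 ^ k) (real n * (\<eta>0 / 4 ^ k))) \<omega>)"
      proof -
        have "f k \<le> suminf f" for f :: "nat \<Rightarrow> ennreal"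
          using sum_le_suminf[of f "{k}"] by simp
        then show ?thesis .
      qed
      finally show ?thesis unfolding ls_dominator_def by (rule order.trans) simp
    qed
  qed
qed

text \<open>The score contributes \<open>m N / n\<^sup>2\<close>. In the series, Cauchy--Schwarz bounds the noise energy on the near singular event
by \<open>m N\<close> times the square root of its probability, which is of order \<open>8\<^sup>-\<^sup>k / n\<close>; with the factor \<open>4\<^sup>k / n\<close> the series is
geometric and of order \<open>1 / n\<close>. Here \<open>n\<close> is the number of blocks, at least \<open>m N / (2 p)\<close>.\<close>

lemma least_squares_risk:
  assumes "m \<ge> 1" "p \<ge> 1" and N: "p * (4 * p + 6) \<le> N"
    and C: "\<And>n::nat. 3 ^ p * real n ^ (p + 2) \<le> C * 2 ^ n"
  shows "\<exists>D\<in>borel_measurable M.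
      (\<integral>\<^sup>+\<omega>. D \<omega> \<partial>M) \<le> ennreal (2 * real p * (128 * real p ^ 4 * \<kappa> / \<eta>0\<^sup>2
          + 512 * (real p)\<^sup>2 * sqrt (8 * real p ^ 3 * \<kappa> / \<eta>0 + C) / \<eta>0) / real (m * N)) \<and>
      (AE \<omega> in M. \<forall>\<Delta>. design_form N \<Delta> \<omega> \<le> 2 * (\<Sum>j=1..p. \<Delta> j * score N j \<omega>)
          \<longrightarrow> ennreal (\<Sum>j=1..p. (\<Delta> j)\<^sup>2) \<le> D \<omega>)"
proof -
  define B where "B = N div p"
  define n where "n = m * B"
  define C2 where "C2 = 8 * real p ^ 3 * \<kappa> / \<eta>0 + C"
  have B6: "4 * p + 6 \<le> B" unfolding B_def using N assms(2) by (simp add: less_eq_div_iff_mult_less_eq mult.commute)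
  have n1: "n \<ge> 1" unfolding n_def using assms(1) B6 by (auto simp: Suc_le_eq)
  have np: "real n > 0" using n1 by simp
  have C0: "0 \<le> C" using C[of 0] by simp
  have C20: "0 \<le> C2" unfolding C2_def using C0 \<kappa>_nonneg \<eta>0_pos by simp
  have mN: "real (m * N) \<le> 2 * real p * real n" by (rule block_count[OF assms(2) B_def n_def]) (use B6 in simp)
  have "N > 0" using N assms(2) by (cases N) auto
  then have mN0: "real (m * N) > 0" using assms(1) by simp
  let ?E = "\<lambda>k. near_singular N (n * 16 ^ k) (real n * (\<eta>0 / 4 ^ k))"
  have PE: "measure M (?E k) \<le> C2 / (real n)\<^sup>2 * (1 / 64) ^ k" for k
    unfolding C2_def by (rule near_singular_prob[OF assms(1,2) B_def n_def B6 C])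
  have "measure M (\<Inter>k. ?E k) \<le> C2 / (real n)\<^sup>2 * (1 / 64) ^ k" for k
    by (rule order.trans[OF finite_measure_mono PE[of k]]) auto
  moreover have "(\<lambda>k. C2 / (real n)\<^sup>2 * (1 / 64) ^ k) \<longlonglongrightarrow> C2 / (real n)\<^sup>2 * 0"
    by (intro tendsto_intros LIMSEQ_power_zero) simp
  ultimately have "measure M (\<Inter>k. ?E k) \<le> 0"
    using LIMSEQ_le_const by fastforce
  then have "emeasure M (\<Inter>k. ?E k) = 0"
    unfolding emeasure_eq_measure by (simp only: ennreal_eq_0_iff)
  then have null: "(\<Inter>k. ?E k) \<in> null_sets M" by (intro null_setsI) auto
  have AE1: "AE \<omega> in M. \<omega> \<notin> (\<Inter>k. ?E k)" by (rule AE_not_in[OF null])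
  have AE2: "AE \<omega> in M. \<forall>\<Delta>. design_form N \<Delta> \<omega> \<le> 2 * (\<Sum>j=1..p. \<Delta> j * score N j \<omega>)
          \<longrightarrow> ennreal (\<Sum>j=1..p. (\<Delta> j)\<^sup>2) \<le> ls_dominator N n \<omega>"
    using AE1 AE_space
  proof eventually_elim
    case (elim \<omega>)
    then show ?case using ls_dominator_bounds[OF assms(2) n1 elim(2,1)] by blast
  qed
  have "(\<integral>\<^sup>+\<omega>. ls_dominator N n \<omega> \<partial>M)
      = (\<integral>\<^sup>+\<omega>. ennreal (64 * (real p)\<^sup>2 / (real n * \<eta>0)\<^sup>2 * (\<Sum>j=1..p. (score N j \<omega>)\<^sup>2)) \<partial>M)
      + (\<Sum>k. \<integral>\<^sup>+\<omega>. ennreal (64 * real p / (real n * \<eta>0) * 4 ^ k * noise_energy N \<omega>) * indicator (?E k) \<omega> \<partial>M)"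
    unfolding ls_dominator_def by (subst nn_integral_add) (measurable, simp add: nn_integral_suminf)
  also have "\<dots> \<le> ennreal (128 * real p ^ 4 * \<kappa> / (\<eta>0\<^sup>2 * real n))
      + ennreal (512 * (real p)\<^sup>2 * sqrt C2 / (\<eta>0 * real n))"
  proof (rule add_mono)
    have i: "integrable M (\<lambda>\<omega>. \<Sum>j=1..p. (score N j \<omega>)\<^sup>2)"
      using score_second_moment by (intro Bochner_Integration.integrable_sum) auto
    have "(\<integral>\<omega>. (\<Sum>j=1..p. (score N j \<omega>)\<^sup>2) \<partial>M) = (\<Sum>j=1..p. (\<integral>\<omega>. (score N j \<omega>)\<^sup>2 \<partial>M))"
      using score_second_moment by (intro Bochner_Integration.integral_sum) auto
    also have "\<dots> \<le> (\<Sum>j=1..p. real (m * N) * \<kappa>)" by (intro sum_mono score_second_moment)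
    also have "\<dots> \<le> real p * (2 * real p * real n * \<kappa>)"
      using mult_right_mono[OF mN \<kappa>_nonneg] by (simp add: mult_left_mono)
    finally have s: "(\<integral>\<omega>. (\<Sum>j=1..p. (score N j \<omega>)\<^sup>2) \<partial>M) \<le> real p * (2 * real p * real n * \<kappa>)" .
    have "(\<integral>\<^sup>+\<omega>. ennreal (64 * (real p)\<^sup>2 / (real n * \<eta>0)\<^sup>2 * (\<Sum>j=1..p. (score N j \<omega>)\<^sup>2)) \<partial>M)
        = ennreal (\<integral>\<omega>. 64 * (real p)\<^sup>2 / (real n * \<eta>0)\<^sup>2 * (\<Sum>j=1..p. (score N j \<omega>)\<^sup>2) \<partial>M)"
      by (rule nn_integral_eq_integral) (use i in \<open>auto intro!: sum_nonneg mult_nonneg_nonneg divide_nonneg_nonneg\<close>)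
    also have "(\<integral>\<omega>. 64 * (real p)\<^sup>2 / (real n * \<eta>0)\<^sup>2 * (\<Sum>j=1..p. (score N j \<omega>)\<^sup>2) \<partial>M)
        = 64 * (real p)\<^sup>2 / (real n * \<eta>0)\<^sup>2 * (\<integral>\<omega>. (\<Sum>j=1..p. (score N j \<omega>)\<^sup>2) \<partial>M)" by simp
    also have "\<dots> \<le> 64 * (real p)\<^sup>2 / (real n * \<eta>0)\<^sup>2 * (real p * (2 * real p * real n * \<kappa>))"
      by (intro mult_left_mono s) auto
    also have "\<dots> = 128 * real p ^ 4 * \<kappa> / (\<eta>0\<^sup>2 * real n)"
      using np \<eta>0_pos by (simp add: field_simps power2_eq_square power4_eq_xxxx)
    finally show "(\<integral>\<^sup>+\<omega>. ennreal (64 * (real p)\<^sup>2 / (real n * \<eta>0)\<^sup>2 * (\<Sum>j=1..p. (score N j \<omega>)\<^sup>2)) \<partial>M)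
        \<le> ennreal (128 * real p ^ 4 * \<kappa> / (\<eta>0\<^sup>2 * real n))" by (simp add: ennreal_leI)
  next
    define c where "c = 256 * (real p)\<^sup>2 * sqrt C2 / (\<eta>0 * real n)"
    have c0: "0 \<le> c" unfolding c_def using np \<eta>0_pos C20 by simp
    have piece: "(\<integral>\<^sup>+\<omega>. ennreal (64 * real p / (real n * \<eta>0) * 4 ^ k * noise_energy N \<omega>) * indicator (?E k) \<omega> \<partial>M)
        \<le> ennreal (c * (1 / 2) ^ k)" for k
    proof -
      have si: "square_integrable M (indicator (?E k))"
        unfolding square_integrable_def using near_singular_sets[of N "n * 16 ^ k" "real n * (\<eta>0 / 4 ^ k)"]
        by (auto simp: power2_eq_square indicator_inter_arith[symmetric] emeasure_eq_measure intro!: integrable_real_indicator)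
      note sn = noise_energy_second_moment[of N]
      have int: "integrable M (\<lambda>\<omega>. noise_energy N \<omega> * indicator (?E k) \<omega>)"
        by (rule square_integrable_mult[OF sn(1) si])
      have "(\<integral>\<omega>. noise_energy N \<omega> * indicator (?E k) \<omega> \<partial>M)
          \<le> sqrt (\<integral>\<omega>. (noise_energy N \<omega>)\<^sup>2 \<partial>M) * sqrt (\<integral>\<omega>. (indicator (?E k) \<omega>)\<^sup>2 \<partial>M)"
        using cauchy_schwarz_L2_abs[OF sn(1) si] by linarith
      also have "(\<integral>\<omega>. (indicator (?E k) \<omega> :: real)\<^sup>2 \<partial>M) = measure M (?E k)"
        by (simp add: power2_eq_square indicator_inter_arith[symmetric])
      also have "sqrt (\<integral>\<omega>. (noise_energy N \<omega>)\<^sup>2 \<partial>M) * sqrt (measure M (?E k))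
          \<le> (2 * real (m * N)) * (sqrt C2 / real n * (1 / 8) ^ k)"
      proof (rule mult_mono)
        show "sqrt (\<integral>\<omega>. (noise_energy N \<omega>)\<^sup>2 \<partial>M) \<le> 2 * real (m * N)"
          by (rule real_le_lsqrt) (use sn(2) in \<open>auto simp: power_mult_distrib intro: order.trans\<close>)
        have "(1 / 64 :: real) ^ k = ((1 / 8) ^ k)\<^sup>2" by (simp add: power2_eq_square power_mult_distrib[symmetric])
        then have "sqrt (C2 / (real n)\<^sup>2 * (1 / 64) ^ k) = sqrt C2 / real n * (1 / 8) ^ k"
          by (simp add: real_sqrt_mult real_sqrt_divide)
        then show "sqrt (measure M (?E k)) \<le> sqrt C2 / real n * (1 / 8) ^ k"
          using real_sqrt_le_mono[OF PE[of k]] by simp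
      qed auto
      also have "\<dots> \<le> (2 * (2 * real p * real n)) * (sqrt C2 / real n * (1 / 8) ^ k)"
        using mN C20 np by (intro mult_right_mono mult_left_mono) auto
      also have "\<dots> = 4 * real p * sqrt C2 * (1 / 8) ^ k" using np by simp
      finally have e: "(\<integral>\<omega>. noise_energy N \<omega> * indicator (?E k) \<omega> \<partial>M) \<le> 4 * real p * sqrt C2 * (1 / 8) ^ k" .
      define K where "K = 64 * real p / (real n * \<eta>0) * 4 ^ k"
      have K0: "0 \<le> K" unfolding K_def using np \<eta>0_pos by simp
      have "(\<integral>\<^sup>+\<omega>. ennreal (K * noise_energy N \<omega>) * indicator (?E k) \<omega> \<partial>M)
          = (\<integral>\<^sup>+\<omega>. ennreal (K * (noise_energy N \<omega> * indicator (?E k) \<omega>)) \<partial>M)"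
        by (intro nn_integral_cong) (auto split: split_indicator)
      also have "\<dots> = ennreal (\<integral>\<omega>. K * (noise_energy N \<omega> * indicator (?E k) \<omega>) \<partial>M)"
        by (rule nn_integral_eq_integral) (use int K0 noise_energy_nonneg in auto)
      also have "(\<integral>\<omega>. K * (noise_energy N \<omega> * indicator (?E k) \<omega>) \<partial>M)
          = K * (\<integral>\<omega>. noise_energy N \<omega> * indicator (?E k) \<omega> \<partial>M)" by simp
      also have "\<dots> \<le> K * (4 * real p * sqrt C2 * (1 / 8) ^ k)" by (rule mult_left_mono[OF e K0])
      also have "\<dots> = c * (4 ^ k * (1 / 8) ^ k)"
        unfolding K_def c_def using np \<eta>0_pos by (simp add: field_simps power2_eq_square)
      also have "(4::real) ^ k * (1 / 8) ^ k = (1 / 2) ^ k" by (simp add: power_mult_distrib[symmetric])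
      finally show ?thesis unfolding K_def by (simp add: ennreal_leI)
    qed
    have sums: "(\<lambda>k. c * (1 / 2) ^ k) sums (c * 2)"
      using sums_mult[OF geometric_sums[of "1/2 :: real"], of c] by simp
    have "(\<Sum>k. \<integral>\<^sup>+\<omega>. ennreal (64 * real p / (real n * \<eta>0) * 4 ^ k * noise_energy N \<omega>) * indicator (?E k) \<omega> \<partial>M)
        \<le> (\<Sum>k. ennreal (c * (1 / 2) ^ k))"
      by (intro suminf_le piece) auto
    also have "\<dots> = ennreal (\<Sum>k. c * (1 / 2) ^ k)"
      using c0 sums by (intro suminf_ennreal2) (auto simp: sums_iff)
    also have "(\<Sum>k. c * (1 / 2) ^ k) = 512 * (real p)\<^sup>2 * sqrt C2 / (\<eta>0 * real n)"
      using sums unfolding sums_iff c_def by simp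
    finally show "(\<Sum>k. \<integral>\<^sup>+\<omega>. ennreal (64 * real p / (real n * \<eta>0) * 4 ^ k * noise_energy N \<omega>) * indicator (?E k) \<omega> \<partial>M)
        \<le> ennreal (512 * (real p)\<^sup>2 * sqrt C2 / (\<eta>0 * real n))" .
  qed
  also have "\<dots> = ennreal ((128 * real p ^ 4 * \<kappa> / \<eta>0\<^sup>2 + 512 * (real p)\<^sup>2 * sqrt C2 / \<eta>0) / real n)"
    using np \<eta>0_pos C20 \<kappa>_nonneg by (subst ennreal_plus[symmetric]) (auto simp: add_divide_distrib)
  also have "\<dots> \<le> ennreal (2 * real p * (128 * real p ^ 4 * \<kappa> / \<eta>0\<^sup>2 + 512 * (real p)\<^sup>2 * sqrt C2 / \<eta>0) / real (m * N))"
  proof (rule ennreal_leI)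
    let ?K = "128 * real p ^ 4 * \<kappa> / \<eta>0\<^sup>2 + 512 * (real p)\<^sup>2 * sqrt C2 / \<eta>0"
    have K0: "0 \<le> ?K" using \<eta>0_pos C20 \<kappa>_nonneg by simp
    have "1 / real n \<le> 2 * real p / real (m * N)" using mN mN0 np by (simp add: divide_simps mult_ac)
    from mult_left_mono[OF this K0] show "?K / real n \<le> 2 * real p * ?K / real (m * N)" by (simp add: mult_ac)
  qed
  finally show ?thesis using AE2 unfolding C2_def by (intro bexI[of _ "ls_dominator N n"] conjI) auto
qed

end

section \<open>Surface measure of the sphere\<close>

lemma lborel_distr_orthogonal:
  fixes f :: "real^'n::{finite,wellorder} \<Rightarrow> real^'n::{finite,wellorder}"
  assumes f: "orthogonal_transformation f"
  shows "distr lborel borel f = lborel"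
proof (rule lborel_eqI[symmetric])
  have lin: "linear f" using f by (rule orthogonal_transformation_linear)
  have [measurable]: "f \<in> borel_measurable borel"
    using linear_continuous_on[OF linear_conv_bounded_linear[THEN iffD1, OF lin]] by (rule borel_measurable_continuous_onI)
  define g where "g = inv f"
  have g: "orthogonal_transformation g" unfolding g_def by (rule orthogonal_transformation_inv[OF f])
  have bij: "bij f" by (rule orthogonal_transformation_bij[OF f])
  fix l u :: "real^'n::{finite,wellorder}" assume le: "\<And>b. b \<in> Basis \<Longrightarrow> l \<bullet> b \<le> u \<bullet> b"
  have vim: "f -` box l u = g ` box l u" unfolding g_def by (rule bij_vimage_eq_inv_image[OF bij])
  have det: "\<bar>det (matrix g)\<bar> = 1" using g by simp
  have "emeasure (distr lborel borel f) (box l u) = emeasure lborel (g ` box l u)"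
    by (subst emeasure_distr) (auto simp: vim)
  also have "\<dots> = emeasure lebesgue (g ` box l u)"
    using measurable_sets[of f borel borel "box l u"] by (simp add: vim)
  also have "\<dots> = ennreal (measure lebesgue (g ` box l u))"
    using measurable_linear_image[OF orthogonal_transformation_linear[OF g] lmeasurable_box, of l u]
    by (simp add: emeasure_eq_measure2)
  also have "measure lebesgue (g ` box l u) = measure lebesgue (box l u)"
    using measure_linear_image[OF orthogonal_transformation_linear[OF g] lmeasurable_box, of l u] det by simp
  also have "ennreal (measure lebesgue (box l u)) = (\<Prod>b\<in>Basis. (u - l) \<bullet> b)"
    using le by (simp add: measure_lborel_box_eq inner_diff_left)
  finally show "emeasure (distr lborel borel f) (box l u) = (\<Prod>b\<in>Basis. (u - l) \<bullet> b)" .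
qed simp

lemma sets_S2_measure [measurable_cong, simp]: "sets S2_measure = sets (restrict_space borel S2)"
  by (simp add: S2_measure_def sets_scale_measure)

lemma space_S2_measure [simp]: "space S2_measure = S2"
  by (simp add: S2_measure_def space_scale_measure space_restrict_space)

lemma measurable_S2_id [measurable]: "(\<lambda>x. x) \<in> S2_measure \<rightarrow>\<^sub>M borel"
proof -
  have "(\<lambda>x. x) \<in> restrict_space borel S2 \<rightarrow>\<^sub>M borel" by (rule measurable_restrict_space1) simp
  then show ?thesis unfolding measurable_cong_sets[OF sets_S2_measure refl] .
qed

lemma measurable_S2_borel: "f \<in> borel_measurable borel \<Longrightarrow> f \<in> borel_measurable S2_measure"
  by (rule measurable_compose[OF measurable_S2_id])

lemma measurable_sgn_S2: "sgn \<in> restrict_space lborel (ball 0 1 - {0::real^3}) \<rightarrow>\<^sub>M restrict_space borel S2"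
proof (rule measurable_restrict_space2)
  show "sgn \<in> borel_measurable (restrict_space lborel (ball 0 1 - {0::real^3}))"
    by (rule measurable_restrict_space1) simp
  show "sgn \<in> space (restrict_space lborel (ball 0 1 - {0::real^3})) \<rightarrow> S2"
    by (auto simp: space_restrict_space norm_sgn)
qed

lemma emeasure_S2_measure:
  assumes "A \<in> sets (restrict_space borel S2)"
  shows "emeasure S2_measure A = 3 * emeasure lborel {x \<in> ball 0 1 - {0}. sgn x \<in> A}"
proof -
  have "emeasure S2_measure A = 3 * emeasure (restrict_space lborel (ball 0 1 - {0}))
      (sgn -` A \<inter> space (restrict_space lborel (ball 0 1 - {0})))"
    unfolding S2_measure_def using assms by (simp add: emeasure_distr measurable_sgn_S2)
  also have "sgn -` A \<inter> space (restrict_space lborel (ball 0 1 - {0})) = {x \<in> ball 0 1 - {0}. sgn x \<in> A}"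
    by (auto simp: space_restrict_space)
  also have "emeasure (restrict_space lborel (ball 0 1 - {0})) {x \<in> ball 0 1 - {0}. sgn x \<in> A}
      = emeasure lborel {x \<in> ball 0 1 - {0}. sgn x \<in> A}"
    by (subst emeasure_restrict_space) auto
  finally show ?thesis .
qed

lemma emeasure_S2_total: "emeasure S2_measure S2 = ennreal (4 * pi)"
proof -
  have "{x \<in> ball 0 1 - {0::real^3}. sgn x \<in> S2} = ball 0 1 - {0}" by (auto simp: norm_sgn)
  moreover have "emeasure lborel (ball 0 1 - {0::real^3}) = emeasure lborel (ball 0 1 :: (real^3) set)"
    by (rule emeasure_Diff_null_set) (auto intro: null_setsI)
  moreover have "emeasure lborel (ball 0 1 :: (real^3) set) = ennreal (4 / 3 * pi)"
    by (subst emeasure_ball) (simp_all add: unit_ball_vol_3)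
  ultimately have "emeasure S2_measure S2 = ennreal 3 * ennreal (4 / 3 * pi)"
    using emeasure_S2_measure[of S2] by (simp add: sets_restrict_space_iff)
  also have "\<dots> = ennreal (4 * pi)" by (subst ennreal_mult[symmetric]) auto
  finally show ?thesis .
qed

interpretation S2: finite_measure S2_measure
  by (rule finite_measureI) (simp add: emeasure_S2_total)

lemma measure_S2_total [simp]: "measure S2_measure S2 = 4 * pi"
  by (simp add: measure_def emeasure_S2_total)

lemma orthogonal_S2_measurable:
  assumes f: "orthogonal_transformation (f :: real^3 \<Rightarrow> real^3)"
  shows "f \<in> S2_measure \<rightarrow>\<^sub>M S2_measure"
proof -
  have "f \<in> borel_measurable borel"
    using linear_continuous_on[OF linear_conv_bounded_linear[THEN iffD1, OF orthogonal_transformation_linear[OF f]]]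
    by (rule borel_measurable_continuous_onI)
  then have "f \<in> S2_measure \<rightarrow>\<^sub>M restrict_space borel S2"
    by (intro measurable_restrict_space2 measurable_S2_borel)
       (auto simp: orthogonal_transformation_norm[OF f])
  then show ?thesis unfolding measurable_cong_sets[OF refl sets_S2_measure] .
qed

text \<open>Rotations preserve Lebesgue measure and the punctured ball, and commute with the radial projection \<open>sgn\<close>.\<close>

lemma S2_measure_rotation_invariant:
  assumes f: "orthogonal_transformation (f :: real^3 \<Rightarrow> real^3)"
  shows "distr S2_measure S2_measure f = S2_measure"
proof (rule measure_eqI)
  note mf = orthogonal_S2_measurable[OF f]
  have mb[measurable]: "f \<in> borel_measurable borel"
    using linear_continuous_on[OF linear_conv_bounded_linear[THEN iffD1, OF orthogonal_transformation_linear[OF f]]]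
    by (rule borel_measurable_continuous_onI)
  have n: "norm (f x) = norm x" for x by (rule orthogonal_transformation_norm[OF f])
  have nz: "f x = 0 \<longleftrightarrow> x = 0" for x using n[of x] by (metis norm_eq_zero)
  have sgn: "sgn (f x) = f (sgn x)" for x
    unfolding sgn_div_norm n using orthogonal_transformation_scaleR[OF f] by metis
  fix A assume "A \<in> sets (distr S2_measure S2_measure f)"
  then have A: "A \<in> sets (restrict_space borel S2)" by simp
  then have AS: "A \<subseteq> S2" and Ab[measurable]: "A \<in> sets borel" by (auto simp: sets_restrict_space_iff)
  have pre: "f -` A \<inter> S2 \<in> sets (restrict_space borel S2)" using measurable_sets[OF mf, of A] A by simp
  have "{x \<in> ball 0 1 - {0}. sgn x \<in> f -` A \<inter> S2} = f -` {x \<in> ball 0 1 - {0}. sgn x \<in> A}"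
    using nz n by (auto simp: norm_sgn sgn)
  moreover have [measurable]: "{x \<in> ball 0 1 - {0}. sgn x \<in> A} \<in> sets borel"
    by measurable
  then have "emeasure lborel (f -` {x \<in> ball 0 1 - {0}. sgn x \<in> A}) = emeasure (distr lborel borel f) {x \<in> ball 0 1 - {0}. sgn x \<in> A}"
    by (subst emeasure_distr) auto
  ultimately show "emeasure (distr S2_measure S2_measure f) A = emeasure S2_measure A"
    using A pre by (simp add: emeasure_distr[OF mf] emeasure_S2_measure lborel_distr_orthogonal[OF f])
qed simp

lemma S2_integral_rotate:
  fixes g :: "real^3 \<Rightarrow> real"
  assumes f: "orthogonal_transformation f" and g: "g \<in> borel_measurable S2_measure"
  shows "(\<integral>z. g (f z) \<partial>S2_measure) = (\<integral>z. g z \<partial>S2_measure)"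
  using integral_distr[OF orthogonal_S2_measurable[OF f] g] S2_measure_rotation_invariant[OF f] by simp

lemma S2_integrable_bounded:
  fixes g :: "real^3 \<Rightarrow> real"
  assumes "g \<in> borel_measurable S2_measure" "\<And>z. z \<in> S2 \<Longrightarrow> \<bar>g z\<bar> \<le> B"
  shows "integrable S2_measure g"
  by (rule S2.integrable_const_bound[of _ B]) (use assms in auto)

lemma S2_inner_le: "x \<in> S2 \<Longrightarrow> y \<in> S2 \<Longrightarrow> \<bar>x \<bullet> y\<bar> \<le> 1"
  using Cauchy_Schwarz_ineq2[of x y] by simp

lemma S2_inner_range: "x \<in> S2 \<Longrightarrow> y \<in> S2 \<Longrightarrow> x \<bullet> y \<in> {-1..1}"
  using S2_inner_le[of x y] by (auto simp: abs_le_iff)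

lemma S2_inner_measurable [measurable]: "(\<lambda>z. x \<bullet> z) \<in> borel_measurable S2_measure"
  by measurable

definition S2_moment :: "nat \<Rightarrow> real" where
  "S2_moment n = (\<integral>z. (axis 1 1 \<bullet> z) ^ n \<partial>S2_measure)"

lemma S2_integral_inner_power: "(\<integral>z. (v \<bullet> z) ^ n \<partial>S2_measure) = norm v ^ n * S2_moment n"
proof (cases "v = 0")
  case True
  then show ?thesis by (cases n) (auto simp: S2_moment_def)
next
  case False
  define e :: "real^3" where "e = axis 1 1"
  define w where "w = v /\<^sub>R norm v"
  have "norm e = 1" "norm w = 1" using False by (auto simp: e_def w_def)
  then obtain f where f: "orthogonal_transformation f" "f e = w"
    by (rule orthogonal_transformation_exists_1)
  have "(\<integral>z. (w \<bullet> z) ^ n \<partial>S2_measure) = (\<integral>z. (w \<bullet> f z) ^ n \<partial>S2_measure)"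
    by (rule S2_integral_rotate[OF f(1), symmetric]) measurable
  also have "\<dots> = S2_moment n"
    unfolding S2_moment_def e_def[symmetric] using f by (simp add: orthogonal_transformation_def f(2)[symmetric])
  finally have "(\<integral>z. (w \<bullet> z) ^ n \<partial>S2_measure) = S2_moment n" .
  moreover have "(v \<bullet> z) ^ n = norm v ^ n * (w \<bullet> z) ^ n" for z
    using False by (simp add: w_def power_mult_distrib[symmetric] mult.assoc[symmetric])
  ultimately show ?thesis by simp
qed

lemma S2_moment_odd: "odd n \<Longrightarrow> S2_moment n = 0"
  using S2_integral_rotate[of "\<lambda>z. - z" "\<lambda>z. (axis 1 1 \<bullet> z) ^ n"] orthogonal_transformation_neg[of "\<lambda>x::real^3. x"]
  by (simp add: S2_moment_def)

lemma coeff_quadratic_power: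
  "\<exists>q. degree q \<le> i \<and> (\<forall>\<sigma>::real. coeff ([:1, 2 * \<sigma>, 1:] ^ k) i = poly q \<sigma>)"
proof (induction k arbitrary: i)
  case 0
  show ?case by (rule exI[of _ "if i = 0 then 1 else 0"]) (auto simp: coeff_eq_0)
next
  case (Suc k)
  obtain q where "\<forall>i. degree (q i) \<le> i \<and> (\<forall>\<sigma>::real. coeff ([:1, 2 * \<sigma>, 1:] ^ k) i = poly (q i) \<sigma>)"
  proof -
    have "\<forall>i. \<exists>q. degree q \<le> i \<and> (\<forall>\<sigma>::real. coeff ([:1, 2 * \<sigma>, 1:] ^ k) i = poly q \<sigma>)"
      using Suc.IH by blast
    from choice[OF this] show ?thesis using that by (elim exE)
  qed
  then have q: "\<And>i. degree (q i) \<le> i" "\<And>i (\<sigma>::real). coeff ([:1, 2 * \<sigma>, 1:] ^ k) i = poly (q i) \<sigma>"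
    by blast+
  have c: "coeff ([:1, 2 * \<sigma>, 1:] * P) i = coeff P i + (if i \<ge> 1 then 2 * \<sigma> * coeff P (i - 1) else 0)
      + (if i \<ge> 2 then coeff P (i - 2) else 0)" for \<sigma> :: real and P
    by (cases i; cases "i - 1") (auto simp: coeff_pCons split: nat.splits)
  define r where "r = q i + (if i \<ge> 1 then [:0, 2:] * q (i - 1) else 0) + (if i \<ge> 2 then q (i - 2) else 0)"
  have "degree r \<le> i"
    unfolding r_def
  proof (intro degree_add_le)
    show "degree (if i \<ge> 1 then [:0, 2:] * q (i - 1) else 0) \<le> i"
      using degree_mult_le[of "[:0, 2::real:]" "q (i - 1)"] q(1)[of "i - 1"] by auto
    show "degree (if i \<ge> 2 then q (i - 2) else 0) \<le> i" using q(1)[of "i - 2"] by auto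
  qed (rule q(1))
  moreover have "coeff ([:1, 2 * \<sigma>, 1:] ^ Suc k) i = poly r \<sigma>" for \<sigma>
    unfolding power_Suc c q(2) r_def by simp
  ultimately show ?case by blast
qed

text \<open>Expand \<open>((s x + y) \<bullet> z)\<^sup>n\<close> by the binomial theorem and compare powers of \<open>s\<close>: by rotation invariance its integral is
a constant times \<open>\<parallel>s x + y\<parallel>\<^sup>n\<close>, and \<open>\<parallel>s x + y\<parallel>\<^sup>2 = 1 + 2 s (x \<bullet> y) + s\<^sup>2\<close>.\<close>

lemma S2_mixed_moment_coeff:
  assumes x: "x \<in> S2" and y: "y \<in> S2" and i: "i \<le> n"
  shows "real (n choose i) * (\<integral>z. (x \<bullet> z) ^ i * (y \<bullet> z) ^ (n - i) \<partial>S2_measure)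
      = S2_moment n * (if even n then coeff ([:1, 2 * (x \<bullet> y), 1:] ^ (n div 2)) i else 0)"
proof -
  define I where "I i = (\<integral>z. (x \<bullet> z) ^ i * (y \<bullet> z) ^ (n - i) \<partial>S2_measure)" for i
  define L where "L = (\<Sum>i\<le>n. monom (real (n choose i) * I i) i)"
  define R where "R = (if even n then smult (S2_moment n) ([:1, 2 * (x \<bullet> y), 1:] ^ (n div 2)) else 0)"
  have "poly L s = poly R s" for s
  proof -
    have int: "integrable S2_measure (\<lambda>z. (x \<bullet> z) ^ i * (y \<bullet> z) ^ (n - i))" for i
    proof (rule S2_integrable_bounded[where B = 1])
      fix z assume "z \<in> S2"
      then have "\<bar>x \<bullet> z\<bar> ^ i * \<bar>y \<bullet> z\<bar> ^ (n - i) \<le> 1 * 1"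
        using x y by (intro mult_mono power_le_one S2_inner_le) auto
      then show "\<bar>(x \<bullet> z) ^ i * (y \<bullet> z) ^ (n - i)\<bar> \<le> 1" by (simp add: abs_mult power_abs)
    qed measurable
    have "poly L s = (\<Sum>i\<le>n. real (n choose i) * I i * s ^ i)"
      unfolding L_def by (simp add: poly_sum poly_monom)
    also have "\<dots> = (\<integral>z. (\<Sum>i\<le>n. real (n choose i) * s ^ i * ((x \<bullet> z) ^ i * (y \<bullet> z) ^ (n - i))) \<partial>S2_measure)"
      unfolding I_def using int by (simp add: Bochner_Integration.integral_sum mult_ac)
    also have "\<dots> = (\<integral>z. ((s *\<^sub>R x + y) \<bullet> z) ^ n \<partial>S2_measure)"
      by (simp add: inner_add_left binomial_ring power_mult_distrib mult_ac)
    also have "\<dots> = norm (s *\<^sub>R x + y) ^ n * S2_moment n" by (rule S2_integral_inner_power)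
    also have "\<dots> = poly R s"
    proof (cases "even n")
      case True
      have "(norm (s *\<^sub>R x + y))\<^sup>2 = poly [:1, 2 * (x \<bullet> y), 1:] s"
      proof -
        have xx: "x \<bullet> x = 1" and yy: "y \<bullet> y = 1" using x y by (simp_all add: dot_square_norm)
        show ?thesis unfolding power2_norm_eq_inner
          by (simp add: inner_add_left inner_add_right xx yy inner_commute[of y x] algebra_simps)
      qed
      moreover have "norm (s *\<^sub>R x + y) ^ n = ((norm (s *\<^sub>R x + y))\<^sup>2) ^ (n div 2)"
        using True by (simp add: power_mult[symmetric])
      ultimately show ?thesis unfolding R_def using True by (simp add: poly_power)
    qed (simp add: S2_moment_odd R_def)
    finally show ?thesis .
  qed
  then have "L = R" using poly_eq_poly_eq_iff by blast
  then have "coeff L i = coeff R i" by simp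
  moreover have "coeff L i = real (n choose i) * I i"
    unfolding L_def coeff_sum coeff_monom using i by simp
  ultimately show ?thesis unfolding R_def I_def by simp
qed

lemma S2_convolution_monomials:
  "\<exists>q. degree q \<le> i \<and> (\<forall>x\<in>S2. \<forall>y\<in>S2. (\<integral>z. (x \<bullet> z) ^ i * (y \<bullet> z) ^ j \<partial>S2_measure) = poly q (x \<bullet> y))"
proof -
  obtain q where q: "degree q \<le> i" "\<And>\<sigma>::real. coeff ([:1, 2 * \<sigma>, 1:] ^ ((i + j) div 2)) i = poly q \<sigma>"
    using coeff_quadratic_power by blast
  define c where "c = (if even (i + j) then S2_moment (i + j) / real ((i + j) choose i) else 0)"
  have ch: "real ((i + j) choose i) \<noteq> 0" by simp
  have "(\<integral>z. (x \<bullet> z) ^ i * (y \<bullet> z) ^ j \<partial>S2_measure) = poly (smult c q) (x \<bullet> y)" if "x \<in> S2" "y \<in> S2" for x y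
    using S2_mixed_moment_coeff[OF that, of i "i + j"] ch unfolding c_def q(2) by (auto simp: field_simps split: if_splits)
  moreover have "degree (smult c q) \<le> i" using q(1) by (rule order.trans[OF degree_smult_le])
  ultimately show ?thesis by blast
qed

lemma poly_inner_bounded: "\<exists>B. \<forall>x\<in>S2. \<forall>y\<in>S2. \<bar>poly f (x \<bullet> y)\<bar> \<le> B"
proof -
  have "\<bar>poly f (x \<bullet> y)\<bar> \<le> (\<Sum>i\<le>degree f. \<bar>coeff f i\<bar>)" if "x \<in> S2" "y \<in> S2" for x y
    unfolding poly_altdef
  proof (rule order.trans[OF sum_abs], rule sum_mono)
    fix i
    have "\<bar>x \<bullet> y\<bar> ^ i \<le> 1" using S2_inner_le[OF that] by (intro power_le_one) auto
    then show "\<bar>coeff f i * (x \<bullet> y) ^ i\<bar> \<le> \<bar>coeff f i\<bar>" by (simp add: abs_mult power_abs mult_left_le)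
  qed
  then show ?thesis by blast
qed

lemma poly_inner_measurable [measurable]: "(\<lambda>z. poly f (x \<bullet> z)) \<in> borel_measurable S2_measure"
  unfolding poly_altdef by measurable

lemma poly_inner_integrable:
  assumes "x \<in> S2" "y \<in> S2" shows "integrable S2_measure (\<lambda>z. poly f (x \<bullet> z) * poly g (y \<bullet> z))"
proof -
  obtain A where A: "\<And>x y. x \<in> S2 \<Longrightarrow> y \<in> S2 \<Longrightarrow> \<bar>poly f (x \<bullet> y)\<bar> \<le> A" using poly_inner_bounded by blast
  obtain B where B: "\<And>x y. x \<in> S2 \<Longrightarrow> y \<in> S2 \<Longrightarrow> \<bar>poly g (x \<bullet> y)\<bar> \<le> B" using poly_inner_bounded by blast
  show ?thesis
  proof (rule S2_integrable_bounded[where B = "A * B"])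
    fix z assume "z \<in> S2"
    then show "\<bar>poly f (x \<bullet> z) * poly g (y \<bullet> z)\<bar> \<le> A * B"
      unfolding abs_mult using assms A[of x z] B[of y z] by (intro mult_mono) auto
  qed measurable
qed

text \<open>By rotation invariance the convolution of zonal polynomials is zonal. Its degree is bounded by that of either factor, as
the factors may be exchanged; the Funk--Hecke formula rests on this bound.\<close>

lemma S2_convolution_polys:
  "\<exists>q. degree q \<le> degree f \<and> (\<forall>x\<in>S2. \<forall>y\<in>S2. (\<integral>z. poly f (x \<bullet> z) * poly g (y \<bullet> z) \<partial>S2_measure) = poly q (x \<bullet> y))"
proof -
  obtain Q where Q: "\<And>i j. degree (Q i j) \<le> i"
    "\<And>i j x y. x \<in> S2 \<Longrightarrow> y \<in> S2 \<Longrightarrow> (\<integral>z. (x \<bullet> z) ^ i * (y \<bullet> z) ^ j \<partial>S2_measure) = poly (Q i j) (x \<bullet> y)"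
  proof -
    have "\<forall>i j. \<exists>q. degree q \<le> i \<and> (\<forall>x\<in>S2. \<forall>y\<in>S2.
        (\<integral>z. (x \<bullet> z) ^ i * (y \<bullet> z) ^ j \<partial>S2_measure) = poly q (x \<bullet> y))"
      using S2_convolution_monomials by (intro allI)
    then show ?thesis using that unfolding choice_iff by (elim exE) (rule that, simp_all)
  qed
  define q where "q = (\<Sum>i\<le>degree f. \<Sum>j\<le>degree g. smult (coeff f i * coeff g j) (Q i j))"
  have "degree q \<le> degree f"
  proof -
    have "degree (smult (coeff f i * coeff g j) (Q i j)) \<le> degree f" if "i \<le> degree f" for i j
      using order.trans[OF order.trans[OF degree_smult_le Q(1)] that] .
    then show ?thesis unfolding q_def by (intro degree_sum_le) simp_all
  qed
  moreover have "(\<integral>z. poly f (x \<bullet> z) * poly g (y \<bullet> z) \<partial>S2_measure) = poly q (x \<bullet> y)" if xy: "x \<in> S2" "y \<in> S2" for x y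
  proof -
    have int: "integrable S2_measure (\<lambda>z. (x \<bullet> z) ^ i * (y \<bullet> z) ^ j)" for i j
      using poly_inner_integrable[OF xy, of "monom 1 i" "monom 1 j"] by (simp add: poly_monom)
    have eq: "poly f (x \<bullet> z) * poly g (y \<bullet> z)
        = (\<Sum>i\<le>degree f. \<Sum>j\<le>degree g. coeff f i * coeff g j * ((x \<bullet> z) ^ i * (y \<bullet> z) ^ j))" for z
      unfolding poly_altdef[of f] poly_altdef[of g] sum_product
      by (intro sum.cong refl) (simp only: mult_ac)
    have "(\<integral>z. poly f (x \<bullet> z) * poly g (y \<bullet> z) \<partial>S2_measure)
        = (\<Sum>i\<le>degree f. \<Sum>j\<le>degree g. coeff f i * coeff g j * (\<integral>z. (x \<bullet> z) ^ i * (y \<bullet> z) ^ j \<partial>S2_measure))"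
      unfolding eq using int by (simp add: Bochner_Integration.integral_sum)
    also have "\<dots> = (\<Sum>i\<le>degree f. \<Sum>j\<le>degree g. coeff f i * coeff g j * poly (Q i j) (x \<bullet> y))"
      by (simp only: Q(2)[OF xy])
    also have "\<dots> = poly q (x \<bullet> y)" unfolding q_def by (simp add: poly_sum)
    finally show ?thesis .
  qed
  ultimately show ?thesis by blast
qed

lemma coeff_one_plus_square_power:
  "coeff ([:1, 0, 1:] ^ k :: real poly) 0 = 1 \<and> coeff ([:1, 0, 1:] ^ k :: real poly) 1 = 0 \<and> coeff ([:1, 0, 1:] ^ k :: real poly) 2 = real k"
  by (induction k) (auto simp: numeral_2_eq_2)

text \<open>Recursion: insert \<open>1 = \<Sum>i. (e i \<bullet> z)\<^sup>2\<close> into the moment of order \<open>2 k\<close> and express the mixed moments by the moment of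
order \<open>2 k + 2\<close>.\<close>

lemma S2_moment_even: "S2_moment (2 * k) = 4 * pi / (2 * real k + 1)"
proof (induction k)
  case 0
  then show ?case by (simp add: S2_moment_def)
next
  case (Suc k)
  define e :: "3 \<Rightarrow> real^3" where "e i = axis i 1" for i
  have eS: "e i \<in> S2" for i by (simp add: e_def)
  have I: "(\<integral>z. (e i \<bullet> z)\<^sup>2 * (e 1 \<bullet> z) ^ (2 * k) \<partial>S2_measure) = S2_moment (2 * Suc k) / (2 * real k + 1)" if "i \<noteq> 1" for i
  proof -
    have orth: "e i \<bullet> e 1 = 0" using that by (simp add: e_def inner_axis_axis)
    have b: "real (2 * Suc k choose 2) = real (Suc k) * (2 * real k + 1)"
      by (simp add: choose_two) (simp add: field_simps)
    have "real (2 * Suc k choose 2) * (\<integral>z. (e i \<bullet> z)\<^sup>2 * (e 1 \<bullet> z) ^ (2 * k) \<partial>S2_measure) = S2_moment (2 * Suc k) * real (Suc k)"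
      using S2_mixed_moment_coeff[OF eS[of i] eS[of 1], of 2 "2 * Suc k"] coeff_one_plus_square_power[of "Suc k"]
      by (simp add: orth)
    then have "real (Suc k) * ((2 * real k + 1) * (\<integral>z. (e i \<bullet> z)\<^sup>2 * (e 1 \<bullet> z) ^ (2 * k) \<partial>S2_measure))
        = real (Suc k) * S2_moment (2 * Suc k)"
      unfolding b by (simp only: mult_ac)
    then have "(2 * real k + 1) * (\<integral>z. (e i \<bullet> z)\<^sup>2 * (e 1 \<bullet> z) ^ (2 * k) \<partial>S2_measure) = S2_moment (2 * Suc k)"
      by (subst (asm) mult_left_cancel) simp_all
    moreover have nz: "2 * real k + 1 \<noteq> 0" by linarith
    ultimately show ?thesis unfolding nonzero_eq_divide_eq[OF nz] by (simp only: mult.commute)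
  qed
  have one: "z \<in> S2 \<Longrightarrow> (e 1 \<bullet> z)\<^sup>2 + (e 2 \<bullet> z)\<^sup>2 + (e 3 \<bullet> z)\<^sup>2 = 1" for z
  proof -
    assume "z \<in> S2"
    then have "z \<bullet> z = 1" by (simp add: dot_square_norm)
    then have "z $ 1 * z $ 1 + z $ 2 * z $ 2 + z $ 3 * z $ 3 = 1" by (simp add: inner_vec_def sum_3)
    moreover have "e i \<bullet> z = z $ i" for i by (simp add: e_def inner_axis')
    ultimately show ?thesis by (simp add: power2_eq_square)
  qed
  have int: "integrable S2_measure (\<lambda>z. (e i \<bullet> z) ^ a * (e 1 \<bullet> z) ^ b)" for i a b
    using poly_inner_integrable[OF eS[of i] eS[of 1], of "monom 1 a" "monom 1 b"] by (simp add: poly_monom)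
  have "S2_moment (2 * k) = (\<integral>z. (e 1 \<bullet> z)\<^sup>2 * (e 1 \<bullet> z) ^ (2 * k) + (e 2 \<bullet> z)\<^sup>2 * (e 1 \<bullet> z) ^ (2 * k)
      + (e 3 \<bullet> z)\<^sup>2 * (e 1 \<bullet> z) ^ (2 * k) \<partial>S2_measure)"
    unfolding S2_moment_def e_def[symmetric] distrib_right[symmetric]
    by (intro Bochner_Integration.integral_cong refl) (simp add: one)
  also have "\<dots> = S2_moment (2 * Suc k) + S2_moment (2 * Suc k) / (2 * real k + 1) + S2_moment (2 * Suc k) / (2 * real k + 1)"
  proof -
    have "(\<integral>z. (e 1 \<bullet> z)\<^sup>2 * (e 1 \<bullet> z) ^ (2 * k) \<partial>S2_measure) = S2_moment (2 * Suc k)"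
      unfolding S2_moment_def e_def[symmetric] by (simp add: power2_eq_square mult_ac)
    moreover have "(2::3) \<noteq> 1" "(3::3) \<noteq> 1" by simp_all
    ultimately show ?thesis using int I by (simp del: power_Suc)
  qed
  finally have m: "S2_moment (2 * k) = S2_moment (2 * Suc k) + S2_moment (2 * Suc k) / (2 * real k + 1) + S2_moment (2 * Suc k) / (2 * real k + 1)" .
  have solve: "M = 4 * pi / (c + 2)" if "4 * pi / c = M + M / c + M / c" "c > 0" for M c :: real
    using that by (simp add: field_simps)
  have "S2_moment (2 * Suc k) = 4 * pi / (2 * real k + 1 + 2)"
    by (rule solve) (use m Suc.IH in auto)
  then show ?case by (simp add: algebra_simps)
qed

section \<open>Legendre polynomials\<close>

definition poly_integral :: "real poly \<Rightarrow> real" where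
  "poly_integral f = (\<integral>x. poly f x * indicator {-1..1} x \<partial>lborel)"

lemma poly_integrable: "integrable lborel (\<lambda>x. poly f x * indicator {-1..1::real} x)"
  using borel_integrable_atLeastAtMost[of "-1" 1 "poly f"] by (auto simp: mult.commute poly_isCont)

lemma poly_integral_pderiv: "poly_integral (pderiv F) = poly F 1 - poly F (-1)"
  unfolding poly_integral_def
  by (rule integral_FTC_Icc_real) (auto intro: poly_DERIV)

lemma poly_integral_add: "poly_integral (f + g) = poly_integral f + poly_integral g"
  unfolding poly_integral_def using poly_integrable by (simp add: distrib_right)

lemma poly_integral_smult: "poly_integral (smult c f) = c * poly_integral f"
  unfolding poly_integral_def by (simp add: mult.assoc)

lemma poly_integral_diff: "poly_integral (f - g) = poly_integral f - poly_integral g"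
  unfolding poly_integral_def using poly_integrable by (simp add: left_diff_distrib)

lemma poly_integral_zero [simp]: "poly_integral 0 = 0"
  by (simp add: poly_integral_def)

lemma poly_integral_sum: "finite A \<Longrightarrow> poly_integral (\<Sum>i\<in>A. f i) = (\<Sum>i\<in>A. poly_integral (f i))"
  by (induction A rule: finite_induct) (auto simp: poly_integral_add)

lemma poly_integral_monom: "poly_integral (monom 1 n) = (if even n then 2 / (real n + 1) else 0)"
proof -
  have "pderiv (monom (1 / (real n + 1)) (Suc n)) = monom 1 n" by (simp add: pderiv_monom)
  then have "poly_integral (monom 1 n) = poly (monom (1 / (real n + 1)) (Suc n)) 1 - poly (monom (1 / (real n + 1)) (Suc n)) (-1)"
    using poly_integral_pderiv by metis
  then show ?thesis by (auto simp: poly_monom)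
qed

lemma poly_integral_square_zero:
  assumes "poly_integral (b * b) = 0" shows "b = 0"
proof (rule ccontr)
  assume b: "b \<noteq> 0"
  have "AE x in lborel. poly (b * b) x * indicator {-1..1} x = 0"
    using integral_nonneg_eq_0_iff_AE[OF poly_integrable[of "b * b"]] assms unfolding poly_integral_def
    by (auto simp: indicator_def)
  moreover have "finite {x. poly b x = 0}" using poly_roots_finite[OF b] .
  then have "AE x in lborel. x \<notin> {x. poly b x = 0}"
    by (intro AE_not_in finite_imp_null_set_lborel)
  ultimately have "AE x in lborel. x \<notin> {-1..1::real}" by eventually_elim (auto simp: indicator_def)
  then have "emeasure lborel {-1..1::real} = 0"
    by (subst (asm) AE_iff_measurable[of "{-1..1}"]) auto
  then show False by simp
qed

text \<open>Archimedes' theorem on the projection of the sphere to an axis, for polynomials: both sides have the same moments.\<close>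

lemma S2_integral_zonal_poly:
  assumes x: "x \<in> S2" shows "(\<integral>z. poly f (x \<bullet> z) \<partial>S2_measure) = 2 * pi * poly_integral f"
proof -
  have mom: "S2_moment n = 2 * pi * poly_integral (monom 1 n)" for n
  proof (cases "even n")
    case True
    then obtain k where "n = 2 * k" by blast
    then show ?thesis using S2_moment_even[of k] by (simp add: poly_integral_monom)
  qed (simp add: S2_moment_odd poly_integral_monom)
  have int: "integrable S2_measure (\<lambda>z. (x \<bullet> z) ^ i)" for i
    using poly_inner_integrable[OF x x, of "monom 1 i" 1] by (simp add: poly_monom)
  have f: "f = (\<Sum>i\<le>degree f. smult (coeff f i) (monom 1 i))" by (simp add: smult_monom poly_as_sum_of_monoms)
  have "(\<integral>z. poly f (x \<bullet> z) \<partial>S2_measure) = (\<integral>z. (\<Sum>i\<le>degree f. coeff f i * (x \<bullet> z) ^ i) \<partial>S2_measure)"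
    by (simp only: poly_altdef)
  also have "\<dots> = (\<Sum>i\<le>degree f. coeff f i * (\<integral>z. (x \<bullet> z) ^ i \<partial>S2_measure))"
    using int by (simp add: Bochner_Integration.integral_sum)
  also have "\<dots> = (\<Sum>i\<le>degree f. coeff f i * (2 * pi * poly_integral (monom 1 i)))"
    using x by (simp add: S2_integral_inner_power mom)
  also have "\<dots> = 2 * pi * poly_integral (\<Sum>i\<le>degree f. smult (coeff f i) (monom 1 i))"
    by (simp add: poly_integral_sum poly_integral_smult sum_distrib_left mult_ac)
  finally show ?thesis using f by simp
qed

text \<open>Differentiating \<open>(z - c)\<^sup>i\<^sup>+\<^sup>k q\<close> lowers the order of the zero by one each time. With \<open>k > 0\<close> this gives the vanishing
boundary terms in the integration by parts, and with \<open>k = 0\<close> the values of the Legendre polynomials at \<open>\<plusminus>1\<close>.\<close>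

lemma pderiv_iterate_factor:
  "\<exists>r. (pderiv ^^ i) ([:-c, 1:] ^ (i + k) * q) = [:-c, 1:] ^ k * r \<and> poly r c = fact (i + k) / fact k * poly q (c::real)"
proof (induction i arbitrary: q)
  case 0
  then show ?case by (intro exI[of _ q]) simp
next
  case (Suc i)
  define q' where "q' = smult (real (Suc i + k)) q + [:-c, 1:] * pderiv q"
  have "pderiv ([:-c, 1:] ^ (Suc i + k) * q) = [:-c, 1:] ^ (i + k) * q'"
    unfolding q'_def by (simp add: pderiv_mult pderiv_power_Suc pderiv_pCons algebra_simps del: power_Suc)
       (simp add: algebra_simps)
  then have "(pderiv ^^ Suc i) ([:-c, 1:] ^ (Suc i + k) * q) = (pderiv ^^ i) ([:-c, 1:] ^ (i + k) * q')"
    by (simp only: funpow_Suc_right o_apply)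
  moreover obtain r where r: "(pderiv ^^ i) ([:-c, 1:] ^ (i + k) * q') = [:-c, 1:] ^ k * r"
     "poly r c = fact (i + k) / fact k * poly q' c" using Suc.IH by blast
  moreover have "poly q' c = real (Suc i + k) * poly q c" unfolding q'_def by simp
  ultimately show ?case by (intro exI[of _ r]) (simp add: field_simps)
qed

lemma quadratic_power_factor:
  "([:-1, 0, 1:] :: real poly) ^ l = [:-1, 1:] ^ l * [:1, 1:] ^ l" "([:-1, 0, 1:] :: real poly) ^ l = [:-(-1), 1:] ^ l * [:-1, 1:] ^ l"
  by (simp_all add: power_mult_distrib[symmetric])

lemma pderiv_iterate_vanish:
  assumes "i < l" shows "poly ((pderiv ^^ i) (([:-1, 0, 1:] :: real poly) ^ l)) 1 = 0" "poly ((pderiv ^^ i) (([:-1, 0, 1:] :: real poly) ^ l)) (-1) = 0"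
proof -
  have l: "l = i + (l - i)" and li: "l - i > 0" using assms by auto
  obtain r :: "real poly" where "(pderiv ^^ i) ([:-1, 1:] ^ (i + (l - i)) * [:1, 1:] ^ l) = [:-1, 1:] ^ (l - i) * r"
    using pderiv_iterate_factor[of i 1 "l - i" "[:1, 1:] ^ l"] by blast
  then show "poly ((pderiv ^^ i) (([:-1, 0, 1:] :: real poly) ^ l)) 1 = 0"
    using li l unfolding quadratic_power_factor(1) by (simp add: poly_power power_0_left)
  obtain r :: "real poly" where "(pderiv ^^ i) ([:-(-1), 1:] ^ (i + (l - i)) * [:-1, 1:] ^ l) = [:-(-1), 1:] ^ (l - i) * r"
    using pderiv_iterate_factor[of i "-1" "l - i" "[:-1, 1:] ^ l"] by blast
  then show "poly ((pderiv ^^ i) (([:-1, 0, 1:] :: real poly) ^ l)) (-1) = 0"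
    using li l unfolding quadratic_power_factor(2) by (simp add: poly_power power_0_left)
qed

lemma legendre_at_1: "poly (legendre l) 1 = 1"
proof -
  obtain r :: "real poly" where "(pderiv ^^ l) ([:-1, 1:] ^ l * [:1, 1:] ^ l) = r" "poly r 1 = fact l * poly ([:1, 1:] ^ l) (1::real)"
    using pderiv_iterate_factor[of l 1 0 "[:1, 1:] ^ l"] by auto
  then show ?thesis unfolding legendre_def quadratic_power_factor(1) by (simp add: poly_power)
qed

lemma legendre_at_minus_1: "poly (legendre l) (-1) = (-1) ^ l"
proof -
  obtain r :: "real poly" where "(pderiv ^^ l) ([:-(-1), 1:] ^ l * [:-1, 1:] ^ l) = r" "poly r (-1) = fact l * poly ([:-1, 1:] ^ l) (-1::real)"
    using pderiv_iterate_factor[of l "-1" 0 "[:-1, 1:] ^ l"] by auto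
  moreover have "(-2::real) ^ l = (-1) ^ l * 2 ^ l" by (simp add: power_mult_distrib[symmetric])
  ultimately show ?thesis unfolding legendre_def quadratic_power_factor(2) by (simp add: poly_power)
qed

lemma degree_pderiv_iterate: "degree ((pderiv ^^ i) (q :: real poly)) = degree q - i"
  by (induction i) (auto simp: degree_pderiv)

lemma degree_legendre: "degree (legendre l) = l"
proof -
  have "degree (([:-1, 0, 1:] :: real poly) ^ l) = 2 * l" by (subst degree_power_eq) auto
  then show ?thesis unfolding legendre_def by (simp add: degree_pderiv_iterate)
qed

lemma legendre_nz: "legendre l \<noteq> 0"
  using legendre_at_1[of l] by auto

lemma poly_integral_by_parts:
  "poly_integral (pderiv f * g) = poly (f * g) 1 - poly (f * g) (-1) - poly_integral (f * pderiv g)"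
  using poly_integral_pderiv[of "f * g"] by (simp add: pderiv_mult poly_integral_add mult.commute)

lemma legendre_orthogonal_lower:
  assumes "q = 0 \<or> degree q < l" shows "poly_integral (legendre l * q) = 0"
proof -
  have "poly_integral ((pderiv ^^ i) ([:-1, 0, 1:] ^ l) * q) = 0" if "i \<le> l" "q = 0 \<or> degree q < i" for i q
    using that
  proof (induction i arbitrary: q)
    case (Suc i)
    have z: "pderiv q = 0 \<or> degree (pderiv q) < i"
    proof (cases "degree q = 0")
      case True
      then show ?thesis by (simp add: pderiv_eq_0_iff)
    next
      case False then show ?thesis using Suc.prems by (auto simp: degree_pderiv)
    qed
    have "poly_integral (pderiv ((pderiv ^^ i) ([:-1, 0, 1:] ^ l)) * q)
       = - poly_integral ((pderiv ^^ i) ([:-1, 0, 1:] ^ l) * pderiv q)"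
      unfolding poly_integral_by_parts using pderiv_iterate_vanish[of i l] Suc.prems by simp
    also have "\<dots> = 0" using Suc.IH[of "pderiv q"] z Suc.prems by simp
    finally show ?case by simp
  qed auto
  from this[of l q] show ?thesis using assms unfolding legendre_def by (simp add: poly_integral_smult)
qed

text \<open>Integrate the derivative of \<open>z P\<^sup>2\<close>: it equals \<open>P\<^sup>2 + 2 P (z P')\<close>, and \<open>z P' - l P\<close> has lower degree, hence is orthogonal
to \<open>P\<close>.\<close>

lemma legendre_norm: "poly_integral (legendre l * legendre l) = 2 / (2 * real l + 1)"
proof -
  let ?P = "legendre l"
  define r where "r = [:0, 1:] * pderiv ?P - smult (real l) ?P"
  have r: "r = 0 \<or> degree r < l"
  proof (cases "l = 0")
    case True
    then have "degree ?P = 0" using degree_legendre by simp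
    then have "pderiv ?P = 0" by (simp add: pderiv_eq_0_iff)
    then show ?thesis using True unfolding r_def by simp
  next
    case False
    have "coeff r l = 0" using False unfolding r_def by (cases l) (auto simp: coeff_pderiv)
    moreover have "degree r \<le> l"
      unfolding r_def
    proof (rule degree_diff_le)
      show "degree ([:0, 1:] * pderiv ?P) \<le> l"
        using degree_mult_le[of "[:0, 1::real:]" "pderiv ?P"] False by (simp add: degree_pderiv degree_legendre)
      show "degree (smult (real l) ?P) \<le> l" by (simp add: degree_legendre)
    qed
    ultimately show ?thesis using False by (metis degree_0 eq_zero_or_degree_less le_neq_implies_less leading_coeff_0_iff)
  qed
  have "pderiv ([:0, 1:] * (?P * ?P)) = ?P * ?P + smult 2 (?P * ([:0, 1:] * pderiv ?P))"
  proof -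
    have "smult 2 q = q + q" for q :: "real poly" using smult_add_left[of 1 1 q] by simp
    then show ?thesis by (simp add: pderiv_mult pderiv_pCons algebra_simps)
  qed
  also have "[:0, 1:] * pderiv ?P = r + smult (real l) ?P" unfolding r_def by simp
  finally have eq: "pderiv ([:0, 1:] * (?P * ?P)) = ?P * ?P + smult 2 (?P * (r + smult (real l) ?P))" .
  have "poly_integral (pderiv ([:0, 1:] * (?P * ?P))) = 2"
    unfolding poly_integral_pderiv by (simp add: legendre_at_1 legendre_at_minus_1 power_mult_distrib[symmetric])
  then have "poly_integral (?P * ?P) + 2 * (real l * poly_integral (?P * ?P)) = 2"
    unfolding eq using legendre_orthogonal_lower[OF r]
    by (simp add: poly_integral_add poly_integral_smult distrib_left)
  then have "(2 * real l + 1) * poly_integral (?P * ?P) = 2" by (simp add: algebra_simps)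
  then show ?thesis by (simp add: field_simps)
qed

lemma legendre_orthogonal: "l \<noteq> l' \<Longrightarrow> poly_integral (legendre l * legendre l') = 0"
proof (induction l l' rule: linorder_wlog)
  case (le a b)
  then show ?case using legendre_orthogonal_lower[of "legendre a" b] by (simp add: degree_legendre mult.commute)
next
  case (sym a b) then show ?case by (simp add: mult.commute)
qed

section \<open>Legendre kernels on the sphere\<close>

interpretation S22: pair_sigma_finite S2_measure S2_measure ..

lemma S2_pair_integrable_bounded:
  fixes F :: "(real^3) \<times> (real^3) \<Rightarrow> real"
  assumes m: "F \<in> borel_measurable (S2_measure \<Otimes>\<^sub>M S2_measure)"
    and b: "\<And>x y. x \<in> S2 \<Longrightarrow> y \<in> S2 \<Longrightarrow> \<bar>F (x, y)\<bar> \<le> B"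
  shows "integrable (S2_measure \<Otimes>\<^sub>M S2_measure) F"
proof -
  interpret P: finite_measure "S2_measure \<Otimes>\<^sub>M S2_measure"
    by (intro finite_measure_pair_measure S2.finite_measure_axioms)
  show ?thesis
  proof (rule P.integrable_const_bound[of _ B])
    show "AE z in S2_measure \<Otimes>\<^sub>M S2_measure. norm (F z) \<le> B"
      using b by (intro AE_I2) (auto simp: space_pair_measure)
  qed (rule m)
qed

lemma S2_swap_bounded:
  fixes F :: "real^3 \<Rightarrow> real^3 \<Rightarrow> real"
  assumes "(\<lambda>(x, y). F x y) \<in> borel_measurable (S2_measure \<Otimes>\<^sub>M S2_measure)"
    and "\<And>x y. x \<in> S2 \<Longrightarrow> y \<in> S2 \<Longrightarrow> \<bar>F x y\<bar> \<le> B"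
  shows "(\<integral>x. (\<integral>y. F x y \<partial>S2_measure) \<partial>S2_measure) = (\<integral>y. (\<integral>x. F x y \<partial>S2_measure) \<partial>S2_measure)"
  by (rule S22.Fubini_integral[symmetric], rule S2_pair_integrable_bounded) (use assms in auto)

lemma poly_inner_pair_measurable [measurable]:
  assumes "f \<in> N \<rightarrow>\<^sub>M (borel :: (real^3) measure)" "g \<in> N \<rightarrow>\<^sub>M borel"
  shows "(\<lambda>w. poly q (f w \<bullet> g w)) \<in> borel_measurable N"
  unfolding poly_altdef using assms by measurable

lemma S2_triple_swap:
  assumes x: "x \<in> S2"
  shows "(\<integral>y. poly a (x \<bullet> y) * (\<integral>z. poly b (x \<bullet> z) * poly c (y \<bullet> z) \<partial>S2_measure) \<partial>S2_measure)
       = (\<integral>z. poly b (x \<bullet> z) * (\<integral>y. poly a (x \<bullet> y) * poly c (y \<bullet> z) \<partial>S2_measure) \<partial>S2_measure)"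
proof -
  obtain A where A: "\<forall>x\<in>S2. \<forall>y\<in>S2. \<bar>poly a (x \<bullet> y)\<bar> \<le> A" using poly_inner_bounded by blast
  obtain B where B: "\<forall>x\<in>S2. \<forall>y\<in>S2. \<bar>poly b (x \<bullet> y)\<bar> \<le> B" using poly_inner_bounded by blast
  obtain C where C: "\<forall>x\<in>S2. \<forall>y\<in>S2. \<bar>poly c (x \<bullet> y)\<bar> \<le> C" using poly_inner_bounded by blast
  have "(\<integral>y. (\<integral>z. poly a (x \<bullet> y) * (poly b (x \<bullet> z) * poly c (y \<bullet> z)) \<partial>S2_measure) \<partial>S2_measure)
      = (\<integral>z. (\<integral>y. poly a (x \<bullet> y) * (poly b (x \<bullet> z) * poly c (y \<bullet> z)) \<partial>S2_measure) \<partial>S2_measure)"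
  proof (rule S2_swap_bounded[where B = "A * (B * C)"])
    fix y z assume yz: "y \<in> S2" "z \<in> S2"
    have "\<bar>poly a (x \<bullet> y)\<bar> \<le> A" "\<bar>poly b (x \<bullet> z)\<bar> \<le> B" "\<bar>poly c (y \<bullet> z)\<bar> \<le> C" using A B C x yz by blast+
    moreover from this have "0 \<le> B" "0 \<le> C" "0 \<le> A" by linarith+
    ultimately show "\<bar>poly a (x \<bullet> y) * (poly b (x \<bullet> z) * poly c (y \<bullet> z))\<bar> \<le> A * (B * C)"
      unfolding abs_mult by (intro mult_mono) auto
  qed measurable
  moreover have "(\<integral>z. poly a (x \<bullet> y) * (poly b (x \<bullet> z) * poly c (y \<bullet> z)) \<partial>S2_measure)
      = poly a (x \<bullet> y) * (\<integral>z. poly b (x \<bullet> z) * poly c (y \<bullet> z) \<partial>S2_measure)" for y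
    by (rule integral_mult_right_zero)
  moreover have "(\<integral>y. poly a (x \<bullet> y) * (poly b (x \<bullet> z) * poly c (y \<bullet> z)) \<partial>S2_measure)
      = poly b (x \<bullet> z) * (\<integral>y. poly a (x \<bullet> y) * poly c (y \<bullet> z) \<partial>S2_measure)" for z
    unfolding integral_mult_right_zero[symmetric] by (intro Bochner_Integration.integral_cong refl) (simp only: mult_ac)
  ultimately show ?thesis by simp
qed

text \<open>The convolution is a zonal polynomial \<open>b (x \<bullet> y)\<close>. Its square norm is, after exchanging the integrals, the integral
of the Legendre polynomial against a polynomial \<open>c\<close> of degree less than \<open>l\<close>, which vanishes; so \<open>b = 0\<close>.\<close>

lemma S2_legendre_orthogonal_lower:
  assumes xy: "x \<in> S2" "y \<in> S2" and r: "r = 0 \<or> degree r < l"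
  shows "(\<integral>z. poly (legendre l) (x \<bullet> z) * poly r (y \<bullet> z) \<partial>S2_measure) = 0"
proof (cases "r = 0")
  case False
  then have dr: "degree r < l" using r by simp
  obtain b where b: "degree b \<le> degree r"
    "\<forall>y\<in>S2. \<forall>x\<in>S2. (\<integral>z. poly r (y \<bullet> z) * poly (legendre l) (x \<bullet> z) \<partial>S2_measure) = poly b (y \<bullet> x)"
    using S2_convolution_polys[of r "legendre l"] by blast
  obtain c where c: "degree c \<le> degree r"
    "\<forall>z\<in>S2. \<forall>x\<in>S2. (\<integral>y. poly r (z \<bullet> y) * poly b (x \<bullet> y) \<partial>S2_measure) = poly c (z \<bullet> x)"
    using S2_convolution_polys[of r b] by blast
  have "2 * pi * poly_integral (b * b) = (\<integral>y. poly b (x \<bullet> y) * poly b (x \<bullet> y) \<partial>S2_measure)"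
    using S2_integral_zonal_poly[OF xy(1), of "b * b"] by simp
  also have "\<dots> = (\<integral>y. poly b (x \<bullet> y) * (\<integral>z. poly (legendre l) (x \<bullet> z) * poly r (y \<bullet> z) \<partial>S2_measure) \<partial>S2_measure)"
  proof (intro Bochner_Integration.integral_cong refl)
    fix y assume "y \<in> space S2_measure"
    then have "(\<integral>z. poly r (y \<bullet> z) * poly (legendre l) (x \<bullet> z) \<partial>S2_measure) = poly b (y \<bullet> x)" using b xy by auto
    then show "poly b (x \<bullet> y) * poly b (x \<bullet> y) = poly b (x \<bullet> y) * (\<integral>z. poly (legendre l) (x \<bullet> z) * poly r (y \<bullet> z) \<partial>S2_measure)"
      by (simp only: mult.commute inner_commute)
  qed
  also have "\<dots> = (\<integral>z. poly (legendre l) (x \<bullet> z) * (\<integral>y. poly b (x \<bullet> y) * poly r (y \<bullet> z) \<partial>S2_measure) \<partial>S2_measure)"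
    by (rule S2_triple_swap[OF xy(1)])
  also have "\<dots> = (\<integral>z. poly (legendre l * c) (x \<bullet> z) \<partial>S2_measure)"
  proof (intro Bochner_Integration.integral_cong refl)
    fix z assume "z \<in> space S2_measure"
    then have "(\<integral>y. poly r (z \<bullet> y) * poly b (x \<bullet> y) \<partial>S2_measure) = poly c (z \<bullet> x)" using c xy by auto
    then have "(\<integral>y. poly b (x \<bullet> y) * poly r (y \<bullet> z) \<partial>S2_measure) = poly c (x \<bullet> z)"
      by (simp only: mult.commute inner_commute)
    then show "poly (legendre l) (x \<bullet> z) * (\<integral>y. poly b (x \<bullet> y) * poly r (y \<bullet> z) \<partial>S2_measure) = poly (legendre l * c) (x \<bullet> z)"
      by simp
  qed
  also have "\<dots> = 0"
    using S2_integral_zonal_poly[OF xy(1), of "legendre l * c"] legendre_orthogonal_lower[of c l] c(1) dr by simp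
  finally have "b = 0" by (intro poly_integral_square_zero) simp
  moreover have "(\<integral>z. poly r (y \<bullet> z) * poly (legendre l) (x \<bullet> z) \<partial>S2_measure) = poly b (y \<bullet> x)" using b xy by blast
  ultimately show ?thesis by (simp add: mult.commute)
qed simp

text \<open>The convolution with \<open>legendre l\<close> is a polynomial \<open>u\<close> of degree at most \<open>l\<close>. Write it as a multiple of \<open>legendre l\<close> plus
a remainder \<open>r\<close> of lower degree; the argument of the previous lemma shows that \<open>r\<close> is orthogonal to \<open>u\<close>, hence
zero, and the constant is read off at \<open>y = x\<close>.\<close>

lemma funk_hecke_poly:
  assumes xy: "x \<in> S2" "y \<in> S2"
  shows "(\<integral>z. poly q (x \<bullet> z) * poly (legendre l) (y \<bullet> z) \<partial>S2_measure)
    = 2 * pi * poly_integral (q * legendre l) * poly (legendre l) (x \<bullet> y)"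
proof -
  obtain u where u: "degree u \<le> l"
    "\<forall>y\<in>S2. \<forall>x\<in>S2. (\<integral>z. poly (legendre l) (y \<bullet> z) * poly q (x \<bullet> z) \<partial>S2_measure) = poly u (y \<bullet> x)"
    using S2_convolution_polys[of "legendre l" q] unfolding degree_legendre by blast
  define c where "c = coeff u l / coeff (legendre l) l"
  define r where "r = u - smult c (legendre l)"
  have lead: "coeff (legendre l) l \<noteq> 0" using legendre_nz degree_legendre by (metis leading_coeff_0_iff)
  have r: "r = 0 \<or> degree r < l"
  proof -
    have "coeff r l = 0" unfolding r_def c_def using lead by simp
    moreover have "degree r \<le> l" unfolding r_def by (intro degree_diff_le u(1)) (simp add: degree_legendre)
    ultimately show ?thesis using eq_zero_or_degree_less by blast
  qed
  have "2 * pi * poly_integral (r * u) = (\<integral>z. poly r (x \<bullet> z) * poly u (x \<bullet> z) \<partial>S2_measure)"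
    using S2_integral_zonal_poly[OF xy(1), of "r * u"] by simp
  also have "\<dots> = (\<integral>w. poly r (x \<bullet> w) * (\<integral>z. poly q (x \<bullet> z) * poly (legendre l) (w \<bullet> z) \<partial>S2_measure) \<partial>S2_measure)"
  proof (intro Bochner_Integration.integral_cong refl)
    fix w assume "w \<in> space S2_measure"
    then have "(\<integral>z. poly (legendre l) (w \<bullet> z) * poly q (x \<bullet> z) \<partial>S2_measure) = poly u (w \<bullet> x)" using u xy by auto
    then show "poly r (x \<bullet> w) * poly u (x \<bullet> w) = poly r (x \<bullet> w) * (\<integral>z. poly q (x \<bullet> z) * poly (legendre l) (w \<bullet> z) \<partial>S2_measure)"
      by (simp only: mult.commute inner_commute)
  qed
  also have "\<dots> = (\<integral>z. poly q (x \<bullet> z) * (\<integral>w. poly r (x \<bullet> w) * poly (legendre l) (w \<bullet> z) \<partial>S2_measure) \<partial>S2_measure)"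
    by (rule S2_triple_swap[OF xy(1)])
  also have "\<dots> = (\<integral>z. 0 \<partial>S2_measure)"
  proof (intro Bochner_Integration.integral_cong refl)
    fix z assume "z \<in> space S2_measure"
    then have "(\<integral>w. poly (legendre l) (z \<bullet> w) * poly r (x \<bullet> w) \<partial>S2_measure) = 0"
      by (intro S2_legendre_orthogonal_lower r xy) simp
    then have "(\<integral>w. poly r (x \<bullet> w) * poly (legendre l) (w \<bullet> z) \<partial>S2_measure) = 0"
      by (simp only: mult.commute inner_commute)
    then show "poly q (x \<bullet> z) * (\<integral>w. poly r (x \<bullet> w) * poly (legendre l) (w \<bullet> z) \<partial>S2_measure) = 0" by simp
  qed
  finally have "poly_integral (u * r) = 0" by (simp add: mult.commute)
  then have "poly_integral (r * r) = 0"
    using legendre_orthogonal_lower[OF r] unfolding r_def left_diff_distrib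
    by (simp add: poly_integral_diff poly_integral_smult)
  then have "r = 0" by (rule poly_integral_square_zero)
  then have uc: "u = smult c (legendre l)" unfolding r_def by simp
  have "x \<bullet> x = 1" using xy(1) by (simp add: dot_square_norm)
  then have "c = (\<integral>z. poly (legendre l * q) (x \<bullet> z) \<partial>S2_measure)"
    using u(2) xy(1) uc by (auto simp: legendre_at_1)
  also have "\<dots> = 2 * pi * poly_integral (q * legendre l)"
    unfolding S2_integral_zonal_poly[OF xy(1)] by (simp only: mult.commute)
  finally have c: "c = 2 * pi * poly_integral (q * legendre l)" .
  have "(\<integral>z. poly (legendre l) (y \<bullet> z) * poly q (x \<bullet> z) \<partial>S2_measure) = poly u (y \<bullet> x)" using u xy by blast
  then show ?thesis unfolding uc c by (simp add: mult.commute inner_commute)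
qed

text \<open>The integral kernel of the projection on the harmonics of degree \<open>l\<close>.\<close>

definition legendre_kernel :: "nat \<Rightarrow> real^3 \<Rightarrow> real^3 \<Rightarrow> real" where
  "legendre_kernel l x y = legendre_term l (x \<bullet> y)"

lemma legendre_kernel_poly: "legendre_kernel l x y = poly (smult ((2 * real l + 1) / (4 * pi)) (legendre l)) (x \<bullet> y)"
  by (simp add: legendre_kernel_def legendre_term_def)

lemma legendre_kernel_commute: "legendre_kernel l x y = legendre_kernel l y x"
  by (simp add: legendre_kernel_def inner_commute)

lemma legendre_kernel_reproducing:
  assumes "x \<in> S2" "y \<in> S2"
  shows "(\<integral>z. legendre_kernel l x z * legendre_kernel l' z y \<partial>S2_measure) = (if l = l' then legendre_kernel l x y else 0)"
proof -
  have "(\<integral>z. legendre_kernel l x z * legendre_kernel l' z y \<partial>S2_measure)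
      = (\<integral>z. ((2 * real l + 1) / (4 * pi) * ((2 * real l' + 1) / (4 * pi))) * (poly (legendre l) (x \<bullet> z) * poly (legendre l') (y \<bullet> z)) \<partial>S2_measure)"
    unfolding legendre_kernel_poly by (simp add: inner_commute[of _ y] mult_ac)
  also have "\<dots> = ((2 * real l + 1) / (4 * pi) * ((2 * real l' + 1) / (4 * pi))) *
      (2 * pi * poly_integral (legendre l * legendre l') * poly (legendre l') (x \<bullet> y))"
    unfolding integral_mult_right_zero funk_hecke_poly[OF assms] ..
  also have "\<dots> = (if l = l' then legendre_kernel l x y else 0)"
    using legendre_orthogonal[of l l']
    by (auto simp: legendre_norm legendre_kernel_poly field_simps add_nonneg_eq_0_iff)
  finally show ?thesis .
qed

text \<open>Kernels of orthogonal projections of rank \<open>n\<close>, the rank being the trace.\<close>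

definition projection_kernel :: "(real^3 \<Rightarrow> real^3 \<Rightarrow> real) \<Rightarrow> nat \<Rightarrow> bool" where
  "projection_kernel K n \<longleftrightarrow>
     (\<lambda>(x, y). K x y) \<in> borel_measurable (S2_measure \<Otimes>\<^sub>M S2_measure) \<and>
     (\<exists>B. \<forall>x\<in>S2. \<forall>y\<in>S2. \<bar>K x y\<bar> \<le> B) \<and>
     (\<forall>x\<in>S2. \<forall>y\<in>S2. K x y = K y x) \<and>
     (\<forall>x\<in>S2. \<forall>y\<in>S2. (\<integral>z. K x z * K z y \<partial>S2_measure) = K x y) \<and>
     (\<integral>x. K x x \<partial>S2_measure) = real n"

definition orthonormal_S2 :: "nat \<Rightarrow> (nat \<Rightarrow> real^3 \<Rightarrow> real) \<Rightarrow> bool" where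
  "orthonormal_S2 n e \<longleftrightarrow>
     (\<forall>i<n. e i \<in> borel_measurable S2_measure \<and> (\<exists>B. \<forall>x\<in>S2. \<bar>e i x\<bar> \<le> B)) \<and>
     (\<forall>i<n. \<forall>j<n. (\<integral>x. e i x * e j x \<partial>S2_measure) = (if i = j then 1 else 0))"

lemma projection_kernel_diag_nonneg:
  assumes K: "projection_kernel K n" and x: "x \<in> S2"
  shows "K x x = (\<integral>z. (K x z)\<^sup>2 \<partial>S2_measure)"
proof -
  have "K x x = (\<integral>z. K x z * K z x \<partial>S2_measure)" using K x unfolding projection_kernel_def by simp
  also have "\<dots> = (\<integral>z. (K x z)\<^sup>2 \<partial>S2_measure)"
    using K x unfolding projection_kernel_def
    by (intro Bochner_Integration.integral_cong refl) (simp add: power2_eq_square)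
  finally show ?thesis .
qed

lemma bounded_mult_S2:
  assumes "\<forall>x\<in>S2. \<bar>f x\<bar> \<le> A" "\<forall>x\<in>S2. \<bar>g x\<bar> \<le> (B::real)" "x \<in> S2"
  shows "\<bar>f x * g x\<bar> \<le> A * B"
proof -
  have "\<bar>f x\<bar> \<le> A" "\<bar>g x\<bar> \<le> B" using assms by auto
  then show ?thesis unfolding abs_mult by (intro mult_mono) auto
qed

lemma S2_section_measurable:
  assumes "(\<lambda>(x, y). K x y) \<in> borel_measurable (S2_measure \<Otimes>\<^sub>M S2_measure)" "y \<in> S2"
  shows "(\<lambda>x. K x y) \<in> borel_measurable S2_measure" "(\<lambda>x. K y x) \<in> borel_measurable S2_measure"
  using measurable_Pair1[OF assms(1), of y] measurable_Pair2[OF assms(1), of y] assms(2) by simp_all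

text \<open>A basis of the range without explicit formulas: a section \<open>K x y0\<close> with \<open>K y0 y0 > 0\<close>, normalised, is an element \<open>f\<close> of
the range, and subtracting \<open>f x * f y\<close> leaves a projection kernel of trace \<open>n - 1\<close>. At trace zero the kernel vanishes
almost everywhere, and then everywhere by the reproducing property.\<close>

lemma projection_kernel_expansion:
  "projection_kernel K n \<Longrightarrow> \<exists>e. orthonormal_S2 n e \<and>
     (\<forall>x\<in>S2. \<forall>y\<in>S2. K x y = (\<Sum>i<n. e i x * e i y)) \<and>
     (\<forall>i<n. \<forall>x\<in>S2. (\<integral>z. K x z * e i z \<partial>S2_measure) = e i x)"
proof (induction n arbitrary: K)
  case 0
  note K = 0[unfolded projection_kernel_def]
  have m: "(\<lambda>(x, y). K x y) \<in> borel_measurable (S2_measure \<Otimes>\<^sub>M S2_measure)" using K by blast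
  have [measurable]: "(\<lambda>x. K x x) \<in> borel_measurable S2_measure"
    using measurable_compose[OF measurable_Pair[OF measurable_ident_sets[OF refl] measurable_ident_sets[OF refl]] m] by simp
  obtain B where B: "\<forall>x\<in>S2. \<forall>y\<in>S2. \<bar>K x y\<bar> \<le> B" using K by blast
  have "AE x in S2_measure. K x x = 0"
  proof (subst integral_nonneg_eq_0_iff_AE[symmetric])
    show "integrable S2_measure (\<lambda>x. K x x)" by (rule S2_integrable_bounded[where B = B]) (use B in auto)
    show "AE x in S2_measure. 0 \<le> K x x" by (rule AE_I2) (simp add: projection_kernel_diag_nonneg[OF 0])
  qed (use K in simp)
  then have z: "AE y in S2_measure. \<forall>x\<in>S2. K x y = 0"
    using AE_space
  proof eventually_elim
    case (elim y)
    then have y: "y \<in> S2" by simp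
    have my: "(\<lambda>z. K y z) \<in> borel_measurable S2_measure" by (rule S2_section_measurable[OF m y])
    have "(\<integral>z. (K y z)\<^sup>2 \<partial>S2_measure) = 0" using projection_kernel_diag_nonneg[OF 0 y] elim by simp
    then have ae: "AE z in S2_measure. (K y z)\<^sup>2 = 0"
    proof (subst (asm) integral_nonneg_eq_0_iff_AE)
      show "integrable S2_measure (\<lambda>z. (K y z)\<^sup>2)"
        unfolding power2_eq_square
      proof (rule S2_integrable_bounded[where B = "B * B"])
        show "(\<lambda>z. K y z * K y z) \<in> borel_measurable S2_measure" using my by measurable
        show "\<bar>K y z * K y z\<bar> \<le> B * B" if "z \<in> S2" for z
          by (rule bounded_mult_S2[OF _ _ that]) (use B y in auto)
      qed
    qed auto
    show ?case
    proof
      fix x assume x: "x \<in> S2"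
      have "K x y = (\<integral>z. K x z * K z y \<partial>S2_measure)" using K x y by simp
      also have "\<dots> = (\<integral>z. 0 \<partial>S2_measure)"
      proof (rule integral_cong_AE)
        show "(\<lambda>z. K x z * K z y) \<in> borel_measurable S2_measure"
          using S2_section_measurable[OF m x] S2_section_measurable[OF m y] by measurable
        show "AE z in S2_measure. K x z * K z y = 0"
          using ae AE_space by eventually_elim (use K y in auto)
      qed simp
      finally show "K x y = 0" by simp
    qed
  qed
  have "K x y = 0" if xy: "x \<in> S2" "y \<in> S2" for x y
  proof -
    have "K x y = (\<integral>z. K x z * K z y \<partial>S2_measure)" using K xy by simp
    also have "\<dots> = (\<integral>z. 0 \<partial>S2_measure)"
    proof (rule integral_cong_AE)
      show "(\<lambda>z. K x z * K z y) \<in> borel_measurable S2_measure"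
        using S2_section_measurable[OF m xy(1)] S2_section_measurable[OF m xy(2)] by measurable
      show "AE z in S2_measure. K x z * K z y = 0" using z by eventually_elim (use xy in auto)
    qed simp
    finally show ?thesis by simp
  qed
  then show ?case by (intro exI[of _ "\<lambda>_ _. 0"]) (auto simp: orthonormal_S2_def)
next
  case (Suc n)
  note K = Suc.prems[unfolded projection_kernel_def]
  have m: "(\<lambda>(x, y). K x y) \<in> borel_measurable (S2_measure \<Otimes>\<^sub>M S2_measure)" using K by blast
  have sym: "K x y = K y x" if "x \<in> S2" "y \<in> S2" for x y using K that by blast
  have rep: "(\<integral>z. K x z * K z y \<partial>S2_measure) = K x y" if "x \<in> S2" "y \<in> S2" for x y using K that by blast
  obtain B where B: "\<forall>x\<in>S2. \<forall>y\<in>S2. \<bar>K x y\<bar> \<le> B" using K by blast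
  have "\<exists>y\<in>S2. K y y \<noteq> 0"
  proof (rule ccontr)
    assume "\<not> ?thesis"
    then have "(\<integral>x. K x x \<partial>S2_measure) = (\<integral>x. 0 \<partial>S2_measure)"
      by (intro Bochner_Integration.integral_cong refl) auto
    then show False using K by simp
  qed
  then obtain y0 where y0: "y0 \<in> S2" "K y0 y0 \<noteq> 0" by blast
  have "K y0 y0 \<ge> 0" unfolding projection_kernel_diag_nonneg[OF Suc.prems y0(1)] by simp
  then have pos: "K y0 y0 > 0" using y0 by simp
  define f where "f x = K x y0 / sqrt (K y0 y0)" for x
  have fm[measurable]: "f \<in> borel_measurable S2_measure"
    unfolding f_def using S2_section_measurable[OF m y0(1)] by measurable
  have fB: "\<forall>x\<in>S2. \<bar>f x\<bar> \<le> B / sqrt (K y0 y0)"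
    unfolding f_def using B y0 pos by (auto simp: abs_divide intro!: divide_right_mono)
  have Kf: "(\<integral>z. K x z * f z \<partial>S2_measure) = f x" if "x \<in> S2" for x
    unfolding f_def using rep[OF that y0(1)] by simp
  have ff: "(\<integral>x. f x * f x \<partial>S2_measure) = 1"
  proof -
    have "(\<integral>x. f x * f x \<partial>S2_measure) = (\<integral>x. (K y0 x * K x y0) / K y0 y0 \<partial>S2_measure)"
      using pos sym[OF _ y0(1)] by (intro Bochner_Integration.integral_cong refl) (simp add: f_def)
    also have "\<dots> = 1" using rep[OF y0(1) y0(1)] pos by simp
    finally show ?thesis .
  qed
  define K' where "K' x y = K x y - f x * f y" for x y
  have Kint: "integrable S2_measure (\<lambda>z. K x z * g z)"
    if "x \<in> S2" "g \<in> borel_measurable S2_measure" "\<forall>z\<in>S2. \<bar>g z\<bar> \<le> D" for x g D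
  proof (rule S2_integrable_bounded[where B = "B * D"])
    show "(\<lambda>z. K x z * g z) \<in> borel_measurable S2_measure" using S2_section_measurable[OF m that(1)] that(2) by measurable
    show "\<bar>K x z * g z\<bar> \<le> B * D" if "z \<in> S2" for z
      by (rule bounded_mult_S2[OF _ \<open>\<forall>z\<in>S2. \<bar>g z\<bar> \<le> D\<close> that]) (use B \<open>x \<in> S2\<close> in auto)
  qed
  have fint: "integrable S2_measure (\<lambda>z. f z * g z)"
    if "g \<in> borel_measurable S2_measure" "\<forall>z\<in>S2. \<bar>g z\<bar> \<le> D" for g D
  proof (rule S2_integrable_bounded[where B = "B / sqrt (K y0 y0) * D"])
    show "(\<lambda>z. f z * g z) \<in> borel_measurable S2_measure" using that(1) by measurable
    show "\<bar>f z * g z\<bar> \<le> B / sqrt (K y0 y0) * D" if "z \<in> S2" for z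
      by (rule bounded_mult_S2[OF fB \<open>\<forall>z\<in>S2. \<bar>g z\<bar> \<le> D\<close> that])
  qed
  have K'g: "(\<integral>z. K' x z * g z \<partial>S2_measure) = (\<integral>z. K x z * g z \<partial>S2_measure) - f x * (\<integral>z. f z * g z \<partial>S2_measure)"
    if "x \<in> S2" "g \<in> borel_measurable S2_measure" "\<forall>z\<in>S2. \<bar>g z\<bar> \<le> D" for x g D
  proof -
    have "(\<lambda>z. K' x z * g z) = (\<lambda>z. K x z * g z - f x * (f z * g z))" unfolding K'_def by (auto simp: algebra_simps)
    then show ?thesis using Kint[OF that] fint[OF that(2,3)] by simp
  qed
  have mK': "(\<lambda>(x, y). K' x y) \<in> borel_measurable (S2_measure \<Otimes>\<^sub>M S2_measure)"
  proof -
    have "(\<lambda>w. (case w of (x, y) \<Rightarrow> K x y) - f (fst w) * f (snd w)) \<in> borel_measurable (S2_measure \<Otimes>\<^sub>M S2_measure)"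
      using m by measurable
    then show ?thesis by (simp add: K'_def split_beta)
  qed
  have secB: "\<forall>z\<in>S2. \<bar>K z y\<bar> \<le> B" if "y \<in> S2" for y using B that by blast
  have "projection_kernel K' n"
    unfolding projection_kernel_def
  proof (intro conjI)
    show "\<exists>B. \<forall>x\<in>S2. \<forall>y\<in>S2. \<bar>K' x y\<bar> \<le> B"
    proof (intro exI ballI)
      fix x y assume xy: "x \<in> S2" "y \<in> S2"
      have "\<bar>K' x y\<bar> \<le> \<bar>K x y\<bar> + \<bar>f x\<bar> * \<bar>f y\<bar>" unfolding K'_def abs_mult[symmetric] by linarith
      also have "\<dots> \<le> B + (B / sqrt (K y0 y0)) * (B / sqrt (K y0 y0))"
      proof (intro add_mono mult_mono)
        show "\<bar>f x\<bar> \<le> B / sqrt (K y0 y0)" "\<bar>f y\<bar> \<le> B / sqrt (K y0 y0)" "\<bar>K x y\<bar> \<le> B" using fB B xy by auto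
        then show "0 \<le> B / sqrt (K y0 y0)" by linarith
      qed simp
      finally show "\<bar>K' x y\<bar> \<le> B + (B / sqrt (K y0 y0)) * (B / sqrt (K y0 y0))" .
    qed
    show "\<forall>x\<in>S2. \<forall>y\<in>S2. K' x y = K' y x" unfolding K'_def using sym by (auto simp: mult.commute)
    show "\<forall>x\<in>S2. \<forall>y\<in>S2. (\<integral>z. K' x z * K' z y \<partial>S2_measure) = K' x y"
    proof (intro ballI)
      fix x y assume xy: "x \<in> S2" "y \<in> S2"
      have Ky: "(\<lambda>z. K z y) \<in> borel_measurable S2_measure" by (rule S2_section_measurable[OF m xy(2)])
      have i1: "integrable S2_measure (\<lambda>z. K' x z * K z y)" "integrable S2_measure (\<lambda>z. K' x z * f z)"
      proof -
        have "(\<lambda>z. K' x z * g z) = (\<lambda>z. K x z * g z - f x * (f z * g z))" for g unfolding K'_def by (auto simp: algebra_simps)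
        then show "integrable S2_measure (\<lambda>z. K' x z * K z y)" "integrable S2_measure (\<lambda>z. K' x z * f z)"
          using Kint[OF xy(1) Ky secB[OF xy(2)]] fint[OF Ky secB[OF xy(2)]] Kint[OF xy(1) fm fB] fint[OF fm fB] by simp_all
      qed
      have fK: "(\<integral>z. f z * K z y \<partial>S2_measure) = f y"
      proof -
        have "(\<integral>z. f z * K z y \<partial>S2_measure) = (\<integral>z. K y z * f z \<partial>S2_measure)"
          using sym[OF _ xy(2)] by (intro Bochner_Integration.integral_cong refl) (simp add: mult.commute)
        then show ?thesis using Kf[OF xy(2)] by simp
      qed
      have "(\<lambda>z. K' x z * K' z y) = (\<lambda>z. K' x z * K z y - f y * (K' x z * f z))"
        unfolding K'_def by (auto simp: algebra_simps)
      then have "(\<integral>z. K' x z * K' z y \<partial>S2_measure) = (\<integral>z. K' x z * K z y \<partial>S2_measure) - f y * (\<integral>z. K' x z * f z \<partial>S2_measure)"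
        using i1 by simp
      also have "(\<integral>z. K' x z * K z y \<partial>S2_measure) = K x y - f x * f y"
        by (simp only: K'g[OF xy(1) Ky secB[OF xy(2)]] rep[OF xy] fK)
      also have "(\<integral>z. K' x z * f z \<partial>S2_measure) = 0"
        unfolding K'g[OF xy(1) fm fB] Kf[OF xy(1)] ff by simp
      also have "K x y - f x * f y - f y * 0 = K' x y" unfolding K'_def by simp
      finally show "(\<integral>z. K' x z * K' z y \<partial>S2_measure) = K' x y" .
    qed
    have mxx[measurable]: "(\<lambda>x. K x x) \<in> borel_measurable S2_measure"
      using measurable_compose[OF measurable_Pair[OF measurable_ident_sets[OF refl] measurable_ident_sets[OF refl]] m] by simp
    have "integrable S2_measure (\<lambda>x. K x x)" by (rule S2_integrable_bounded[where B = B]) (use B in auto)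
    then show "(\<integral>x. K' x x \<partial>S2_measure) = real n"
      unfolding K'_def using fint[OF fm fB] ff K by simp
  qed (rule mK')
  from Suc.IH[OF this] obtain e where e: "orthonormal_S2 n e"
    "\<forall>x\<in>S2. \<forall>y\<in>S2. K' x y = (\<Sum>i<n. e i x * e i y)"
    "\<forall>i<n. \<forall>x\<in>S2. (\<integral>z. K' x z * e i z \<partial>S2_measure) = e i x" by blast
  have K'f: "(\<integral>z. K' x z * f z \<partial>S2_measure) = 0" if "x \<in> S2" for x
    unfolding K'g[OF that fm fB] Kf[OF that] ff by simp
  have em: "e i \<in> borel_measurable S2_measure" "\<exists>D. \<forall>z\<in>S2. \<bar>e i z\<bar> \<le> D" if "i < n" for i
    using e(1) that unfolding orthonormal_S2_def by auto
  have ef: "(\<integral>x. f x * e i x \<partial>S2_measure) = 0" if i: "i < n" for i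
  proof -
    obtain D where D: "\<forall>z\<in>S2. \<bar>e i z\<bar> \<le> D" using em(2)[OF i] by blast
    obtain B' where B': "\<forall>x\<in>S2. \<forall>y\<in>S2. \<bar>K' x y\<bar> \<le> B'" using \<open>projection_kernel K' n\<close> unfolding projection_kernel_def by blast
    have "(\<integral>x. f x * e i x \<partial>S2_measure) = (\<integral>x. (\<integral>z. f x * (K' x z * e i z) \<partial>S2_measure) \<partial>S2_measure)"
      using e(3) i by (intro Bochner_Integration.integral_cong refl) simp
    also have "\<dots> = (\<integral>z. (\<integral>x. f x * (K' x z * e i z) \<partial>S2_measure) \<partial>S2_measure)"
    proof (rule S2_swap_bounded[where B = "B / sqrt (K y0 y0) * (B' * D)"])
      have "(\<lambda>w. f (fst w) * ((case w of (x, y) \<Rightarrow> K' x y) * e i (snd w))) \<in> borel_measurable (S2_measure \<Otimes>\<^sub>M S2_measure)"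
        using mK' em(1)[OF i] by measurable
      then show "(\<lambda>(x, z). f x * (K' x z * e i z)) \<in> borel_measurable (S2_measure \<Otimes>\<^sub>M S2_measure)" by (simp add: split_beta)
      fix x z assume xz: "x \<in> S2" "z \<in> S2"
      have "\<bar>f x\<bar> \<le> B / sqrt (K y0 y0)" "\<bar>K' x z\<bar> \<le> B'" "\<bar>e i z\<bar> \<le> D" using fB B' D xz by auto
      moreover from this have "0 \<le> B'" "0 \<le> D" "0 \<le> B / sqrt (K y0 y0)" by linarith+
      ultimately show "\<bar>f x * (K' x z * e i z)\<bar> \<le> B / sqrt (K y0 y0) * (B' * D)"
        unfolding abs_mult by (intro mult_mono) auto
    qed
    also have "\<dots> = (\<integral>z. 0 \<partial>S2_measure)"
    proof (intro Bochner_Integration.integral_cong refl)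
      fix z assume "z \<in> space S2_measure"
      then have z: "z \<in> S2" by simp
      have "(\<integral>x. f x * (K' x z * e i z) \<partial>S2_measure) = (\<integral>x. e i z * (K' z x * f x) \<partial>S2_measure)"
        unfolding K'_def using sym[OF z] by (intro Bochner_Integration.integral_cong refl) (simp add: algebra_simps)
      also have "\<dots> = e i z * (\<integral>x. K' z x * f x \<partial>S2_measure)" by (rule integral_mult_right_zero)
      finally show "(\<integral>x. f x * (K' x z * e i z) \<partial>S2_measure) = 0" using K'f[OF z] by simp
    qed
    finally show ?thesis by simp
  qed
  define e' where "e' = e(n := f)"
  have "orthonormal_S2 (Suc n) e'"
    using e(1) ff ef fm fB unfolding orthonormal_S2_def e'_def
    by (auto simp: less_Suc_eq mult.commute)
  moreover have "\<forall>x\<in>S2. \<forall>y\<in>S2. K x y = (\<Sum>i<Suc n. e' i x * e' i y)"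
  proof (intro ballI)
    fix x y assume "x \<in> S2" "y \<in> S2"
    then have "K x y = (\<Sum>i<n. e i x * e i y) + f x * f y" using e(2) unfolding K'_def by force
    then show "K x y = (\<Sum>i<Suc n. e' i x * e' i y)" by (simp add: e'_def)
  qed
  moreover have "(\<integral>z. K x z * e' i z \<partial>S2_measure) = e' i x" if ix: "i < Suc n" "x \<in> S2" for i x
  proof (cases "i = n")
    case True then show ?thesis using Kf[OF ix(2)] by (simp add: e'_def)
  next
    case False
    then have i: "i < n" using ix by simp
    obtain D where D: "\<forall>z\<in>S2. \<bar>e i z\<bar> \<le> D" using em(2)[OF i] by blast
    show ?thesis using K'g[OF ix(2) em(1)[OF i] D] ef[OF i] e(3) i ix(2) by (simp add: e'_def)
  qed
  ultimately show ?case by blast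
qed

lemma legendre_kernel_projection: "projection_kernel (legendre_kernel l) (2 * l + 1)"
  unfolding projection_kernel_def
proof (intro conjI)
  show "(\<lambda>(x, y). legendre_kernel l x y) \<in> borel_measurable (S2_measure \<Otimes>\<^sub>M S2_measure)"
    unfolding legendre_kernel_poly split_beta by measurable
  show "\<exists>B. \<forall>x\<in>S2. \<forall>y\<in>S2. \<bar>legendre_kernel l x y\<bar> \<le> B"
    unfolding legendre_kernel_poly by (rule poly_inner_bounded)
  show "\<forall>x\<in>S2. \<forall>y\<in>S2. legendre_kernel l x y = legendre_kernel l y x" using legendre_kernel_commute by blast
  show "\<forall>x\<in>S2. \<forall>y\<in>S2. (\<integral>z. legendre_kernel l x z * legendre_kernel l z y \<partial>S2_measure) = legendre_kernel l x y"
    by (simp add: legendre_kernel_reproducing)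
  have "(\<integral>x. legendre_kernel l x x \<partial>S2_measure) = (\<integral>x. (2 * real l + 1) / (4 * pi) \<partial>S2_measure)"
    by (intro Bochner_Integration.integral_cong refl)
       (simp add: legendre_kernel_def legendre_term_def dot_square_norm legendre_at_1)
  then show "(\<integral>x. legendre_kernel l x x \<partial>S2_measure) = real (2 * l + 1)" by simp
qed

section \<open>Zonal functions and polynomial approximation\<close>

definition lborel_interval :: "real measure" where
  "lborel_interval = restrict_space lborel {-1..1}"

lemma sets_lborel_interval [simp, measurable_cong]: "sets lborel_interval = sets (restrict_space borel {-1..1})"
  unfolding lborel_interval_def by (intro sets_restrict_space_cong) simp

lemma space_lborel_interval [simp]: "space lborel_interval = {-1..1}"
  by (simp add: lborel_interval_def space_restrict_space)

lemma emeasure_lborel_interval: "A \<in> sets lborel_interval \<Longrightarrow> emeasure lborel_interval A = emeasure lborel A"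
  unfolding lborel_interval_def by (subst emeasure_restrict_space) (auto simp: sets_restrict_space space_restrict_space)

interpretation LI: finite_measure lborel_interval
  by (rule finite_measureI) (simp add: emeasure_lborel_interval sets_restrict_space_iff)

lemma measure_lborel_interval [simp]: "measure lborel_interval {-1..1} = 2"
  by (simp add: measure_def emeasure_lborel_interval sets_restrict_space_iff)

lemma integral_lborel_interval: "(\<integral>x. f x \<partial>lborel_interval) = (\<integral>x. f x * indicator {-1..1} x \<partial>lborel)" for f :: "real \<Rightarrow> real"
  unfolding lborel_interval_def by (subst integral_restrict_space) (auto simp: mult.commute)

lemma poly_integral_eq: "poly_integral f = (\<integral>x. poly f x \<partial>lborel_interval)"
  unfolding poly_integral_def integral_lborel_interval ..

lemma borel_imp_lborel_interval: "f \<in> borel_measurable borel \<Longrightarrow> f \<in> borel_measurable lborel_interval"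
  unfolding measurable_cong_sets[OF sets_lborel_interval refl] by (rule measurable_restrict_space1)

lemma poly_square_integrable: "square_integrable lborel_interval (poly f)"
proof -
  have m: "poly g \<in> borel_measurable lborel_interval" for g :: "real poly"
    by (rule borel_imp_lborel_interval, rule borel_measurable_continuous_onI)
       (use continuous_on_poly[OF continuous_on_id, of UNIV g] in simp)
  have "integrable lborel_interval (poly (f * f))"
    unfolding lborel_interval_def
    by (subst integrable_restrict_space) (use poly_integrable[of "f * f"] in \<open>auto simp: mult.commute\<close>)
  moreover have "poly (f * f) = (\<lambda>x. (poly f x)\<^sup>2)" by (auto simp: power2_eq_square)
  ultimately show ?thesis unfolding square_integrable_def using m by simp
qed

lemma exp_tail_tendsto_0: "(\<lambda>n. 4 * \<bar>t\<bar> ^ n / fact n :: real) \<longlonglongrightarrow> 0"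
proof -
  have "(\<lambda>n. inverse (fact n) * \<bar>t\<bar> ^ n) \<longlonglongrightarrow> 0" by (rule summable_LIMSEQ_zero[OF summable_exp])
  from tendsto_mult_left[OF this, of 4] show ?thesis by (simp add: field_simps)
qed

text \<open>Bounded variables are determined by their moments: the Taylor series of the characteristic function converges.\<close>

lemma real_distribution_eq_of_moments:
  assumes "real_distribution M1" "real_distribution M2"
    and b1: "AE x in M1. \<bar>x\<bar> \<le> 1" and b2: "AE x in M2. \<bar>x\<bar> \<le> 1"
    and mom: "\<And>n. (\<integral>x. x ^ n \<partial>M1) = (\<integral>x. x ^ n \<partial>M2)"
  shows "M1 = M2"
proof (rule Levy_uniqueness[OF assms(1,2)], rule ext)
  fix t
  have approx: "cmod (char M t - (\<Sum>k\<le>n. ((\<i> * t) ^ k / fact k) * (\<integral>x. x ^ k \<partial>M))) \<le> 2 * \<bar>t\<bar> ^ n / fact n"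
    if "real_distribution M" and b: "AE x in M. \<bar>x\<bar> \<le> 1" for M n
  proof -
    interpret real_distribution M by fact
    have ae: "AE x in M. \<bar>x ^ k\<bar> \<le> 1" for k
      using b by eventually_elim (auto simp: power_abs intro: power_le_one)
    have int: "integrable M (\<lambda>x. x ^ k)" for k
      by (rule integrable_const_bound[of _ 1]) (use ae in auto)
    have "expectation (\<lambda>x. \<bar>x\<bar> ^ n) \<le> expectation (\<lambda>x. 1)"
      by (rule integral_mono_AE) (use ae[of n] int[of n] in \<open>auto simp: power_abs[symmetric]\<close>)
    then have "expectation (\<lambda>x. \<bar>x\<bar> ^ n) \<le> 1" using prob_space space_eq_univ by simp
    then have "(2 * \<bar>t\<bar> ^ n / fact n) * expectation (\<lambda>x. \<bar>x\<bar> ^ n) \<le> (2 * \<bar>t\<bar> ^ n / fact n) * 1"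
      by (intro mult_left_mono) auto
    with char_approx1[of n t, OF int] show ?thesis by simp
  qed
  have "cmod (char M1 t - char M2 t) \<le> 4 * \<bar>t\<bar> ^ n / fact n" for n
  proof -
    define S where "S = (\<Sum>k\<le>n. ((\<i> * t) ^ k / fact k) * complex_of_real (\<integral>x. x ^ k \<partial>M2))"
    have "cmod (char M1 t - S) \<le> 2 * \<bar>t\<bar> ^ n / fact n" "cmod (char M2 t - S) \<le> 2 * \<bar>t\<bar> ^ n / fact n"
      using approx[OF assms(1) b1, of n] approx[OF assms(2) b2, of n] unfolding mom S_def by simp_all
    moreover have "cmod (char M1 t - char M2 t) \<le> cmod (char M1 t - S) + cmod (char M2 t - S)"
      using norm_triangle_ineq4[of "char M1 t - S" "char M2 t - S"] by simp
    ultimately have "cmod (char M1 t - char M2 t) \<le> 2 * \<bar>t\<bar> ^ n / fact n + 2 * \<bar>t\<bar> ^ n / fact n" by linarith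
    then show ?thesis by simp
  qed
  then have "cmod (char M1 t - char M2 t) \<le> 0"
    by (intro LIMSEQ_le_const[OF exp_tail_tendsto_0]) blast
  then show "char M1 t = char M2 t" by simp
qed

text \<open>Archimedes' theorem for arbitrary Borel functions, from the equality of all moments.\<close>

lemma S2_distr_inner:
  assumes x: "x \<in> S2"
  shows "distr S2_measure borel (\<lambda>z. x \<bullet> z) = density lborel (\<lambda>t. ennreal (2 * pi) * indicator {-1..1} t)"
proof -
  define D where "D = distr S2_measure borel (\<lambda>z. x \<bullet> z)"
  define N1 where "N1 = density D (\<lambda>_. ennreal (1 / (4 * pi)))"
  define N2 where "N2 = density lborel (\<lambda>t. ennreal (1 / 2 * indicator {-1..1::real} t))"
  have p2: "prob_space N2"
  proof (rule prob_spaceI)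
    have m: "(\<lambda>t. ennreal (1 / 2 * indicator {-1..1::real} t)) \<in> borel_measurable lborel" by measurable
    have "emeasure N2 UNIV = (\<integral>\<^sup>+t. ennreal (1 / 2 * indicator {-1..1::real} t) * indicator UNIV t \<partial>lborel)"
      unfolding N2_def by (rule emeasure_density[OF m]) simp
    also have "\<dots> = (\<integral>\<^sup>+t. ennreal (1 / 2) * indicator {-1..1::real} t \<partial>lborel)"
      by (intro nn_integral_cong) (auto simp: indicator_def)
    also have "\<dots> = ennreal (1 / 2) * emeasure lborel {-1..1::real}"
      by (rule nn_integral_cmult_indicator) simp
    also have "emeasure lborel {-1..1::real} = ennreal 2" by simp
    also have "ennreal (1 / 2) * ennreal 2 = 1" by (subst ennreal_mult''[symmetric]) simp_all
    finally show "emeasure N2 (space N2) = 1" by (simp add: N2_def)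
  qed
  have p1: "prob_space N1"
  proof (rule prob_spaceI)
    have "emeasure D UNIV = ennreal (4 * pi)"
      unfolding D_def by (subst emeasure_distr) (auto simp: emeasure_S2_total)
    then show "emeasure N1 (space N1) = 1"
      unfolding N1_def D_def by (simp add: emeasure_density nn_integral_cmult ennreal_mult''[symmetric])
  qed
  have "N1 = N2"
  proof (rule real_distribution_eq_of_moments)
    show r1: "real_distribution N1" using p1 unfolding real_distribution_def real_distribution_axioms_def N1_def D_def by simp
    show r2: "real_distribution N2" using p2 unfolding real_distribution_def real_distribution_axioms_def N2_def by simp
    have "AE t in D. \<bar>t\<bar> \<le> 1"
      unfolding D_def by (subst AE_distr_iff) (auto simp: S2_inner_le[OF x] intro!: AE_I2)
    then show "AE t in N1. \<bar>t\<bar> \<le> 1" unfolding N1_def by (subst AE_density) auto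
    show "AE t in N2. \<bar>t\<bar> \<le> 1" unfolding N2_def by (subst AE_density) (auto simp: indicator_def)
    fix n
    have "(\<integral>t. t ^ n \<partial>N1) = 1 / (4 * pi) * (\<integral>z. (x \<bullet> z) ^ n \<partial>S2_measure)"
      unfolding N1_def D_def by (subst integral_density, simp, simp, simp, subst integral_distr) auto
    also have "\<dots> = 1 / (4 * pi) * (2 * pi * poly_integral (monom 1 n))"
      using S2_integral_zonal_poly[OF x, of "monom 1 n"] by (simp add: poly_monom)
    also have "\<dots> = (\<integral>t. t ^ n \<partial>N2)"
      unfolding N2_def poly_integral_def by (subst integral_density) (auto simp: poly_monom mult_ac)
    finally show "(\<integral>t. t ^ n \<partial>N1) = (\<integral>t. t ^ n \<partial>N2)" .
  qed
  have "D = density D (\<lambda>_. ennreal (1 / (4 * pi)) * ennreal (4 * pi))"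
    by (simp add: ennreal_mult''[symmetric] density_1)
  also have "\<dots> = density N1 (\<lambda>_. ennreal (4 * pi))"
    unfolding N1_def by (subst density_density_eq) auto
  also have "\<dots> = density lborel (\<lambda>t. ennreal (1 / 2 * indicator {-1..1} t) * ennreal (4 * pi))"
    unfolding \<open>N1 = N2\<close> N2_def by (subst density_density_eq) auto
  also have "\<dots> = density lborel (\<lambda>t. ennreal (2 * pi) * indicator {-1..1} t)"
    by (intro arg_cong[where f = "density lborel"] ext) (auto simp: indicator_def ennreal_mult''[symmetric])
  finally show ?thesis unfolding D_def .
qed

lemma measurable_inner_interval:
  assumes x: "x \<in> S2" shows "(\<lambda>z. x \<bullet> z) \<in> S2_measure \<rightarrow>\<^sub>M lborel_interval"
  unfolding measurable_cong_sets[OF refl sets_lborel_interval]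
  by (rule measurable_restrict_space2) (use S2_inner_range[OF x] in auto)

lemma measurable_inner_interval_pair:
  "(\<lambda>(x, y). x \<bullet> y) \<in> S2_measure \<Otimes>\<^sub>M S2_measure \<rightarrow>\<^sub>M lborel_interval"
  unfolding measurable_cong_sets[OF refl sets_lborel_interval]
proof (rule measurable_restrict_space2)
  show "(\<lambda>(x, y). x \<bullet> y) \<in> S2_measure \<Otimes>\<^sub>M S2_measure \<rightarrow>\<^sub>M borel" unfolding split_beta by measurable
  show "(\<lambda>(x, y). x \<bullet> y) \<in> space (S2_measure \<Otimes>\<^sub>M S2_measure) \<rightarrow> {-1..1}"
    using S2_inner_range by (force simp: space_pair_measure)
qed

lemma S2_distr_inner_interval:
  assumes x: "x \<in> S2"
  shows "distr S2_measure lborel_interval (\<lambda>z. x \<bullet> z) = density lborel_interval (\<lambda>_. ennreal (2 * pi))"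
proof (rule measure_eqI)
  fix A assume "A \<in> sets (distr S2_measure lborel_interval (\<lambda>z. x \<bullet> z))"
  then have A: "A \<in> sets lborel_interval" by simp
  then have A': "A \<subseteq> {-1..1}" "A \<in> sets borel" by (auto simp: sets_restrict_space_iff)
  have "emeasure (distr S2_measure lborel_interval (\<lambda>z. x \<bullet> z)) A = emeasure (distr S2_measure borel (\<lambda>z. x \<bullet> z)) A"
    by (simp add: emeasure_distr[OF measurable_inner_interval[OF x] A] emeasure_distr A')
  also have "\<dots> = (\<integral>\<^sup>+t. ennreal (2 * pi) * indicator A t \<partial>lborel)"
    unfolding S2_distr_inner[OF x] using A'
    by (subst emeasure_density) (auto intro!: nn_integral_cong simp: indicator_def)
  also have "\<dots> = emeasure (density lborel_interval (\<lambda>_. ennreal (2 * pi))) A"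
    using A A' by (subst emeasure_density) (auto simp: nn_integral_cmult emeasure_lborel_interval)
  finally show "emeasure (distr S2_measure lborel_interval (\<lambda>z. x \<bullet> z)) A
      = emeasure (density lborel_interval (\<lambda>_. ennreal (2 * pi))) A" .
qed simp

text \<open>The integral of a zonal function is one-dimensional; in particular integrability of \<open>k (x \<bullet> z)\<close> depends neither on \<open>x\<close>
nor on the values of \<open>k\<close> on a null set.\<close>

lemma S2_integral_zonal:
  fixes k :: "real \<Rightarrow> real"
  assumes x: "x \<in> S2" and k: "k \<in> borel_measurable lborel_interval"
  shows "(\<integral>z. k (x \<bullet> z) \<partial>S2_measure) = 2 * pi * (\<integral>t. k t \<partial>lborel_interval)"
    and "integrable S2_measure (\<lambda>z. k (x \<bullet> z)) \<longleftrightarrow> integrable lborel_interval k"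
proof -
  have "(\<integral>z. k (x \<bullet> z) \<partial>S2_measure) = (\<integral>t. k t \<partial>distr S2_measure lborel_interval (\<lambda>z. x \<bullet> z))"
    by (rule integral_distr[OF measurable_inner_interval[OF x] k, symmetric])
  also have "\<dots> = (\<integral>t. 2 * pi * k t \<partial>lborel_interval)"
    unfolding S2_distr_inner_interval[OF x] using k by (subst integral_density) auto
  finally show "(\<integral>z. k (x \<bullet> z) \<partial>S2_measure) = 2 * pi * (\<integral>t. k t \<partial>lborel_interval)" by simp
  have "integrable S2_measure (\<lambda>z. k (x \<bullet> z)) \<longleftrightarrow> integrable (distr S2_measure lborel_interval (\<lambda>z. x \<bullet> z)) k"
    by (rule integrable_distr_eq[OF measurable_inner_interval[OF x] k, symmetric])
  also have "\<dots> \<longleftrightarrow> integrable lborel_interval (\<lambda>t. 2 * pi * k t)"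
    unfolding S2_distr_inner_interval[OF x] using k by (subst integrable_density) auto
  also have "\<dots> \<longleftrightarrow> integrable lborel_interval k" by (simp add: integrable_mult_left_iff)
  finally show "integrable S2_measure (\<lambda>z. k (x \<bullet> z)) \<longleftrightarrow> integrable lborel_interval k" .
qed

lemma zonal_square_integrable:
  assumes x: "x \<in> S2" and k: "square_integrable lborel_interval k"
  shows "square_integrable S2_measure (\<lambda>z. k (x \<bullet> z))"
    and "(\<integral>z. (k (x \<bullet> z))\<^sup>2 \<partial>S2_measure) = 2 * pi * (\<integral>t. (k t)\<^sup>2 \<partial>lborel_interval)"
proof -
  have m: "k \<in> borel_measurable lborel_interval" using k by (rule square_integrable_measurable)
  then have m2: "(\<lambda>t. (k t)\<^sup>2) \<in> borel_measurable lborel_interval" by measurable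
  show "(\<integral>z. (k (x \<bullet> z))\<^sup>2 \<partial>S2_measure) = 2 * pi * (\<integral>t. (k t)\<^sup>2 \<partial>lborel_interval)"
    by (rule S2_integral_zonal(1)[OF x m2])
  show "square_integrable S2_measure (\<lambda>z. k (x \<bullet> z))"
    using S2_integral_zonal(2)[OF x m2] measurable_compose[OF measurable_inner_interval[OF x] m] k
    unfolding square_integrable_def by simp
qed

lemma bounded_square_integrable_interval:
  assumes "f \<in> borel_measurable lborel_interval" "\<And>x. x \<in> {-1..1} \<Longrightarrow> \<bar>f x\<bar> \<le> B"
  shows "square_integrable lborel_interval f"
  unfolding square_integrable_def
proof
  show "integrable lborel_interval (\<lambda>x. (f x)\<^sup>2)"
  proof (rule LI.integrable_const_bound[of _ "B\<^sup>2"])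
    show "AE x in lborel_interval. norm ((f x)\<^sup>2) \<le> B\<^sup>2"
      using assms(2) by (intro AE_I2) (auto intro: power_mono simp: abs_le_square_iff[symmetric] intro: order.trans[OF _ abs_ge_self])
  qed (use assms in measurable)
qed (rule assms)

text \<open>Truncate, approximate the bounded function almost everywhere by continuous ones, and these uniformly by polynomials;
each step costs at most \<open>\<epsilon> / 3\<close>.\<close>

lemma polynomials_dense_L2:
  assumes k: "square_integrable lborel_interval k" and "\<epsilon> > 0"
  shows "\<exists>q. sqrt (\<integral>x. (k x - poly q x)\<^sup>2 \<partial>lborel_interval) < \<epsilon>"
proof -
  have km: "k \<in> borel_measurable lborel_interval" and k2: "integrable lborel_interval (\<lambda>x. (k x)\<^sup>2)"
    using k unfolding square_integrable_def by auto
  define clamp where "clamp R y = max (- R) (min R y)" for R y :: real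
  have cl: "\<bar>clamp R y\<bar> \<le> R" if "R \<ge> 0" for R y using that unfolding clamp_def by auto
  have clc: "continuous_on UNIV (clamp R)" for R unfolding clamp_def by (intro continuous_intros)
  have "(\<lambda>n. \<integral>x. (k x - clamp (real n) (k x))\<^sup>2 \<partial>lborel_interval) \<longlonglongrightarrow> (\<integral>x. 0 \<partial>lborel_interval)"
  proof (rule integral_dominated_convergence[where w = "\<lambda>x. (k x)\<^sup>2"])
    have "(\<lambda>n. (y - clamp (real n) y)\<^sup>2) \<longlonglongrightarrow> 0" for y
    proof (rule tendsto_eventually)
      obtain N where N: "\<bar>y\<bar> \<le> real N" using real_arch_simple by blast
      show "\<forall>\<^sub>F n in sequentially. (y - clamp (real n) y)\<^sup>2 = 0"
        by (rule eventually_sequentiallyI[of N]) (use N in \<open>auto simp: clamp_def\<close>)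
    qed
    then show "AE x in lborel_interval. (\<lambda>n. (k x - clamp (real n) (k x))\<^sup>2) \<longlonglongrightarrow> 0" by simp
    have "\<bar>y - clamp (real n) y\<bar> \<le> \<bar>y\<bar>" for y n unfolding clamp_def by auto
    then show "AE x in lborel_interval. norm ((k x - clamp (real n) (k x))\<^sup>2) \<le> (k x)\<^sup>2" for n
      by (auto simp: abs_le_square_iff)
    show "(\<lambda>x. (k x - clamp (real n) (k x))\<^sup>2) \<in> borel_measurable lborel_interval" for n
      unfolding clamp_def using km by measurable
  qed (use k2 in auto)
  then have "\<forall>\<^sub>F n in sequentially. (\<integral>x. (k x - clamp (real n) (k x))\<^sup>2 \<partial>lborel_interval) < (\<epsilon> / 3)\<^sup>2"
    by (intro order_tendstoD) (use \<open>\<epsilon> > 0\<close> in auto)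
  then obtain n where n: "(\<integral>x. (k x - clamp (real n) (k x))\<^sup>2 \<partial>lborel_interval) < (\<epsilon> / 3)\<^sup>2"
    by (auto simp: eventually_sequentially)
  define R where "R = real n"
  have R0: "R \<ge> 0" unfolding R_def by simp
  define h where "h x = clamp R (k x)" for x
  have hm: "h \<in> borel_measurable lborel_interval" unfolding h_def clamp_def using km by measurable
  have "(\<lambda>x. indicator {-1..1} x *\<^sub>R h x) \<in> borel_measurable lborel"
    using hm unfolding lborel_interval_def by (subst (asm) borel_measurable_restrict_space_iff) auto
  then have "(\<lambda>x. indicator {-1..1} x *\<^sub>R h x) \<in> borel_measurable lebesgue" by (rule measurable_completion)
  then have "(\<lambda>x. indicator {-1..1} x *\<^sub>R h x) measurable_on UNIV"
    by (rule lebesgue_measurable_imp_measurable_on) simp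
  then obtain Nn g where g: "negligible Nn" "\<And>n. continuous_on UNIV (g n)"
    "\<And>x. x \<notin> Nn \<Longrightarrow> (\<lambda>n. g n x) \<longlonglongrightarrow> indicator {-1..1} x *\<^sub>R h x"
    unfolding measurable_on_def by auto
  have gm: "(\<lambda>x. clamp R (g n x)) \<in> borel_measurable lborel_interval" for n
    by (intro borel_imp_lborel_interval borel_measurable_continuous_onI continuous_on_compose2[OF clc g(2)]) auto
  have "(\<lambda>n. \<integral>x. (h x - clamp R (g n x))\<^sup>2 \<partial>lborel_interval) \<longlonglongrightarrow> (\<integral>x. 0 \<partial>lborel_interval)"
  proof (rule integral_dominated_convergence[where w = "\<lambda>x. (2 * R)\<^sup>2"])
    have "AE x in lebesgue. x \<notin> Nn" using g(1) by (simp add: AE_not_in negligible_iff_null_sets)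
    then have "AE x in lborel. x \<notin> Nn" by (simp add: AE_completion_iff)
    then have "AE x in lborel_interval. x \<notin> Nn"
      unfolding lborel_interval_def by (subst AE_restrict_space_iff) auto
    then show "AE x in lborel_interval. (\<lambda>n. (h x - clamp R (g n x))\<^sup>2) \<longlonglongrightarrow> 0"
      using AE_space
    proof eventually_elim
      case (elim x)
      then have "(\<lambda>n. g n x) \<longlonglongrightarrow> h x" using g(3)[of x] by simp
      then have "(\<lambda>n. clamp R (g n x)) \<longlonglongrightarrow> clamp R (h x)"
        by (rule continuous_on_tendsto_compose[OF clc]) auto
      moreover have "clamp R (h x) = h x" unfolding h_def clamp_def by auto
      ultimately have "(\<lambda>n. (h x - clamp R (g n x))\<^sup>2) \<longlonglongrightarrow> (h x - h x)\<^sup>2" by (intro tendsto_intros) auto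
      then show ?case by simp
    qed
    have "\<bar>h x - clamp R (g n x)\<bar> \<le> \<bar>2 * R\<bar>" for x n
      using cl[OF R0, of "k x"] cl[OF R0, of "g n x"] unfolding h_def by linarith
    then show "AE x in lborel_interval. norm ((h x - clamp R (g n x))\<^sup>2) \<le> (2 * R)\<^sup>2" for n
      unfolding abs_le_square_iff by auto
    show "(\<lambda>x. (h x - clamp R (g n x))\<^sup>2) \<in> borel_measurable lborel_interval" for n
      using hm gm by measurable
  qed auto
  then have "\<forall>\<^sub>F n in sequentially. (\<integral>x. (h x - clamp R (g n x))\<^sup>2 \<partial>lborel_interval) < (\<epsilon> / 3)\<^sup>2"
    by (intro order_tendstoD) (use \<open>\<epsilon> > 0\<close> in auto)
  then obtain n' where n': "(\<integral>x. (h x - clamp R (g n' x))\<^sup>2 \<partial>lborel_interval) < (\<epsilon> / 3)\<^sup>2"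
    by (auto simp: eventually_sequentially)
  define G where "G x = clamp R (g n' x)" for x
  have "continuous_on {-1..1} G"
    unfolding G_def by (rule continuous_on_subset[OF continuous_on_compose2[OF clc g(2)]]) auto
  then obtain p where p: "real_polynomial_function p" "\<And>x. x \<in> {-1..1} \<Longrightarrow> \<bar>G x - p x\<bar> < \<epsilon> / 6"
    using Stone_Weierstrass_real_polynomial_function[of "{-1..1}" G "\<epsilon> / 6"] \<open>\<epsilon> > 0\<close> by auto
  obtain a d where ad: "p = (\<lambda>x. \<Sum>i\<le>d. a i * x ^ i)" using p(1) real_polynomial_function_iff_sum by blast
  define q where "q = (\<Sum>i\<le>d. monom (a i) i)"
  have q: "poly q x = p x" for x unfolding q_def ad by (simp add: poly_sum poly_monom)
  have sqk: "square_integrable lborel_interval h" "square_integrable lborel_interval G"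
    by (rule bounded_square_integrable_interval[where B = R];
        use hm gm cl[OF R0] in \<open>auto simp: h_def G_def[abs_def]\<close>)+
  note sqq = poly_square_integrable[of q]
  have 3: "(\<integral>x. (G x - poly q x)\<^sup>2 \<partial>lborel_interval) < (\<epsilon> / 3)\<^sup>2"
  proof -
    have "(\<integral>x. (G x - poly q x)\<^sup>2 \<partial>lborel_interval) \<le> (\<integral>x. (\<epsilon> / 6)\<^sup>2 \<partial>lborel_interval)"
    proof (rule integral_mono)
      show "integrable lborel_interval (\<lambda>x. (G x - poly q x)\<^sup>2)"
        using square_integrable_diff[OF sqk(2) sqq] by (simp add: square_integrable_def)
      fix x assume "x \<in> space lborel_interval"
      then have "\<bar>G x - poly q x\<bar> \<le> \<bar>\<epsilon> / 6\<bar>" using p(2)[of x] \<open>\<epsilon> > 0\<close> unfolding q by simp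
      then show "(G x - poly q x)\<^sup>2 \<le> (\<epsilon> / 6)\<^sup>2" unfolding abs_le_square_iff .
    qed simp
    also have "\<dots> = 2 * (\<epsilon> / 6)\<^sup>2" by (simp add: integral_lborel_interval)
    also have "\<dots> < (\<epsilon> / 3)\<^sup>2" using \<open>\<epsilon> > 0\<close> by (simp add: power_divide)
    finally show ?thesis .
  qed
  have lt: "sqrt y < \<epsilon> / 3" if "y < (\<epsilon> / 3)\<^sup>2" for y
    using real_sqrt_less_mono[OF that] \<open>\<epsilon> > 0\<close> by simp
  have "sqrt (\<integral>x. ((k x - h x) + (h x - poly q x))\<^sup>2 \<partial>lborel_interval)
      \<le> sqrt (\<integral>x. (k x - h x)\<^sup>2 \<partial>lborel_interval) + sqrt (\<integral>x. (h x - poly q x)\<^sup>2 \<partial>lborel_interval)"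
    by (intro minkowski_L2 square_integrable_diff k sqk sqq)
  also have "sqrt (\<integral>x. (h x - poly q x)\<^sup>2 \<partial>lborel_interval) = sqrt (\<integral>x. ((h x - G x) + (G x - poly q x))\<^sup>2 \<partial>lborel_interval)" by simp
  also have "\<dots> \<le> sqrt (\<integral>x. (h x - G x)\<^sup>2 \<partial>lborel_interval) + sqrt (\<integral>x. (G x - poly q x)\<^sup>2 \<partial>lborel_interval)"
    by (intro minkowski_L2 square_integrable_diff k sqk sqq)
  finally have "sqrt (\<integral>x. (k x - poly q x)\<^sup>2 \<partial>lborel_interval) \<le> sqrt (\<integral>x. (k x - h x)\<^sup>2 \<partial>lborel_interval)
     + (sqrt (\<integral>x. (h x - G x)\<^sup>2 \<partial>lborel_interval) + sqrt (\<integral>x. (G x - poly q x)\<^sup>2 \<partial>lborel_interval))" by simp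
  also have "\<dots> < \<epsilon> / 3 + (\<epsilon> / 3 + \<epsilon> / 3)"
    by (intro add_strict_mono lt 3 n'[folded G_def] n[folded R_def, folded h_def])
  finally show ?thesis by (intro exI[of _ q]) simp
qed

section \<open>The Funk--Hecke formula and Legendre series\<close>

lemma bounded_square_integrable_S2:
  assumes "g \<in> borel_measurable S2_measure" "\<forall>x\<in>S2. \<bar>g x\<bar> \<le> B" shows "square_integrable S2_measure g"
  unfolding square_integrable_def power2_eq_square
proof
  show "integrable S2_measure (\<lambda>x. g x * g x)"
  proof (rule S2_integrable_bounded[where B = "B * B"])
    show "(\<lambda>x. g x * g x) \<in> borel_measurable S2_measure" using assms(1) by measurable
    show "\<bar>g z * g z\<bar> \<le> B * B" if "z \<in> S2" for z by (rule bounded_mult_S2[OF assms(2,2) that])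
  qed
qed (rule assms)

text \<open>The range of the projection with kernel \<open>legendre_kernel l\<close>, that is, the spherical harmonics of degree \<open>l\<close>.\<close>

definition harmonic :: "nat \<Rightarrow> (real^3 \<Rightarrow> real) \<Rightarrow> bool" where
  "harmonic l e \<longleftrightarrow> e \<in> borel_measurable S2_measure \<and> (\<exists>B. \<forall>z\<in>S2. \<bar>e z\<bar> \<le> B) \<and>
     (\<forall>x\<in>S2. (\<integral>z. legendre_kernel l x z * e z \<partial>S2_measure) = e x)"

lemma funk_hecke_poly_harmonic:
  assumes e: "harmonic l e" and x: "x \<in> S2"
  shows "(\<integral>z. poly q (x \<bullet> z) * e z \<partial>S2_measure) = 2 * pi * poly_integral (q * legendre l) * e x"
proof -
  obtain B where B: "\<forall>z\<in>S2. \<bar>e z\<bar> \<le> B" and [measurable]: "e \<in> borel_measurable S2_measure"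
    and rep: "\<And>x. x \<in> S2 \<Longrightarrow> (\<integral>z. legendre_kernel l x z * e z \<partial>S2_measure) = e x"
    using e unfolding harmonic_def by blast
  obtain A where A: "\<forall>x\<in>S2. \<forall>y\<in>S2. \<bar>poly q (x \<bullet> y)\<bar> \<le> A" using poly_inner_bounded by blast
  obtain C where C: "\<forall>x\<in>S2. \<forall>y\<in>S2. \<bar>legendre_kernel l x y\<bar> \<le> C"
    using poly_inner_bounded unfolding legendre_kernel_poly by blast
  have km: "(\<lambda>(x, y). legendre_kernel l x y) \<in> borel_measurable (S2_measure \<Otimes>\<^sub>M S2_measure)"
    using legendre_kernel_projection unfolding projection_kernel_def by blast
  let ?c = "2 * pi * poly_integral (q * legendre l)"
  have "(\<integral>z. poly q (x \<bullet> z) * e z \<partial>S2_measure)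
      = (\<integral>z. (\<integral>w. poly q (x \<bullet> z) * (legendre_kernel l z w * e w) \<partial>S2_measure) \<partial>S2_measure)"
    using rep by (intro Bochner_Integration.integral_cong refl) simp
  also have "\<dots> = (\<integral>w. (\<integral>z. poly q (x \<bullet> z) * (legendre_kernel l z w * e w) \<partial>S2_measure) \<partial>S2_measure)"
  proof (rule S2_swap_bounded[where B = "A * (C * B)"])
    have "(\<lambda>v. poly q (x \<bullet> fst v) * ((case v of (x, y) \<Rightarrow> legendre_kernel l x y) * e (snd v))) \<in> borel_measurable (S2_measure \<Otimes>\<^sub>M S2_measure)"
      using km by measurable
    then show "(\<lambda>(z, w). poly q (x \<bullet> z) * (legendre_kernel l z w * e w)) \<in> borel_measurable (S2_measure \<Otimes>\<^sub>M S2_measure)"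
      by (simp add: split_beta)
    fix z w assume zw: "z \<in> S2" "w \<in> S2"
    have "\<bar>poly q (x \<bullet> z)\<bar> \<le> A" "\<bar>legendre_kernel l z w\<bar> \<le> C" "\<bar>e w\<bar> \<le> B" using A B C x zw by blast+
    moreover from this have "0 \<le> B" "0 \<le> C" "0 \<le> A" by linarith+
    ultimately show "\<bar>poly q (x \<bullet> z) * (legendre_kernel l z w * e w)\<bar> \<le> A * (C * B)"
      unfolding abs_mult by (intro mult_mono) auto
  qed
  also have "\<dots> = (\<integral>w. ?c * (legendre_kernel l x w * e w) \<partial>S2_measure)"
  proof (intro Bochner_Integration.integral_cong refl)
    fix w assume "w \<in> space S2_measure"
    then have w: "w \<in> S2" by simp
    let ?a = "(2 * real l + 1) / (4 * pi)"
    have "(\<integral>z. poly q (x \<bullet> z) * (legendre_kernel l z w * e w) \<partial>S2_measure)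
        = (\<integral>z. (?a * e w) * (poly q (x \<bullet> z) * poly (legendre l) (w \<bullet> z)) \<partial>S2_measure)"
      unfolding legendre_kernel_poly by (simp add: inner_commute[of _ w] mult_ac)
    also have "\<dots> = (?a * e w) * (?c * poly (legendre l) (x \<bullet> w))"
      unfolding integral_mult_right_zero funk_hecke_poly[OF x w] ..
    finally show "(\<integral>z. poly q (x \<bullet> z) * (legendre_kernel l z w * e w) \<partial>S2_measure) = ?c * (legendre_kernel l x w * e w)"
      unfolding legendre_kernel_poly by simp
  qed
  also have "\<dots> = ?c * e x" unfolding integral_mult_right_zero rep[OF x] ..
  finally show ?thesis .
qed

text \<open>The eigenvalue of the operator with kernel \<open>k\<close> on harmonics of degree \<open>l\<close>, by \<open>funk_hecke\<close>.\<close>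

definition legendre_coeff :: "(real \<Rightarrow> real) \<Rightarrow> nat \<Rightarrow> real" where
  "legendre_coeff k l = 2 * pi * (\<integral>t. k t * poly (legendre l) t \<partial>lborel_interval)"

text \<open>Both sides are continuous in \<open>k\<close> with respect to the norm of \<open>L\<^sup>2\<close>, so the formula extends from polynomials.\<close>

lemma funk_hecke:
  assumes k: "square_integrable lborel_interval k" and e: "harmonic l e" and x: "x \<in> S2"
  shows "(\<integral>z. k (x \<bullet> z) * e z \<partial>S2_measure) = legendre_coeff k l * e x"
proof -
  obtain B where em: "e \<in> borel_measurable S2_measure" and B: "\<forall>z\<in>S2. \<bar>e z\<bar> \<le> B"
    using e unfolding harmonic_def by blast
  define D where "D = \<bar>(\<integral>z. k (x \<bullet> z) * e z \<partial>S2_measure) - legendre_coeff k l * e x\<bar>"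
  define P where "P = sqrt (\<integral>t. (poly (legendre l) t)\<^sup>2 \<partial>lborel_interval)"
  define C where "C = sqrt (2 * pi) * sqrt (\<integral>z. (e z)\<^sup>2 \<partial>S2_measure) + 2 * pi * P * \<bar>e x\<bar>"
  have C0: "0 \<le> C" unfolding C_def P_def by (intro add_nonneg_nonneg mult_nonneg_nonneg) auto
  have bd: "D \<le> C * sqrt (\<integral>t. (k t - poly q t)\<^sup>2 \<partial>lborel_interval)" for q
  proof -
    have sq: "square_integrable lborel_interval (\<lambda>t. k t - poly q t)"
      by (intro square_integrable_diff k poly_square_integrable)
    note sqe = bounded_square_integrable_S2[OF em B] and zon = zonal_square_integrable[OF x]
    have cs: "\<bar>\<integral>z. (k (x \<bullet> z) - poly q (x \<bullet> z)) * e z \<partial>S2_measure\<bar>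
        \<le> sqrt (2 * pi * (\<integral>t. (k t - poly q t)\<^sup>2 \<partial>lborel_interval)) * sqrt (\<integral>z. (e z)\<^sup>2 \<partial>S2_measure)"
      using cauchy_schwarz_L2_abs[OF zon(1)[OF sq] sqe] unfolding zon(2)[OF sq] .
    have "(\<integral>z. (k (x \<bullet> z) - poly q (x \<bullet> z)) * e z \<partial>S2_measure)
        = (\<integral>z. k (x \<bullet> z) * e z \<partial>S2_measure) - (\<integral>z. poly q (x \<bullet> z) * e z \<partial>S2_measure)"
      unfolding left_diff_distrib
      by (intro Bochner_Integration.integral_diff square_integrable_mult zon(1) k poly_square_integrable sqe)
    then have 1: "(\<integral>z. k (x \<bullet> z) * e z \<partial>S2_measure) = (\<integral>z. (k (x \<bullet> z) - poly q (x \<bullet> z)) * e z \<partial>S2_measure)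
        + 2 * pi * poly_integral (q * legendre l) * e x"
      unfolding funk_hecke_poly_harmonic[OF e x] by simp
    have e1: "(\<integral>t. (k t - poly q t) * poly (legendre l) t \<partial>lborel_interval)
        = (\<integral>t. k t * poly (legendre l) t \<partial>lborel_interval) - poly_integral (q * legendre l)"
      unfolding left_diff_distrib poly_integral_eq poly_mult
      by (intro Bochner_Integration.integral_diff square_integrable_mult k poly_square_integrable)
    have 2: "legendre_coeff k l = 2 * pi * (\<integral>t. (k t - poly q t) * poly (legendre l) t \<partial>lborel_interval) + 2 * pi * poly_integral (q * legendre l)"
      unfolding legendre_coeff_def e1 by (simp add: right_diff_distrib)
    have cs2: "\<bar>\<integral>t. (k t - poly q t) * poly (legendre l) t \<partial>lborel_interval\<bar>
        \<le> sqrt (\<integral>t. (k t - poly q t)\<^sup>2 \<partial>lborel_interval) * P"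
      unfolding P_def by (rule cauchy_schwarz_L2_abs[OF sq poly_square_integrable])
    let ?I = "\<integral>z. (k (x \<bullet> z) - poly q (x \<bullet> z)) * e z \<partial>S2_measure"
    let ?J = "\<integral>t. (k t - poly q t) * poly (legendre l) t \<partial>lborel_interval"
    have "D = \<bar>?I - 2 * pi * ?J * e x\<bar>" unfolding D_def 1 2 by (simp add: algebra_simps)
    also have "\<dots> \<le> \<bar>?I\<bar> + 2 * pi * \<bar>?J\<bar> * \<bar>e x\<bar>"
      using abs_triangle_ineq4[of ?I "2 * pi * ?J * e x"] by (simp add: abs_mult)
    also have "\<dots> \<le> sqrt (2 * pi * (\<integral>t. (k t - poly q t)\<^sup>2 \<partial>lborel_interval)) * sqrt (\<integral>z. (e z)\<^sup>2 \<partial>S2_measure)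
        + 2 * pi * (sqrt (\<integral>t. (k t - poly q t)\<^sup>2 \<partial>lborel_interval) * P) * \<bar>e x\<bar>"
      by (intro add_mono cs mult_right_mono mult_left_mono cs2) auto
    also have "\<dots> = C * sqrt (\<integral>t. (k t - poly q t)\<^sup>2 \<partial>lborel_interval)"
      unfolding C_def by (simp add: real_sqrt_mult algebra_simps)
    finally show ?thesis .
  qed
  have "D \<le> 0"
  proof (rule field_le_epsilon)
    fix \<epsilon> :: real assume "\<epsilon> > 0"
    then obtain q where q: "sqrt (\<integral>t. (k t - poly q t)\<^sup>2 \<partial>lborel_interval) < \<epsilon> / (C + 1)"
      using polynomials_dense_L2[OF k, of "\<epsilon> / (C + 1)"] C0 by auto
    have "D \<le> C * (\<epsilon> / (C + 1))" using bd[of q] mult_left_mono[OF less_imp_le[OF q] C0] by linarith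
    also have "\<dots> \<le> \<epsilon>" using C0 \<open>\<epsilon> > 0\<close> by (simp add: field_simps)
    finally show "D \<le> 0 + \<epsilon>" by simp
  qed
  then show ?thesis unfolding D_def by simp
qed

lemma harmonic_legendre_kernel:
  assumes "y \<in> S2" shows "harmonic l (\<lambda>z. legendre_kernel l z y)"
proof -
  have "(\<lambda>z. legendre_kernel l z y) = (\<lambda>z. poly (smult ((2 * real l + 1) / (4 * pi)) (legendre l)) (y \<bullet> z))"
    unfolding legendre_kernel_poly by (simp add: inner_commute)
  then have "(\<lambda>z. legendre_kernel l z y) \<in> borel_measurable S2_measure" by simp
  moreover have "\<exists>B. \<forall>z\<in>S2. \<bar>legendre_kernel l z y\<bar> \<le> B"
    using poly_inner_bounded[of "smult ((2 * real l + 1) / (4 * pi)) (legendre l)"] assms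
    unfolding legendre_kernel_poly by blast
  moreover have "(\<integral>z. legendre_kernel l x z * legendre_kernel l z y \<partial>S2_measure) = legendre_kernel l x y" if "x \<in> S2" for x
    using legendre_kernel_reproducing[OF that assms, of l l] by simp
  ultimately show ?thesis unfolding harmonic_def by blast
qed

text \<open>Cauchy--Schwarz in the reproducing property; the diagonal value is \<open>(2 l + 1) / (4 \<pi>)\<close>.\<close>

lemma legendre_kernel_bound:
  assumes x: "x \<in> S2" "y \<in> S2" shows "\<bar>legendre_kernel l x y\<bar> \<le> (2 * real l + 1) / (4 * pi)"
proof -
  have diag: "legendre_kernel l x x = (2 * real l + 1) / (4 * pi)" if "x \<in> S2" for x
    using that by (simp add: legendre_kernel_def legendre_term_def dot_square_norm legendre_at_1)
  have sq: "square_integrable S2_measure (\<lambda>z. legendre_kernel l x z)" if "x \<in> S2" for x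
    unfolding legendre_kernel_poly by (rule zonal_square_integrable(1)[OF that poly_square_integrable])
  have "legendre_kernel l x y = (\<integral>z. legendre_kernel l x z * legendre_kernel l y z \<partial>S2_measure)"
    using legendre_kernel_reproducing[OF x, of l l] by (simp add: legendre_kernel_commute[of l _ y])
  then have "\<bar>legendre_kernel l x y\<bar> \<le> sqrt (\<integral>z. (legendre_kernel l x z)\<^sup>2 \<partial>S2_measure) * sqrt (\<integral>z. (legendre_kernel l y z)\<^sup>2 \<partial>S2_measure)"
    using cauchy_schwarz_L2_abs[OF sq[OF x(1)] sq[OF x(2)]] by simp
  also have "\<dots> = sqrt ((2 * real l + 1) / (4 * pi)) * sqrt ((2 * real l + 1) / (4 * pi))"
    using projection_kernel_diag_nonneg[OF legendre_kernel_projection[of l]] x diag by metis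
  also have "\<dots> = (2 * real l + 1) / (4 * pi)" by simp
  finally show ?thesis .
qed

text \<open>Every \<open>z\<close> in the interval is the inner product of two points of the sphere.\<close>

lemma legendre_term_bound:
  assumes "z \<in> {-1..1}" shows "\<bar>legendre_term l z\<bar> \<le> (2 * real l + 1) / (4 * pi)"
proof -
  define y :: "real^3" where "y = z *\<^sub>R axis 1 1 + sqrt (1 - z\<^sup>2) *\<^sub>R axis 2 1"
  have z2: "z\<^sup>2 \<le> 1" using assms abs_le_square_iff[of z 1] by auto
  have "y \<bullet> y = z * z + sqrt (1 - z\<^sup>2) * sqrt (1 - z\<^sup>2)"
    unfolding y_def by (simp add: inner_add_left inner_add_right inner_axis_axis)
  also have "\<dots> = 1" using z2 by (simp add: power2_eq_square)
  finally have "norm y = 1" by (simp add: norm_eq_1)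
  moreover have "axis 1 1 \<bullet> y = z" unfolding y_def by (simp add: inner_add_right inner_axis_axis)
  ultimately show ?thesis
    using legendre_kernel_bound[of "axis 1 1" y l] by (simp add: legendre_kernel_def)
qed

lemma kernel_with_eigenvalues_square_integrable:
  assumes "kernel_with_eigenvalues k \<phi>" shows "square_integrable lborel_interval k"
proof -
  have "k \<in> borel_measurable lborel_interval"
    using assms unfolding kernel_with_eigenvalues_def set_borel_measurable_def lborel_interval_def
    by (subst borel_measurable_restrict_space_iff) auto
  moreover have "integrable lborel_interval (\<lambda>x. (k x)\<^sup>2)"
    using assms unfolding kernel_with_eigenvalues_def set_integrable_def lborel_interval_def
    by (subst integrable_restrict_space) auto
  ultimately show ?thesis unfolding square_integrable_def by simp
qed

text \<open>The harmonic of order \<open>m = 0\<close> is the Legendre kernel centred at the north pole, up to a factor, so one eigenfunction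
suffices to identify the eigenvalue.\<close>

lemma eigenvalue_legendre_coeff:
  assumes k: "kernel_with_eigenvalues k \<phi>" shows "\<phi> l = legendre_coeff k l"
proof -
  define n :: "real^3" where "n = axis 3 1"
  have n: "n \<in> S2" unfolding n_def by simp
  define c where "c = sqrt ((2 * real l + 1) / (4 * pi)) * (4 * pi / (2 * real l + 1))"
  have sh: "sph_harm l 0 x = c * legendre_kernel l x n" for x
  proof -
    have "x $ 3 = x \<bullet> n" unfolding n_def by (simp add: inner_axis)
    moreover have "(4 * pi / (2 * real l + 1)) * ((2 * real l + 1) / (4 * pi)) = 1" by (simp add: add_nonneg_eq_0_iff)
    then have "c * ((2 * real l + 1) / (4 * pi)) = sqrt ((2 * real l + 1) / (4 * pi))" unfolding c_def by (simp only: mult.assoc mult_1_right)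
    ultimately show ?thesis
      unfolding sph_harm_def legendre_kernel_def legendre_term_def mult.assoc[symmetric] by simp
  qed
  have c: "c \<noteq> 0" unfolding c_def by (simp add: add_nonneg_eq_0_iff)
  have "AE x in S2_measure. kernel_op k (sph_harm l 0) x = \<phi> l * sph_harm l 0 x"
    using k unfolding kernel_with_eigenvalues_def by simp
  then have ae: "AE x in S2_measure. (\<phi> l - legendre_coeff k l) * legendre_kernel l n x = 0"
    using AE_space
  proof eventually_elim
    case (elim x)
    then have x: "x \<in> S2" by simp
    have "kernel_op k (sph_harm l 0) x = (\<integral>z. c * (k (x \<bullet> z) * legendre_kernel l z n) \<partial>S2_measure)"
      unfolding kernel_op_def sh by (simp add: mult_ac)
    also have "\<dots> = c * (legendre_coeff k l * legendre_kernel l x n)"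
      unfolding integral_mult_right_zero
        funk_hecke[OF kernel_with_eigenvalues_square_integrable[OF k] harmonic_legendre_kernel[OF n] x] ..
    finally have s: "kernel_op k (sph_harm l 0) x = c * (legendre_coeff k l * legendre_kernel l x n)" .
    have "c * (legendre_coeff k l * legendre_kernel l x n) = \<phi> l * (c * legendre_kernel l x n)"
      using elim(1) unfolding s sh .
    then have "c * (legendre_coeff k l * legendre_kernel l x n) = c * (\<phi> l * legendre_kernel l x n)"
      by (simp only: mult.left_commute)
    then have "legendre_coeff k l * legendre_kernel l x n = \<phi> l * legendre_kernel l x n"
      unfolding mult_left_cancel[OF c] .
    then show ?case by (auto simp: legendre_kernel_commute[of l n x] left_diff_distrib)
  qed
  show ?thesis
  proof (rule ccontr)
    assume ne: "\<phi> l \<noteq> legendre_coeff k l"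
    have "legendre_kernel l n n = (\<integral>z. (legendre_kernel l n z)\<^sup>2 \<partial>S2_measure)"
      by (rule projection_kernel_diag_nonneg[OF legendre_kernel_projection n])
    also have "\<dots> = 0"
      by (rule integral_eq_zero_AE) (use ae ne in \<open>auto elim: eventually_mono\<close>)
    finally show False
      using n by (simp add: legendre_kernel_def legendre_term_def dot_square_norm legendre_at_1 add_nonneg_eq_0_iff)
  qed
qed

lemma poly_legendre_expansion: "degree q \<le> n \<Longrightarrow> \<exists>b. \<forall>z. poly q z = (\<Sum>l\<le>n. b l * legendre_term l z)"
proof (induction n arbitrary: q)
  case 0
  have "legendre_term 0 z = 1 / (4 * pi)" for z
    by (simp add: legendre_term_def legendre_def)
  moreover obtain c where "q = [:c:]" using 0 by (metis degree_eq_zeroE le_0_eq)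
  ultimately show ?case by (intro exI[of _ "\<lambda>_. 4 * pi * c"]) simp
next
  case (Suc n)
  have lead: "coeff (legendre (Suc n)) (Suc n) \<noteq> 0" using legendre_nz degree_legendre by (metis leading_coeff_0_iff)
  define c where "c = coeff q (Suc n) / coeff (legendre (Suc n)) (Suc n)"
  define r where "r = q - smult c (legendre (Suc n))"
  have "degree r \<le> n"
  proof -
    have "coeff r (Suc n) = 0" unfolding r_def c_def using lead by simp
    moreover have "degree r \<le> Suc n" unfolding r_def by (intro degree_diff_le Suc.prems) (simp add: degree_legendre)
    ultimately show ?thesis by (metis degree_0 eq_zero_or_degree_less le0 less_Suc_eq_le)
  qed
  then obtain b where b: "\<forall>z. poly r z = (\<Sum>l\<le>n. b l * legendre_term l z)" using Suc.IH by blast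
  define a where "a = (2 * real (Suc n) + 1) / (4 * pi)"
  have a: "a \<noteq> 0" unfolding a_def by (simp add: add_nonneg_eq_0_iff)
  have "poly q z = poly r z + (c / a) * legendre_term (Suc n) z" for z
    unfolding r_def legendre_term_def a_def[symmetric] using a by simp
  then show ?case
    using b by (intro exI[of _ "b(Suc n := c / a)"]) simp
qed

text \<open>The squared norm of \<open>legendre_term l\<close> on the interval.\<close>

definition legendre_weight :: "nat \<Rightarrow> real" where
  "legendre_weight l = (2 * real l + 1) / (8 * pi\<^sup>2)"

lemma legendre_term_inner:
  "(\<integral>t. legendre_term l t * legendre_term l' t \<partial>lborel_interval) = (if l = l' then legendre_weight l else 0)"
proof -
  have "(\<integral>t. legendre_term l t * legendre_term l' t \<partial>lborel_interval)
      = (2 * real l + 1) / (4 * pi) * ((2 * real l' + 1) / (4 * pi)) * poly_integral (legendre l * legendre l')"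
    unfolding poly_integral_eq integral_mult_right_zero[symmetric] legendre_term_def by (simp add: mult_ac)
  also have "\<dots> = (if l = l' then legendre_weight l else 0)"
  proof -
    have "n / (4 * pi) * (n / (4 * pi)) * (2 / n) = n / (8 * pi\<^sup>2)" if "n > 0" for n :: real
      using that by (simp add: field_simps power2_eq_square)
    from this[of "2 * real l + 1"] show ?thesis
      using legendre_orthogonal[of l l'] by (auto simp: legendre_norm legendre_weight_def simp del: times_divide_eq_left times_divide_eq_right)
  qed
  finally show ?thesis .
qed

lemma legendre_term_square_integrable: "square_integrable lborel_interval (legendre_term l)"
  using square_integrable_cmult[OF poly_square_integrable[of "legendre l"], of "(2 * real l + 1) / (4 * pi)"]
  by (simp add: legendre_term_def[abs_def])

lemma legendre_term_coeff: "(\<integral>t. k t * legendre_term l t \<partial>lborel_interval) = legendre_weight l * legendre_coeff k l"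
proof -
  have "(\<integral>t. k t * legendre_term l t \<partial>lborel_interval) = (\<integral>t. (2 * real l + 1) / (4 * pi) * (k t * poly (legendre l) t) \<partial>lborel_interval)"
    by (simp add: legendre_term_def mult_ac)
  also have "\<dots> = legendre_weight l * legendre_coeff k l"
    unfolding integral_mult_right_zero legendre_weight_def legendre_coeff_def by (simp add: power2_eq_square)
  finally show ?thesis .
qed

lemma legendre_pythagoras:
  assumes k: "square_integrable lborel_interval k"
  shows "(\<integral>t. (k t - (\<Sum>l\<le>L. c l * legendre_term l t))\<^sup>2 \<partial>lborel_interval)
    = (\<Sum>l\<le>L. legendre_weight l * (c l - legendre_coeff k l)\<^sup>2)
      + ((\<integral>t. (k t)\<^sup>2 \<partial>lborel_interval) - (\<Sum>l\<le>L. legendre_weight l * (legendre_coeff k l)\<^sup>2))"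
proof -
  note lt = legendre_term_square_integrable
  have i1: "integrable lborel_interval (\<lambda>t. c l * (k t * legendre_term l t))" for l
    by (intro integrable_mult_right square_integrable_mult k lt)
  have i2: "integrable lborel_interval (\<lambda>t. c l * c l' * (legendre_term l t * legendre_term l' t))" for l l'
    by (intro integrable_mult_right square_integrable_mult lt)
  have "(\<integral>t. (k t - (\<Sum>l\<le>L. c l * legendre_term l t))\<^sup>2 \<partial>lborel_interval)
    = (\<integral>t. (k t)\<^sup>2 - 2 * (\<Sum>l\<le>L. c l * (k t * legendre_term l t))
        + (\<Sum>l\<le>L. \<Sum>l'\<le>L. c l * c l' * (legendre_term l t * legendre_term l' t)) \<partial>lborel_interval)"
  proof (intro Bochner_Integration.integral_cong refl)
    fix t
    have "(\<Sum>l\<le>L. c l * legendre_term l t)\<^sup>2 = (\<Sum>l\<le>L. \<Sum>l'\<le>L. c l * c l' * (legendre_term l t * legendre_term l' t))"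
      unfolding power2_eq_square sum_product by (intro sum.cong refl) (simp only: mult_ac)
    moreover have "k t * (\<Sum>l\<le>L. c l * legendre_term l t) = (\<Sum>l\<le>L. c l * (k t * legendre_term l t))"
      unfolding sum_distrib_left by (intro sum.cong refl) (simp only: mult_ac)
    ultimately show "(k t - (\<Sum>l\<le>L. c l * legendre_term l t))\<^sup>2 = (k t)\<^sup>2 - 2 * (\<Sum>l\<le>L. c l * (k t * legendre_term l t))
        + (\<Sum>l\<le>L. \<Sum>l'\<le>L. c l * c l' * (legendre_term l t * legendre_term l' t))"
      by (simp add: power2_diff)
  qed
  also have "\<dots> = (\<integral>t. (k t)\<^sup>2 \<partial>lborel_interval) - 2 * (\<Sum>l\<le>L. c l * (\<integral>t. k t * legendre_term l t \<partial>lborel_interval))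
      + (\<Sum>l\<le>L. \<Sum>l'\<le>L. c l * c l' * (\<integral>t. legendre_term l t * legendre_term l' t \<partial>lborel_interval))"
    using k i1 i2 unfolding square_integrable_def
    by (subst Bochner_Integration.integral_add; (subst Bochner_Integration.integral_diff)?) (auto simp: Bochner_Integration.integral_sum)
  also have "(\<Sum>l\<le>L. \<Sum>l'\<le>L. c l * c l' * (\<integral>t. legendre_term l t * legendre_term l' t \<partial>lborel_interval))
      = (\<Sum>l\<le>L. legendre_weight l * (c l)\<^sup>2)"
    unfolding legendre_term_inner by (intro sum.cong refl) (simp add: if_distrib power2_eq_square cong: if_cong)
  also have "(\<integral>t. (k t)\<^sup>2 \<partial>lborel_interval) - 2 * (\<Sum>l\<le>L. c l * (\<integral>t. k t * legendre_term l t \<partial>lborel_interval)) + (\<Sum>l\<le>L. legendre_weight l * (c l)\<^sup>2)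
      = (\<Sum>l\<le>L. legendre_weight l * (c l - legendre_coeff k l)\<^sup>2)
      + ((\<integral>t. (k t)\<^sup>2 \<partial>lborel_interval) - (\<Sum>l\<le>L. legendre_weight l * (legendre_coeff k l)\<^sup>2))"
    unfolding legendre_term_coeff
    by (simp add: power2_diff algebra_simps sum.distrib sum_subtractf sum_distrib_left)
  finally show ?thesis .
qed

lemma legendre_weight_nonneg: "0 \<le> legendre_weight l"
  unfolding legendre_weight_def by simp

text \<open>By the theorem of Pythagoras the error is the weighted squared error of the coefficients plus the energy of \<open>k\<close> outside the
span. Density of the polynomials identifies the latter with the tail of the series, as in Parseval's identity.\<close>

lemma legendre_truncation_error:
  assumes k: "square_integrable lborel_interval k"
    and tail: "\<And>M. (\<Sum>l\<in>{L<..M}. legendre_weight l * (legendre_coeff k l)\<^sup>2) \<le> \<tau>"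
  shows "(\<integral>t. (k t - (\<Sum>l\<le>L. c l * legendre_term l t))\<^sup>2 \<partial>lborel_interval)
    \<le> (\<Sum>l\<le>L. legendre_weight l * (c l - legendre_coeff k l)\<^sup>2) + \<tau>"
proof -
  define R where "R M = (\<integral>t. (k t)\<^sup>2 \<partial>lborel_interval) - (\<Sum>l\<le>M. legendre_weight l * (legendre_coeff k l)\<^sup>2)" for M
  have "R L \<le> \<tau>"
  proof (rule field_le_epsilon)
    fix \<epsilon> :: real assume e: "\<epsilon> > 0"
    then obtain q where q: "sqrt (\<integral>t. (k t - poly q t)\<^sup>2 \<partial>lborel_interval) < sqrt \<epsilon>"
      using polynomials_dense_L2[OF k, of "sqrt \<epsilon>"] by auto
    define M where "M = max L (degree q)"
    obtain b where b: "\<And>z. poly q z = (\<Sum>l\<le>M. b l * legendre_term l z)"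
      using poly_legendre_expansion[of q M] unfolding M_def by auto
    have "R M \<le> (\<Sum>l\<le>M. legendre_weight l * (b l - legendre_coeff k l)\<^sup>2) + R M"
      using legendre_weight_nonneg by (auto intro!: sum_nonneg)
    also have "\<dots> = (\<integral>t. (k t - poly q t)\<^sup>2 \<partial>lborel_interval)"
      unfolding R_def b legendre_pythagoras[OF k] ..
    also have "\<dots> < \<epsilon>" using q by simp
    finally have "R M \<le> \<epsilon>" by simp
    moreover have "R L = R M + (\<Sum>l\<in>{L<..M}. legendre_weight l * (legendre_coeff k l)\<^sup>2)"
    proof -
      have "{..M} = {..L} \<union> {L<..M}" unfolding M_def by auto
      then have "(\<Sum>l\<le>M. legendre_weight l * (legendre_coeff k l)\<^sup>2) = (\<Sum>l\<le>L. legendre_weight l * (legendre_coeff k l)\<^sup>2)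
          + (\<Sum>l\<in>{L<..M}. legendre_weight l * (legendre_coeff k l)\<^sup>2)"
        by (simp only:) (subst sum.union_disjoint, auto)
      then show ?thesis unfolding R_def by simp
    qed
    ultimately show "R L \<le> \<tau> + \<epsilon>" using tail[of M] by linarith
  qed
  then show ?thesis unfolding legendre_pythagoras[OF k] R_def by simp
qed

section \<open>Mean square closure of a Gaussian space\<close>

lemma gaussian_rv_centered:
  assumes "prob_space M" and g: "gaussian_rv M X" and mean: "(\<integral>\<omega>. X \<omega> \<partial>M) = 0"
  shows "centered_gaussian M X"
proof -
  interpret prob_space M by fact
  have X[measurable]: "X \<in> borel_measurable M" using g by (simp add: gaussian_rv_def)
  obtain \<mu> \<sigma> where ms: "(\<sigma> = 0 \<and> (AE \<omega> in M. X \<omega> = \<mu>)) \<or>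
      (\<sigma> > 0 \<and> distributed M lborel X (\<lambda>x. ennreal (normal_density \<mu> \<sigma> x)))"
    using g unfolding gaussian_rv_def by blast
  show ?thesis
  proof (cases "\<sigma> = 0")
    case True
    then have ae: "AE \<omega> in M. X \<omega> = \<mu>" using ms by auto
    have "(\<integral>\<omega>. X \<omega> \<partial>M) = (\<integral>\<omega>. \<mu> \<partial>M)" by (rule integral_cong_AE) (use ae in auto)
    then have "\<mu> = 0" using mean by (simp add: prob_space)
    then have ae0: "AE \<omega> in M. X \<omega> = 0" using ae by simp
    have i: "integrable M (\<lambda>\<omega>. (X \<omega>)\<^sup>2)"
      by (subst integrable_cong_AE[where g = "\<lambda>_. 0"]) (use ae0 in auto)
    have v: "(\<integral>\<omega>. (X \<omega>)\<^sup>2 \<partial>M) = 0" by (rule integral_eq_zero_AE) (use ae0 in auto)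
    have "(\<integral>\<omega>. iexp (\<theta> * X \<omega>) \<partial>M) = (\<integral>\<omega>. 1 \<partial>M)" for \<theta>
      by (rule integral_cong_AE) (use ae0 in auto)
    then show ?thesis unfolding centered_gaussian_def square_integrable_def v using i by (simp add: prob_space)
  next
    case False
    then have s: "\<sigma> > 0" and d: "distributed M lborel X (\<lambda>x. ennreal (normal_density \<mu> \<sigma> x))" using ms by auto
    have "\<mu> = 0" using normal_distributed_expectation[OF s d] mean by simp
    define Y where "Y \<omega> = X \<omega> / \<sigma>" for \<omega>
    have "distributed M lborel Y (\<lambda>x. ennreal (std_normal_density x))"
      using normal_standard_normal_convert[OF s, of X \<mu>] d \<open>\<mu> = 0\<close> unfolding Y_def by simp
    then have Y: "distr M lborel Y = std_normal_distribution" and Ym[measurable]: "Y \<in> borel_measurable M"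
      unfolding distributed_def by auto
    have XY: "X \<omega> = \<sigma> * Y \<omega>" for \<omega> unfolding Y_def using s by simp
    have "integrable (distr M lborel Y) (\<lambda>x. x ^ (2 * 1))" "(\<integral>x. x ^ (2 * 1) \<partial>distr M lborel Y) = fact (2 * 1) / (2 ^ 1 * fact 1)"
      unfolding Y by (rule std_normal_distribution_even_moments)+
    then have Y2: "integrable M (\<lambda>\<omega>. (Y \<omega>)\<^sup>2)" "(\<integral>\<omega>. (Y \<omega>)\<^sup>2 \<partial>M) = 1"
      by (simp_all add: integrable_distr_eq integral_distr)
    have "(\<integral>\<omega>. iexp (\<theta> * X \<omega>) \<partial>M) = complex_of_real (exp (- (\<theta>\<^sup>2 * (\<integral>\<omega>. (X \<omega>)\<^sup>2 \<partial>M)) / 2))" for \<theta>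
    proof -
      have "(\<integral>\<omega>. iexp (\<theta> * X \<omega>) \<partial>M) = (\<integral>x. iexp (\<theta> * \<sigma> * x) \<partial>distr M lborel Y)"
        by (subst integral_distr) (auto simp: XY mult.assoc)
      also have "\<dots> = char std_normal_distribution (\<theta> * \<sigma>)" unfolding Y char_def ..
      also have "\<dots> = complex_of_real (exp (- (\<theta>\<^sup>2 * \<sigma>\<^sup>2) / 2))"
        unfolding char_std_normal_distribution by (simp add: power_mult_distrib)
      also have "\<sigma>\<^sup>2 = (\<integral>\<omega>. (X \<omega>)\<^sup>2 \<partial>M)" unfolding XY power_mult_distrib using Y2 by simp
      finally show ?thesis .
    qed
    moreover have "integrable M (\<lambda>\<omega>. (X \<omega>)\<^sup>2)" unfolding XY power_mult_distrib using Y2 by simp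
    ultimately show ?thesis unfolding centered_gaussian_def square_integrable_def by auto
  qed
qed

definition L2_closure :: "'a measure \<Rightarrow> ('a \<Rightarrow> real) set \<Rightarrow> ('a \<Rightarrow> real) set" where
  "L2_closure M H = {X. square_integrable M X \<and>
     (\<exists>Y. (\<forall>n. Y n \<in> H) \<and> (\<lambda>n. \<integral>\<omega>. (X \<omega> - Y n \<omega>)\<^sup>2 \<partial>M) \<longlonglongrightarrow> 0)}"

lemma integral_power2_nonneg: "0 \<le> (\<integral>x. (f x :: real)\<^sup>2 \<partial>M)" by simp

lemma L2_convergence_add:
  assumes X: "square_integrable M X" "\<And>n. square_integrable M (Y n)" "(\<lambda>n. \<integral>\<omega>. (X \<omega> - Y n \<omega>)\<^sup>2 \<partial>M) \<longlonglongrightarrow> 0"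
    and X': "square_integrable M X'" "\<And>n. square_integrable M (Y' n)" "(\<lambda>n. \<integral>\<omega>. (X' \<omega> - Y' n \<omega>)\<^sup>2 \<partial>M) \<longlonglongrightarrow> 0"
  shows "(\<lambda>n. \<integral>\<omega>. ((X \<omega> + c * X' \<omega>) - (Y n \<omega> + c * Y' n \<omega>))\<^sup>2 \<partial>M) \<longlonglongrightarrow> 0"
proof -
  let ?u = "\<lambda>n. sqrt (\<integral>\<omega>. (X \<omega> - Y n \<omega>)\<^sup>2 \<partial>M)" and ?v = "\<lambda>n. sqrt (\<integral>\<omega>. (X' \<omega> - Y' n \<omega>)\<^sup>2 \<partial>M)"
  have uv: "?u \<longlonglongrightarrow> 0" "?v \<longlonglongrightarrow> 0" using tendsto_real_sqrt[OF X(3)] tendsto_real_sqrt[OF X'(3)] by simp_all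
  have le: "sqrt (\<integral>\<omega>. ((X \<omega> + c * X' \<omega>) - (Y n \<omega> + c * Y' n \<omega>))\<^sup>2 \<partial>M) \<le> ?u n + \<bar>c\<bar> * ?v n" for n
  proof -
    have "sqrt (\<integral>\<omega>. ((X \<omega> - Y n \<omega>) + c * (X' \<omega> - Y' n \<omega>))\<^sup>2 \<partial>M)
        \<le> ?u n + sqrt (\<integral>\<omega>. (c * (X' \<omega> - Y' n \<omega>))\<^sup>2 \<partial>M)"
      by (intro minkowski_L2 square_integrable_diff square_integrable_cmult X X')
    also have "sqrt (\<integral>\<omega>. (c * (X' \<omega> - Y' n \<omega>))\<^sup>2 \<partial>M) = \<bar>c\<bar> * ?v n"
      by (simp add: power_mult_distrib real_sqrt_mult)
    finally show ?thesis by (simp add: algebra_simps)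
  qed
  have lim: "(\<lambda>n. ?u n + \<bar>c\<bar> * ?v n) \<longlonglongrightarrow> 0"
    using tendsto_add[OF uv(1) tendsto_mult_left[OF uv(2), of "\<bar>c\<bar>"]] by simp
  have "(\<lambda>n. sqrt (\<integral>\<omega>. ((X \<omega> + c * X' \<omega>) - (Y n \<omega> + c * Y' n \<omega>))\<^sup>2 \<partial>M)) \<longlonglongrightarrow> 0"
    by (rule tendsto_sandwich[OF _ _ tendsto_const lim]) (use le in auto)
  from tendsto_power[OF this, of 2] show ?thesis by simp
qed

text \<open>Characteristic functions are Lipschitz continuous with respect to the norm of \<open>L\<^sup>2\<close>, and variances are continuous.\<close>

lemma gaussian_space_L2_closure:
  assumes "prob_space M" and G: "gaussian_space M H"
  shows "gaussian_space M (L2_closure M H)"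
  unfolding gaussian_space_def
proof (intro conjI ballI allI)
  interpret prob_space M by fact
  fix X assume "X \<in> L2_closure M H"
  then obtain Y where X: "square_integrable M X" and Y: "\<And>n. Y n \<in> H"
    and lim: "(\<lambda>n. \<integral>\<omega>. (X \<omega> - Y n \<omega>)\<^sup>2 \<partial>M) \<longlonglongrightarrow> 0"
    unfolding L2_closure_def by blast
  have Ys: "square_integrable M (Y n)" for n by (rule gaussian_space_sq[OF G Y])
  have [measurable]: "X \<in> borel_measurable M" "Y n \<in> borel_measurable M" for n
    using X Ys square_integrable_measurable by auto
  define d where "d n = sqrt (\<integral>\<omega>. (X \<omega> - Y n \<omega>)\<^sup>2 \<partial>M)" for n
  have d0: "d \<longlonglongrightarrow> 0" unfolding d_def using tendsto_real_sqrt[OF lim] by simp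
  let ?x = "sqrt (\<integral>\<omega>. (X \<omega>)\<^sup>2 \<partial>M)" and ?y = "\<lambda>n. sqrt (\<integral>\<omega>. (Y n \<omega>)\<^sup>2 \<partial>M)"
  have "\<bar>?y n - ?x\<bar> \<le> d n" for n
  proof -
    have "?x \<le> d n + ?y n"
      using minkowski_L2[OF square_integrable_diff[OF X Ys[of n]] Ys[of n]] unfolding d_def by simp
    moreover have "?y n \<le> d n + ?x"
      using minkowski_L2[OF square_integrable_diff[OF Ys[of n] X] X] unfolding d_def by (simp add: power2_commute)
    ultimately show ?thesis by linarith
  qed
  then have "(\<lambda>n. ?y n - ?x) \<longlonglongrightarrow> 0"
    by (intro tendsto_sandwich[OF _ _ tendsto_minus[OF d0, simplified] d0]) (auto simp: abs_le_iff intro!: always_eventually, smt (verit))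
  from tendsto_power[OF LIM_zero_cancel[OF this], of 2]
  have var: "(\<lambda>n. \<integral>\<omega>. (Y n \<omega>)\<^sup>2 \<partial>M) \<longlonglongrightarrow> (\<integral>\<omega>. (X \<omega>)\<^sup>2 \<partial>M)" by simp
  have "(\<integral>\<omega>. iexp (\<theta> * X \<omega>) \<partial>M) = complex_of_real (exp (- (\<theta>\<^sup>2 * (\<integral>\<omega>. (X \<omega>)\<^sup>2 \<partial>M)) / 2))" for \<theta>
  proof (rule LIMSEQ_unique)
    have "(\<integral>\<omega>. iexp (\<theta> * Y n \<omega>) \<partial>M) = complex_of_real (exp (- (\<theta>\<^sup>2 * (\<integral>\<omega>. (Y n \<omega>)\<^sup>2 \<partial>M)) / 2))" for n
      using G Y unfolding gaussian_space_def centered_gaussian_def by blast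
    then show "(\<lambda>n. \<integral>\<omega>. iexp (\<theta> * Y n \<omega>) \<partial>M) \<longlonglongrightarrow> complex_of_real (exp (- (\<theta>\<^sup>2 * (\<integral>\<omega>. (X \<omega>)\<^sup>2 \<partial>M)) / 2))"
      by (simp only:) (intro tendsto_intros var, simp)
    have int: "integrable M (\<lambda>\<omega>. iexp (\<theta> * Z \<omega>))" if "Z \<in> borel_measurable M" for Z :: "'a \<Rightarrow> real"
      by (rule integrable_const_bound[of _ 1]) (use that in auto)
    have le: "norm ((\<integral>\<omega>. iexp (\<theta> * Y n \<omega>) \<partial>M) - (\<integral>\<omega>. iexp (\<theta> * X \<omega>) \<partial>M)) \<le> \<bar>\<theta>\<bar> * d n" for n
    proof -
      have lip: "norm (iexp a - iexp b) \<le> \<bar>a - b\<bar>" for a b :: real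
      proof -
        have "iexp a - iexp b = iexp b * (iexp (a - b) - 1)" by (simp add: algebra_simps exp_add[symmetric])
        then have "norm (iexp a - iexp b) = norm (iexp (a - b) - 1)" by (simp add: norm_mult)
        also have "\<dots> \<le> \<bar>a - b\<bar>" using iexp_approx1[of "a - b" 0] by simp
        finally show ?thesis .
      qed
      have sqd: "square_integrable M (\<lambda>\<omega>. \<bar>Y n \<omega> - X \<omega>\<bar>)"
        using square_integrable_diff[OF Ys[of n] X] by (auto simp: square_integrable_def)
      have sq1: "square_integrable M (\<lambda>\<omega>. 1)" by (simp add: square_integrable_def)
      have "norm ((\<integral>\<omega>. iexp (\<theta> * Y n \<omega>) \<partial>M) - (\<integral>\<omega>. iexp (\<theta> * X \<omega>) \<partial>M))
          = norm (\<integral>\<omega>. iexp (\<theta> * Y n \<omega>) - iexp (\<theta> * X \<omega>) \<partial>M)"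
        using int by (subst Bochner_Integration.integral_diff) auto
      also have "\<dots> \<le> (\<integral>\<omega>. norm (iexp (\<theta> * Y n \<omega>) - iexp (\<theta> * X \<omega>)) \<partial>M)" by (rule integral_norm_bound)
      also have "\<dots> \<le> (\<integral>\<omega>. \<bar>\<theta>\<bar> * (\<bar>Y n \<omega> - X \<omega>\<bar> * 1) \<partial>M)"
      proof (rule integral_mono')
        show "integrable M (\<lambda>\<omega>. \<bar>\<theta>\<bar> * (\<bar>Y n \<omega> - X \<omega>\<bar> * 1))"
          by (intro integrable_mult_right square_integrable_mult sqd sq1)
        show "norm (iexp (\<theta> * Y n \<omega>) - iexp (\<theta> * X \<omega>)) \<le> \<bar>\<theta>\<bar> * (\<bar>Y n \<omega> - X \<omega>\<bar> * 1)" for \<omega>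
          using lip[of "\<theta> * Y n \<omega>" "\<theta> * X \<omega>"] by (simp add: abs_mult right_diff_distrib[symmetric])
      qed auto
      also have "\<dots> = \<bar>\<theta>\<bar> * (\<integral>\<omega>. \<bar>Y n \<omega> - X \<omega>\<bar> * 1 \<partial>M)" by simp
      also have "\<dots> \<le> \<bar>\<theta>\<bar> * (sqrt (\<integral>\<omega>. \<bar>Y n \<omega> - X \<omega>\<bar>\<^sup>2 \<partial>M) * sqrt (\<integral>\<omega>. 1\<^sup>2 \<partial>M))"
        using cauchy_schwarz_L2_abs[OF sqd sq1] by (intro mult_left_mono) (auto simp: abs_le_iff)
      also have "\<dots> = \<bar>\<theta>\<bar> * d n" unfolding d_def by (simp add: prob_space power2_commute)
      finally show ?thesis .
    qed
    have "(\<lambda>n. (\<integral>\<omega>. iexp (\<theta> * Y n \<omega>) \<partial>M) - (\<integral>\<omega>. iexp (\<theta> * X \<omega>) \<partial>M)) \<longlonglongrightarrow> 0"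
      by (rule Lim_null_comparison[OF always_eventually[OF allI[OF le]]])
         (use tendsto_mult_left[OF d0, of "\<bar>\<theta>\<bar>"] in simp)
    then show "(\<lambda>n. \<integral>\<omega>. iexp (\<theta> * Y n \<omega>) \<partial>M) \<longlonglongrightarrow> (\<integral>\<omega>. iexp (\<theta> * X \<omega>) \<partial>M)" by (rule LIM_zero_cancel)
  qed
  then show "centered_gaussian M X" unfolding centered_gaussian_def using X by blast
next
  fix X X' c assume "X \<in> L2_closure M H" "X' \<in> L2_closure M H"
  then obtain Y Y' where X: "square_integrable M X" "\<And>n. Y n \<in> H" "(\<lambda>n. \<integral>\<omega>. (X \<omega> - Y n \<omega>)\<^sup>2 \<partial>M) \<longlonglongrightarrow> 0"
    and X': "square_integrable M X'" "\<And>n. Y' n \<in> H" "(\<lambda>n. \<integral>\<omega>. (X' \<omega> - Y' n \<omega>)\<^sup>2 \<partial>M) \<longlonglongrightarrow> 0"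
    unfolding L2_closure_def by blast
  have "(\<lambda>n. \<integral>\<omega>. ((X \<omega> + c * X' \<omega>) - (Y n \<omega> + c * Y' n \<omega>))\<^sup>2 \<partial>M) \<longlonglongrightarrow> 0"
    by (rule L2_convergence_add) (use X X' gaussian_space_sq[OF G] in auto)
  moreover have "(\<lambda>\<omega>. Y n \<omega> + c * Y' n \<omega>) \<in> H" for n by (rule gaussian_space_lin[OF G X(2) X'(2)])
  moreover have "square_integrable M (\<lambda>\<omega>. X \<omega> + c * X' \<omega>)"
    by (intro square_integrable_add square_integrable_cmult X X')
  ultimately show "(\<lambda>\<omega>. X \<omega> + c * X' \<omega>) \<in> L2_closure M H"
    unfolding L2_closure_def mem_Collect_eq by (intro conjI exI[of _ "\<lambda>n \<omega>. Y n \<omega> + c * Y' n \<omega>"]) auto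
qed

text \<open>A criterion that avoids approximating \<open>X\<close> explicitly. Choose \<open>Y\<close> in \<open>H\<close> almost at minimal distance. Then \<open>X - Y\<close> is almost
orthogonal to \<open>H\<close>, and by \<open>dual\<close> also almost orthogonal to \<open>X\<close>; so \<open>\<parallel>X - Y\<parallel>\<^sup>2 = \<langle>X - Y, X\<rangle> - \<langle>X - Y, Y\<rangle>\<close> is small.\<close>

lemma L2_closureI:
  assumes G: "gaussian_space M H" "H \<noteq> {}" and X: "square_integrable M X" and K: "0 \<le> K"
    and dual: "\<And>Y \<epsilon>. square_integrable M Y \<Longrightarrow> 0 \<le> \<epsilon> \<Longrightarrow> (\<And>h. h \<in> H \<Longrightarrow> (\<integral>\<omega>. Y \<omega> * h \<omega> \<partial>M)\<^sup>2 \<le> \<epsilon> * (\<integral>\<omega>. (h \<omega>)\<^sup>2 \<partial>M))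
      \<Longrightarrow> (\<integral>\<omega>. Y \<omega> * X \<omega> \<partial>M) \<le> K * sqrt \<epsilon>"
  shows "X \<in> L2_closure M H"
proof -
  let ?D = "\<lambda>Y. \<integral>\<omega>. (X \<omega> - Y \<omega>)\<^sup>2 \<partial>M"
  define d where "d = Inf (?D ` H)"
  have bdd: "bdd_below (?D ` H)" by (rule bdd_belowI2[of _ 0]) simp
  have "\<forall>n. \<exists>Y. Y \<in> H \<and> ?D Y < d + 1 / real (Suc n)"
  proof
    fix n
    have "d < d + 1 / real (Suc n)" by simp
    from cINF_less_iff[OF G(2) bdd, THEN iffD1, OF this[unfolded d_def]]
    show "\<exists>Y. Y \<in> H \<and> ?D Y < d + 1 / real (Suc n)" unfolding d_def Bex_def .
  qed
  from choice[OF this] obtain Y where "\<forall>n. Y n \<in> H \<and> ?D (Y n) < d + 1 / real (Suc n)" by (rule exE)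
  then have Y: "Y n \<in> H" "?D (Y n) < d + 1 / real (Suc n)" for n by (simp_all only:)
  define R where "R = sqrt (\<integral>\<omega>. (X \<omega>)\<^sup>2 \<partial>M) + sqrt (d + 1)"
  have up: "?D (Y n) \<le> (K + R) * sqrt (1 / real (Suc n))" for n
  proof -
    let ?e = "1 / real (Suc n)" and ?Z = "\<lambda>\<omega>. X \<omega> - Y n \<omega>"
    note sY = gaussian_space_sq[OF G(1) Y(1)[of n]]
    have sZ: "square_integrable M ?Z" by (rule square_integrable_diff[OF X sY])
    \<comment> \<open>Near minimality of the distance makes the error nearly orthogonal to the whole space.\<close>
    have orth: "(\<integral>\<omega>. ?Z \<omega> * h \<omega> \<partial>M)\<^sup>2 \<le> ?e * (\<integral>\<omega>. (h \<omega>)\<^sup>2 \<partial>M)" if h: "h \<in> H" for h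
    proof (rule quadratic_discriminant)
      fix s
      have "d \<le> ?D (\<lambda>\<omega>. Y n \<omega> + s * h \<omega>)"
        unfolding d_def by (rule cINF_lower[OF bdd gaussian_space_lin[OF G(1) Y(1) h]])
      also have "\<dots> = ?D (Y n) - 2 * s * (\<integral>\<omega>. ?Z \<omega> * h \<omega> \<partial>M) + s\<^sup>2 * (\<integral>\<omega>. (h \<omega>)\<^sup>2 \<partial>M)"
        unfolding L2_distance_expand[OF sZ gaussian_space_sq[OF G(1) h], symmetric] diff_diff_eq ..
      finally show "0 \<le> ?e - 2 * s * (\<integral>\<omega>. ?Z \<omega> * h \<omega> \<partial>M) + s\<^sup>2 * (\<integral>\<omega>. (h \<omega>)\<^sup>2 \<partial>M)" using Y(2)[of n] by linarith
    qed simp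
    have "?e \<le> 1" by simp
    then have "?D (Y n) \<le> d + 1" using Y(2)[of n] by linarith
    then have "sqrt (?D (Y n)) \<le> sqrt (d + 1)" by (rule real_sqrt_le_mono)
    moreover have "sqrt (\<integral>\<omega>. (Y n \<omega>)\<^sup>2 \<partial>M) \<le> sqrt (\<integral>\<omega>. (X \<omega>)\<^sup>2 \<partial>M) + sqrt (?D (Y n))"
      using minkowski_L2[OF X square_integrable_diff[OF sY X]] by (simp add: power2_commute[of "X _"])
    ultimately have "sqrt (\<integral>\<omega>. (Y n \<omega>)\<^sup>2 \<partial>M) \<le> R" unfolding R_def by linarith
    then have "sqrt ?e * sqrt (\<integral>\<omega>. (Y n \<omega>)\<^sup>2 \<partial>M) \<le> sqrt ?e * R" by (intro mult_left_mono) auto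
    moreover have "\<bar>\<integral>\<omega>. ?Z \<omega> * Y n \<omega> \<partial>M\<bar> \<le> sqrt ?e * sqrt (\<integral>\<omega>. (Y n \<omega>)\<^sup>2 \<partial>M)"
      unfolding real_sqrt_mult[symmetric] using orth[OF Y(1)[of n]] by (intro real_le_rsqrt) simp
    moreover have "?D (Y n) = (\<integral>\<omega>. ?Z \<omega> * X \<omega> \<partial>M) - (\<integral>\<omega>. ?Z \<omega> * Y n \<omega> \<partial>M)"
    proof -
      have "(\<integral>\<omega>. ?Z \<omega> * X \<omega> - ?Z \<omega> * Y n \<omega> \<partial>M) = (\<integral>\<omega>. ?Z \<omega> * X \<omega> \<partial>M) - (\<integral>\<omega>. ?Z \<omega> * Y n \<omega> \<partial>M)"
        by (rule Bochner_Integration.integral_diff[OF square_integrable_mult[OF sZ X] square_integrable_mult[OF sZ sY]])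
      moreover have "?Z \<omega> * X \<omega> - ?Z \<omega> * Y n \<omega> = (?Z \<omega>)\<^sup>2" for \<omega>
        by (simp only: power2_eq_square right_diff_distrib)
      ultimately show ?thesis by simp
    qed
    moreover have "(\<integral>\<omega>. ?Z \<omega> * X \<omega> \<partial>M) \<le> K * sqrt ?e" by (rule dual[OF sZ _ orth]) auto
    ultimately have "?D (Y n) \<le> K * sqrt ?e + sqrt ?e * R" by linarith
    then show ?thesis by (simp only: distrib_right mult.commute)
  qed
  have lim: "(\<lambda>n. (K + R) * sqrt (1 / real (Suc n))) \<longlonglongrightarrow> 0"
    using tendsto_mult_left[OF tendsto_real_sqrt[OF LIMSEQ_Suc[OF lim_1_over_n]], of "K + R"] by simp
  have "(\<lambda>n. ?D (Y n)) \<longlonglongrightarrow> 0"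
    by (rule tendsto_sandwich[OF _ _ tendsto_const lim]) (simp_all only: always_eventually up integral_power2_nonneg simp_thms)
  then show ?thesis unfolding L2_closure_def mem_Collect_eq using X Y(1) by (intro conjI exI[of _ Y]) simp_all
qed

section \<open>Coefficients of random fields\<close>

lemma pair_integrable_section:
  fixes G :: "real^3 \<Rightarrow> 'b \<Rightarrow> real"
  assumes "sigma_finite_measure N" and m: "(\<lambda>(x, y). G x y) \<in> borel_measurable (S2_measure \<Otimes>\<^sub>M N)"
    and nn: "\<And>x y. 0 \<le> G x y"
    and i: "\<And>x. x \<in> S2 \<Longrightarrow> integrable N (G x)" and b: "\<And>x. x \<in> S2 \<Longrightarrow> (\<integral>y. G x y \<partial>N) \<le> B"
  shows "integrable (S2_measure \<Otimes>\<^sub>M N) (\<lambda>(x, y). G x y)"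
proof (rule integrableI_bounded[OF m])
  interpret N: sigma_finite_measure N by fact
  have "(\<integral>\<^sup>+z. ennreal (norm (case z of (x, y) \<Rightarrow> G x y)) \<partial>(S2_measure \<Otimes>\<^sub>M N)) = (\<integral>\<^sup>+x. (\<integral>\<^sup>+y. ennreal (G x y) \<partial>N) \<partial>S2_measure)"
    using m nn by (subst N.nn_integral_fst[symmetric]) (auto simp: split_beta)
  also have "\<dots> \<le> (\<integral>\<^sup>+x. ennreal B \<partial>S2_measure)"
  proof (rule nn_integral_mono)
    fix x assume "x \<in> space S2_measure"
    then have x: "x \<in> S2" by simp
    have "(\<integral>\<^sup>+y. ennreal (G x y) \<partial>N) = ennreal (\<integral>y. G x y \<partial>N)"
      by (rule nn_integral_eq_integral[OF i[OF x]]) (simp add: nn)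
    then show "(\<integral>\<^sup>+y. ennreal (G x y) \<partial>N) \<le> ennreal B" using b[OF x] by (simp add: ennreal_leI)
  qed
  also have "\<dots> = ennreal B * ennreal (4 * pi)" by (simp add: emeasure_S2_total)
  also have "\<dots> < \<infinity>" by (simp add: ennreal_mult_less_top)
  finally show "(\<integral>\<^sup>+z. ennreal (norm (case z of (x, y) \<Rightarrow> G x y)) \<partial>(S2_measure \<Otimes>\<^sub>M N)) < \<infinity>" .
qed

definition L2_field :: "'w measure \<Rightarrow> (real^3 \<Rightarrow> 'w \<Rightarrow> real) \<Rightarrow> bool" where
  "L2_field M F \<longleftrightarrow> (\<lambda>(x, \<omega>). F x \<omega>) \<in> borel_measurable (S2_measure \<Otimes>\<^sub>M M) \<and>
     (\<forall>x\<in>S2. square_integrable M (F x)) \<and> (\<exists>B. \<forall>x\<in>S2. (\<integral>\<omega>. (F x \<omega>)\<^sup>2 \<partial>M) \<le> B)"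

definition field_coeff :: "(real^3 \<Rightarrow> 'w \<Rightarrow> real) \<Rightarrow> (real^3 \<Rightarrow> real) \<Rightarrow> 'w \<Rightarrow> real" where
  "field_coeff F g \<omega> = (\<integral>x. F x \<omega> * g x \<partial>S2_measure)"

locale sphere_prob = prob_space M for M :: "'w measure"
begin

sublocale SM: pair_sigma_finite S2_measure M ..

lemma field_measurable_swap:
  assumes "L2_field M F" shows "(\<lambda>(\<omega>, x). F x \<omega>) \<in> borel_measurable (M \<Otimes>\<^sub>M S2_measure)"
  using measurable_pair_swap[of "\<lambda>(x, \<omega>). F x \<omega>" S2_measure M borel] assms unfolding L2_field_def by simp

lemma field_section_measurable:
  assumes "L2_field M F" "\<omega> \<in> space M" shows "(\<lambda>x. F x \<omega>) \<in> borel_measurable S2_measure"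
  using measurable_Pair1[of "\<lambda>(x, \<omega>). F x \<omega>" S2_measure M borel \<omega>] assms unfolding L2_field_def by simp

lemma field_square_integrable_pair:
  assumes F: "L2_field M F" shows "integrable (S2_measure \<Otimes>\<^sub>M M) (\<lambda>(x, \<omega>). (F x \<omega>)\<^sup>2)"
proof -
  obtain B where B: "\<And>x. x \<in> S2 \<Longrightarrow> (\<integral>\<omega>. (F x \<omega>)\<^sup>2 \<partial>M) \<le> B" using F unfolding L2_field_def by blast
  have "(\<lambda>(x, \<omega>). F x \<omega>) \<in> borel_measurable (S2_measure \<Otimes>\<^sub>M M)" using F unfolding L2_field_def by blast
  then have "(\<lambda>z. ((\<lambda>(x, \<omega>). F x \<omega>) z)\<^sup>2) \<in> borel_measurable (S2_measure \<Otimes>\<^sub>M M)" by measurable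
  then have "(\<lambda>(x, \<omega>). (F x \<omega>)\<^sup>2) \<in> borel_measurable (S2_measure \<Otimes>\<^sub>M M)" by (simp add: split_beta)
  then show ?thesis
    by (rule pair_integrable_section[OF sigma_finite_measure_axioms _ _ _ B]) (use F in \<open>auto simp: L2_field_def square_integrable_def\<close>)
qed

lemma field_path_square_integrable:
  assumes F: "L2_field M F" shows "AE \<omega> in M. square_integrable S2_measure (\<lambda>x. F x \<omega>)"
  using SM.AE_integrable_snd[OF field_square_integrable_pair[OF F]] AE_space
  by eventually_elim (use field_section_measurable[OF F] in \<open>auto simp: square_integrable_def\<close>)

lemma field_energy:
  assumes F: "L2_field M F"
  shows "integrable M (\<lambda>\<omega>. \<integral>x. (F x \<omega>)\<^sup>2 \<partial>S2_measure)"
    and "(\<integral>\<omega>. (\<integral>x. (F x \<omega>)\<^sup>2 \<partial>S2_measure) \<partial>M) = (\<integral>x. (\<integral>\<omega>. (F x \<omega>)\<^sup>2 \<partial>M) \<partial>S2_measure)"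
    and "integrable S2_measure (\<lambda>x. \<integral>\<omega>. (F x \<omega>)\<^sup>2 \<partial>M)"
  using SM.integrable_snd[OF field_square_integrable_pair[OF F]] SM.Fubini_integral[OF field_square_integrable_pair[OF F]]
    SM.integrable_fst[OF field_square_integrable_pair[OF F]] by simp_all

lemma field_coeff_measurable:
  assumes F: "L2_field M F" and g: "g \<in> borel_measurable S2_measure"
  shows "field_coeff F g \<in> borel_measurable M"
proof -
  have "(\<lambda>z. ((\<lambda>(\<omega>, x). F x \<omega>) z) * g (snd z)) \<in> borel_measurable (M \<Otimes>\<^sub>M S2_measure)"
    using field_measurable_swap[OF F] g by measurable
  then have "(\<lambda>(\<omega>, x). F x \<omega> * g x) \<in> borel_measurable (M \<Otimes>\<^sub>M S2_measure)" by (simp add: split_beta)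
  then show ?thesis unfolding field_coeff_def[abs_def] by (rule S2.borel_measurable_lebesgue_integral)
qed

lemma field_coeff_L2:
  assumes F: "L2_field M F" and g: "g \<in> borel_measurable S2_measure" "\<forall>x\<in>S2. \<bar>g x\<bar> \<le> B"
  shows "square_integrable M (field_coeff F g)"
    and "(\<integral>\<omega>. (field_coeff F g \<omega>)\<^sup>2 \<partial>M) \<le> (\<integral>x. (g x)\<^sup>2 \<partial>S2_measure) * (\<integral>x. (\<integral>\<omega>. (F x \<omega>)\<^sup>2 \<partial>M) \<partial>S2_measure)"
proof -
  note sg = bounded_square_integrable_S2[OF g]
  have le: "AE \<omega> in M. (field_coeff F g \<omega>)\<^sup>2 \<le> (\<integral>x. (F x \<omega>)\<^sup>2 \<partial>S2_measure) * (\<integral>x. (g x)\<^sup>2 \<partial>S2_measure)"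
    using field_path_square_integrable[OF F]
    by eventually_elim (unfold field_coeff_def, rule cauchy_schwarz_L2[OF _ sg])
  have int: "integrable M (\<lambda>\<omega>. (\<integral>x. (F x \<omega>)\<^sup>2 \<partial>S2_measure) * (\<integral>x. (g x)\<^sup>2 \<partial>S2_measure))"
    using field_energy(1)[OF F] by simp
  note m = field_coeff_measurable[OF F g(1)]
  show s: "square_integrable M (field_coeff F g)"
    unfolding square_integrable_def
  proof
    show "integrable M (\<lambda>\<omega>. (field_coeff F g \<omega>)\<^sup>2)"
      by (rule Bochner_Integration.integrable_bound[OF int]) (use m le in \<open>auto elim!: eventually_mono intro: order.trans[OF _ abs_ge_self]\<close>)
  qed (rule m)
  have "(\<integral>\<omega>. (field_coeff F g \<omega>)\<^sup>2 \<partial>M) \<le> (\<integral>\<omega>. (\<integral>x. (F x \<omega>)\<^sup>2 \<partial>S2_measure) * (\<integral>x. (g x)\<^sup>2 \<partial>S2_measure) \<partial>M)"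
    by (rule integral_mono_AE) (use s int le in \<open>auto simp: square_integrable_def\<close>)
  also have "\<dots> = (\<integral>x. (g x)\<^sup>2 \<partial>S2_measure) * (\<integral>x. (\<integral>\<omega>. (F x \<omega>)\<^sup>2 \<partial>M) \<partial>S2_measure)"
    unfolding field_energy(2)[OF F, symmetric] by (simp add: mult.commute)
  finally show "(\<integral>\<omega>. (field_coeff F g \<omega>)\<^sup>2 \<partial>M) \<le> (\<integral>x. (g x)\<^sup>2 \<partial>S2_measure) * (\<integral>x. (\<integral>\<omega>. (F x \<omega>)\<^sup>2 \<partial>M) \<partial>S2_measure)" .
qed

text \<open>Fubini's theorem: covariances of coefficients are integrals of covariances of the field.\<close>

lemma field_coeff_inner:
  assumes F: "L2_field M F" and g: "g \<in> borel_measurable S2_measure" "\<forall>x\<in>S2. \<bar>g x\<bar> \<le> B" and X: "square_integrable M X"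
  shows "(\<integral>\<omega>. X \<omega> * field_coeff F g \<omega> \<partial>M) = (\<integral>x. (\<integral>\<omega>. X \<omega> * F x \<omega> \<partial>M) * g x \<partial>S2_measure)"
proof -
  have Xm: "X \<in> borel_measurable M" by (rule square_integrable_measurable[OF X])
  have Fm: "(\<lambda>(x, \<omega>). F x \<omega>) \<in> borel_measurable (S2_measure \<Otimes>\<^sub>M M)" using F unfolding L2_field_def by blast
  have "L2_field M (\<lambda>x. X)"
  proof -
    have "(\<lambda>z. X (snd z)) \<in> borel_measurable (S2_measure \<Otimes>\<^sub>M M)" using Xm by measurable
    then show ?thesis using X unfolding L2_field_def by (auto simp: split_beta)
  qed
  note iX = field_square_integrable_pair[OF this] and iF = field_square_integrable_pair[OF F]
  have int: "integrable (S2_measure \<Otimes>\<^sub>M M) (\<lambda>(x, \<omega>). X \<omega> * F x \<omega> * g x)"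
  proof (rule Bochner_Integration.integrable_bound)
    show "integrable (S2_measure \<Otimes>\<^sub>M M) (\<lambda>z. B * ((\<lambda>(x, \<omega>). (X \<omega>)\<^sup>2) z + (\<lambda>(x, \<omega>). (F x \<omega>)\<^sup>2) z))"
      using iX iF by simp
    have "(\<lambda>z. X (snd z) * ((\<lambda>(x, \<omega>). F x \<omega>) z) * g (fst z)) \<in> borel_measurable (S2_measure \<Otimes>\<^sub>M M)"
      using Xm Fm g(1) by measurable
    then show "(\<lambda>(x, \<omega>). X \<omega> * F x \<omega> * g x) \<in> borel_measurable (S2_measure \<Otimes>\<^sub>M M)" by (simp add: split_beta)
    show "AE z in S2_measure \<Otimes>\<^sub>M M. norm (case z of (x, \<omega>) \<Rightarrow> X \<omega> * F x \<omega> * g x)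
        \<le> norm (B * ((\<lambda>(x, \<omega>). (X \<omega>)\<^sup>2) z + (\<lambda>(x, \<omega>). (F x \<omega>)\<^sup>2) z))"
    proof (rule AE_I2)
      fix z assume "z \<in> space (S2_measure \<Otimes>\<^sub>M M)"
      then obtain x \<omega> where z: "z = (x, \<omega>)" "x \<in> S2" by (auto simp: space_pair_measure)
      have gB: "\<bar>g x\<bar> \<le> B" using g(2) z by auto
      have "\<bar>X \<omega> * F x \<omega>\<bar> \<le> (X \<omega>)\<^sup>2 + (F x \<omega>)\<^sup>2" by (rule abs_mult_le_squares)
      then have "\<bar>X \<omega> * F x \<omega>\<bar> * \<bar>g x\<bar> \<le> ((X \<omega>)\<^sup>2 + (F x \<omega>)\<^sup>2) * B"
        using gB by (intro mult_mono) auto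
      then have "\<bar>X \<omega> * F x \<omega> * g x\<bar> \<le> B * ((X \<omega>)\<^sup>2 + (F x \<omega>)\<^sup>2)" by (simp add: abs_mult mult.commute)
      also have "\<dots> \<le> \<bar>B * ((X \<omega>)\<^sup>2 + (F x \<omega>)\<^sup>2)\<bar>" by (rule abs_ge_self)
      finally show "norm (case z of (x, \<omega>) \<Rightarrow> X \<omega> * F x \<omega> * g x)
        \<le> norm (B * ((\<lambda>(x, \<omega>). (X \<omega>)\<^sup>2) z + (\<lambda>(x, \<omega>). (F x \<omega>)\<^sup>2) z))" by (simp add: z(1))
    qed
  qed
  have "(\<integral>\<omega>. X \<omega> * field_coeff F g \<omega> \<partial>M) = (\<integral>\<omega>. (\<integral>x. X \<omega> * F x \<omega> * g x \<partial>S2_measure) \<partial>M)"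
    unfolding field_coeff_def integral_mult_right_zero[symmetric] by (simp add: mult.assoc)
  also have "\<dots> = (\<integral>x. (\<integral>\<omega>. X \<omega> * F x \<omega> * g x \<partial>M) \<partial>S2_measure)"
    by (rule SM.Fubini_integral[OF int])
  also have "\<dots> = (\<integral>x. (\<integral>\<omega>. X \<omega> * F x \<omega> \<partial>M) * g x \<partial>S2_measure)" by simp
  finally show ?thesis .
qed

end

section \<open>Kernel operators and covariance kernels\<close>

lemma family_law_component:
  fixes h :: "real \<Rightarrow> real"
  assumes X: "\<And>i. i \<in> I \<Longrightarrow> X i \<in> borel_measurable M" and Y: "\<And>i. i \<in> I \<Longrightarrow> Y i \<in> borel_measurable M"
    and law: "family_law M I X = family_law M I Y" and i: "i \<in> I" and h: "h \<in> borel_measurable borel"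
  shows "(\<integral>\<omega>. h (X i \<omega>) \<partial>M) = (\<integral>\<omega>. h (Y i \<omega>) \<partial>M)"
proof -
  have *: "(\<integral>\<omega>. h (W i \<omega>) \<partial>M) = (\<integral>f. h (f i) \<partial>family_law M I W)" if W: "\<And>i. i \<in> I \<Longrightarrow> W i \<in> borel_measurable M" for W
  proof -
    have m: "(\<lambda>\<omega>. \<lambda>i\<in>I. W i \<omega>) \<in> M \<rightarrow>\<^sub>M Pi\<^sub>M I (\<lambda>_. borel)" by (rule measurable_restrict) (rule W)
    have c: "(\<lambda>f. h (f i)) \<in> borel_measurable (Pi\<^sub>M I (\<lambda>_. borel))"
      by (rule measurable_compose[OF measurable_component_singleton[OF i] h])
    show ?thesis unfolding family_law_def integral_distr[OF m c] using i by simp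
  qed
  have "(\<integral>\<omega>. h (X i \<omega>) \<partial>M) = (\<integral>f. h (f i) \<partial>family_law M I X)" by (rule *) (rule X)
  also have "\<dots> = (\<integral>\<omega>. h (Y i \<omega>) \<partial>M)" unfolding law by (rule *[symmetric]) (rule Y)
  finally show ?thesis .
qed

lemma kernel_pair_measurable:
  assumes "k \<in> borel_measurable lborel_interval"
  shows "(\<lambda>(x, y). k (x \<bullet> y)) \<in> borel_measurable (S2_measure \<Otimes>\<^sub>M S2_measure)"
  using measurable_compose[OF measurable_inner_interval_pair assms] by (simp add: split_beta)

lemma kernel_op_measurable:
  assumes k: "k \<in> borel_measurable lborel_interval" and f: "f \<in> borel_measurable S2_measure"
  shows "kernel_op k f \<in> borel_measurable S2_measure"
proof -
  have "(\<lambda>z. ((\<lambda>(x, y). k (x \<bullet> y)) z) * f (snd z)) \<in> borel_measurable (S2_measure \<Otimes>\<^sub>M S2_measure)"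
    using kernel_pair_measurable[OF k] f by measurable
  then have "(\<lambda>(x, y). k (x \<bullet> y) * f y) \<in> borel_measurable (S2_measure \<Otimes>\<^sub>M S2_measure)" by (simp add: split_beta)
  then show ?thesis unfolding kernel_op_def[abs_def] by (rule S2.borel_measurable_lebesgue_integral)
qed

text \<open>A kernel operator is symmetric, so it can be moved to the harmonic, where it acts by the Funk--Hecke formula.\<close>

lemma kernel_op_adjoint:
  assumes k: "square_integrable lborel_interval k" and f: "square_integrable S2_measure f" and e: "harmonic l e"
  shows "integrable S2_measure (\<lambda>x. kernel_op k f x * e x)"
    and "(\<integral>x. kernel_op k f x * e x \<partial>S2_measure) = legendre_coeff k l * (\<integral>y. f y * e y \<partial>S2_measure)"
proof -
  obtain B where em: "e \<in> borel_measurable S2_measure" and B: "\<forall>z\<in>S2. \<bar>e z\<bar> \<le> B" using e unfolding harmonic_def by blast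
  have km: "k \<in> borel_measurable lborel_interval" and fm: "f \<in> borel_measurable S2_measure"
    using k f square_integrable_measurable by auto
  note kpm = kernel_pair_measurable[OF km]
  have "(\<lambda>z. ((\<lambda>(x, y). k (x \<bullet> y)) z)\<^sup>2 + (f (snd z))\<^sup>2) \<in> borel_measurable (S2_measure \<Otimes>\<^sub>M S2_measure)"
    using kpm fm by measurable
  then have m1: "(\<lambda>(x, y). (k (x \<bullet> y))\<^sup>2 + (f y)\<^sup>2) \<in> borel_measurable (S2_measure \<Otimes>\<^sub>M S2_measure)" by (simp add: split_beta)
  have int1: "integrable (S2_measure \<Otimes>\<^sub>M S2_measure) (\<lambda>(x, y). (k (x \<bullet> y))\<^sup>2 + (f y)\<^sup>2)"
  proof (rule pair_integrable_section[OF _ m1])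
    fix x assume x: "x \<in> S2"
    have ik: "integrable S2_measure (\<lambda>y. (k (x \<bullet> y))\<^sup>2)" and "integrable S2_measure (\<lambda>y. (f y)\<^sup>2)"
      using zonal_square_integrable(1)[OF x k] f unfolding square_integrable_def by auto
    then show "integrable S2_measure (\<lambda>y. (k (x \<bullet> y))\<^sup>2 + (f y)\<^sup>2)"
      and "(\<integral>y. (k (x \<bullet> y))\<^sup>2 + (f y)\<^sup>2 \<partial>S2_measure) \<le> 2 * pi * (\<integral>t. (k t)\<^sup>2 \<partial>lborel_interval) + (\<integral>y. (f y)\<^sup>2 \<partial>S2_measure)"
      by (simp_all add: zonal_square_integrable(2)[OF x k])
  qed (simp_all add: S2.sigma_finite_measure_axioms)
  have int: "integrable (S2_measure \<Otimes>\<^sub>M S2_measure) (\<lambda>(x, y). k (x \<bullet> y) * f y * e x)"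
  proof (rule Bochner_Integration.integrable_bound)
    show "integrable (S2_measure \<Otimes>\<^sub>M S2_measure) (\<lambda>z. B * ((\<lambda>(x, y). (k (x \<bullet> y))\<^sup>2 + (f y)\<^sup>2) z))"
      by (intro integrable_mult_right int1)
    have "(\<lambda>z. ((\<lambda>(x, y). k (x \<bullet> y)) z) * f (snd z) * e (fst z)) \<in> borel_measurable (S2_measure \<Otimes>\<^sub>M S2_measure)"
      using kpm fm em by measurable
    then show "(\<lambda>(x, y). k (x \<bullet> y) * f y * e x) \<in> borel_measurable (S2_measure \<Otimes>\<^sub>M S2_measure)" by (simp add: split_beta)
    show "AE z in S2_measure \<Otimes>\<^sub>M S2_measure. norm (case z of (x, y) \<Rightarrow> k (x \<bullet> y) * f y * e x)
        \<le> norm (B * ((\<lambda>(x, y). (k (x \<bullet> y))\<^sup>2 + (f y)\<^sup>2) z))"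
    proof (rule AE_I2)
      fix z assume "z \<in> space (S2_measure \<Otimes>\<^sub>M S2_measure)"
      then obtain x y where z: "z = (x, y)" "x \<in> S2" by (auto simp: space_pair_measure)
      have eB: "\<bar>e x\<bar> \<le> B" using B z by auto
      have "\<bar>k (x \<bullet> y)\<bar> * \<bar>f y\<bar> * \<bar>e x\<bar> \<le> ((k (x \<bullet> y))\<^sup>2 + (f y)\<^sup>2) * B"
      proof (rule mult_mono[OF _ eB])
        show "\<bar>k (x \<bullet> y)\<bar> * \<bar>f y\<bar> \<le> (k (x \<bullet> y))\<^sup>2 + (f y)\<^sup>2"
          unfolding abs_mult[symmetric] by (rule abs_mult_le_squares)
      qed auto
      also have "\<dots> \<le> \<bar>B * ((k (x \<bullet> y))\<^sup>2 + (f y)\<^sup>2)\<bar>" by (simp add: mult.commute)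
      finally show "norm (case z of (x, y) \<Rightarrow> k (x \<bullet> y) * f y * e x)
          \<le> norm (B * ((\<lambda>(x, y). (k (x \<bullet> y))\<^sup>2 + (f y)\<^sup>2) z))" by (simp add: z(1) abs_mult)
    qed
  qed
  have kop: "(\<integral>y. k (x \<bullet> y) * f y * e x \<partial>S2_measure) = kernel_op k f x * e x" for x
    unfolding kernel_op_def by simp
  show "integrable S2_measure (\<lambda>x. kernel_op k f x * e x)"
    using S22.integrable_fst[OF int] unfolding kop .
  have "(\<integral>x. kernel_op k f x * e x \<partial>S2_measure) = (\<integral>y. (\<integral>x. k (x \<bullet> y) * f y * e x \<partial>S2_measure) \<partial>S2_measure)"
    using S22.Fubini_integral[OF int] unfolding kop by simp
  also have "\<dots> = (\<integral>y. legendre_coeff k l * (f y * e y) \<partial>S2_measure)"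
  proof (intro Bochner_Integration.integral_cong refl)
    fix y assume "y \<in> space S2_measure"
    then have y: "y \<in> S2" by simp
    have "(\<integral>x. k (x \<bullet> y) * f y * e x \<partial>S2_measure) = (\<integral>x. f y * (k (y \<bullet> x) * e x) \<partial>S2_measure)"
      by (simp add: inner_commute mult_ac)
    also have "\<dots> = f y * (legendre_coeff k l * e y)"
      unfolding integral_mult_right_zero funk_hecke[OF k e y] ..
    finally show "(\<integral>x. k (x \<bullet> y) * f y * e x \<partial>S2_measure) = legendre_coeff k l * (f y * e y)" by simp
  qed
  finally show "(\<integral>x. kernel_op k f x * e x \<partial>S2_measure) = legendre_coeff k l * (\<integral>y. f y * e y \<partial>S2_measure)" by simp
qed

definition covariance_kernel :: "(nat \<Rightarrow> real) \<Rightarrow> real \<Rightarrow> real" where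
  "covariance_kernel C z = (\<Sum>l. C l * legendre_term l z)"

lemma covariance_kernel_props:
  assumes C: "\<And>l. C l \<ge> 0" and sm: "summable (\<lambda>l. (2 * real l + 1) / (4 * pi) * C l)"
  shows "square_integrable lborel_interval (covariance_kernel C)"
    and "legendre_coeff (covariance_kernel C) l = C l"
proof -
  define S where "S = (\<Sum>l. (2 * real l + 1) / (4 * pi) * C l)"
  have bd: "norm (C l * legendre_term l z) \<le> (2 * real l + 1) / (4 * pi) * C l" if "z \<in> {-1..1}" for l z
    using mult_left_mono[OF legendre_term_bound[OF that, of l] C[of l]] C[of l] by (simp add: abs_mult mult.commute)
  have lm: "legendre_term l \<in> borel_measurable lborel_interval" for l
    by (rule square_integrable_measurable[OF legendre_term_square_integrable])
  have gm: "covariance_kernel C \<in> borel_measurable lborel_interval"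
    unfolding covariance_kernel_def[abs_def] using lm by (intro borel_measurable_suminf borel_measurable_times) auto
  have bS: "\<bar>covariance_kernel C z\<bar> \<le> S" if "z \<in> {-1..1}" for z
  proof -
    have "norm (covariance_kernel C z) \<le> S"
      unfolding covariance_kernel_def S_def by (rule norm_suminf_le[OF bd[OF that] sm])
    then show ?thesis by simp
  qed
  show "square_integrable lborel_interval (covariance_kernel C)"
    by (rule bounded_square_integrable_interval[OF gm bS])
  have S1: "legendre_weight l > 0" unfolding legendre_weight_def by (intro divide_pos_pos) auto
  have "(\<integral>t. covariance_kernel C t * legendre_term l t \<partial>lborel_interval)
      = (\<integral>t. (\<Sum>i. C i * legendre_term i t * legendre_term l t) \<partial>lborel_interval)"
  proof (intro Bochner_Integration.integral_cong refl)
    fix t assume "t \<in> space lborel_interval"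
    then have "summable (\<lambda>i. C i * legendre_term i t)"
      using bd by (intro summable_comparison_test'[OF sm]) auto
    then show "covariance_kernel C t * legendre_term l t = (\<Sum>i. C i * legendre_term i t * legendre_term l t)"
      unfolding covariance_kernel_def by (rule suminf_mult2)
  qed
  also have "\<dots> = (\<Sum>i. \<integral>t. C i * legendre_term i t * legendre_term l t \<partial>lborel_interval)"
  proof (rule integral_suminf)
    let ?K = "(2 * real l + 1) / (4 * pi)"
    have b2: "norm (C i * legendre_term i t * legendre_term l t) \<le> (2 * real i + 1) / (4 * pi) * C i * ?K" if "t \<in> {-1..1}" for i t
      unfolding norm_mult[of "C i * legendre_term i t"]
      using bd[OF that, of i] legendre_term_bound[OF that, of l] C[of i] by (intro mult_mono) auto
    have sK: "summable (\<lambda>i. (2 * real i + 1) / (4 * pi) * C i * ?K)" by (rule summable_mult2[OF sm])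
    show int: "integrable lborel_interval (\<lambda>t. C i * legendre_term i t * legendre_term l t)" for i
      unfolding mult.assoc by (intro integrable_mult_right square_integrable_mult legendre_term_square_integrable)
    show "AE t in lborel_interval. summable (\<lambda>i. norm (C i * legendre_term i t * legendre_term l t))"
      by (rule AE_I2, rule summable_comparison_test'[OF sK]) (use b2 in auto)
    show "summable (\<lambda>i. \<integral>t. norm (C i * legendre_term i t * legendre_term l t) \<partial>lborel_interval)"
    proof (rule summable_comparison_test'[OF summable_mult2[OF sK, of 2]])
      fix i :: nat
      have "(\<integral>t. norm (C i * legendre_term i t * legendre_term l t) \<partial>lborel_interval)
          \<le> (\<integral>t. (2 * real i + 1) / (4 * pi) * C i * ?K \<partial>lborel_interval)"
        by (rule integral_mono[OF integrable_norm[OF int]]) (use b2 in auto)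
      also have "\<dots> = (2 * real i + 1) / (4 * pi) * C i * ?K * 2" by (simp add: mult_ac)
      finally show "norm (\<integral>t. norm (C i * legendre_term i t * legendre_term l t) \<partial>lborel_interval)
          \<le> (2 * real i + 1) / (4 * pi) * C i * ?K * 2"
        by (simp only: real_norm_def abs_of_nonneg integral_nonneg_AE AE_I2 abs_ge_zero)
    qed
  qed
  also have "\<dots> = (\<Sum>i. C i * (if i = l then legendre_weight i else 0))"
    unfolding mult.assoc integral_mult_right_zero legendre_term_inner ..
  also have "\<dots> = (\<Sum>i. if i = l then C i * legendre_weight i else 0)"
    by (intro arg_cong[where f = suminf] ext) simp
  also have "\<dots> = C l * legendre_weight l"
    using suminf_finite[of "{l}" "\<lambda>i. if i = l then C i * legendre_weight i else 0"] by simp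
  finally have "legendre_weight l * legendre_coeff (covariance_kernel C) l = C l * legendre_weight l"
    unfolding legendre_term_coeff .
  then show "legendre_coeff (covariance_kernel C) l = C l" using S1 by simp
qed

section \<open>Harmonic coefficients of a spherical autoregression\<close>

locale sphar_model = sphere_prob M for M :: "'w measure" +
  fixes p :: nat and k :: "nat \<Rightarrow> real \<Rightarrow> real" and \<phi> :: "nat \<Rightarrow> nat \<Rightarrow> real" and C :: "nat \<Rightarrow> real"
    and Z T :: "int \<Rightarrow> real^3 \<Rightarrow> 'w \<Rightarrow> real"
  assumes kernels: "\<And>j. j \<in> {1..p} \<Longrightarrow> kernel_with_eigenvalues (k j) (\<lambda>l. \<phi> l j)"
    and noise: "gaussian_spherical_white_noise M Z C"
    and sphar: "gaussian_sphar M p k Z T"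
    and C_pos: "\<And>l. C l > 0"
begin

lemma gaussian_rv_single:
  assumes "gaussian_family M I X" "i \<in> I" shows "gaussian_rv M (X i)"
proof -
  have "finite {i} \<and> {i} \<subseteq> I" using assms(2) by simp
  then have "gaussian_rv M (\<lambda>\<omega>. \<Sum>j\<in>{i}. (\<lambda>_. 1) j * X j \<omega>)"
    using assms(1)[unfolded gaussian_family_def, THEN spec, THEN spec, of "{i}" "\<lambda>_. 1"] by (rule rev_mp)
  then show ?thesis by simp
qed

lemma Z_gaussian: assumes "x \<in> S2" shows "centered_gaussian M (Z t x)"
proof (rule gaussian_rv_centered[OF prob_space_axioms])
  show "gaussian_rv M (Z t x)"
    using noise assms unfolding gaussian_spherical_white_noise_def by (intro gaussian_rv_single[of S2 "Z t"]) auto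
  show "(\<integral>\<omega>. Z t x \<omega> \<partial>M) = 0" using noise assms unfolding gaussian_spherical_white_noise_def by blast
qed

lemma Z_sq: "x \<in> S2 \<Longrightarrow> square_integrable M (Z t x)"
  using Z_gaussian unfolding centered_gaussian_def by blast

lemma T_gaussian_rv: "x \<in> S2 \<Longrightarrow> gaussian_rv M (T t x)"
  using gaussian_rv_single[of "UNIV \<times> S2" "\<lambda>(t, x). T t x" "(t, x)"] sphar unfolding gaussian_sphar_def by simp

lemma T_sq: "x \<in> S2 \<Longrightarrow> square_integrable M (T t x)"
  using T_gaussian_rv sphar unfolding gaussian_sphar_def square_integrable_def gaussian_rv_def by blast

lemma sq_integrable: "square_integrable M X \<Longrightarrow> integrable M X"
  using square_integrable_mult[of M X "\<lambda>_. 1"] by (simp add: square_integrable_def)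

text \<open>Linear combinations of finitely many values of the field: the Gaussian variables supplied by the model.\<close>

definition field_span :: "('w \<Rightarrow> real) set" where
  "field_span = {\<lambda>\<omega>. \<Sum>i\<in>J. c i * T (fst i) (snd i) \<omega> | c J. finite J \<and> J \<subseteq> UNIV \<times> S2}"

lemma gaussian_space_field_span: "gaussian_space M field_span"
  unfolding gaussian_space_def
proof (intro conjI ballI allI)
  fix X assume "X \<in> field_span"
  then obtain c J where X: "X = (\<lambda>\<omega>. \<Sum>i\<in>J. c i * T (fst i) (snd i) \<omega>)" and J: "finite J" "J \<subseteq> UNIV \<times> S2"
    unfolding field_span_def by blast
  show "centered_gaussian M X"
  proof (rule gaussian_rv_centered[OF prob_space_axioms])
    show "gaussian_rv M X"
      using sphar J unfolding X gaussian_sphar_def gaussian_family_def by (simp add: split_beta)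
    have "(\<integral>\<omega>. X \<omega> \<partial>M) = (\<Sum>i\<in>J. c i * (\<integral>\<omega>. T (fst i) (snd i) \<omega> \<partial>M))"
      unfolding X using J sq_integrable[OF T_sq] by (subst Bochner_Integration.integral_sum) auto
    also have "\<dots> = 0" using sphar J unfolding gaussian_sphar_def by (intro sum.neutral) auto
    finally show "(\<integral>\<omega>. X \<omega> \<partial>M) = 0" .
  qed
next
  fix X Y a assume "X \<in> field_span" "Y \<in> field_span"
  then obtain c J c' J' where X: "X = (\<lambda>\<omega>. \<Sum>i\<in>J. c i * T (fst i) (snd i) \<omega>)" and J: "finite J" "J \<subseteq> UNIV \<times> S2"
    and Y: "Y = (\<lambda>\<omega>. \<Sum>i\<in>J'. c' i * T (fst i) (snd i) \<omega>)" and J': "finite J'" "J' \<subseteq> UNIV \<times> S2"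
    unfolding field_span_def by blast
  define b where "b i = (if i \<in> J then c i else 0) + a * (if i \<in> J' then c' i else 0)" for i
  have "X \<omega> + a * Y \<omega> = (\<Sum>i\<in>J \<union> J'. b i * T (fst i) (snd i) \<omega>)" for \<omega>
  proof -
    have 1: "(\<Sum>i\<in>J. c i * T (fst i) (snd i) \<omega>) = (\<Sum>i\<in>J \<union> J'. (if i \<in> J then c i else 0) * T (fst i) (snd i) \<omega>)"
      using J J' by (intro sum.mono_neutral_cong_left) auto
    have 2: "(\<Sum>i\<in>J'. c' i * T (fst i) (snd i) \<omega>) = (\<Sum>i\<in>J \<union> J'. (if i \<in> J' then c' i else 0) * T (fst i) (snd i) \<omega>)"
      using J J' by (intro sum.mono_neutral_cong_left) auto
    show ?thesis unfolding X Y 1 2 b_def by (simp only: sum_distrib_left sum.distrib[symmetric] distrib_right mult.assoc)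
  qed
  then show "(\<lambda>\<omega>. X \<omega> + a * Y \<omega>) \<in> field_span"
    unfolding field_span_def mem_Collect_eq using J J'
    by (intro exI[of _ b] exI[of _ "J \<union> J'"]) auto
qed

text \<open>Rotations act transitively on the sphere, and stationarity removes the time.\<close>

lemma T_variance_constant: "\<exists>v. \<forall>t. \<forall>x\<in>S2. (\<integral>\<omega>. (T t x \<omega>)\<^sup>2 \<partial>M) = v"
proof -
  define e :: "real^3" where "e = axis 1 1"
  have e: "norm e = 1" unfolding e_def by simp
  have "(\<integral>\<omega>. (T t x \<omega>)\<^sup>2 \<partial>M) = (\<integral>\<omega>. (T 0 e \<omega>)\<^sup>2 \<partial>M)" if x: "x \<in> S2" for t x
  proof -
    obtain f :: "real^3 \<Rightarrow> real^3" where f: "orthogonal_transformation f" "det (matrix f) = 1" "f e = x"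
      using rotation_exists_1[of e x] e x by auto
    define g where "g = matrix f"
    have gv: "g *v y = f y" for y
      unfolding g_def using matrix_works[of f y] orthogonal_transformation_linear[OF f(1)] by simp
    have g: "rotation_matrix g"
      unfolding rotation_matrix_def g_def using f orthogonal_transformation_matrix[of f] by simp
    have nS: "g *v y \<in> S2" if "y \<in> S2" for y
      unfolding gv using that orthogonal_transformation_norm[OF f(1)] by simp
    have law: "family_law M (UNIV \<times> S2) (\<lambda>(s, y). T (s + t) (g *v y)) = family_law M (UNIV \<times> S2) (\<lambda>(s, y). T s y)"
      using sphar g unfolding gaussian_sphar_def by blast
    have "(\<integral>\<omega>. ((\<lambda>(s, y). T (s + t) (g *v y)) (0, e) \<omega>)\<^sup>2 \<partial>M) = (\<integral>\<omega>. ((\<lambda>(s, y). T s y) (0, e) \<omega>)\<^sup>2 \<partial>M)"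
      by (rule family_law_component[OF _ _ law, where h = "\<lambda>u. u\<^sup>2"])
         (use nS square_integrable_measurable[OF T_sq] e in auto)
    then show ?thesis using f(3) by (simp add: gv)
  qed
  then show ?thesis by blast
qed

lemma T_field: "L2_field M (T t)"
  using sphar T_sq T_variance_constant unfolding L2_field_def gaussian_sphar_def measurable_field_def by (metis order_refl)

lemma noise_covariance:
  assumes "x \<in> S2" "y \<in> S2" shows "(\<integral>\<omega>. Z t x \<omega> * Z t y \<omega> \<partial>M) = covariance_kernel C (x \<bullet> y)"
  using noise assms unfolding gaussian_spherical_white_noise_def covariance_kernel_def by blast

lemma Z_field: "L2_field M (Z t)"
proof -
  have "(\<integral>\<omega>. (Z t x \<omega>)\<^sup>2 \<partial>M) = covariance_kernel C 1" if "x \<in> S2" for x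
    using noise_covariance[OF that that, of t] that by (simp add: power2_eq_square dot_square_norm)
  then have "\<exists>B. \<forall>x\<in>S2. (\<integral>\<omega>. (Z t x \<omega>)\<^sup>2 \<partial>M) \<le> B" by (intro exI[of _ "covariance_kernel C 1"]) auto
  then show ?thesis
    using noise Z_sq unfolding L2_field_def gaussian_spherical_white_noise_def measurable_field_def by blast
qed

lemma noise_cross_covariance:
  assumes "x \<in> S2" "y \<in> S2" and "s \<noteq> t" shows "(\<integral>\<omega>. Z s x \<omega> * Z t y \<omega> \<partial>M) = 0"
proof -
  have "indep_vars (\<lambda>t. Pi\<^sub>M S2 (\<lambda>_. borel)) (\<lambda>t \<omega>. \<lambda>x\<in>S2. Z t x \<omega>) (UNIV :: int set)"
    using noise unfolding gaussian_spherical_white_noise_def by blast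
  then have "indep_vars (\<lambda>_. borel) (\<lambda>i \<omega>. (\<lambda>f. f (if i = s then x else y)) (\<lambda>x\<in>S2. Z i x \<omega>)) (UNIV :: int set)"
    by (rule indep_vars_compose2) (use assms in \<open>auto intro!: measurable_component_singleton\<close>)
  then have "indep_vars (\<lambda>_. borel) (\<lambda>i \<omega>. (\<lambda>f. f (if i = s then x else y)) (\<lambda>x\<in>S2. Z i x \<omega>)) {s, t}"
    by (rule indep_vars_subset) simp
  then have ind: "indep_vars (\<lambda>_. borel) (\<lambda>i. Z i (if i = s then x else y)) {s, t}"
    using assms by (subst (asm) indep_vars_cong[OF refl _ refl]) auto
  have "(\<integral>\<omega>. (\<Prod>i\<in>{s, t}. Z i (if i = s then x else y) \<omega>) \<partial>M) = (\<Prod>i\<in>{s, t}. \<integral>\<omega>. Z i (if i = s then x else y) \<omega> \<partial>M)"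
    by (rule indep_vars_lebesgue_integral[OF _ ind]) (use sq_integrable[OF Z_sq] assms in auto)
  then show ?thesis using assms noise unfolding gaussian_spherical_white_noise_def by auto
qed

lemma harmonicD:
  assumes "harmonic l e" obtains B where "e \<in> borel_measurable S2_measure" "\<forall>x\<in>S2. \<bar>e x\<bar> \<le> B"
  using assms unfolding harmonic_def by blast

lemma C_props: "C l \<ge> 0" "summable (\<lambda>l. (2 * real l + 1) / (4 * pi) * C l)"
  using noise unfolding gaussian_spherical_white_noise_def by auto

text \<open>The covariance operator of the noise is a kernel operator with eigenvalues \<open>C l\<close>.\<close>

lemma noise_coeff_covariance:
  assumes g: "harmonic l g" and h: "harmonic l h"
  shows "(\<integral>\<omega>. field_coeff (Z s) g \<omega> * field_coeff (Z t) h \<omega> \<partial>M) = (if s = t then C l * (\<integral>x. g x * h x \<partial>S2_measure) else 0)"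
proof -
  obtain B where gm: "g \<in> borel_measurable S2_measure" and gB: "\<forall>x\<in>S2. \<bar>g x\<bar> \<le> B" using harmonicD[OF g] .
  obtain B' where hm: "h \<in> borel_measurable S2_measure" and hB: "\<forall>x\<in>S2. \<bar>h x\<bar> \<le> B'" using harmonicD[OF h] .
  have inner: "(\<integral>\<omega>. field_coeff (Z s) g \<omega> * Z t x \<omega> \<partial>M) = (if s = t then C l * g x else 0)" if x: "x \<in> S2" for x
  proof -
    have "(\<integral>\<omega>. field_coeff (Z s) g \<omega> * Z t x \<omega> \<partial>M) = (\<integral>\<omega>. Z t x \<omega> * field_coeff (Z s) g \<omega> \<partial>M)"
      by (simp add: mult.commute)
    also have "\<dots> = (\<integral>y. (\<integral>\<omega>. Z t x \<omega> * Z s y \<omega> \<partial>M) * g y \<partial>S2_measure)"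
      by (rule field_coeff_inner[OF Z_field gm gB Z_sq[OF x]])
    also have "\<dots> = (if s = t then C l * g x else 0)"
    proof (cases "s = t")
      case True
      have "(\<integral>y. (\<integral>\<omega>. Z t x \<omega> * Z s y \<omega> \<partial>M) * g y \<partial>S2_measure) = (\<integral>y. covariance_kernel C (x \<bullet> y) * g y \<partial>S2_measure)"
        using noise_covariance[OF x] True by (intro Bochner_Integration.integral_cong refl) simp
      then show ?thesis
        using funk_hecke[OF covariance_kernel_props(1)[OF C_props] g x] covariance_kernel_props(2)[OF C_props] True by simp
    next
      case False
      have "(\<integral>y. (\<integral>\<omega>. Z t x \<omega> * Z s y \<omega> \<partial>M) * g y \<partial>S2_measure) = (\<integral>y. 0 \<partial>S2_measure)"
        using noise_cross_covariance[OF x, of _ t s] False by (intro Bochner_Integration.integral_cong refl) simp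
      then show ?thesis using False by simp
    qed
    finally show ?thesis .
  qed
  have "(\<integral>\<omega>. field_coeff (Z s) g \<omega> * field_coeff (Z t) h \<omega> \<partial>M) = (\<integral>x. (\<integral>\<omega>. field_coeff (Z s) g \<omega> * Z t x \<omega> \<partial>M) * h x \<partial>S2_measure)"
    by (rule field_coeff_inner[OF Z_field hm hB field_coeff_L2(1)[OF Z_field gm gB]])
  also have "\<dots> = (\<integral>x. (if s = t then C l * (g x * h x) else 0) \<partial>S2_measure)"
    using inner by (intro Bochner_Integration.integral_cong refl) auto
  finally show ?thesis by simp
qed

lemma kernel_sq: "j \<in> {1..p} \<Longrightarrow> square_integrable lborel_interval (k j)"
  using kernels kernel_with_eigenvalues_square_integrable by blast

lemma kernel_coeff: "j \<in> {1..p} \<Longrightarrow> legendre_coeff (k j) l = \<phi> l j"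
  using eigenvalue_legendre_coeff[OF kernels] by simp

text \<open>The equation of the model holds almost everywhere on the product of sphere and probability space; Fubini's theorem gives
it for almost all points of the sphere, along almost every path.\<close>

lemma AE_residual_paths: "AE \<omega> in M. AE x in S2_measure. sphar_residual p k T t x \<omega> = Z t x \<omega>"
proof -
  have "AE z in S2_measure \<Otimes>\<^sub>M M. (case z of (x, \<omega>) \<Rightarrow> sphar_residual p k T t x \<omega> - Z t x \<omega> = 0)"
    using sphar unfolding gaussian_sphar_def by blast
  then obtain N where N: "N \<in> null_sets (S2_measure \<Otimes>\<^sub>M M)"
    "{z \<in> space (S2_measure \<Otimes>\<^sub>M M). \<not> (case z of (x, \<omega>) \<Rightarrow> sphar_residual p k T t x \<omega> - Z t x \<omega> = 0)} \<subseteq> N"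
    unfolding eventually_ae_filter by blast
  have "AE z in S2_measure \<Otimes>\<^sub>M M. z \<notin> N" by (rule AE_not_in[OF N(1)])
  then have "AE x in S2_measure. AE \<omega> in M. (x, \<omega>) \<notin> N" by (rule SM.AE_pair)
  moreover have "{z \<in> space (S2_measure \<Otimes>\<^sub>M M). (fst z, snd z) \<notin> N} \<in> sets (S2_measure \<Otimes>\<^sub>M M)"
  proof -
    have "{z \<in> space (S2_measure \<Otimes>\<^sub>M M). (fst z, snd z) \<notin> N} = space (S2_measure \<Otimes>\<^sub>M M) - N" by auto
    moreover have "space (S2_measure \<Otimes>\<^sub>M M) - N \<in> sets (S2_measure \<Otimes>\<^sub>M M)"
      by (rule sets.compl_sets[OF null_setsD2[OF N(1)]])
    ultimately show ?thesis by simp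
  qed
  ultimately have "AE \<omega> in M. AE x in S2_measure. (x, \<omega>) \<notin> N"
    using SM.AE_commute[of "\<lambda>x \<omega>. (x, \<omega>) \<notin> N"] by simp
  then show ?thesis
    using AE_space
  proof eventually_elim
    case (elim \<omega>)
    show ?case
      using elim(1) AE_space
    proof eventually_elim
      case (elim x)
      then have "(x, \<omega>) \<in> space (S2_measure \<Otimes>\<^sub>M M)" using \<open>\<omega> \<in> space M\<close> elim by (simp add: space_pair_measure)
      then show ?case using N(2) elim(1) by force
    qed
  qed
qed

lemma AE_paths_square_integrable: "AE \<omega> in M. \<forall>t. square_integrable S2_measure (\<lambda>x. T t x \<omega>)"
  unfolding AE_all_countable using field_path_square_integrable[OF T_field] by blast

text \<open>Integrate the equation of the model against \<open>e\<close> and move the operators to \<open>e\<close>.\<close>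

lemma coeff_autoregression:
  assumes e: "harmonic l e"
  shows "AE \<omega> in M. ar_residual p (\<phi> l) (\<lambda>t. field_coeff (T t) e) t \<omega> = field_coeff (Z t) e \<omega>"
  using AE_residual_paths[of t] AE_paths_square_integrable AE_space
proof eventually_elim
  case (elim \<omega>)
  obtain B where em: "e \<in> borel_measurable S2_measure" and eB: "\<forall>x\<in>S2. \<bar>e x\<bar> \<le> B" using harmonicD[OF e] .
  have km: "k j \<in> borel_measurable lborel_interval" if "j \<in> {1..p}" for j
    by (rule square_integrable_measurable[OF kernel_sq[OF that]])
  have Tm: "(\<lambda>x. T s x \<omega>) \<in> borel_measurable S2_measure" for s
    using elim(2) square_integrable_measurable by blast
  have Zm: "(\<lambda>x. Z t x \<omega>) \<in> borel_measurable S2_measure" by (rule field_section_measurable[OF Z_field elim(3)])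
  have Rm: "(\<lambda>x. sphar_residual p k T t x \<omega>) \<in> borel_measurable S2_measure"
    unfolding sphar_residual_def using Tm kernel_op_measurable[OF km Tm]
    by (intro borel_measurable_diff borel_measurable_sum) auto
  have iT: "integrable S2_measure (\<lambda>x. T s x \<omega> * e x)" for s
    using elim(2) bounded_square_integrable_S2[OF em eB] by (intro square_integrable_mult) auto
  note adj = kernel_op_adjoint[OF kernel_sq _ e]
  have "field_coeff (Z t) e \<omega> = (\<integral>x. sphar_residual p k T t x \<omega> * e x \<partial>S2_measure)"
    unfolding field_coeff_def
    by (rule integral_cong_AE) (use Zm Rm em elim(1) in auto)
  also have "\<dots> = (\<integral>x. T t x \<omega> * e x - (\<Sum>j=1..p. kernel_op (k j) (\<lambda>y. T (t - int j) y \<omega>) x * e x) \<partial>S2_measure)"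
    unfolding sphar_residual_def by (simp add: left_diff_distrib sum_distrib_right)
  also have "\<dots> = (\<integral>x. T t x \<omega> * e x \<partial>S2_measure) - (\<Sum>j=1..p. \<integral>x. kernel_op (k j) (\<lambda>y. T (t - int j) y \<omega>) x * e x \<partial>S2_measure)"
    using iT adj(1) elim(2)
    by (subst Bochner_Integration.integral_diff) (auto intro!: Bochner_Integration.integrable_sum Bochner_Integration.integral_sum)
  also have "\<dots> = ar_residual p (\<phi> l) (\<lambda>t. field_coeff (T t) e) t \<omega>"
    unfolding ar_residual_def field_coeff_def using adj(2) elim(2) kernel_coeff by simp
  finally show ?case by simp
qed

lemma T_in_field_span: assumes "x \<in> S2" shows "T t x \<in> field_span"
proof -
  have "T t x = (\<lambda>\<omega>. \<Sum>i\<in>{(t, x)}. 1 * T (fst i) (snd i) \<omega>)" by simp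
  moreover have "finite {(t, x)} \<and> {(t, x)} \<subseteq> UNIV \<times> S2" using assms by auto
  ultimately show ?thesis unfolding field_span_def mem_Collect_eq by (intro exI[of _ "\<lambda>_. 1"] exI[of _ "{(t, x)}"] conjI) simp_all
qed

text \<open>The coefficient is an integral of the values of the field. A variable that is almost uncorrelated with all values of
the field is, by \<open>field_coeff_inner\<close>, almost uncorrelated with the coefficient, so \<open>L2_closureI\<close> applies.\<close>

lemma coeff_in_closure:
  assumes gm: "g \<in> borel_measurable S2_measure" and gB: "\<forall>x\<in>S2. \<bar>g x\<bar> \<le> B"
  shows "field_coeff (T t) g \<in> L2_closure M field_span"
proof -
  obtain v where v: "\<And>x. x \<in> S2 \<Longrightarrow> (\<integral>\<omega>. (T t x \<omega>)\<^sup>2 \<partial>M) = v" using T_variance_constant by blast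
  let ?K = "\<bar>\<integral>x. sqrt v * \<bar>B\<bar> \<partial>S2_measure\<bar>"
  show ?thesis
  proof (rule L2_closureI[OF gaussian_space_field_span _ field_coeff_L2(1)[OF T_field gm gB], of ?K])
    have "T t (axis 1 1) \<in> field_span" by (rule T_in_field_span) simp
    then show "field_span \<noteq> {}" unfolding ex_in_conv[symmetric] by (rule exI[of "\<lambda>X. X \<in> field_span"])
    fix Y \<epsilon>
    assume Y: "square_integrable M Y" and \<epsilon>: "0 \<le> \<epsilon>"
      and dual: "\<And>h. h \<in> field_span \<Longrightarrow> (\<integral>\<omega>. Y \<omega> * h \<omega> \<partial>M)\<^sup>2 \<le> \<epsilon> * (\<integral>\<omega>. (h \<omega>)\<^sup>2 \<partial>M)"
    have v0: "0 \<le> v" using v[of "axis 1 1"] integral_power2_nonneg[of M "T t (axis 1 1)"] by simp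
    have bd: "(\<integral>\<omega>. Y \<omega> * T t x \<omega> \<partial>M) * g x \<le> sqrt \<epsilon> * (sqrt v * \<bar>B\<bar>)" if x: "x \<in> S2" for x
    proof -
      have "\<bar>\<integral>\<omega>. Y \<omega> * T t x \<omega> \<partial>M\<bar> \<le> sqrt (\<epsilon> * v)"
        using dual[OF T_in_field_span[OF x, of t]] v[OF x] by (intro real_le_rsqrt) simp
      moreover have "\<bar>g x\<bar> \<le> \<bar>B\<bar>" using gB[rule_format, OF x] by linarith
      ultimately have "\<bar>\<integral>\<omega>. Y \<omega> * T t x \<omega> \<partial>M\<bar> * \<bar>g x\<bar> \<le> sqrt (\<epsilon> * v) * \<bar>B\<bar>"
        by (rule mult_mono) (simp_all add: \<epsilon> v0)
      then show ?thesis unfolding abs_mult[symmetric] real_sqrt_mult by linarith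
    qed
    have "(\<integral>\<omega>. Y \<omega> * field_coeff (T t) g \<omega> \<partial>M) = (\<integral>x. (\<integral>\<omega>. Y \<omega> * T t x \<omega> \<partial>M) * g x \<partial>S2_measure)"
      by (rule field_coeff_inner[OF T_field gm gB Y])
    also have "\<dots> \<le> (\<integral>x. sqrt \<epsilon> * (sqrt v * \<bar>B\<bar>) \<partial>S2_measure)"
    proof (rule integral_mono_AE')
      show "integrable S2_measure (\<lambda>x. sqrt \<epsilon> * (sqrt v * \<bar>B\<bar>))" by simp
      show "AE x in S2_measure. (\<integral>\<omega>. Y \<omega> * T t x \<omega> \<partial>M) * g x \<le> sqrt \<epsilon> * (sqrt v * \<bar>B\<bar>)"
        by (rule AE_I2, rule bd) (simp only: space_S2_measure)
      show "AE x in S2_measure. 0 \<le> sqrt \<epsilon> * (sqrt v * \<bar>B\<bar>)" using \<epsilon> v0 by simp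
    qed
    also have "\<dots> = (\<integral>x. sqrt v * \<bar>B\<bar> \<partial>S2_measure) * sqrt \<epsilon>" by simp
    also have "\<dots> \<le> ?K * sqrt \<epsilon>" using \<epsilon> by (intro mult_right_mono) auto
    finally show "(\<integral>\<omega>. Y \<omega> * field_coeff (T t) g \<omega> \<partial>M) \<le> ?K * sqrt \<epsilon>" .
  qed simp
qed

end

section \<open>The least squares criterion in harmonic coordinates\<close>

lemma harmonic_basis_exists:
  "\<exists>e. \<forall>l. orthonormal_S2 (2 * l + 1) (e l) \<and>
     (\<forall>x\<in>S2. \<forall>y\<in>S2. legendre_kernel l x y = (\<Sum>i<2 * l + 1. e l i x * e l i y)) \<and>
     (\<forall>i<2 * l + 1. harmonic l (e l i))"
proof (rule choice, rule allI)
  fix l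
  obtain e where e: "orthonormal_S2 (2 * l + 1) e"
    "\<forall>x\<in>S2. \<forall>y\<in>S2. legendre_kernel l x y = (\<Sum>i<2 * l + 1. e i x * e i y)"
    "\<forall>i<2 * l + 1. \<forall>x\<in>S2. (\<integral>z. legendre_kernel l x z * e i z \<partial>S2_measure) = e i x"
    using projection_kernel_expansion[OF legendre_kernel_projection[of l]] by blast
  have "\<forall>i<2 * l + 1. harmonic l (e i)"
    using e(1,3) unfolding orthonormal_S2_def harmonic_def by blast
  then show "\<exists>e. orthonormal_S2 (2 * l + 1) e \<and>
     (\<forall>x\<in>S2. \<forall>y\<in>S2. legendre_kernel l x y = (\<Sum>i<2 * l + 1. e i x * e i y)) \<and>
     (\<forall>i<2 * l + 1. harmonic l (e i))" using e by blast
qed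

text \<open>An orthonormal basis of harmonics at every level. The choice is arbitrary: the least squares criterion depends only on
the projections on the levels.\<close>

definition harmonic_basis :: "nat \<Rightarrow> nat \<Rightarrow> real^3 \<Rightarrow> real" where
  "harmonic_basis = (SOME e. \<forall>l. orthonormal_S2 (2 * l + 1) (e l) \<and>
     (\<forall>x\<in>S2. \<forall>y\<in>S2. legendre_kernel l x y = (\<Sum>i<2 * l + 1. e l i x * e l i y)) \<and>
     (\<forall>i<2 * l + 1. harmonic l (e l i)))"

lemma harmonic_basis_props:
  "orthonormal_S2 (2 * l + 1) (harmonic_basis l)"
  "x \<in> S2 \<Longrightarrow> y \<in> S2 \<Longrightarrow> legendre_kernel l x y = (\<Sum>i<2 * l + 1. harmonic_basis l i x * harmonic_basis l i y)"
  "i < 2 * l + 1 \<Longrightarrow> harmonic l (harmonic_basis l i)"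
  using someI_ex[OF harmonic_basis_exists] unfolding harmonic_basis_def[symmetric] by blast+

lemma harmonic_square_integrable: "harmonic l e \<Longrightarrow> square_integrable S2_measure e"
  using bounded_square_integrable_S2 unfolding harmonic_def by blast

lemma kernel_op_legendre_term:
  assumes f: "square_integrable S2_measure f" and x: "x \<in> S2"
  shows "kernel_op (legendre_term l) f x
    = (\<Sum>i<2 * l + 1. (\<integral>y. f y * harmonic_basis l i y \<partial>S2_measure) * harmonic_basis l i x)"
proof -
  have "legendre_kernel l x y * f y = (\<Sum>i<2 * l + 1. harmonic_basis l i x * (f y * harmonic_basis l i y))"
    if "y \<in> S2" for y
    unfolding harmonic_basis_props(2)[OF x that] sum_distrib_right by (rule sum.cong) auto
  then have "kernel_op (legendre_term l) f x
      = (\<integral>y. (\<Sum>i<2 * l + 1. harmonic_basis l i x * (f y * harmonic_basis l i y)) \<partial>S2_measure)"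
    unfolding kernel_op_def legendre_kernel_def[symmetric]
    by (intro Bochner_Integration.integral_cong refl) (simp only: space_S2_measure)
  also have "\<dots> = (\<Sum>i<2 * l + 1. harmonic_basis l i x * (\<integral>y. f y * harmonic_basis l i y \<partial>S2_measure))"
  proof -
    have "integrable S2_measure (\<lambda>y. harmonic_basis l i x * (f y * harmonic_basis l i y))" if "i \<in> {..<2 * l + 1}" for i
      using square_integrable_mult[OF f harmonic_square_integrable[OF harmonic_basis_props(3)]] that by simp
    then show ?thesis by (subst Bochner_Integration.integral_sum) auto
  qed
  finally show ?thesis by (simp add: mult.commute)
qed

lemma legendre_coeff_legendre_term: assumes "l \<noteq> l'" shows "legendre_coeff (legendre_term l) l' = 0"
proof -
  have "legendre_weight l' > 0" unfolding legendre_weight_def by (simp add: add_nonneg_pos)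
  then show ?thesis using legendre_term_coeff[of "legendre_term l" l'] legendre_term_inner[of l l'] assms by simp
qed

text \<open>The projection on level \<open>l\<close> fixes \<open>g\<close> and annihilates \<open>h\<close>.\<close>

lemma harmonic_orthogonal:
  assumes g: "harmonic l g" and h: "harmonic l' h" and "l \<noteq> l'"
  shows "(\<integral>x. g x * h x \<partial>S2_measure) = 0"
proof -
  have "(\<integral>x. g x * h x \<partial>S2_measure) = (\<integral>x. kernel_op (legendre_term l) g x * h x \<partial>S2_measure)"
    using g unfolding kernel_op_def legendre_kernel_def[symmetric] harmonic_def
    by (intro Bochner_Integration.integral_cong refl) simp
  also have "\<dots> = 0"
    unfolding kernel_op_adjoint(2)[OF legendre_term_square_integrable harmonic_square_integrable[OF g] h]
    by (simp add: legendre_coeff_legendre_term[OF assms(3)])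
  finally show ?thesis .
qed

definition levels :: "nat \<Rightarrow> (nat \<times> nat) set" where "levels L = (SIGMA l:{..L}. {..<2 * l + 1})"

lemma finite_levels [simp]: "finite (levels L)" unfolding levels_def by simp

lemma harmonic_basis_orthonormal:
  assumes "P \<in> levels L" "Q \<in> levels L"
  shows "(\<integral>x. case_prod harmonic_basis P x * case_prod harmonic_basis Q x \<partial>S2_measure) = (if P = Q then 1 else 0)"
proof (cases "fst P = fst Q")
  case True
  then show ?thesis
    using assms harmonic_basis_props(1)[of "fst P"] unfolding levels_def orthonormal_S2_def
    by (cases P; cases Q) auto
next
  case False
  then have "(\<integral>x. harmonic_basis (fst P) (snd P) x * harmonic_basis (fst Q) (snd Q) x \<partial>S2_measure) = 0"
    using assms harmonic_basis_props(3) unfolding levels_def by (intro harmonic_orthogonal[of "fst P" _ "fst Q"]) auto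
  then show ?thesis using False by (auto simp: split_beta)
qed

text \<open>Completing the square in the span of an orthonormal family.\<close>

lemma orthonormal_distance:
  assumes I: "finite I" and E: "\<And>P. P \<in> I \<Longrightarrow> square_integrable M (E P)"
    and orth: "\<And>P Q. P \<in> I \<Longrightarrow> Q \<in> I \<Longrightarrow> (\<integral>x. E P x * E Q x \<partial>M) = (if P = Q then 1 else (0::real))"
    and f: "square_integrable M f"
  shows "(\<integral>x. (f x - (\<Sum>P\<in>I. b P * E P x))\<^sup>2 \<partial>M)
    = (\<integral>x. (f x)\<^sup>2 \<partial>M) - (\<Sum>P\<in>I. (\<integral>x. f x * E P x \<partial>M)\<^sup>2) + (\<Sum>P\<in>I. ((\<integral>x. f x * E P x \<partial>M) - b P)\<^sup>2)"
proof -
  have g: "square_integrable M (\<lambda>x. \<Sum>P\<in>I. b P * E P x)"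
    by (intro square_integrable_sum square_integrable_cmult I E)
  have fg: "(\<integral>x. f x * (\<Sum>P\<in>I. b P * E P x) \<partial>M) = (\<Sum>P\<in>I. b P * (\<integral>x. f x * E P x \<partial>M))"
  proof -
    have "(\<integral>x. f x * (\<Sum>P\<in>I. b P * E P x) \<partial>M) = (\<integral>x. (\<Sum>P\<in>I. b P * (f x * E P x)) \<partial>M)"
      by (simp add: sum_distrib_left mult.left_commute)
    then show ?thesis using square_integrable_mult[OF f E] by (simp add: Bochner_Integration.integral_sum)
  qed
  have eg: "(\<integral>x. E Q x * (\<Sum>P\<in>I. b P * E P x) \<partial>M) = b Q" if Q: "Q \<in> I" for Q
  proof -
    have "(\<integral>x. E Q x * (\<Sum>P\<in>I. b P * E P x) \<partial>M) = (\<integral>x. (\<Sum>P\<in>I. b P * (E Q x * E P x)) \<partial>M)"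
      by (simp add: sum_distrib_left mult.left_commute)
    also have "\<dots> = (\<Sum>P\<in>I. b P * (if Q = P then 1 else 0))"
      using square_integrable_mult[OF E[OF Q] E] orth[OF Q] by (simp add: Bochner_Integration.integral_sum)
    also have "\<dots> = b Q" using I Q by (simp add: if_distrib cong: if_cong)
    finally show ?thesis .
  qed
  have gg: "(\<integral>x. (\<Sum>P\<in>I. b P * E P x)\<^sup>2 \<partial>M) = (\<Sum>P\<in>I. (b P)\<^sup>2)"
  proof -
    have "(\<integral>x. (\<Sum>P\<in>I. b P * E P x)\<^sup>2 \<partial>M) = (\<integral>x. (\<Sum>Q\<in>I. b Q * (E Q x * (\<Sum>P\<in>I. b P * E P x))) \<partial>M)"
      by (simp add: power2_eq_square sum_distrib_right mult.assoc)
    also have "\<dots> = (\<Sum>Q\<in>I. b Q * b Q)"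
      using square_integrable_mult[OF E g] eg by (simp add: Bochner_Integration.integral_sum)
    finally show ?thesis by (simp add: power2_eq_square)
  qed
  have "(\<integral>x. (f x - (\<Sum>P\<in>I. b P * E P x))\<^sup>2 \<partial>M)
      = (\<integral>x. (f x)\<^sup>2 - 2 * (f x * (\<Sum>P\<in>I. b P * E P x)) + (\<Sum>P\<in>I. b P * E P x)\<^sup>2 \<partial>M)"
    by (simp add: power2_diff algebra_simps)
  also have "\<dots> = (\<integral>x. (f x)\<^sup>2 \<partial>M) - 2 * (\<Sum>P\<in>I. b P * (\<integral>x. f x * E P x \<partial>M)) + (\<Sum>P\<in>I. (b P)\<^sup>2)"
    using f g square_integrable_mult[OF f g] unfolding fg[symmetric] gg[symmetric] by (simp add: square_integrable_def)
  finally show ?thesis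
    by (simp add: power2_diff sum.distrib sum_subtractf sum_distrib_left mult_ac)
qed

lemma kernel_op_legendre_sum:
  assumes f: "square_integrable S2_measure f" and x: "x \<in> S2"
  shows "kernel_op (\<lambda>z. \<Sum>l\<le>L. c l * legendre_term l z) f x
    = (\<Sum>P\<in>levels L. (c (fst P) * (\<integral>y. f y * case_prod harmonic_basis P y \<partial>S2_measure)) * case_prod harmonic_basis P x)"
proof -
  have i: "integrable S2_measure (\<lambda>y. legendre_term l (x \<bullet> y) * f y)" for l
    by (rule square_integrable_mult[OF zonal_square_integrable(1)[OF x legendre_term_square_integrable] f])
  have "kernel_op (\<lambda>z. \<Sum>l\<le>L. c l * legendre_term l z) f x = (\<integral>y. (\<Sum>l\<le>L. c l * (legendre_term l (x \<bullet> y) * f y)) \<partial>S2_measure)"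
    unfolding kernel_op_def by (simp add: sum_distrib_right mult.assoc)
  also have "\<dots> = (\<Sum>l\<le>L. c l * kernel_op (legendre_term l) f x)"
    unfolding kernel_op_def using i by (simp add: Bochner_Integration.integral_sum)
  also have "\<dots> = (\<Sum>l\<le>L. \<Sum>i<2 * l + 1. (c l * (\<integral>y. f y * harmonic_basis l i y \<partial>S2_measure)) * harmonic_basis l i x)"
    unfolding kernel_op_legendre_term[OF f x] by (simp only: sum_distrib_left mult.assoc)
  also have "\<dots> = (\<Sum>(l, i)\<in>levels L. (c l * (\<integral>y. f y * harmonic_basis l i y \<partial>S2_measure)) * harmonic_basis l i x)"
    unfolding levels_def by (rule sum.Sigma) auto
  finally show ?thesis by (simp add: split_beta)
qed

context sphar_model
begin

definition coeff :: "nat \<Rightarrow> nat \<Rightarrow> int \<Rightarrow> 'w \<Rightarrow> real" where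
  "coeff l i t = field_coeff (T t) (harmonic_basis l i)"

text \<open>Operators with truncated kernels act only on the levels up to \<open>L\<close>, by multiplication. So the residual is \<open>T t\<close> minus an
element of the span of the basis, and completing the square separates the energy of \<open>T t\<close> beyond these levels from the
autoregressive residuals of the coefficients.\<close>

lemma residual_energy:
  assumes paths: "\<And>t. square_integrable S2_measure (\<lambda>x. T t x \<omega>)"
    and h: "\<And>j. j \<in> {1..p} \<Longrightarrow> h j = (\<lambda>z. \<Sum>l\<le>L. c l j * legendre_term l z)"
  shows "(\<integral>x. (sphar_residual p h T t x \<omega>)\<^sup>2 \<partial>S2_measure)
    = (\<integral>x. (T t x \<omega>)\<^sup>2 \<partial>S2_measure) - (\<Sum>(l, i)\<in>levels L. (coeff l i t \<omega>)\<^sup>2)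
      + (\<Sum>(l, i)\<in>levels L. (ar_residual p (c l) (coeff l i) t \<omega>)\<^sup>2)"
proof -
  define b where "b P = (\<Sum>j=1..p. c (fst P) j * coeff (fst P) (snd P) (t - int j) \<omega>)" for P
  have "sphar_residual p h T t x \<omega> = T t x \<omega> - (\<Sum>P\<in>levels L. b P * case_prod harmonic_basis P x)" if x: "x \<in> S2" for x
  proof -
    have "(\<Sum>j=1..p. kernel_op (h j) (\<lambda>y. T (t - int j) y \<omega>) x)
        = (\<Sum>j=1..p. \<Sum>P\<in>levels L. (c (fst P) j * coeff (fst P) (snd P) (t - int j) \<omega>) * case_prod harmonic_basis P x)"
      using h kernel_op_legendre_sum[OF paths x] by (simp add: coeff_def field_coeff_def split_beta)
    also have "\<dots> = (\<Sum>P\<in>levels L. b P * case_prod harmonic_basis P x)"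
      unfolding b_def by (subst sum.swap) (simp add: sum_distrib_right)
    finally show ?thesis unfolding sphar_residual_def by simp
  qed
  then have "(\<integral>x. (sphar_residual p h T t x \<omega>)\<^sup>2 \<partial>S2_measure)
      = (\<integral>x. (T t x \<omega> - (\<Sum>P\<in>levels L. b P * case_prod harmonic_basis P x))\<^sup>2 \<partial>S2_measure)"
    by (intro Bochner_Integration.integral_cong refl) simp
  also have "\<dots> = (\<integral>x. (T t x \<omega>)\<^sup>2 \<partial>S2_measure) - (\<Sum>P\<in>levels L. (\<integral>x. T t x \<omega> * case_prod harmonic_basis P x \<partial>S2_measure)\<^sup>2)
      + (\<Sum>P\<in>levels L. ((\<integral>x. T t x \<omega> * case_prod harmonic_basis P x \<partial>S2_measure) - b P)\<^sup>2)"
  proof (rule orthonormal_distance[OF finite_levels _ harmonic_basis_orthonormal paths])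
    show "square_integrable S2_measure (case_prod harmonic_basis P)" if "P \<in> levels L" for P
      using that harmonic_square_integrable[OF harmonic_basis_props(3)] unfolding levels_def by auto
  qed
  finally show ?thesis
    unfolding b_def ar_residual_def coeff_def field_coeff_def by (simp add: split_beta)
qed

text \<open>Compare the minimiser with the kernels that have the true eigenvalues at level \<open>l0\<close> and agree with it at all other
levels: by \<open>residual_energy\<close> the other levels cancel.\<close>

lemma least_squares_basic_inequality:
  assumes paths: "\<And>t. square_integrable S2_measure (\<lambda>x. T t x \<omega>)"
    and h: "\<And>j. j \<in> {1..p} \<Longrightarrow> h j = (\<lambda>z. \<Sum>l\<le>L. c l j * legendre_term l z)"
    and min: "is_arg_min (sphar_sse p T N \<omega>) (\<lambda>h. h \<in> {1..p} \<rightarrow> legendre_space L) h" and l0: "l0 \<le> L"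
  shows "(\<Sum>t=1..N. \<Sum>i<2 * l0 + 1. (ar_residual p (c l0) (coeff l0 i) (int (t + p)) \<omega>)\<^sup>2)
    \<le> (\<Sum>t=1..N. \<Sum>i<2 * l0 + 1. (ar_residual p (\<phi> l0) (coeff l0 i) (int (t + p)) \<omega>)\<^sup>2)"
proof -
  define c' where "c' = c(l0 := \<phi> l0)"
  define h' where "h' j = (\<lambda>z. \<Sum>l\<le>L. c' l j * legendre_term l z)" for j
  have "h' \<in> {1..p} \<rightarrow> legendre_space L" unfolding h'_def legendre_space_def by auto
  then have le: "sphar_sse p T N \<omega> h \<le> sphar_sse p T N \<omega> h'"
    using min unfolding is_arg_min_def by (meson not_less)
  define R where "R c l = (\<Sum>t=1..N. \<Sum>i<2 * l + 1. (ar_residual p (c l) (coeff l i) (int (t + p)) \<omega>)\<^sup>2)"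
    for c :: "nat \<Rightarrow> nat \<Rightarrow> real" and l
  define K where "K = (\<Sum>t=1..N. (\<integral>x. (T (int (t + p)) x \<omega>)\<^sup>2 \<partial>S2_measure)) - (\<Sum>t=1..N. \<Sum>(l, i)\<in>levels L. (coeff l i (int (t + p)) \<omega>)\<^sup>2)"
  have expand: "sphar_sse p T N \<omega> g = K + (\<Sum>l\<le>L. R d l)"
    if "\<And>j. j \<in> {1..p} \<Longrightarrow> g j = (\<lambda>z. \<Sum>l\<le>L. d l j * legendre_term l z)" for g d
  proof -
    have s: "(\<Sum>(l, i)\<in>levels L. f l i) = (\<Sum>l\<le>L. \<Sum>i<2 * l + 1. f l i)" for f :: "nat \<Rightarrow> nat \<Rightarrow> real"
      unfolding levels_def by (rule sum.Sigma[symmetric]) auto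
    have "sphar_sse p T N \<omega> g = K + (\<Sum>t=1..N. \<Sum>(l, i)\<in>levels L. (ar_residual p (d l) (coeff l i) (int (t + p)) \<omega>)\<^sup>2)"
    proof -
      have "(\<integral>x. (sphar_residual p g T t x \<omega>)\<^sup>2 \<partial>S2_measure)
        = (\<integral>x. (T t x \<omega>)\<^sup>2 \<partial>S2_measure) - (\<Sum>(l, i)\<in>levels L. (coeff l i t \<omega>)\<^sup>2)
          + (\<Sum>(l, i)\<in>levels L. (ar_residual p (d l) (coeff l i) t \<omega>)\<^sup>2)" for t
        by (rule residual_energy[OF paths that])
      then show ?thesis unfolding sphar_sse_def K_def by (simp add: sum.distrib sum_subtractf)
    qed
    also have "\<dots> = K + (\<Sum>l\<le>L. R d l)"
      unfolding s R_def by (subst sum.swap) (rule refl)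
    finally show ?thesis .
  qed
  have "(\<Sum>l\<le>L. R c l) \<le> (\<Sum>l\<le>L. R c' l)"
    using le expand[OF h] expand[of h' c'] by (simp add: h'_def)
  moreover have split: "(\<Sum>l\<le>L. R d l) = R d l0 + (\<Sum>l\<in>{..L} - {l0}. R d l)" for d
    using l0 by (intro sum.remove) auto
  moreover have "(\<Sum>l\<in>{..L} - {l0}. R c' l) = (\<Sum>l\<in>{..L} - {l0}. R c l)"
    by (intro sum.cong refl) (simp add: R_def c'_def)
  ultimately have "R c l0 \<le> R c' l0" by simp
  then show ?thesis by (simp add: R_def c'_def)
qed

end

section \<open>Risk of the estimated eigenvalues\<close>

locale stable_sphar_model = sphar_model M p k \<phi> C Z T
  for M :: "'w measure" and p :: nat and k :: "nat \<Rightarrow> real \<Rightarrow> real" and \<phi> :: "nat \<Rightarrow> nat \<Rightarrow> real" and C :: "nat \<Rightarrow> real"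
    and Z T :: "int \<Rightarrow> real^3 \<Rightarrow> 'w \<Rightarrow> real" +
  fixes \<delta> :: real
  assumes p1: "p \<ge> 1" and \<delta>: "\<delta> > 0"
    and stable: "\<And>l z::complex. norm z \<le> 1 + \<delta> \<Longrightarrow> 1 - (\<Sum>j=1..p. of_real (\<phi> l j) * z ^ j) \<noteq> 0"
begin

text \<open>Coefficients in units of the standard deviation of the noise, so that the innovations have unit variance at every
level. Least squares is invariant under this scaling.\<close>

definition scaled_coeff :: "nat \<Rightarrow> nat \<Rightarrow> int \<Rightarrow> 'w \<Rightarrow> real" where
  "scaled_coeff l i t \<omega> = 1 / sqrt (C l) * coeff l i t \<omega>"

lemma ar_residual_scaled_coeff: "ar_residual p c (scaled_coeff l i) t \<omega> = 1 / sqrt (C l) * ar_residual p c (coeff l i) t \<omega>"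
  unfolding ar_residual_def scaled_coeff_def right_diff_distrib sum_distrib_left by (simp add: mult.left_commute)

lemma coeff_props:
  assumes "i < 2 * l + 1"
  shows "square_integrable M (coeff l i t)" "coeff l i t \<in> L2_closure M field_span"
    "\<exists>B. \<forall>t. (\<integral>\<omega>. (coeff l i t \<omega>)\<^sup>2 \<partial>M) \<le> B"
proof -
  obtain B where em: "harmonic_basis l i \<in> borel_measurable S2_measure" and eB: "\<forall>x\<in>S2. \<bar>harmonic_basis l i x\<bar> \<le> B"
    using harmonicD[OF harmonic_basis_props(3)[OF assms]] .
  show "square_integrable M (coeff l i t)" unfolding coeff_def by (rule field_coeff_L2(1)[OF T_field em eB])
  show "coeff l i t \<in> L2_closure M field_span" unfolding coeff_def by (rule coeff_in_closure[OF em eB])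
  obtain v where v: "\<And>t x. x \<in> S2 \<Longrightarrow> (\<integral>\<omega>. (T t x \<omega>)\<^sup>2 \<partial>M) = v" using T_variance_constant by blast
  have "(\<integral>x. (\<integral>\<omega>. (T t x \<omega>)\<^sup>2 \<partial>M) \<partial>S2_measure) = (\<integral>x. v \<partial>S2_measure)" for t
    by (intro Bochner_Integration.integral_cong refl) (simp add: v)
  then show "\<exists>B. \<forall>t. (\<integral>\<omega>. (coeff l i t \<omega>)\<^sup>2 \<partial>M) \<le> B"
    using field_coeff_L2(2)[OF T_field em eB] unfolding coeff_def
    by (intro exI[of _ "(\<integral>x. (harmonic_basis l i x)\<^sup>2 \<partial>S2_measure) * (\<integral>x. v \<partial>S2_measure)"]) simp
qed

text \<open>At level \<open>l\<close> the coordinates are the \<open>2 l + 1\<close> scaled coefficients. Joint Gaussianity comes from the closure of the span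
of the field.\<close>

lemma level_gaussian_ar: "gaussian_ar M (L2_closure M field_span) (scaled_coeff l) p (2 * l + 1) (\<phi> l) \<delta>"
proof (unfold_locales)
  show G: "gaussian_space M (L2_closure M field_span)"
    by (rule gaussian_space_L2_closure[OF prob_space_axioms gaussian_space_field_span])
  show "scaled_coeff l i t \<in> L2_closure M field_span" if "i < 2 * l + 1" for i t
    using gaussian_space_cmult[OF G coeff_props(2)[OF that]] unfolding scaled_coeff_def[abs_def] .
  show "\<exists>B. \<forall>t. (\<integral>\<omega>. (scaled_coeff l i t \<omega>)\<^sup>2 \<partial>M) \<le> B" if i: "i < 2 * l + 1" for i
  proof -
    obtain B where B: "\<And>t. (\<integral>\<omega>. (coeff l i t \<omega>)\<^sup>2 \<partial>M) \<le> B" using coeff_props(3)[OF i] by blast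
    have "(\<integral>\<omega>. (scaled_coeff l i t \<omega>)\<^sup>2 \<partial>M) \<le> (1 / sqrt (C l))\<^sup>2 * B" for t
      unfolding scaled_coeff_def power_mult_distrib integral_mult_right_zero by (intro mult_left_mono B) simp
    then show ?thesis by blast
  qed
  show "(\<integral>\<omega>. ar_residual p (\<phi> l) (scaled_coeff l i) t \<omega> * ar_residual p (\<phi> l) (scaled_coeff l i') s \<omega> \<partial>M) = (if i = i' \<and> t = s then 1 else 0)"
    if i: "i < 2 * l + 1" and i': "i' < 2 * l + 1" for i i' t s
  proof -
    have m: "ar_residual p (\<phi> l) (coeff l j) u \<in> borel_measurable M" if "j < 2 * l + 1" for j u
      using square_integrable_measurable[OF coeff_props(1)[OF that]] unfolding ar_residual_def[abs_def] by measurable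
    have zm: "field_coeff (Z u) (harmonic_basis l j) \<in> borel_measurable M" if "j < 2 * l + 1" for j u
      using harmonic_basis_props(3)[OF that] field_coeff_measurable[OF Z_field] unfolding harmonic_def by blast
    have "(\<integral>\<omega>. ar_residual p (\<phi> l) (coeff l i) t \<omega> * ar_residual p (\<phi> l) (coeff l i') s \<omega> \<partial>M)
        = (\<integral>\<omega>. field_coeff (Z t) (harmonic_basis l i) \<omega> * field_coeff (Z s) (harmonic_basis l i') \<omega> \<partial>M)"
    proof (rule integral_cong_AE)
      show "AE \<omega> in M. ar_residual p (\<phi> l) (coeff l i) t \<omega> * ar_residual p (\<phi> l) (coeff l i') s \<omega>
          = field_coeff (Z t) (harmonic_basis l i) \<omega> * field_coeff (Z s) (harmonic_basis l i') \<omega>"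
        using coeff_autoregression[OF harmonic_basis_props(3)[OF i], of t] coeff_autoregression[OF harmonic_basis_props(3)[OF i'], of s]
        by eventually_elim (simp add: coeff_def[abs_def])
    qed (intro borel_measurable_times m zm i i')+
    also have "\<dots> = (if t = s then C l * (if i = i' then 1 else 0) else 0)"
      unfolding noise_coeff_covariance[OF harmonic_basis_props(3)[OF i] harmonic_basis_props(3)[OF i']]
      using harmonic_basis_props(1)[of l] i i' unfolding orthonormal_S2_def by simp
    finally have *: "(\<integral>\<omega>. ar_residual p (\<phi> l) (coeff l i) t \<omega> * ar_residual p (\<phi> l) (coeff l i') s \<omega> \<partial>M)
        = (if t = s then C l * (if i = i' then 1 else 0) else 0)" .
    have "(\<integral>\<omega>. ar_residual p (\<phi> l) (scaled_coeff l i) t \<omega> * ar_residual p (\<phi> l) (scaled_coeff l i') s \<omega> \<partial>M)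
        = (\<integral>\<omega>. (1 / C l) * (ar_residual p (\<phi> l) (coeff l i) t \<omega> * ar_residual p (\<phi> l) (coeff l i') s \<omega>) \<partial>M)"
      unfolding ar_residual_scaled_coeff using C_pos[of l]
      by (intro Bochner_Integration.integral_cong refl) (simp add: field_simps)
    then show ?thesis unfolding integral_mult_right_zero * using C_pos[of l] by simp
  qed
  show "\<delta> > 0" by (rule \<delta>)
  show "1 - (\<Sum>j=1..p. of_real (\<phi> l j) * z ^ j) \<noteq> 0" if "norm z \<le> 1 + \<delta>" for z :: complex
    by (rule stable[OF that])
qed

lemma least_squares_quadratic_form:
  assumes paths: "\<And>t. square_integrable S2_measure (\<lambda>x. T t x \<omega>)"
    and h: "\<And>j. j \<in> {1..p} \<Longrightarrow> h j = (\<lambda>z. \<Sum>l\<le>L. c l j * legendre_term l z)"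
    and min: "is_arg_min (sphar_sse p T N \<omega>) (\<lambda>h. h \<in> {1..p} \<rightarrow> legendre_space L) h" and l: "l \<le> L"
  defines "\<Delta> \<equiv> \<lambda>j. c l j - \<phi> l j"
  shows "gaussian_ar.design_form (scaled_coeff l) p (2 * l + 1) N \<Delta> \<omega>
    \<le> 2 * (\<Sum>j=1..p. \<Delta> j * gaussian_ar.score (scaled_coeff l) p (2 * l + 1) (\<phi> l) N j \<omega>)"
proof -
  interpret G: gaussian_ar M "L2_closure M field_span" "scaled_coeff l" p "2 * l + 1" "\<phi> l" \<delta>
    by (rule level_gaussian_ar)
  let ?I = "{..<2 * l + 1} \<times> {1..N}"
  have swap: "(\<Sum>t=1..N. \<Sum>i<2 * l + 1. f i t) = (\<Sum>(i, t)\<in>?I. f i t)" for f :: "nat \<Rightarrow> nat \<Rightarrow> real"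
    by (subst sum.swap, subst sum.cartesian_product) (rule refl)
  define e where "e i t = ar_residual p (\<phi> l) (scaled_coeff l i) (int t + int p) \<omega>" for i t :: nat
  define y where "y i t j = scaled_coeff l i (int t + int p - int j) \<omega>" for i t j :: nat
  have scaled: "(\<Sum>(i, t)\<in>?I. (ar_residual p d (scaled_coeff l i) (int (t + p)) \<omega>)\<^sup>2)
      = 1 / C l * (\<Sum>t=1..N. \<Sum>i<2 * l + 1. (ar_residual p d (coeff l i) (int (t + p)) \<omega>)\<^sup>2)" for d
  proof -
    have "(1 / sqrt (C l))\<^sup>2 = 1 / C l" using C_pos[of l] by (simp add: power_divide)
    then show ?thesis
      unfolding swap ar_residual_scaled_coeff power_mult_distrib sum_distrib_left by (simp add: split_beta)
  qed
  have "(\<Sum>(i, t)\<in>?I. (ar_residual p (c l) (scaled_coeff l i) (int (t + p)) \<omega>)\<^sup>2)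
      \<le> (\<Sum>(i, t)\<in>?I. (ar_residual p (\<phi> l) (scaled_coeff l i) (int (t + p)) \<omega>)\<^sup>2)"
    unfolding scaled using least_squares_basic_inequality[OF paths h min l] C_pos[of l]
    by (intro mult_left_mono) auto
  moreover have "ar_residual p (c l) (scaled_coeff l i) (int (t + p)) \<omega> = e i t - (\<Sum>j=1..p. \<Delta> j * y i t j)" for i t
    unfolding e_def y_def ar_residual_def \<Delta>_def by (simp add: left_diff_distrib sum_subtractf)
  ultimately have "(\<Sum>(i, t)\<in>?I. (e i t - (\<Sum>j=1..p. \<Delta> j * y i t j))\<^sup>2) \<le> (\<Sum>(i, t)\<in>?I. (e i t)\<^sup>2)"
    unfolding e_def by simp
  also have "(\<Sum>(i, t)\<in>?I. (e i t - (\<Sum>j=1..p. \<Delta> j * y i t j))\<^sup>2)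
      = (\<Sum>(i, t)\<in>?I. (e i t)\<^sup>2) - 2 * (\<Sum>(i, t)\<in>?I. e i t * (\<Sum>j=1..p. \<Delta> j * y i t j))
        + (\<Sum>(i, t)\<in>?I. (\<Sum>j=1..p. \<Delta> j * y i t j)\<^sup>2)"
    by (simp add: split_beta power2_diff sum.distrib sum_subtractf sum_distrib_left mult.assoc)
  finally have "(\<Sum>(i, t)\<in>?I. (\<Sum>j=1..p. \<Delta> j * y i t j)\<^sup>2) \<le> 2 * (\<Sum>(i, t)\<in>?I. e i t * (\<Sum>j=1..p. \<Delta> j * y i t j))"
    by simp
  moreover have "(\<Sum>(i, t)\<in>?I. e i t * (\<Sum>j=1..p. \<Delta> j * y i t j)) = (\<Sum>j=1..p. \<Delta> j * G.score N j \<omega>)"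
  proof -
    have "(\<Sum>(i, t)\<in>?I. e i t * (\<Sum>j=1..p. \<Delta> j * y i t j)) = (\<Sum>P\<in>?I. \<Sum>j=1..p. \<Delta> j * (y (fst P) (snd P) j * e (fst P) (snd P)))"
      by (simp add: split_beta sum_distrib_left mult_ac)
    also have "\<dots> = (\<Sum>j=1..p. \<Delta> j * G.score N j \<omega>)"
      unfolding G.score_def e_def y_def by (subst sum.swap) (simp add: split_beta sum_distrib_left)
    finally show ?thesis .
  qed
  ultimately show ?thesis unfolding G.design_form_def y_def by simp
qed

text \<open>A measurable bound at each level for the squared error of every minimiser, independent of the truncation and of the choice of
the minimiser.\<close>

definition dominates_estimation_error :: "real \<Rightarrow> nat \<Rightarrow> (nat \<Rightarrow> 'w \<Rightarrow> ennreal) \<Rightarrow> bool" where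
  "dominates_estimation_error K N D \<longleftrightarrow> (\<forall>l. D l \<in> borel_measurable M) \<and>
     (\<forall>l. (\<integral>\<^sup>+\<omega>. D l \<omega> \<partial>M) \<le> ennreal (K / (real (2 * l + 1) * real N))) \<and>
     (AE \<omega> in M. \<forall>L h. is_arg_min (sphar_sse p T N \<omega>) (\<lambda>h. h \<in> {1..p} \<rightarrow> legendre_space L) h \<longrightarrow>
        (\<exists>c. (\<forall>j\<in>{1..p}. h j = (\<lambda>z. \<Sum>l\<le>L. c l j * legendre_term l z)) \<and>
             (\<forall>l\<le>L. ennreal (\<Sum>j=1..p. (c l j - \<phi> l j)\<^sup>2) \<le> D l \<omega>)))"

text \<open>The constant does not depend on the level, because the bound for the autoregressions of one level involves the coefficients
only through \<open>\<delta>\<close>.\<close>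

lemma coefficient_risk:
  "\<exists>K\<ge>0. \<forall>N. p * (4 * p + 6) \<le> N \<longrightarrow> (\<exists>D. dominates_estimation_error K N D)"
proof -
  obtain B where B: "B > 0" "\<And>n::nat. 3 ^ p * real n ^ (p + 2) \<le> B * 2 ^ n"
    using exponential_beats_power[of p] by blast
  define \<eta> where "\<eta> = gaussian_ar.\<eta>0 p \<delta>"
  define \<kappa> where "\<kappa> = ar_variance_bound p \<delta>"
  define K where "K = 2 * real p * (128 * real p ^ 4 * \<kappa> / \<eta>\<^sup>2 + 512 * (real p)\<^sup>2 * sqrt (8 * real p ^ 3 * \<kappa> / \<eta> + B) / \<eta>)"
  have \<eta>: "\<eta> > 0" unfolding \<eta>_def by (rule gaussian_ar.\<eta>0_pos[OF level_gaussian_ar[of 0]])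
  have \<kappa>: "\<kappa> \<ge> 0" unfolding \<kappa>_def ar_variance_bound_def by simp
  have K0: "K \<ge> 0" unfolding K_def using \<eta> \<kappa> B(1) by (intro mult_nonneg_nonneg add_nonneg_nonneg divide_nonneg_nonneg real_sqrt_ge_zero) auto
  have "\<exists>D. dominates_estimation_error K N D"
    if N: "p * (4 * p + 6) \<le> N" for N
  proof -
    have "\<forall>l. \<exists>D. D \<in> borel_measurable M \<and> (\<integral>\<^sup>+\<omega>. D \<omega> \<partial>M) \<le> ennreal (K / (real (2 * l + 1) * real N)) \<and>
      (AE \<omega> in M. \<forall>\<Delta>. gaussian_ar.design_form (scaled_coeff l) p (2 * l + 1) N \<Delta> \<omega>
          \<le> 2 * (\<Sum>j=1..p. \<Delta> j * gaussian_ar.score (scaled_coeff l) p (2 * l + 1) (\<phi> l) N j \<omega>)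
        \<longrightarrow> ennreal (\<Sum>j=1..p. (\<Delta> j)\<^sup>2) \<le> D \<omega>)"
    proof
      fix l :: nat
      have "1 \<le> 2 * l + 1" by simp
      from gaussian_ar.least_squares_risk[OF level_gaussian_ar this p1 N B(2)]
      show "\<exists>D. D \<in> borel_measurable M \<and> (\<integral>\<^sup>+\<omega>. D \<omega> \<partial>M) \<le> ennreal (K / (real (2 * l + 1) * real N)) \<and>
      (AE \<omega> in M. \<forall>\<Delta>. gaussian_ar.design_form (scaled_coeff l) p (2 * l + 1) N \<Delta> \<omega>
          \<le> 2 * (\<Sum>j=1..p. \<Delta> j * gaussian_ar.score (scaled_coeff l) p (2 * l + 1) (\<phi> l) N j \<omega>)
        \<longrightarrow> ennreal (\<Sum>j=1..p. (\<Delta> j)\<^sup>2) \<le> D \<omega>)"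
        unfolding K_def \<eta>_def \<kappa>_def of_nat_mult[symmetric] Bex_def .
    qed
    then obtain D where D: "\<And>l. D l \<in> borel_measurable M" "\<And>l. (\<integral>\<^sup>+\<omega>. D l \<omega> \<partial>M) \<le> ennreal (K / (real (2 * l + 1) * real N))"
      and bd: "\<forall>l. AE \<omega> in M. \<forall>\<Delta>. gaussian_ar.design_form (scaled_coeff l) p (2 * l + 1) N \<Delta> \<omega>
          \<le> 2 * (\<Sum>j=1..p. \<Delta> j * gaussian_ar.score (scaled_coeff l) p (2 * l + 1) (\<phi> l) N j \<omega>)
        \<longrightarrow> ennreal (\<Sum>j=1..p. (\<Delta> j)\<^sup>2) \<le> D l \<omega>"
      by (elim choice[THEN exE]) blast
    have "AE \<omega> in M. \<forall>L h. is_arg_min (sphar_sse p T N \<omega>) (\<lambda>h. h \<in> {1..p} \<rightarrow> legendre_space L) h \<longrightarrow>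
        (\<exists>c. (\<forall>j\<in>{1..p}. h j = (\<lambda>z. \<Sum>l\<le>L. c l j * legendre_term l z)) \<and>
             (\<forall>l\<le>L. ennreal (\<Sum>j=1..p. (c l j - \<phi> l j)\<^sup>2) \<le> D l \<omega>))"
      using bd[unfolded AE_all_countable[symmetric]] AE_paths_square_integrable
    proof eventually_elim
      case (elim \<omega>)
      show ?case
      proof (intro allI impI)
        fix L h
        assume min: "is_arg_min (sphar_sse p T N \<omega>) (\<lambda>h. h \<in> {1..p} \<rightarrow> legendre_space L) h"
        then have "\<forall>j. \<exists>d. j \<in> {1..p} \<longrightarrow> h j = (\<lambda>z. \<Sum>l\<le>L. d l * legendre_term l z)"
          unfolding is_arg_min_def legendre_space_def by (auto dest: PiE)
        from choice[OF this] obtain d where d: "\<And>j. j \<in> {1..p} \<Longrightarrow> h j = (\<lambda>z. \<Sum>l\<le>L. d j l * legendre_term l z)"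
          by blast
        have "ennreal (\<Sum>j=1..p. (d j l - \<phi> l j)\<^sup>2) \<le> D l \<omega>" if "l \<le> L" for l
          using least_squares_quadratic_form[where c = "\<lambda>l j. d j l", OF _ d min that] elim(1)[rule_format, of l "\<lambda>j. d j l - \<phi> l j"] elim(2)
          by blast
        then show "\<exists>c. (\<forall>j\<in>{1..p}. h j = (\<lambda>z. \<Sum>l\<le>L. c l j * legendre_term l z)) \<and>
             (\<forall>l\<le>L. ennreal (\<Sum>j=1..p. (c l j - \<phi> l j)\<^sup>2) \<le> D l \<omega>)"
          using d by (intro exI[of _ "\<lambda>l j. d j l"]) blast
      qed
    qed
    then show ?thesis unfolding dominates_estimation_error_def using D by (intro exI[of _ D]) blast
  qed
  then show ?thesis using K0 by blast
qed

end

section \<open>Truncation of the Legendre series\<close>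

text \<open>Comparison with the integral of \<open>x powr (- s)\<close>, whose primitive is a multiple of \<open>x powr (1 - s)\<close>.\<close>

lemma powr_tail_sum:
  fixes s :: real
  assumes s: "s > 1" and L: "L \<ge> 1"
  shows "(\<Sum>l\<in>{L<..M}. real l powr (- s)) \<le> real L powr (1 - s) / (s - 1)"
proof (cases "L \<le> M")
  case True
  have "(\<Sum>l\<in>{L<..M}. real l powr (- s)) \<le> (real L powr (1 - s) - real M powr (1 - s)) / (s - 1)"
    using True
  proof (induction M rule: dec_induct)
    case base then show ?case by simp
  next
    case (step M)
    have M: "real M > 0" using step(1) L by simp
    have "\<exists>\<xi>. real M < \<xi> \<and> \<xi> < real M + 1 \<and>
        (real M + 1) powr (1 - s) - real M powr (1 - s) = (real M + 1 - real M) * ((1 - s) * \<xi> powr (1 - s - 1))"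
      by (rule MVT2) (use M has_real_derivative_powr[of _ "1 - s"] in force)+
    then obtain \<xi> where \<xi>: "real M < \<xi>" "\<xi> < real M + 1"
      "(real M + 1) powr (1 - s) - real M powr (1 - s) = (1 - s) * \<xi> powr (- s)" by auto
    have "(real M + 1) powr (- s) \<le> \<xi> powr (- s)" using \<xi> M s by (intro powr_mono2') auto
    then have "(s - 1) * (real M + 1) powr (- s) \<le> (s - 1) * \<xi> powr (- s)" using s by (intro mult_left_mono) auto
    also have "\<dots> = real M powr (1 - s) - (real M + 1) powr (1 - s)" using \<xi>(3) by (simp add: algebra_simps)
    finally have "(real M + 1) powr (- s) \<le> (real M powr (1 - s) - (real M + 1) powr (1 - s)) / (s - 1)"
      using s by (simp add: pos_le_divide_eq mult.commute)
    moreover have "{L<..Suc M} = insert (Suc M) {L<..M}" using step(1) by auto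
    ultimately show ?case using step(3) by (simp add: add.commute diff_divide_distrib)
  qed
  also have "\<dots> \<le> real L powr (1 - s) / (s - 1)" using s by (intro divide_right_mono) auto
  finally show ?thesis .
next
  case False
  then show ?thesis using s by simp
qed

lemma ennreal_bigoI:
  assumes "\<forall>\<^sub>F N in sequentially. r N \<le> ennreal (A * f N)" and A: "A \<ge> 0" and f: "\<And>N. f N \<ge> 0"
  shows "ennreal_bigo r f"
  unfolding ennreal_bigo_def
proof
  show "\<forall>\<^sub>F N in sequentially. r N < \<infinity>"
    using assms(1) by eventually_elim (auto intro: le_less_trans)
  show "(\<lambda>N. enn2real (r N)) \<in> O(f)"
  proof (rule bigoI)
    show "\<forall>\<^sub>F N in sequentially. norm (enn2real (r N)) \<le> A * norm (f N)"
      using assms(1)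
    proof eventually_elim
      case (elim N)
      have "enn2real (r N) \<le> enn2real (ennreal (A * f N))" by (rule enn2real_mono[OF elim]) simp
      then show ?case using A f[of N] by simp
    qed
  qed
qed

definition level_decay :: "(nat \<Rightarrow> real) \<Rightarrow> real \<Rightarrow> real \<Rightarrow> bool" where
  "level_decay f \<gamma> \<beta> \<longleftrightarrow> (\<forall>l>0. \<bar>f l\<bar> \<le> \<gamma> * real l powr (- \<beta>))"

lemma level_decay_L2_tail:
  assumes f: "level_decay f \<gamma> \<beta>" and \<beta>: "\<beta> > 1" and L: "L \<ge> 1"
  shows "(\<Sum>l\<in>{L<..M}. legendre_weight l * (f l)\<^sup>2) \<le> 3 * \<gamma>\<^sup>2 / (2 * \<beta> - 2) * real L powr (2 * (1 - \<beta>))"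
proof -
  have "(\<Sum>l\<in>{L<..M}. legendre_weight l * (f l)\<^sup>2) \<le> (\<Sum>l\<in>{L<..M}. 3 * \<gamma>\<^sup>2 * real l powr (- (2 * \<beta> - 1)))"
  proof (rule sum_mono)
    fix l assume "l \<in> {L<..M}"
    then have l: "l > 0" "real l \<ge> 1" using L by auto
    have "\<bar>f l\<bar>\<^sup>2 \<le> (\<gamma> * real l powr (- \<beta>))\<^sup>2" using f l unfolding level_decay_def by (intro power_mono) auto
    then have a: "(f l)\<^sup>2 \<le> \<gamma>\<^sup>2 * real l powr (- 2 * \<beta>)"
      by (simp add: power_mult_distrib power2_eq_square[of "_ powr _"] powr_add[symmetric])
    have "1 * 1 \<le> pi * pi" using pi_gt3 by (intro mult_mono) auto
    then have "1 \<le> 8 * pi\<^sup>2" by (simp add: power2_eq_square)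
    then have "(2 * real l + 1) / (8 * pi\<^sup>2) \<le> (2 * real l + 1) / 1" using l by (intro divide_left_mono) auto
    then have b: "legendre_weight l \<le> 3 * real l" unfolding legendre_weight_def using l by simp
    have "legendre_weight l * (f l)\<^sup>2 \<le> (3 * real l) * (\<gamma>\<^sup>2 * real l powr (- 2 * \<beta>))"
      by (rule mult_mono[OF b a]) auto
    also have "\<dots> = 3 * \<gamma>\<^sup>2 * (real l powr 1 * real l powr (- 2 * \<beta>))" using l by simp
    also have "\<dots> = 3 * \<gamma>\<^sup>2 * real l powr (- (2 * \<beta> - 1))" unfolding powr_add[symmetric] by (simp add: algebra_simps)
    finally show "legendre_weight l * (f l)\<^sup>2 \<le> 3 * \<gamma>\<^sup>2 * real l powr (- (2 * \<beta> - 1))" .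
  qed
  also have "\<dots> \<le> 3 * \<gamma>\<^sup>2 * (real L powr (1 - (2 * \<beta> - 1)) / (2 * \<beta> - 1 - 1))"
    unfolding sum_distrib_left[symmetric] using \<beta> L by (intro mult_left_mono powr_tail_sum) auto
  finally show ?thesis by (simp add: algebra_simps)
qed

lemma level_decay_sup_tail:
  assumes f: "level_decay f \<gamma> \<beta>" and \<beta>: "\<beta> > 2" and L: "L \<ge> 1" and \<gamma>: "\<gamma> \<ge> 0"
  shows "(\<Sum>l\<in>{L<..M}. (2 * real l + 1) / (4 * pi) * \<bar>f l\<bar>) \<le> \<gamma> / (\<beta> - 2) * real L powr (2 - \<beta>)"
    and "summable (\<lambda>l. (2 * real l + 1) * \<bar>f l\<bar>)"
proof -
  have b: "\<bar>f l\<bar> * real l \<le> \<gamma> * real l powr (- (\<beta> - 1))" if l: "l \<ge> 1" for l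
  proof -
    have "\<bar>f l\<bar> * real l \<le> (\<gamma> * real l powr (- \<beta>)) * real l powr 1"
      using f l unfolding level_decay_def by (intro mult_mono) (auto simp: \<gamma>)
    also have "\<dots> = \<gamma> * real l powr (- (\<beta> - 1))" unfolding mult.assoc powr_add[symmetric] by (simp add: algebra_simps)
    finally show ?thesis .
  qed
  have "(\<Sum>l\<in>{L<..M}. (2 * real l + 1) / (4 * pi) * \<bar>f l\<bar>) \<le> (\<Sum>l\<in>{L<..M}. \<gamma> * real l powr (- (\<beta> - 1)))"
  proof (rule sum_mono)
    fix l assume "l \<in> {L<..M}"
    then have l: "l \<ge> 1" "real l \<ge> 1" using L by auto
    have "real l * 12 \<le> real l * (4 * pi)" using pi_gt3 by (intro mult_left_mono) auto
    then have "2 * real l + 1 \<le> real l * (4 * pi)" using l(2) by linarith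
    then have "(2 * real l + 1) / (4 * pi) \<le> real l" by (simp add: pos_divide_le_eq)
    then have "(2 * real l + 1) / (4 * pi) * \<bar>f l\<bar> \<le> real l * \<bar>f l\<bar>" by (intro mult_right_mono) auto
    then show "(2 * real l + 1) / (4 * pi) * \<bar>f l\<bar> \<le> \<gamma> * real l powr (- (\<beta> - 1))" using b[OF l(1)] by (simp add: mult.commute)
  qed
  also have "\<dots> \<le> \<gamma> * (real L powr (1 - (\<beta> - 1)) / (\<beta> - 1 - 1))"
    unfolding sum_distrib_left[symmetric] using \<beta> L \<gamma> by (intro mult_left_mono powr_tail_sum) auto
  finally show "(\<Sum>l\<in>{L<..M}. (2 * real l + 1) / (4 * pi) * \<bar>f l\<bar>) \<le> \<gamma> / (\<beta> - 2) * real L powr (2 - \<beta>)"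
    by (simp add: algebra_simps)
  show "summable (\<lambda>l. (2 * real l + 1) * \<bar>f l\<bar>)"
  proof (rule summable_comparison_test')
    show "summable (\<lambda>l. 3 * \<gamma> * real l powr (- (\<beta> - 1)))"
      using \<beta> by (intro summable_mult) (simp add: summable_real_powr_iff)
    show "norm ((2 * real l + 1) * \<bar>f l\<bar>) \<le> 3 * \<gamma> * real l powr (- (\<beta> - 1))" if "l \<ge> 1" for l
    proof -
      have "(2 * real l + 1) * \<bar>f l\<bar> \<le> (3 * real l) * \<bar>f l\<bar>" using that by (intro mult_right_mono) auto
      also have "\<dots> = 3 * (\<bar>f l\<bar> * real l)" by simp
      also have "\<dots> \<le> 3 * (\<gamma> * real l powr (- (\<beta> - 1)))" using b[OF that] by (intro mult_left_mono) auto
      finally show ?thesis by simp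
    qed
  qed
qed

lemma kernel_pointwise_tail:
  assumes k: "kernel_with_eigenvalues k f" and f: "level_decay f \<gamma> \<beta>" and \<beta>: "\<beta> > 2" and L: "L \<ge> 1" and \<gamma>: "\<gamma> \<ge> 0"
    and z: "z \<in> {-1..1}"
  shows "\<bar>k z - (\<Sum>l\<le>L. f l * legendre_term l z)\<bar> \<le> \<gamma> / (\<beta> - 2) * real L powr (2 - \<beta>)"
proof -
  note sm = level_decay_sup_tail(2)[OF f \<beta> L \<gamma>]
  have bd: "\<bar>f l * legendre_term l z\<bar> \<le> (2 * real l + 1) / (4 * pi) * \<bar>f l\<bar>" for l
    unfolding abs_mult using mult_left_mono[OF legendre_term_bound[OF z, of l], of "\<bar>f l\<bar>"] by (simp add: mult.commute)
  have "summable (\<lambda>l. 1 / (4 * pi) * ((2 * real l + 1) * \<bar>f l\<bar>))" by (rule summable_mult[OF sm])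
  then have "summable (\<lambda>l. f l * legendre_term l z)"
    by (rule summable_comparison_test') (use bd in simp)
  then have "(\<lambda>M. \<Sum>l\<le>M. f l * legendre_term l z) \<longlonglongrightarrow> k z"
    using k sm z summable_LIMSEQ'[of "\<lambda>l. f l * legendre_term l z"] unfolding kernel_with_eigenvalues_def by simp
  then have "(\<lambda>M. \<bar>(\<Sum>l\<le>M. f l * legendre_term l z) - (\<Sum>l\<le>L. f l * legendre_term l z)\<bar>)
      \<longlonglongrightarrow> \<bar>k z - (\<Sum>l\<le>L. f l * legendre_term l z)\<bar>"
    by (intro tendsto_intros)
  then show ?thesis
  proof (rule tendsto_upperbound)
    show "\<forall>\<^sub>F M in sequentially. \<bar>(\<Sum>l\<le>M. f l * legendre_term l z) - (\<Sum>l\<le>L. f l * legendre_term l z)\<bar>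
        \<le> \<gamma> / (\<beta> - 2) * real L powr (2 - \<beta>)"
      using eventually_ge_at_top[of L]
    proof eventually_elim
      case (elim M)
      have "{..M} = {..L} \<union> {L<..M}" using elim by auto
      then have "(\<Sum>l\<le>M. f l * legendre_term l z) = (\<Sum>l\<le>L. f l * legendre_term l z) + (\<Sum>l\<in>{L<..M}. f l * legendre_term l z)"
        by (simp add: sum.union_disjoint ivl_disj_int)
      moreover have "\<bar>\<Sum>l\<in>{L<..M}. f l * legendre_term l z\<bar> \<le> (\<Sum>l\<in>{L<..M}. (2 * real l + 1) / (4 * pi) * \<bar>f l\<bar>)"
        using bd by (rule order.trans[OF sum_abs sum_mono])
      ultimately show ?case using level_decay_sup_tail(1)[OF f \<beta> L \<gamma>, of M] by linarith
    qed
  qed simp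
qed

context stable_sphar_model
begin

lemma kernel_dist_L2_bound:
  assumes h: "\<And>j. j \<in> {1..p} \<Longrightarrow> h j = (\<lambda>z. \<Sum>l\<le>L. c l j * legendre_term l z)"
    and tail: "\<And>j M. j \<in> {1..p} \<Longrightarrow> (\<Sum>l\<in>{L<..M}. legendre_weight l * (\<phi> l j)\<^sup>2) \<le> \<tau> j"
  shows "(\<integral>\<^sup>+z\<in>{-1..1}. ennreal ((kernel_dist p h k z)\<^sup>2) \<partial>lborel)
    \<le> ennreal ((\<Sum>l\<le>L. legendre_weight l * (\<Sum>j=1..p. (c l j - \<phi> l j)\<^sup>2)) + (\<Sum>j=1..p. \<tau> j))"
proof -
  have sqi: "square_integrable lborel_interval (\<lambda>z. k j z - h j z)" if j: "j \<in> {1..p}" for j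
  proof -
    have "square_integrable lborel_interval (h j)"
      unfolding h[OF j] by (intro square_integrable_sum square_integrable_cmult legendre_term_square_integrable) auto
    then show ?thesis by (rule square_integrable_diff[OF kernel_sq[OF j]])
  qed
  have "(\<integral>\<^sup>+z\<in>{-1..1}. ennreal ((kernel_dist p h k z)\<^sup>2) \<partial>lborel)
      = (\<integral>\<^sup>+z. ennreal ((kernel_dist p h k z)\<^sup>2) \<partial>lborel_interval)"
    unfolding lborel_interval_def by (rule nn_integral_restrict_space[symmetric]) simp
  also have "\<dots> = (\<integral>\<^sup>+z. ennreal (\<Sum>j=1..p. (k j z - h j z)\<^sup>2) \<partial>lborel_interval)"
    unfolding kernel_dist_def L2_set_def by (simp add: sum_nonneg power2_commute)
  also have "\<dots> = ennreal (\<integral>z. (\<Sum>j=1..p. (k j z - h j z)\<^sup>2) \<partial>lborel_interval)"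
    using sqi by (intro nn_integral_eq_integral Bochner_Integration.integrable_sum AE_I2 sum_nonneg) (auto simp: square_integrable_def)
  also have "(\<integral>z. (\<Sum>j=1..p. (k j z - h j z)\<^sup>2) \<partial>lborel_interval) = (\<Sum>j=1..p. \<integral>z. (k j z - h j z)\<^sup>2 \<partial>lborel_interval)"
    using sqi by (intro Bochner_Integration.integral_sum) (auto simp: square_integrable_def)
  also have "ennreal \<dots> \<le> ennreal (\<Sum>j=1..p. (\<Sum>l\<le>L. legendre_weight l * (c l j - \<phi> l j)\<^sup>2) + \<tau> j)"
  proof (intro ennreal_leI sum_mono)
    fix j assume j: "j \<in> {1..p}"
    show "(\<integral>z. (k j z - h j z)\<^sup>2 \<partial>lborel_interval) \<le> (\<Sum>l\<le>L. legendre_weight l * (c l j - \<phi> l j)\<^sup>2) + \<tau> j"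
      using legendre_truncation_error[OF kernel_sq[OF j], of L "\<tau> j" "\<lambda>l. c l j"] tail[OF j]
      unfolding kernel_coeff[OF j] h[OF j] by blast
  qed
  also have "(\<Sum>j=1..p. (\<Sum>l\<le>L. legendre_weight l * (c l j - \<phi> l j)\<^sup>2) + \<tau> j)
      = (\<Sum>l\<le>L. legendre_weight l * (\<Sum>j=1..p. (c l j - \<phi> l j)\<^sup>2)) + (\<Sum>j=1..p. \<tau> j)"
    unfolding sum.distrib sum_distrib_left by (subst sum.swap) (rule refl)
  finally show ?thesis .
qed

text \<open>The arithmetic-geometric mean inequality \<open>2 \<bar>x\<bar> \<le> s + x\<^sup>2 / s\<close> replaces the errors by their squares, whose expectations
are available; the scale \<open>s l\<close> is free and may depend on the level.\<close>

lemma kernel_dist_sup_bound: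
  assumes h: "\<And>j. j \<in> {1..p} \<Longrightarrow> h j = (\<lambda>z. \<Sum>l\<le>L. c l j * legendre_term l z)"
    and tail: "\<And>j. j \<in> {1..p} \<Longrightarrow> \<bar>k j z - (\<Sum>l\<le>L. \<phi> l j * legendre_term l z)\<bar> \<le> \<tau> j"
    and z: "z \<in> {-1..1}" and s: "\<And>l. s l > 0"
  shows "kernel_dist p h k z
    \<le> (\<Sum>l\<le>L. (2 * real l + 1) / (4 * pi) * ((real p * s l + (\<Sum>j=1..p. (c l j - \<phi> l j)\<^sup>2) / s l) / 2)) + (\<Sum>j=1..p. \<tau> j)"
proof -
  have "kernel_dist p h k z \<le> (\<Sum>j=1..p. \<bar>h j z - k j z\<bar>)" unfolding kernel_dist_def by (rule L2_set_le_sum_abs)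
  also have "\<dots> \<le> (\<Sum>j=1..p. (\<Sum>l\<le>L. (2 * real l + 1) / (4 * pi) * ((s l + (c l j - \<phi> l j)\<^sup>2 / s l) / 2)) + \<tau> j)"
  proof (rule sum_mono)
    fix j assume j: "j \<in> {1..p}"
    have "\<bar>\<Sum>l\<le>L. (c l j - \<phi> l j) * legendre_term l z\<bar> \<le> (\<Sum>l\<le>L. (2 * real l + 1) / (4 * pi) * ((s l + (c l j - \<phi> l j)\<^sup>2 / s l) / 2))"
    proof (rule order.trans[OF sum_abs sum_mono])
      fix l
      have "0 \<le> (s l - \<bar>c l j - \<phi> l j\<bar>)\<^sup>2" by simp
      then have "2 * s l * \<bar>c l j - \<phi> l j\<bar> \<le> (s l)\<^sup>2 + (c l j - \<phi> l j)\<^sup>2" by (simp add: power2_diff)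
      then have "\<bar>c l j - \<phi> l j\<bar> \<le> (s l + (c l j - \<phi> l j)\<^sup>2 / s l) / 2"
        using s[of l] by (simp add: field_simps power2_eq_square)
      then show "\<bar>(c l j - \<phi> l j) * legendre_term l z\<bar> \<le> (2 * real l + 1) / (4 * pi) * ((s l + (c l j - \<phi> l j)\<^sup>2 / s l) / 2)"
        unfolding abs_mult mult.commute[of "\<bar>c l j - \<phi> l j\<bar>"] by (intro mult_mono legendre_term_bound[OF z]) auto
    qed
    moreover have "h j z - k j z = (\<Sum>l\<le>L. (c l j - \<phi> l j) * legendre_term l z) - (k j z - (\<Sum>l\<le>L. \<phi> l j * legendre_term l z))"
      unfolding h[OF j] by (simp add: left_diff_distrib sum_subtractf)
    ultimately show "\<bar>h j z - k j z\<bar> \<le> (\<Sum>l\<le>L. (2 * real l + 1) / (4 * pi) * ((s l + (c l j - \<phi> l j)\<^sup>2 / s l) / 2)) + \<tau> j"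
      using tail[OF j] by linarith
  qed
  also have "\<dots> = (\<Sum>l\<le>L. (2 * real l + 1) / (4 * pi) * (\<Sum>j=1..p. (s l + (c l j - \<phi> l j)\<^sup>2 / s l) / 2)) + (\<Sum>j=1..p. \<tau> j)"
    unfolding sum.distrib[of _ \<tau>] sum_distrib_left by (subst sum.swap) (rule refl)
  finally show ?thesis by (simp add: sum.distrib sum_divide_distrib[symmetric])
qed

end

section \<open>Rates of convergence\<close>

text \<open>The risk is an upper integral of a function \<open>G\<close> that may fail to be measurable. It is dominated by a measurable function
before the sum over the levels is taken out of the integral.\<close>

lemma nn_integral_level_sum:
  assumes D: "\<And>l. D l \<in> borel_measurable M" "\<And>l. (\<integral>\<^sup>+\<omega>. D l \<omega> \<partial>M) \<le> ennreal (e l)"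
    and nn: "\<And>l. 0 \<le> w l" "\<And>l. 0 \<le> e l" "0 \<le> \<tau>" and M: "emeasure M (space M) = 1"
    and bd: "AE \<omega> in M. \<exists>x. (\<forall>l\<le>L. 0 \<le> x l \<and> ennreal (x l) \<le> D l \<omega>) \<and> G \<omega> \<le> ennreal ((\<Sum>l\<le>L. w l * x l) + \<tau>)"
  shows "(\<integral>\<^sup>+\<omega>. G \<omega> \<partial>M) \<le> ennreal ((\<Sum>l\<le>L. w l * e l) + \<tau>)"
proof -
  have "(\<integral>\<^sup>+\<omega>. G \<omega> \<partial>M) \<le> (\<integral>\<^sup>+\<omega>. (\<Sum>l\<le>L. ennreal (w l) * D l \<omega>) + ennreal \<tau> \<partial>M)"
    using bd
  proof (intro nn_integral_mono_AE, eventually_elim)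
    case (elim \<omega>)
    then obtain x where x: "\<And>l. l \<le> L \<Longrightarrow> 0 \<le> x l" "\<And>l. l \<le> L \<Longrightarrow> ennreal (x l) \<le> D l \<omega>"
      and G: "G \<omega> \<le> ennreal ((\<Sum>l\<le>L. w l * x l) + \<tau>)" by blast
    have wx: "0 \<le> w l * x l" if "l \<in> {..L}" for l using x(1)[of l] nn(1)[of l] that by simp
    note G
    also have "ennreal ((\<Sum>l\<le>L. w l * x l) + \<tau>) = (\<Sum>l\<le>L. ennreal (w l * x l)) + ennreal \<tau>"
    proof -
      have "(\<Sum>l\<le>L. ennreal (w l * x l)) = ennreal (\<Sum>l\<le>L. w l * x l)" by (rule sum_ennreal[OF wx])
      moreover have "0 \<le> (\<Sum>l\<le>L. w l * x l)" by (rule sum_nonneg[OF wx])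
      ultimately show ?thesis using nn(3) by (simp add: ennreal_plus)
    qed
    also have "\<dots> \<le> (\<Sum>l\<le>L. ennreal (w l) * D l \<omega>) + ennreal \<tau>"
      using x nn by (intro add_mono sum_mono) (auto simp: ennreal_mult intro!: mult_left_mono)
    finally show ?case .
  qed
  also have "\<dots> = (\<Sum>l\<le>L. ennreal (w l) * (\<integral>\<^sup>+\<omega>. D l \<omega> \<partial>M)) + ennreal \<tau>"
    using D(1) M by (simp add: nn_integral_add nn_integral_sum nn_integral_cmult)
  also have "\<dots> \<le> (\<Sum>l\<le>L. ennreal (w l * e l)) + ennreal \<tau>"
    using D(2) nn by (intro add_mono sum_mono) (auto simp: ennreal_mult intro!: mult_left_mono)
  also have "\<dots> = ennreal ((\<Sum>l\<le>L. w l * e l) + \<tau>)"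
    using nn by (subst ennreal_plus) (auto intro!: sum_nonneg simp: sum_ennreal)
  finally show ?thesis .
qed

lemma same_order_powrD:
  assumes "same_order_from N0 (\<lambda>N. real (L N)) (\<lambda>N. real N powr d)"
  obtains c1 c2 where "c1 > 0" "c2 > 0" "\<And>N. N \<ge> N0 \<Longrightarrow> N \<ge> 1 \<Longrightarrow> L N \<ge> 1"
    "\<And>N. N \<ge> N0 \<Longrightarrow> N \<ge> 1 \<Longrightarrow> real (L N) \<le> c2 * real N powr d"
    "\<And>N a. N \<ge> N0 \<Longrightarrow> N \<ge> 1 \<Longrightarrow> a \<le> 0 \<Longrightarrow> real (L N) powr a \<le> c1 powr a * real N powr (d * a)"
proof -
  obtain c1 c2 where c: "c1 > 0" "c2 > 0" "\<And>N. N \<ge> N0 \<Longrightarrow> c1 * real N powr d \<le> real (L N)"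
    "\<And>N. N \<ge> N0 \<Longrightarrow> real (L N) \<le> c2 * real N powr d"
    using assms unfolding same_order_from_def by blast
  show thesis
  proof (rule that[OF c(1,2)])
    fix N assume N: "N \<ge> N0" "N \<ge> 1"
    have pos: "0 < c1 * real N powr d" using c(1) N by simp
    then have "0 < real (L N)" using c(3)[OF N(1)] by linarith
    then show "L N \<ge> 1" by simp
    show "real (L N) \<le> c2 * real N powr d" by (rule c(4)[OF N(1)])
    fix a :: real assume "a \<le> 0"
    then have "real (L N) powr a \<le> (c1 * real N powr d) powr a"
      using powr_mono2'[of a "c1 * real N powr d" "real (L N)"] pos c(3)[OF N(1)] by (cases "a = 0") auto
    then show "real (L N) powr a \<le> c1 powr a * real N powr (d * a)"
      using c(1) by (simp add: powr_mult powr_powr)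
  qed
qed

context stable_sphar_model
begin

lemma estimator_risk:
  assumes "\<exists>D. dominates_estimation_error K N D" "N > p" and lse: "sphar_lse M p T L kh"
  shows "\<exists>D. (\<forall>l. D l \<in> borel_measurable M) \<and> (\<forall>l. (\<integral>\<^sup>+\<omega>. D l \<omega> \<partial>M) \<le> ennreal (K / (real (2 * l + 1) * real N))) \<and>
     (AE \<omega> in M. \<exists>c. (\<forall>j\<in>{1..p}. kh N \<omega> j = (\<lambda>z. \<Sum>l\<le>L N. c l j * legendre_term l z)) \<and>
        (\<forall>l\<le>L N. ennreal (\<Sum>j=1..p. (c l j - \<phi> l j)\<^sup>2) \<le> D l \<omega>))"
proof -
  obtain D where D: "dominates_estimation_error K N D" using assms(1) by blast
  have argmin: "AE \<omega> in M. is_arg_min (sphar_sse p T N \<omega>) (\<lambda>h. h \<in> {1..p} \<rightarrow> legendre_space (L N)) (kh N \<omega>)"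
    using lse assms(2) unfolding sphar_lse_def by blast
  have "AE \<omega> in M. \<exists>c. (\<forall>j\<in>{1..p}. kh N \<omega> j = (\<lambda>z. \<Sum>l\<le>L N. c l j * legendre_term l z)) \<and>
        (\<forall>l\<le>L N. ennreal (\<Sum>j=1..p. (c l j - \<phi> l j)\<^sup>2) \<le> D l \<omega>)"
    using D[unfolded dominates_estimation_error_def, THEN conjunct2, THEN conjunct2] argmin by eventually_elim blast
  then show ?thesis using D unfolding dominates_estimation_error_def by blast
qed

text \<open>In \<open>legendre_weight l * K / ((2 l + 1) N)\<close> the multiplicity \<open>2 l + 1\<close> cancels: every estimated level costs the same.\<close>

lemma L2_rate:
  assumes decay: "\<And>j. j \<in> {1..p} \<Longrightarrow> level_decay (\<lambda>l. \<phi> l j) (\<gamma> j) \<beta>" and \<beta>: "\<beta> > 1"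
    and order: "same_order_from (p + 1) (\<lambda>N. real (L N)) (\<lambda>N. real N powr d)"
    and lse: "sphar_lse M p T L kh"
  shows "ennreal_bigo (\<lambda>N. L2_risk M p (kh N) k) (\<lambda>N. real N powr (d - 1) + real N powr (2 * d * (1 - \<beta>)))"
proof -
  obtain K where K: "K \<ge> 0" and risk: "\<And>N. p * (4 * p + 6) \<le> N \<Longrightarrow> \<exists>D. dominates_estimation_error K N D"
    using coefficient_risk by blast
  obtain c1 c2 where c: "c1 > 0" "c2 > 0" and L1: "\<And>N. N \<ge> p + 1 \<Longrightarrow> N \<ge> 1 \<Longrightarrow> L N \<ge> 1"
    and Lup: "\<And>N. N \<ge> p + 1 \<Longrightarrow> N \<ge> 1 \<Longrightarrow> real (L N) \<le> c2 * real N powr d"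
    and Lpow: "\<And>N a. N \<ge> p + 1 \<Longrightarrow> N \<ge> 1 \<Longrightarrow> a \<le> 0 \<Longrightarrow> real (L N) powr a \<le> c1 powr a * real N powr (d * a)"
    using same_order_powrD[OF order] by blast
  define G where "G = (\<Sum>j=1..p. 3 * (\<gamma> j)\<^sup>2 / (2 * \<beta> - 2))"
  have G: "G \<ge> 0" unfolding G_def using \<beta> by (intro sum_nonneg divide_nonneg_pos) auto
  define A where "A = max (2 * c2 * K / (8 * pi\<^sup>2)) (G * c1 powr (2 * (1 - \<beta>)))"
  have A: "0 \<le> A" unfolding A_def using G by (simp add: le_max_iff_disj)
  have main: "L2_risk M p (kh N) k \<le> ennreal (A * (real N powr (d - 1) + real N powr (2 * d * (1 - \<beta>))))"
    if N: "N \<ge> p * (4 * p + 6) + p + 1" for N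
  proof -
    have N': "p * (4 * p + 6) \<le> N" "N \<ge> p + 1" "N \<ge> 1" "N > p" using N by linarith+
    note L1 = L1[OF N'(2,3)] and Lup = Lup[OF N'(2,3)] and Lpow = Lpow[OF N'(2,3)]
    obtain D where D: "\<And>l. D l \<in> borel_measurable M" "\<And>l. (\<integral>\<^sup>+\<omega>. D l \<omega> \<partial>M) \<le> ennreal (K / (real (2 * l + 1) * real N))"
      and bd: "AE \<omega> in M. \<exists>c. (\<forall>j\<in>{1..p}. kh N \<omega> j = (\<lambda>z. \<Sum>l\<le>L N. c l j * legendre_term l z)) \<and>
             (\<forall>l\<le>L N. ennreal (\<Sum>j=1..p. (c l j - \<phi> l j)\<^sup>2) \<le> D l \<omega>)"
      using estimator_risk[OF risk[OF N'(1)] N'(4) lse] by blast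
    define \<tau> where "\<tau> j = 3 * (\<gamma> j)\<^sup>2 / (2 * \<beta> - 2) * real (L N) powr (2 * (1 - \<beta>))" for j
    have tail: "(\<Sum>l\<in>{L N<..M}. legendre_weight l * (\<phi> l j)\<^sup>2) \<le> \<tau> j" if "j \<in> {1..p}" for j M
      unfolding \<tau>_def by (rule level_decay_L2_tail[OF decay[OF that] \<beta> L1])
    have sum\<tau>: "(\<Sum>j=1..p. \<tau> j) = G * real (L N) powr (2 * (1 - \<beta>))" unfolding \<tau>_def G_def sum_distrib_right ..
    have "L2_risk M p (kh N) k \<le> ennreal ((\<Sum>l\<le>L N. legendre_weight l * (K / (real (2 * l + 1) * real N))) + (\<Sum>j=1..p. \<tau> j))"
      unfolding L2_risk_def
    proof (rule nn_integral_level_sum[OF D])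
      show "0 \<le> legendre_weight l" for l unfolding legendre_weight_def by simp
      show "0 \<le> K / (real (2 * l + 1) * real N)" for l using K by simp
      show "0 \<le> (\<Sum>j=1..p. \<tau> j)" unfolding sum\<tau> using G by simp
      show "AE \<omega> in M. \<exists>x. (\<forall>l\<le>L N. 0 \<le> x l \<and> ennreal (x l) \<le> D l \<omega>) \<and>
          (\<integral>\<^sup>+z\<in>{-1..1}. ennreal ((kernel_dist p (kh N \<omega>) k z)\<^sup>2) \<partial>lborel)
            \<le> ennreal ((\<Sum>l\<le>L N. legendre_weight l * x l) + (\<Sum>j=1..p. \<tau> j))"
        using bd
      proof eventually_elim
        case (elim \<omega>)
        then obtain c where h: "\<And>j. j \<in> {1..p} \<Longrightarrow> kh N \<omega> j = (\<lambda>z. \<Sum>l\<le>L N. c l j * legendre_term l z)"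
          and cD: "\<And>l. l \<le> L N \<Longrightarrow> ennreal (\<Sum>j=1..p. (c l j - \<phi> l j)\<^sup>2) \<le> D l \<omega>" by blast
        show ?case
          using cD kernel_dist_L2_bound[OF h tail]
          by (intro exI[of _ "\<lambda>l. \<Sum>j=1..p. (c l j - \<phi> l j)\<^sup>2"]) (auto intro: sum_nonneg)
      qed
    qed (rule emeasure_space_1)
    also have "\<dots> \<le> ennreal (A * (real N powr (d - 1) + real N powr (2 * d * (1 - \<beta>))))"
    proof (rule ennreal_leI)
      have "legendre_weight l * (K / (real (2 * l + 1) * real N)) = K / (8 * pi\<^sup>2) / real N" for l
      proof -
        have "x / c * (K / (x * n)) = K / c / n" if "x > 0" for x c n :: real using that by simp
        moreover have "real (2 * l + 1) = 2 * real l + 1" by simp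
        ultimately show ?thesis unfolding legendre_weight_def by (simp only: add_nonneg_pos zero_less_one mult_nonneg_nonneg zero_le_numeral of_nat_0_le_iff)
      qed
      then have "(\<Sum>l\<le>L N. legendre_weight l * (K / (real (2 * l + 1) * real N))) = (real (L N) + 1) * (K / (8 * pi\<^sup>2) / real N)"
        by (simp add: algebra_simps)
      also have "\<dots> \<le> (2 * (c2 * real N powr d)) * (K / (8 * pi\<^sup>2) / real N)"
        using L1 Lup K by (intro mult_right_mono) auto
      also have "\<dots> = (2 * c2 * K / (8 * pi\<^sup>2)) * real N powr (d - 1)" using N'(3) by (simp add: powr_diff mult_ac)
      also have "\<dots> \<le> A * real N powr (d - 1)" unfolding A_def by (intro mult_right_mono) auto
      finally have 1: "(\<Sum>l\<le>L N. legendre_weight l * (K / (real (2 * l + 1) * real N))) \<le> A * real N powr (d - 1)" .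
      have "(\<Sum>j=1..p. \<tau> j) \<le> G * (c1 powr (2 * (1 - \<beta>)) * real N powr (d * (2 * (1 - \<beta>))))"
        unfolding sum\<tau> using \<beta> by (intro mult_left_mono[OF Lpow G]) auto
      also have "\<dots> = (G * c1 powr (2 * (1 - \<beta>))) * real N powr (2 * d * (1 - \<beta>))" by (simp add: mult_ac)
      also have "\<dots> \<le> A * real N powr (2 * d * (1 - \<beta>))" unfolding A_def by (intro mult_right_mono) auto
      finally show "(\<Sum>l\<le>L N. legendre_weight l * (K / (real (2 * l + 1) * real N))) + (\<Sum>j=1..p. \<tau> j)
          \<le> A * (real N powr (d - 1) + real N powr (2 * d * (1 - \<beta>)))"
        using 1 by (simp add: distrib_left)
    qed
    finally show ?thesis .
  qed
  show ?thesis
    by (rule ennreal_bigoI[OF eventually_sequentiallyI[OF main] A]) simp_all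
qed

text \<open>The scale of the arithmetic-geometric mean inequality is the root mean square error at the level, so the levels add up to
\<open>\<Sum>l\<le>L. sqrt ((2 l + 1) / N)\<close>, up to a constant.\<close>

lemma sup_rate:
  assumes decay: "\<And>j. j \<in> {1..p} \<Longrightarrow> level_decay (\<lambda>l. \<phi> l j) (\<gamma> j) \<beta>" and \<beta>: "\<beta> > 2"
    and \<gamma>: "\<And>j. j \<in> {1..p} \<Longrightarrow> \<gamma> j \<ge> 0"
    and order: "same_order_from (p + 1) (\<lambda>N. real (L N)) (\<lambda>N. real N powr d)"
    and lse: "sphar_lse M p T L kh"
  shows "ennreal_bigo (\<lambda>N. sup_risk M p (kh N) k) (\<lambda>N. real N powr ((3 * d - 1) / 2) + real N powr (d * (2 - \<beta>)))"
proof -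
  obtain K where K: "K \<ge> 0" and risk: "\<And>N. p * (4 * p + 6) \<le> N \<Longrightarrow> \<exists>D. dominates_estimation_error K N D"
    using coefficient_risk by blast
  obtain c1 c2 where c: "c1 > 0" "c2 > 0" and L1: "\<And>N. N \<ge> p + 1 \<Longrightarrow> N \<ge> 1 \<Longrightarrow> L N \<ge> 1"
    and Lup: "\<And>N. N \<ge> p + 1 \<Longrightarrow> N \<ge> 1 \<Longrightarrow> real (L N) \<le> c2 * real N powr d"
    and Lpow: "\<And>N a. N \<ge> p + 1 \<Longrightarrow> N \<ge> 1 \<Longrightarrow> a \<le> 0 \<Longrightarrow> real (L N) powr a \<le> c1 powr a * real N powr (d * a)"
    using same_order_powrD[OF order] by blast
  define G where "G = (\<Sum>j=1..p. \<gamma> j / (\<beta> - 2))"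
  have G: "G \<ge> 0" unfolding G_def using \<beta> \<gamma> by (intro sum_nonneg divide_nonneg_pos) auto
  define A where "A = max ((real p + 1) * c2 * sqrt (3 * (K + 1) * c2)) (G * c1 powr (2 - \<beta>))"
  have A: "0 \<le> A" unfolding A_def using G by (simp add: le_max_iff_disj)
  have main: "sup_risk M p (kh N) k \<le> ennreal (A * (real N powr ((3 * d - 1) / 2) + real N powr (d * (2 - \<beta>))))"
    if N: "N \<ge> p * (4 * p + 6) + p + 1" for N
  proof -
    have N': "p * (4 * p + 6) \<le> N" "N \<ge> p + 1" "N \<ge> 1" "N > p" using N by linarith+
    note L1 = L1[OF N'(2,3)] and Lup = Lup[OF N'(2,3)] and Lpow = Lpow[OF N'(2,3)]
    obtain D where D: "\<And>l. D l \<in> borel_measurable M" "\<And>l. (\<integral>\<^sup>+\<omega>. D l \<omega> \<partial>M) \<le> ennreal (K / (real (2 * l + 1) * real N))"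
      and bd: "AE \<omega> in M. \<exists>c. (\<forall>j\<in>{1..p}. kh N \<omega> j = (\<lambda>z. \<Sum>l\<le>L N. c l j * legendre_term l z)) \<and>
             (\<forall>l\<le>L N. ennreal (\<Sum>j=1..p. (c l j - \<phi> l j)\<^sup>2) \<le> D l \<omega>)"
      using estimator_risk[OF risk[OF N'(1)] N'(4) lse] by blast
    define \<tau> where "\<tau> j = \<gamma> j / (\<beta> - 2) * real (L N) powr (2 - \<beta>)" for j
    have tail: "\<bar>k j z - (\<Sum>l\<le>L N. \<phi> l j * legendre_term l z)\<bar> \<le> \<tau> j" if "j \<in> {1..p}" "z \<in> {-1..1}" for j z
      unfolding \<tau>_def by (rule kernel_pointwise_tail[OF kernels[OF that(1)] decay[OF that(1)] \<beta> L1 \<gamma>[OF that(1)] that(2)])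
    have sum\<tau>: "(\<Sum>j=1..p. \<tau> j) = G * real (L N) powr (2 - \<beta>)" unfolding \<tau>_def G_def sum_distrib_right ..
    define w where "w l = (2 * real l + 1) / (4 * pi)" for l
    \<comment> \<open>The root mean square size of an estimated coefficient, the optimal scale in \<open>2 x \<le> s + x\<^sup>2 / s\<close>.\<close>
    define s where "s l = sqrt ((K + 1) / (real (2 * l + 1) * real N))" for l
    have s: "s l > 0" for l unfolding s_def using K N'(3) by (intro real_sqrt_gt_zero divide_pos_pos mult_pos_pos) auto
    have w: "w l \<ge> 0" for l unfolding w_def by simp
    define \<sigma> where "\<sigma> = (\<Sum>l\<le>L N. w l * (real p * s l / 2)) + (\<Sum>j=1..p. \<tau> j)"
    have "sup_risk M p (kh N) k \<le> ennreal ((\<Sum>l\<le>L N. w l / (2 * s l) * (K / (real (2 * l + 1) * real N))) + \<sigma>)"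
      unfolding sup_risk_def
    proof (rule nn_integral_level_sum[OF D])
      show "0 \<le> w l / (2 * s l)" for l using w[of l] s[of l] by simp
      show "0 \<le> K / (real (2 * l + 1) * real N)" for l using K by simp
      show "0 \<le> \<sigma>" unfolding \<sigma>_def sum\<tau> using G w s by (intro add_nonneg_nonneg sum_nonneg mult_nonneg_nonneg) (auto simp: less_imp_le)
      show "AE \<omega> in M. \<exists>x. (\<forall>l\<le>L N. 0 \<le> x l \<and> ennreal (x l) \<le> D l \<omega>) \<and>
          (SUP z\<in>{-1..1}. ennreal (kernel_dist p (kh N \<omega>) k z)) \<le> ennreal ((\<Sum>l\<le>L N. w l / (2 * s l) * x l) + \<sigma>)"
        using bd
      proof eventually_elim
        case (elim \<omega>)
        then obtain c where h: "\<And>j. j \<in> {1..p} \<Longrightarrow> kh N \<omega> j = (\<lambda>z. \<Sum>l\<le>L N. c l j * legendre_term l z)"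
          and cD: "\<And>l. l \<le> L N \<Longrightarrow> ennreal (\<Sum>j=1..p. (c l j - \<phi> l j)\<^sup>2) \<le> D l \<omega>" by blast
        define x where "x l = (\<Sum>j=1..p. (c l j - \<phi> l j)\<^sup>2)" for l
        have "kernel_dist p (kh N \<omega>) k z \<le> (\<Sum>l\<le>L N. w l / (2 * s l) * x l) + \<sigma>" if z: "z \<in> {-1..1}" for z
        proof -
          have "kernel_dist p (kh N \<omega>) k z \<le> (\<Sum>l\<le>L N. w l * ((real p * s l + x l / s l) / 2)) + (\<Sum>j=1..p. \<tau> j)"
            using kernel_dist_sup_bound[OF h tail[OF _ z] z s] unfolding w_def x_def .
          also have "(\<Sum>l\<le>L N. w l * ((real p * s l + x l / s l) / 2)) = (\<Sum>l\<le>L N. w l * (real p * s l / 2)) + (\<Sum>l\<le>L N. w l / (2 * s l) * x l)"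
            unfolding sum.distrib[symmetric] using s by (intro sum.cong refl) (simp add: add_divide_distrib distrib_left mult.commute)
          finally show ?thesis unfolding \<sigma>_def by simp
        qed
        then have "(SUP z\<in>{-1..1}. ennreal (kernel_dist p (kh N \<omega>) k z)) \<le> ennreal ((\<Sum>l\<le>L N. w l / (2 * s l) * x l) + \<sigma>)"
          by (intro SUP_least ennreal_leI)
        then show ?case using cD unfolding x_def[symmetric]
          by (intro exI[of _ x]) (auto simp: x_def intro: sum_nonneg)
      qed
    qed (rule emeasure_space_1)
    also have "\<dots> \<le> ennreal (A * (real N powr ((3 * d - 1) / 2) + real N powr (d * (2 - \<beta>))))"
    proof (rule ennreal_leI)
      define q where "q = sqrt (3 * (K + 1) * real (L N) / real N)"
      have term_le: "w l / (2 * s l) * (K / (real (2 * l + 1) * real N)) + w l * (real p * s l / 2) \<le> (real p + 1) / 2 * q"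
        if l: "l \<le> L N" for l
      proof -
        have s2: "K / (real (2 * l + 1) * real N) \<le> (s l)\<^sup>2"
          unfolding s_def using K by (simp add: divide_right_mono)
        have "w l / (2 * s l) * (K / (real (2 * l + 1) * real N)) \<le> w l / (2 * s l) * (s l)\<^sup>2"
          using w[of l] s[of l] by (intro mult_left_mono s2) auto
        also have "\<dots> = w l * s l / 2" using s[of l] by (simp add: power2_eq_square)
        finally have "w l / (2 * s l) * (K / (real (2 * l + 1) * real N)) + w l * (real p * s l / 2) \<le> (real p + 1) / 2 * (w l * s l)"
          by (simp add: algebra_simps)
        also have "w l * s l \<le> q"
        proof -
          have "(2 * real l + 1) / (4 * pi) \<le> (2 * real l + 1) / 1" using pi_gt3 by (intro divide_left_mono) auto
          then have "w l * s l \<le> real (2 * l + 1) * s l" unfolding w_def using s[of l] by (intro mult_right_mono) auto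
          also have "\<dots> = sqrt (real (2 * l + 1) * real (2 * l + 1)) * s l" by simp
          also have "\<dots> = sqrt (real (2 * l + 1) * real (2 * l + 1) * ((K + 1) / (real (2 * l + 1) * real N)))"
            unfolding s_def by (rule real_sqrt_mult[symmetric])
          also have "real (2 * l + 1) * real (2 * l + 1) * ((K + 1) / (real (2 * l + 1) * real N)) = real (2 * l + 1) * (K + 1) / real N"
          proof -
            have "x * x * (y / (x * n)) = x * y / n" if "x > 0" for x y n :: real using that by simp
            from this[of "real (2 * l + 1)"] show ?thesis by simp
          qed
          also have "sqrt \<dots> \<le> q"
          proof -
            have "2 * l + 1 \<le> 3 * L N" using l L1 by simp
            then have "real (2 * l + 1) \<le> real (3 * L N)" by (rule of_nat_mono)
            then have "real (2 * l + 1) * (K + 1) \<le> real (3 * L N) * (K + 1)"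
              using K by (intro mult_right_mono) auto
            also have "\<dots> = 3 * (K + 1) * real (L N)" by (simp add: algebra_simps)
            finally show ?thesis unfolding q_def by (intro real_sqrt_le_mono divide_right_mono) auto
          qed
          finally show ?thesis .
        qed
        finally show ?thesis by (simp add: mult_left_mono)
      qed
      have q0: "q \<ge> 0" unfolding q_def using K by simp
      have "(\<Sum>l\<le>L N. w l / (2 * s l) * (K / (real (2 * l + 1) * real N))) + (\<Sum>l\<le>L N. w l * (real p * s l / 2))
          \<le> (\<Sum>l\<le>L N. (real p + 1) / 2 * q)"
        unfolding sum.distrib[symmetric] using term_le by (intro sum_mono) auto
      also have "\<dots> = (real (L N) + 1) * ((real p + 1) / 2 * q)" by simp
      also have "\<dots> \<le> (2 * (c2 * real N powr d)) * ((real p + 1) / 2 * sqrt (3 * (K + 1) * (c2 * real N powr d) / real N))"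
        using L1 Lup K q0 c unfolding q_def
        by (intro mult_mono real_sqrt_le_mono divide_right_mono mult_left_mono mult_nonneg_nonneg) auto
      also have "\<dots> = ((real p + 1) * c2 * sqrt (3 * (K + 1) * c2)) * real N powr ((3 * d - 1) / 2)"
      proof -
        have "3 * (K + 1) * (c2 * real N powr d) / real N = (3 * (K + 1) * c2) * real N powr (d - 1)"
          using N'(3) by (simp add: powr_diff)
        then have e: "sqrt (3 * (K + 1) * (c2 * real N powr d) / real N) = sqrt (3 * (K + 1) * c2) * real N powr ((d - 1) / 2)"
          by (simp add: real_sqrt_mult powr_half_sqrt[symmetric] powr_powr)
        have "real N powr ((3 * d - 1) / 2) = real N powr d * real N powr ((d - 1) / 2)"
          unfolding powr_add[symmetric] by (simp add: field_simps)
        then show ?thesis unfolding e by simp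
      qed
      also have "\<dots> \<le> A * real N powr ((3 * d - 1) / 2)" unfolding A_def by (intro mult_right_mono) auto
      finally have 1: "(\<Sum>l\<le>L N. w l / (2 * s l) * (K / (real (2 * l + 1) * real N))) + (\<Sum>l\<le>L N. w l * (real p * s l / 2))
          \<le> A * real N powr ((3 * d - 1) / 2)" .
      have "(\<Sum>j=1..p. \<tau> j) \<le> G * (c1 powr (2 - \<beta>) * real N powr (d * (2 - \<beta>)))"
        unfolding sum\<tau> using \<beta> by (intro mult_left_mono[OF Lpow G]) auto
      also have "\<dots> = (G * c1 powr (2 - \<beta>)) * real N powr (d * (2 - \<beta>))" by (simp add: mult_ac)
      also have "\<dots> \<le> A * real N powr (d * (2 - \<beta>))" unfolding A_def by (intro mult_right_mono) auto
      finally show "(\<Sum>l\<le>L N. w l / (2 * s l) * (K / (real (2 * l + 1) * real N))) + \<sigma>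
          \<le> A * (real N powr ((3 * d - 1) / 2) + real N powr (d * (2 - \<beta>)))"
        using 1 unfolding \<sigma>_def by (simp add: distrib_left)
    qed
    finally show ?thesis .
  qed
  show ?thesis
    by (rule ennreal_bigoI[OF eventually_sequentiallyI[OF main] A]) simp_all
qed

end

theorem theorem17:
  fixes M :: "'w measure"
    and p :: nat
    and k :: "nat \<Rightarrow> real \<Rightarrow> real"
    and \<phi> :: "nat \<Rightarrow> nat \<Rightarrow> real"
    and C :: "nat \<Rightarrow> real"
    and Z T :: "int \<Rightarrow> real^3 \<Rightarrow> 'w \<Rightarrow> real"
    and \<gamma> \<beta> :: "nat \<Rightarrow> real"
    and \<delta> :: real
  assumes prob: "prob_space M"
    and "p \<ge> 1"
    and "\<forall>j\<in>{1..p}. kernel_with_eigenvalues (k j) (\<lambda>l. \<phi> l j)"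
    and "\<exists>l. \<phi> l p \<noteq> 0"
    and noise: "gaussian_spherical_white_noise M Z C"
    and sphar: "gaussian_sphar M p k Z T"
    and stationarity: "\<delta> > 0"
      "\<forall>l. \<forall>z::complex. norm z \<le> 1 + \<delta> \<longrightarrow> 1 - (\<Sum>j=1..p. of_real (\<phi> l j) * z ^ j) \<noteq> 0"
    and identifiability: "\<forall>l. C l > 0"
    and smoothness: "\<forall>j\<in>{1..p}. \<gamma> j > 0 \<and> \<beta> j > 1 \<and> (\<forall>l>0. \<bar>\<phi> l j\<bar> \<le> \<gamma> j * real l powr (- \<beta> j))"
  defines "\<beta>min \<equiv> Min (\<beta> ` {1..p})"
  shows "(\<forall>d L kh.
            0 < d \<and> d < 1 \<and>
            same_order_from (p + 1) (\<lambda>N. real (L N)) (\<lambda>N. real N powr d) \<and>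
            sphar_lse M p T L kh \<longrightarrow>
            ennreal_bigo (\<lambda>N. L2_risk M p (kh N) k)
              (\<lambda>N. real N powr (d - 1) + real N powr (2 * d * (1 - \<beta>min))))
       \<and> ((\<forall>j\<in>{1..p}. \<beta> j > 2) \<longrightarrow>
          (\<forall>d L kh.
            0 < d \<and> d < 1/3 \<and>
            same_order_from (p + 1) (\<lambda>N. real (L N)) (\<lambda>N. real N powr d) \<and>
            sphar_lse M p T L kh \<longrightarrow>
            ennreal_bigo (\<lambda>N. sup_risk M p (kh N) k)
              (\<lambda>N. real N powr ((3 * d - 1) / 2) + real N powr (d * (2 - \<beta>min)))))"
proof -
  interpret stable_sphar_model M p k \<phi> C Z T \<delta>
    using assms by (intro stable_sphar_model.intro sphar_model.intro sphere_prob.intro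
      sphar_model_axioms.intro stable_sphar_model_axioms.intro) auto
  have le: "\<beta>min \<le> \<beta> j" if "j \<in> {1..p}" for j using that unfolding \<beta>min_def by simp
  have mem: "\<beta>min \<in> \<beta> ` {1..p}" unfolding \<beta>min_def using p1 by (intro Min_in) auto
  \<comment> \<open>At levels \<open>l \<ge> 1\<close> the slowest decay bounds all the others.\<close>
  have decay: "level_decay (\<lambda>l. \<phi> l j) (\<gamma> j) \<beta>min" if j: "j \<in> {1..p}" for j
    unfolding level_decay_def
  proof (intro allI impI)
    fix l :: nat assume l: "l > 0"
    then have "\<bar>\<phi> l j\<bar> \<le> \<gamma> j * real l powr (- \<beta> j)" using smoothness j by blast
    also have "\<dots> \<le> \<gamma> j * real l powr (- \<beta>min)"
      using l smoothness j le[OF j] by (intro mult_left_mono powr_mono) (auto intro: less_imp_le)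
    finally show "\<bar>\<phi> l j\<bar> \<le> \<gamma> j * real l powr (- \<beta>min)" .
  qed
  have "\<beta>min > 1" using mem smoothness by auto
  moreover have "\<beta>min > 2" if "\<forall>j\<in>{1..p}. \<beta> j > 2" using mem that by auto
  moreover have "\<gamma> j \<ge> 0" if "j \<in> {1..p}" for j using smoothness that by (auto intro: less_imp_le)
  ultimately show ?thesis using L2_rate[OF decay] sup_rate[OF decay] by blast
qed

end
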